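(* Let $n\ge 4$ and let $\mathcal Q$ be the quiver of type $D_n$ with vertices $1,\dots,n$ and arrows $1\to2\to\cdots\to n-2$, $n-2\to n-1$, $n-2\to n$. Then $\{\beta(\eta) : \eta\in\bigcup_{\sigma\in P_{\mathcal Q}}\Gamma_\sigma\}$ is precisely the set of real Schur roots of $\mathcal Q$.
   Context: Let $\mathcal Q$ be an acyclic connected quiver with $N$ vertices labelled by $I=\{1,\dots,N\}$. A real Schur root of $\mathcal Q$ is the dimension vector of an indecomposable module $M$ over the path algebra of $\mathcal Q$ (over an algebraically closed field) with $\mathrm{Ext}^1(M,M)=0$; dimension vectors $(m_i)$ are identified with $\sum m_i\alpha_i$. **Weyl group.** The Cartan matrix of $\mathcal Q$ has $a_{ii}=2$ and $a_{ij}=-(\text{number of arrows between } i \text{ and } j)$ for $i\neq j$. Let $\alpha_i$ be the simple roots, $s_i(\alpha_j)=\alpha_j-a_{ij}\alpha_i$ the simple reflections, $W$ the Weyl group. Positive real roots correspond bijectively to reflections in $W$, $w\alpha_i\leftrightarrow ws_iw^{-1}$. Let $\mathfrak W$ be the set of words $i_1\cdots i_k$ in the alphabet $I$ with no two consecutive letters equal; for $w\in W$ let $R_w\subset\mathfrak W$ be the set of words with $s_{i_1}\cdots s_{i_k}=w$ (not necessarily reduced), and let $R=\bigcup R_w$ over all reflections $w\in W$. **Surfaces.** Let $P_{\mathcal Q}\subset S_N$ be the set of permutations $\sigma$ of $I$ such that there is no arrow from $\sigma(j)$ to $\sigma(i)$ for any $j>i$. For $\sigma\in P_{\mathcal Q}$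 take two copies $G_1,G_2$ of a regular $N$-gon (a bigon if $N=2$), and label the edges of each by $T_{\sigma(1)},\dots,T_{\sigma(N)}$ counter-clockwise. On $G_i$ let $L_i$ be the line segment from the center of $G_i$ to the common endpoint of $T_{\sigma(N)}$ and $T_{\sigma(1)}$ at which the counter-clockwise labelling begins (the end of $T_{\sigma(N)}$ and the beginning of $T_{\sigma(1)}$ in counter-clockwise order). Orient all edges of $G_1$ counter-clockwise and all edges of $G_2$ clockwise. Let $\Sigma_\sigma$ be the compact surface obtained by gluing $G_1$ and $G_2$ along edges of the same label according to orientation. Let $\mathcal T=T_1\cup\cdots\cup T_N\subset\Sigma_\sigma$ and let $V$ be the set of images of the vertices of the polygons (one point if $N$ is odd, two points if $N$ is even). **Admissible curves.** A $\sigma$-admissible curve is a continuous $\eta:[0,1]\to\Sigma_\sigma$ such that: (1) $\eta(x)\in V$ iff $x\in\{0,1\}$; (2) there is $\epsilon>0$ with $\eta([0,\epsilon])\subset L_1$ and $\eta([1-\epsilon,1])\subset L_2$; (3) if $\eta(x)\in\mathcal T\setminus V$ then $\eta([x-\epsilon,x+\epsilon])$ meets $\mathcal T$ transversally for sufficiently small $\epsilon>0$; (4) $\upsilon(\eta)\in R$, where $\upsilon(\eta)=i_1\cdots i_k$ is given by $\{x\in(0,1):\eta(x)\in\mathcal T\}=\{x_1<\cdots<x_k\}$ and $\eta(x_\ell)\in T_{i_\ell}$. Let $\Gamma_\sigma$ be the set of (isotopy classes of) $\sigma$-admissible curves without self-intersections, i.e. $\eta(x_1)=\eta(x_2)$ implies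 $x_1=x_2$ or $\{x_1,x_2\}=\{0,1\}$. For $\eta\in\Gamma_\sigma$, $\beta(\eta)$ is the positive real root corresponding to the reflection $w$ with $\upsilon(\eta)\in R_w$. *)

theory Defs
  imports
    "HOL-Analysis.Analysis"
    "HOL-Algebra.Module"
    "HOL-Combinatorics.Permutations"
    "Graph_Theory.Arc_Walk"
begin

section \<open>Quivers and their path algebras\<close>

text \<open>
  A quiver is a \<^typ>\<open>('v, 'e) pre_digraph\<close> (parallel arrows are allowed). A path from \<open>u\<close> to \<open>v\<close> is
  a triple \<open>(u, as, v)\<close> with \<open>as\<close> the list of arrows in the order in which they are traversed; the
  trivial path at \<open>v\<close> is \<open>(v, [], v)\<close>.
\<close>

type_synonym ('v, 'e) qpath = "'v \<times> 'e list \<times> 'v"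

definition qpaths :: "('v, 'e) pre_digraph \<Rightarrow> ('v, 'e) qpath set" where
  "qpaths Q = {(u, as, v). pre_digraph.awalk Q u as v}"

definition src :: "('v, 'e) qpath \<Rightarrow> 'v" where "src p = fst p"
definition arrs :: "('v, 'e) qpath \<Rightarrow> 'e list" where "arrs p = fst (snd p)"
definition trg :: "('v, 'e) qpath \<Rightarrow> 'v" where "trg p = snd (snd p)"

text \<open>
  The product \<open>p q\<close> of paths means ``first \<open>q\<close>, then \<open>p\<close>'', so that left modules over the path
  algebra are (covariant) representations of the quiver. The following set consists of the ways to
  write \<open>r\<close> as such a product.
\<close>

definition factorizations ::
    "('v, 'e) pre_digraph \<Rightarrow> ('v, 'e) qpath \<Rightarrow> (('v, 'e) qpath \<times> ('v, 'e) qpath) set" where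
  "factorizations Q r = {(p, q). p \<in> qpaths Q \<and> q \<in> qpaths Q \<and> src p = trg q
      \<and> r = (src q, arrs q @ arrs p, trg p)}"

text \<open>
  Elements of the path algebra \<open>kQ\<close> are finitely supported functions from paths to \<open>k\<close>.
\<close>

definition path_algebra :: "('v, 'e) pre_digraph \<Rightarrow> (('v, 'e) qpath \<Rightarrow> 'k::field) ring" where
  "path_algebra Q =
    \<lparr> carrier = {f. finite {p. f p \<noteq> 0} \<and> {p. f p \<noteq> 0} \<subseteq> qpaths Q},
      mult = (\<lambda>f g r. \<Sum>(p, q)\<in>factorizations Q r. f p * g q),
      one = (\<lambda>p. if \<exists>v\<in>verts Q. p = (v, [], v) then 1 else 0),
      zero = (\<lambda>p. 0),
      add = (\<lambda>f g p. f p + g p) \<rparr>"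

definition vertex_idempotent :: "'v \<Rightarrow> ('v, 'e) qpath \<Rightarrow> 'k::field" where
  "vertex_idempotent v = (\<lambda>p. if p = (v, [], v) then 1 else 0)"

definition scalar_elt :: "('v, 'e) pre_digraph \<Rightarrow> 'k::field \<Rightarrow> ('v, 'e) qpath \<Rightarrow> 'k" where
  "scalar_elt Q c = (\<lambda>p. c * \<one>\<^bsub>path_algebra Q\<^esub> p)"

lemma qpaths_iff: "p \<in> qpaths Q \<longleftrightarrow> pre_digraph.awalk Q (src p) (arrs p) (trg p)"
  by (cases p) (auto simp: qpaths_def src_def arrs_def trg_def)

lemma qpath_eqI: "src p = src q \<Longrightarrow> arrs p = arrs q \<Longrightarrow> trg p = trg q \<Longrightarrow> p = q"
  by (cases p, cases q) (auto simp: src_def arrs_def trg_def)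

lemma qpath_sel [simp]: "src (u, as, v) = u" "arrs (u, as, v) = as" "trg (u, as, v) = v"
  by (auto simp: src_def arrs_def trg_def)

lemma cas_append:
  "pre_digraph.cas Q u (as @ bs) v \<longleftrightarrow>
     (\<exists>w. pre_digraph.cas Q u as w \<and> pre_digraph.cas Q w bs v)"
  by (induction as arbitrary: u) (auto simp: pre_digraph.cas.simps)

lemma factorizations_subset:
  assumes "(p, q) \<in> factorizations Q r"
  shows "r \<in> qpaths Q" "arrs r = arrs q @ arrs p" "src r = src q" "trg r = trg p" "src p = trg q"
    "p \<in> qpaths Q" "q \<in> qpaths Q"
  using assms
  by (auto simp: factorizations_def qpaths_iff pre_digraph.awalk_def cas_append)

lemma finite_factorizations:
  assumes "finite (verts Q)"
  shows "finite (factorizations Q r)"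
proof (rule finite_subset)
  show "factorizations Q r \<subseteq>
     (\<lambda>(w, k). ((w, drop k (arrs r), trg r), (src r, take k (arrs r), w))) ` (verts Q \<times> {..length (arrs r)})"
  proof clarify
    fix p q assume pq: "(p, q) \<in> factorizations Q r"
    note f = factorizations_subset[OF pq]
    have "src p \<in> verts Q" using f(6) by (auto simp: qpaths_iff pre_digraph.awalk_def)
    moreover have "p = (src p, drop (length (arrs q)) (arrs r), trg r)"
      using f by (intro qpath_eqI) auto
    moreover have "q = (src r, take (length (arrs q)) (arrs r), src p)"
      using f by (intro qpath_eqI) auto
    moreover have "length (arrs q) \<le> length (arrs r)" using f by simp
    ultimately show "(p, q) \<in> (\<lambda>(w, k). ((w, drop k (arrs r), trg r), (src r, take k (arrs r), w)))
        ` (verts Q \<times> {..length (arrs r)})"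
      by (intro image_eqI[of _ _ "(src p, length (arrs q))"]) auto
  qed
  show "finite ((\<lambda>(w, k). ((w, drop k (arrs r), trg r), (src r, take k (arrs r), w)))
      ` (verts Q \<times> {..length (arrs r)}))"
    using assms by auto
qed

lemma ring_path_algebra:
  assumes wf: "wf_digraph Q" and fin: "finite (verts Q)"
  shows "ring (path_algebra Q :: (('v, 'e) qpath \<Rightarrow> 'k::field) ring)"
proof (rule ringI)
  let ?A = "path_algebra Q :: (('v, 'e) qpath \<Rightarrow> 'k::field) ring"
  note ff = finite_factorizations[OF fin]
  have car: "f \<in> carrier ?A \<longleftrightarrow> finite {p. f p \<noteq> 0} \<and> (\<forall>p. f p \<noteq> 0 \<longrightarrow> p \<in> qpaths Q)" for f
    by (auto simp: path_algebra_def)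
  have mlt: "(f \<otimes>\<^bsub>?A\<^esub> g) r = (\<Sum>(p, q)\<in>factorizations Q r. f p * g q)" for f g r
    by (simp add: path_algebra_def)
  have add: "(f \<oplus>\<^bsub>?A\<^esub> g) r = f r + g r" for f g r
    by (simp add: path_algebra_def)
  have one: "\<one>\<^bsub>?A\<^esub> p = (if \<exists>v\<in>verts Q. p = (v, [], v) then 1 else 0)" for p
    by (simp add: path_algebra_def)
  have zero: "\<zero>\<^bsub>?A\<^esub> = (\<lambda>p. 0)"
    by (simp add: path_algebra_def)
  have addc: "f \<oplus>\<^bsub>?A\<^esub> g \<in> carrier ?A" if "f \<in> carrier ?A" "g \<in> carrier ?A" for f g
  proof -
    have "{p. f p + g p \<noteq> 0} \<subseteq> {p. f p \<noteq> 0} \<union> {p. g p \<noteq> 0}" by auto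
    then show ?thesis using that unfolding car add
      by (metis (no_types, lifting) add.left_neutral finite_UnI finite_subset)
  qed
  show "abelian_group ?A"
  proof (rule abelian_groupI)
    fix x assume "x \<in> carrier ?A"
    then have "(\<lambda>p. - x p) \<in> carrier ?A" "(\<lambda>p. - x p) \<oplus>\<^bsub>?A\<^esub> x = \<zero>\<^bsub>?A\<^esub>"
      by (auto simp: car path_algebra_def)
    then show "\<exists>y\<in>carrier ?A. y \<oplus>\<^bsub>?A\<^esub> x = \<zero>\<^bsub>?A\<^esub>" by blast
  qed (use addc in \<open>auto simp: fun_eq_iff add zero add_ac car[of "\<lambda>p. 0"]\<close>)
  have mltc: "f \<otimes>\<^bsub>?A\<^esub> g \<in> carrier ?A" if "f \<in> carrier ?A" "g \<in> carrier ?A" for f g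
  proof -
    have "r \<in> (\<lambda>(p, q). (src q, arrs q @ arrs p, trg p)) ` ({p. f p \<noteq> 0} \<times> {p. g p \<noteq> 0}) \<and> r \<in> qpaths Q"
      if "(f \<otimes>\<^bsub>?A\<^esub> g) r \<noteq> 0" for r
    proof -
      from that have "\<exists>x\<in>factorizations Q r. (\<lambda>(p, q). f p * g q) x \<noteq> 0"
        unfolding mlt by (rule sum.not_neutral_contains_not_neutral) blast
      then obtain p q where pq: "(p, q) \<in> factorizations Q r" "f p * g q \<noteq> 0" by auto
      then have "f p \<noteq> 0" "g q \<noteq> 0" by auto
      moreover have "r = (src q, arrs q @ arrs p, trg p)" using pq by (simp add: factorizations_def)
      ultimately have "r \<in> (\<lambda>(p, q). (src q, arrs q @ arrs p, trg p)) ` ({p. f p \<noteq> 0} \<times> {p. g p \<noteq> 0})"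
        by (intro image_eqI[of _ _ "(p, q)"]) auto
      then show ?thesis using factorizations_subset(1)[OF pq(1)] by simp
    qed
    then have "{r. (f \<otimes>\<^bsub>?A\<^esub> g) r \<noteq> 0} \<subseteq> (\<lambda>(p, q). (src q, arrs q @ arrs p, trg p)) ` ({p. f p \<noteq> 0} \<times> {p. g p \<noteq> 0})"
       "\<forall>r. (f \<otimes>\<^bsub>?A\<^esub> g) r \<noteq> 0 \<longrightarrow> r \<in> qpaths Q" by auto
    with that show ?thesis unfolding car[of "f \<otimes>\<^bsub>?A\<^esub> g"] unfolding car
      by (meson finite_SigmaI finite_imageI finite_subset)
  qed
  show "monoid ?A"
  proof (rule monoidI)
    have "{p. \<one>\<^bsub>?A\<^esub> p \<noteq> 0} = (\<lambda>v. (v, [], v)) ` verts Q" by (auto simp: one split: if_splits)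
    moreover have "(v, [], v) \<in> qpaths Q" if "v \<in> verts Q" for v
      using that by (auto simp: qpaths_def pre_digraph.awalk_def pre_digraph.cas.simps)
    ultimately show "\<one>\<^bsub>?A\<^esub> \<in> carrier ?A" using fin by (auto simp: car one)
  next
    fix g assume g: "g \<in> carrier ?A"
    show "\<one>\<^bsub>?A\<^esub> \<otimes>\<^bsub>?A\<^esub> g = g"
    proof
      fix r
      show "(\<one>\<^bsub>?A\<^esub> \<otimes>\<^bsub>?A\<^esub> g) r = g r"
      proof (cases "r \<in> qpaths Q")
        case False
        then have "factorizations Q r = {}" using factorizations_subset(1) by fast
        moreover have "g r = 0" using False g unfolding car by blast
        ultimately show ?thesis by (simp add: mlt)
      next
        case True
        let ?e = "(trg r, [], trg r)"
        have tr: "trg r \<in> verts Q"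
          using True wf_digraph.awalk_last_in_verts[OF wf] by (auto simp: qpaths_iff)
        then have e: "(?e, r) \<in> factorizations Q r"
          using True by (auto simp: factorizations_def qpaths_iff pre_digraph.awalk_def pre_digraph.cas.simps src_def arrs_def trg_def)
        have *: "(\<lambda>(p, q). \<one>\<^bsub>?A\<^esub> p * g q) x = 0" if x: "x \<in> factorizations Q r - {(?e, r)}" for x
        proof -
          obtain p q where pq: "x = (p, q)" by (rule prod.exhaust)
          with x have f: "(p, q) \<in> factorizations Q r" by auto
          have "p \<noteq> (v, [], v)" for v
          proof
            assume v: "p = (v, [], v)"
            have "q = r" using factorizations_subset[OF f] v by (intro qpath_eqI) auto
            moreover have "p = ?e" using factorizations_subset(4)[OF f] v by simp
            ultimately show False using x pq by auto
          qed
          then show ?thesis by (simp add: pq one)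
        qed
        have "(\<one>\<^bsub>?A\<^esub> \<otimes>\<^bsub>?A\<^esub> g) r = (\<Sum>x\<in>{(?e, r)}. (\<lambda>(p, q). \<one>\<^bsub>?A\<^esub> p * g q) x)"
          unfolding mlt by (rule sum.mono_neutral_right) (use ff e * in auto)
        then show ?thesis using tr by (simp add: one)
      qed
    qed
    show "g \<otimes>\<^bsub>?A\<^esub> \<one>\<^bsub>?A\<^esub> = g"
    proof
      fix r
      show "(g \<otimes>\<^bsub>?A\<^esub> \<one>\<^bsub>?A\<^esub>) r = g r"
      proof (cases "r \<in> qpaths Q")
        case False
        then have "factorizations Q r = {}" using factorizations_subset(1) by fast
        moreover have "g r = 0" using False g unfolding car by blast
        ultimately show ?thesis by (simp add: mlt)
      next
        case True
        let ?e = "(src r, [], src r)"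
        have tr: "src r \<in> verts Q"
          using True by (auto simp: qpaths_iff pre_digraph.awalk_def)
        then have e: "(r, ?e) \<in> factorizations Q r"
          using True by (auto simp: factorizations_def qpaths_iff pre_digraph.awalk_def pre_digraph.cas.simps src_def arrs_def trg_def)
        have *: "(\<lambda>(p, q). g p * \<one>\<^bsub>?A\<^esub> q) x = 0" if x: "x \<in> factorizations Q r - {(r, ?e)}" for x
        proof -
          obtain p q where pq: "x = (p, q)" by (rule prod.exhaust)
          with x have f: "(p, q) \<in> factorizations Q r" by auto
          have "q \<noteq> (v, [], v)" for v
          proof
            assume v: "q = (v, [], v)"
            have "p = r" using factorizations_subset[OF f] v by (intro qpath_eqI) auto
            moreover have "q = ?e" using factorizations_subset(3)[OF f] v by simp
            ultimately show False using x pq by auto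
          qed
          then show ?thesis by (simp add: pq one)
        qed
        have "(g \<otimes>\<^bsub>?A\<^esub> \<one>\<^bsub>?A\<^esub>) r = (\<Sum>x\<in>{(r, ?e)}. (\<lambda>(p, q). g p * \<one>\<^bsub>?A\<^esub> q) x)"
          unfolding mlt by (rule sum.mono_neutral_right) (use ff e * in auto)
        then show ?thesis using tr by (simp add: one)
      qed
    qed
  next
    fix f g h assume "f \<in> carrier ?A" "g \<in> carrier ?A" "h \<in> carrier ?A"
    show "(f \<otimes>\<^bsub>?A\<^esub> g) \<otimes>\<^bsub>?A\<^esub> h = f \<otimes>\<^bsub>?A\<^esub> (g \<otimes>\<^bsub>?A\<^esub> h)"
    proof
      fix r
      let ?F = "factorizations Q"
      have "((f \<otimes>\<^bsub>?A\<^esub> g) \<otimes>\<^bsub>?A\<^esub> h) r = (\<Sum>x\<in>?F r. \<Sum>y\<in>?F (fst x). f (fst y) * g (snd y) * h (snd x))"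
        by (simp add: mlt sum_distrib_right case_prod_beta)
      also have "\<dots> = (\<Sum>(x, y)\<in>Sigma (?F r) (\<lambda>x. ?F (fst x)). f (fst y) * g (snd y) * h (snd x))"
        by (rule sum.Sigma) (use ff in auto)
      also have "\<dots> = (\<Sum>(x, y)\<in>Sigma (?F r) (\<lambda>x. ?F (snd x)). f (fst x) * g (fst y) * h (snd y))"
        by (rule sum.reindex_bij_witness[where
            i = "\<lambda>((p, q), (a, b)). (((src a, arrs a @ arrs p, trg p), b), (p, a))" and
            j = "\<lambda>((q, c), (a, b)). ((a, (src c, arrs c @ arrs b, trg b)), (b, c))"])
          (auto simp: factorizations_def qpaths_iff pre_digraph.awalk_def cas_append)
      also have "\<dots> = (\<Sum>x\<in>?F r. \<Sum>y\<in>?F (snd x). f (fst x) * g (fst y) * h (snd y))"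
        by (rule sum.Sigma[symmetric]) (use ff in auto)
      also have "\<dots> = (f \<otimes>\<^bsub>?A\<^esub> (g \<otimes>\<^bsub>?A\<^esub> h)) r"
        by (simp add: mlt sum_distrib_left case_prod_beta mult.assoc)
      finally show "((f \<otimes>\<^bsub>?A\<^esub> g) \<otimes>\<^bsub>?A\<^esub> h) r = (f \<otimes>\<^bsub>?A\<^esub> (g \<otimes>\<^bsub>?A\<^esub> h)) r" .
    qed
  qed (rule mltc)
qed (auto simp: path_algebra_def fun_eq_iff sum.distrib case_prod_beta algebra_simps)

section \<open>Modules over a not necessarily commutative ring\<close>

locale left_module = R?: ring R + M?: abelian_group M
  for R :: "('a, 'c) ring_scheme" (structure) and M :: "('a, 'b, 'd) module_scheme" (structure) +
  assumes smult_closed: "a \<in> carrier R \<Longrightarrow> x \<in> carrier M \<Longrightarrow> a \<odot>\<^bsub>M\<^esub> x \<in> carrier M"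
    and smult_l_distr: "a \<in> carrier R \<Longrightarrow> b \<in> carrier R \<Longrightarrow> x \<in> carrier M \<Longrightarrow>
      (a \<oplus>\<^bsub>R\<^esub> b) \<odot>\<^bsub>M\<^esub> x = a \<odot>\<^bsub>M\<^esub> x \<oplus>\<^bsub>M\<^esub> b \<odot>\<^bsub>M\<^esub> x"
    and smult_r_distr: "a \<in> carrier R \<Longrightarrow> x \<in> carrier M \<Longrightarrow> y \<in> carrier M \<Longrightarrow>
      a \<odot>\<^bsub>M\<^esub> (x \<oplus>\<^bsub>M\<^esub> y) = a \<odot>\<^bsub>M\<^esub> x \<oplus>\<^bsub>M\<^esub> a \<odot>\<^bsub>M\<^esub> y"
    and smult_assoc: "a \<in> carrier R \<Longrightarrow> b \<in> carrier R \<Longrightarrow> x \<in> carrier M \<Longrightarrow>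
      (a \<otimes>\<^bsub>R\<^esub> b) \<odot>\<^bsub>M\<^esub> x = a \<odot>\<^bsub>M\<^esub> (b \<odot>\<^bsub>M\<^esub> x)"
    and smult_one: "x \<in> carrier M \<Longrightarrow> \<one>\<^bsub>R\<^esub> \<odot>\<^bsub>M\<^esub> x = x"

definition left_submodule ::
    "('a, 'c) ring_scheme \<Rightarrow> ('a, 'b, 'd) module_scheme \<Rightarrow> 'b set \<Rightarrow> bool" where
  "left_submodule R M X \<longleftrightarrow> X \<subseteq> carrier M \<and> \<zero>\<^bsub>M\<^esub> \<in> X
     \<and> (\<forall>x\<in>X. \<forall>y\<in>X. x \<oplus>\<^bsub>M\<^esub> y \<in> X) \<and> (\<forall>a\<in>carrier R. \<forall>x\<in>X. a \<odot>\<^bsub>M\<^esub> x \<in> X)"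

definition indecomposable ::
    "('a, 'c) ring_scheme \<Rightarrow> ('a, 'b, 'd) module_scheme \<Rightarrow> bool" where
  "indecomposable R M \<longleftrightarrow> carrier M \<noteq> {\<zero>\<^bsub>M\<^esub>}
     \<and> (\<forall>X Y. left_submodule R M X \<and> left_submodule R M Y \<and> X \<inter> Y = {\<zero>\<^bsub>M\<^esub>}
          \<and> {x \<oplus>\<^bsub>M\<^esub> y | x y. x \<in> X \<and> y \<in> Y} = carrier M
        \<longrightarrow> X = {\<zero>\<^bsub>M\<^esub>} \<or> Y = {\<zero>\<^bsub>M\<^esub>})"

definition left_module_hom ::
    "('a, 'c) ring_scheme \<Rightarrow> ('a, 'b, 'd) module_scheme \<Rightarrow> ('a, 'e, 'f) module_scheme
       \<Rightarrow> ('b \<Rightarrow> 'e) set" where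
  "left_module_hom R M M' = {h. h \<in> carrier M \<rightarrow> carrier M'
     \<and> (\<forall>x\<in>carrier M. \<forall>y\<in>carrier M. h (x \<oplus>\<^bsub>M\<^esub> y) = h x \<oplus>\<^bsub>M'\<^esub> h y)
     \<and> (\<forall>a\<in>carrier R. \<forall>x\<in>carrier M. h (a \<odot>\<^bsub>M\<^esub> x) = a \<odot>\<^bsub>M'\<^esub> h x)}"

definition short_exact ::
    "('a, 'c) ring_scheme \<Rightarrow> ('a, 'b, 'd) module_scheme \<Rightarrow> ('b \<Rightarrow> 'e)
       \<Rightarrow> ('a, 'e, 'f) module_scheme \<Rightarrow> ('e \<Rightarrow> 'g) \<Rightarrow> ('a, 'g, 'h) module_scheme \<Rightarrow> bool" where
  "short_exact R L f E g M \<longleftrightarrow>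
     f \<in> left_module_hom R L E \<and> g \<in> left_module_hom R E M
     \<and> inj_on f (carrier L) \<and> g ` carrier E = carrier M
     \<and> f ` carrier L = {x \<in> carrier E. g x = \<zero>\<^bsub>M\<^esub>}"

section \<open>Real Schur roots\<close>

text \<open>
  All modules have carriers inside \<^typ>\<open>nat \<Rightarrow> 'k\<close>. Every finite-dimensional \<open>kQ\<close>-module is isomorphic
  to one of this form, and so is every extension of one such module by another.
\<close>

type_synonym ('v, 'e, 'k) kQ_module = "(('v, 'e) qpath \<Rightarrow> 'k, nat \<Rightarrow> 'k) module"

text \<open>
  \<open>Ext\<^sup>1(M, L)\<close> in the sense of Yoneda is the set of classes of extensions \<open>0 \<rightarrow> L \<rightarrow> E \<rightarrow> M \<rightarrow> 0\<close>, the zero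
  element being the class of split extensions.
\<close>

definition Ext1_zero ::
    "('v, 'e) pre_digraph \<Rightarrow> ('v, 'e, 'k::field) kQ_module \<Rightarrow> ('v, 'e, 'k) kQ_module \<Rightarrow> bool" where
  "Ext1_zero Q M L \<longleftrightarrow>
     (\<forall>(E :: ('v, 'e, 'k) kQ_module) f g.
        left_module (path_algebra Q) E \<and> short_exact (path_algebra Q) L f E g M
        \<longrightarrow> (\<exists>s\<in>left_module_hom (path_algebra Q) M E. \<forall>x\<in>carrier M. g (s x) = x))"

definition has_dimension ::
    "('v, 'e) pre_digraph \<Rightarrow> ('v, 'e, 'k::field) kQ_module \<Rightarrow> (nat \<Rightarrow> 'k) set \<Rightarrow> nat \<Rightarrow> bool" where
  "has_dimension Q M X d \<longleftrightarrow>
     (\<exists>b. b ` {..<d} \<subseteq> X \<and>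
        (\<forall>x\<in>X. \<exists>!c. c \<in> {..<d} \<rightarrow>\<^sub>E UNIV
           \<and> x = (\<Oplus>\<^bsub>M\<^esub>j\<in>{..<d}. scalar_elt Q (c j) \<odot>\<^bsub>M\<^esub> b j)))"

definition vertex_space ::
    "('v, 'e, 'k::field) kQ_module \<Rightarrow> 'v \<Rightarrow> (nat \<Rightarrow> 'k) set" where
  "vertex_space M v = (\<lambda>x. vertex_idempotent v \<odot>\<^bsub>M\<^esub> x) ` carrier M"

definition has_dimension_vector ::
    "('v, 'e) pre_digraph \<Rightarrow> ('v, 'e, 'k::field) kQ_module \<Rightarrow> ('v \<Rightarrow> nat) \<Rightarrow> bool" where
  "has_dimension_vector Q M m \<longleftrightarrow>
     (\<forall>v\<in>verts Q. has_dimension Q M (vertex_space M v) (m v)) \<and> (\<forall>v. v \<notin> verts Q \<longrightarrow> m v = 0)"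

text \<open>
  An element \<open>\<Sum>i. m\<^sub>i \<alpha>\<^sub>i\<close> of the root lattice is represented by its coefficient function \<open>m\<close>, which
  vanishes off the vertex set.
\<close>

definition real_Schur_roots ::
    "'k::field itself \<Rightarrow> ('v, 'e) pre_digraph \<Rightarrow> ('v \<Rightarrow> int) set" where
  "real_Schur_roots k Q =
     {(\<lambda>v. int (m v)) | m. \<exists>M :: ('v, 'e, 'k) kQ_module.
        left_module (path_algebra Q) M \<and> indecomposable (path_algebra Q) M
        \<and> Ext1_zero Q M M \<and> has_dimension_vector Q M m}"

section \<open>The Weyl group\<close>

definition cartan :: "('v, 'e) pre_digraph \<Rightarrow> 'v \<Rightarrow> 'v \<Rightarrow> int" where
  "cartan Q i j = (if i = j then 2 else
     - int (card {a \<in> arcs Q. tail Q a = i \<and> head Q a = j \<or> tail Q a = j \<and> head Q a = i}))"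

definition simple_root :: "'v \<Rightarrow> 'v \<Rightarrow> int" where
  "simple_root i = (\<lambda>j. if j = i then 1 else 0)"

text \<open>The linear map with \<open>s\<^sub>i(\<alpha>\<^sub>j) = \<alpha>\<^sub>j - a\<^sub>i\<^sub>j \<alpha>\<^sub>i\<close>.\<close>

definition simple_reflection :: "('v, 'e) pre_digraph \<Rightarrow> 'v \<Rightarrow> ('v \<Rightarrow> int) \<Rightarrow> 'v \<Rightarrow> int" where
  "simple_reflection Q i x = (\<lambda>k. x k - (\<Sum>j\<in>verts Q. x j * cartan Q i j) * simple_root i k)"

definition word_elt :: "('v, 'e) pre_digraph \<Rightarrow> 'v list \<Rightarrow> ('v \<Rightarrow> int) \<Rightarrow> 'v \<Rightarrow> int" where
  "word_elt Q u = foldr (\<lambda>i f. simple_reflection Q i \<circ> f) u id"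

text \<open>Simple reflections are involutions, so the monoid they generate is a group.\<close>

definition weyl_group :: "('v, 'e) pre_digraph \<Rightarrow> (('v \<Rightarrow> int) \<Rightarrow> 'v \<Rightarrow> int) set" where
  "weyl_group Q = word_elt Q ` lists (verts Q)"

definition conj_reflection ::
    "('v, 'e) pre_digraph \<Rightarrow> (('v \<Rightarrow> int) \<Rightarrow> 'v \<Rightarrow> int) \<Rightarrow> 'v \<Rightarrow> ('v \<Rightarrow> int) \<Rightarrow> 'v \<Rightarrow> int" where
  "conj_reflection Q w i = w \<circ> simple_reflection Q i \<circ> inv_into UNIV w"

definition reflections :: "('v, 'e) pre_digraph \<Rightarrow> (('v \<Rightarrow> int) \<Rightarrow> 'v \<Rightarrow> int) set" where
  "reflections Q = {conj_reflection Q w i | w i. w \<in> weyl_group Q \<and> i \<in> verts Q}"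

definition root_of_reflection ::
    "('v, 'e) pre_digraph \<Rightarrow> (('v \<Rightarrow> int) \<Rightarrow> 'v \<Rightarrow> int) \<Rightarrow> 'v \<Rightarrow> int" where
  "root_of_reflection Q t = (THE b. (\<forall>v. b v \<ge> 0) \<and>
     (\<exists>w\<in>weyl_group Q. \<exists>i\<in>verts Q. b = w (simple_root i) \<and> t = conj_reflection Q w i))"

definition words :: "('v, 'e) pre_digraph \<Rightarrow> 'v list set" where
  "words Q = {u. set u \<subseteq> verts Q \<and> distinct_adj u}"

definition words_of :: "('v, 'e) pre_digraph \<Rightarrow> (('v \<Rightarrow> int) \<Rightarrow> 'v \<Rightarrow> int) \<Rightarrow> 'v list set" where
  "words_of Q w = {u \<in> words Q. word_elt Q u = w}"

definition reflection_words :: "('v, 'e) pre_digraph \<Rightarrow> 'v list set" where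
  "reflection_words Q = (\<Union>w\<in>reflections Q. words_of Q w)"

section \<open>The surfaces\<close>

definition quotient_topology :: "'a topology \<Rightarrow> ('a \<times> 'a) set \<Rightarrow> 'a set topology" where
  "quotient_topology X r =
     topology (\<lambda>U. U \<subseteq> topspace X // r \<and> openin X (\<Union>U))"

lemma istopology_quotient:
  assumes "equiv (topspace X) r"
  shows "istopology (\<lambda>U. U \<subseteq> topspace X // r \<and> openin X (\<Union>U))"
  unfolding istopology_def
proof (intro conjI allI impI)
  fix S T
  assume S: "S \<subseteq> topspace X // r \<and> openin X (\<Union>S)" and T: "T \<subseteq> topspace X // r \<and> openin X (\<Union>T)"
  have "\<Union>(S \<inter> T) = \<Union>S \<inter> \<Union>T"
  proof
    show "\<Union>S \<inter> \<Union>T \<subseteq> \<Union>(S \<inter> T)"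
    proof
      fix x assume "x \<in> \<Union>S \<inter> \<Union>T"
      then obtain A B where "A \<in> S" "B \<in> T" "x \<in> A" "x \<in> B" by auto
      moreover from this have "A = B"
        using quotient_disj[OF assms, of A B] S T by blast
      ultimately show "x \<in> \<Union>(S \<inter> T)" by blast
    qed
  qed auto
  then show "openin X (\<Union>(S \<inter> T))" using S T by auto
  show "S \<inter> T \<subseteq> topspace X // r" using S by auto
next
  fix K assume K: "\<forall>U\<in>K. U \<subseteq> topspace X // r \<and> openin X (\<Union>U)"
  then show "\<Union>K \<subseteq> topspace X // r" by auto
  have "\<Union>(\<Union>K) = (\<Union>U\<in>K. \<Union>U)" by auto
  then show "openin X (\<Union>(\<Union>K))" using K by auto
qed

lemma openin_quotient_topology:
  assumes "equiv (topspace X) r"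
  shows "openin (quotient_topology X r) U \<longleftrightarrow> U \<subseteq> topspace X // r \<and> openin X (\<Union>U)"
  unfolding quotient_topology_def by (simp add: istopology_quotient[OF assms])

lemma topspace_quotient_topology:
  assumes "equiv (topspace X) r"
  shows "topspace (quotient_topology X r) = topspace X // r"
proof -
  have "openin (quotient_topology X r) (topspace X // r)"
    by (simp add: openin_quotient_topology[OF assms] Union_quotient[OF assms])
  moreover have "\<And>U. openin (quotient_topology X r) U \<Longrightarrow> U \<subseteq> topspace X // r"
    by (simp add: openin_quotient_topology[OF assms])
  ultimately show ?thesis
    by (meson openin_subset openin_topspace subset_antisym)
qed

lemma quotient_map_quotient_topology:
  assumes "equiv (topspace X) r"
  shows "quotient_map X (quotient_topology X r) (\<lambda>x. r `` {x})"
  unfolding quotient_map_def topspace_quotient_topology[OF assms]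
proof (intro conjI allI impI)
  show "(\<lambda>x. r `` {x}) ` topspace X = topspace X // r"
    by (auto simp: quotient_def)
  fix U assume U: "U \<subseteq> topspace X // r"
  have "{x \<in> topspace X. r `` {x} \<in> U} = \<Union>U"
  proof
    show "{x \<in> topspace X. r `` {x} \<in> U} \<subseteq> \<Union>U"
      using equiv_class_self[OF assms] by auto
    show "\<Union>U \<subseteq> {x \<in> topspace X. r `` {x} \<in> U}"
    proof
      fix x assume "x \<in> \<Union>U"
      then obtain A where A: "A \<in> U" "x \<in> A" by auto
      then obtain y where "y \<in> topspace X" "A = r `` {y}" using U by (auto elim!: quotientE)
      then have "r `` {x} = A" "x \<in> topspace X"
        using A equiv_class_eq[OF assms, of y x] equiv_type[OF assms] by auto
      then show "x \<in> {x \<in> topspace X. r `` {x} \<in> U}" using A by auto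
    qed
  qed
  then show "openin X {x \<in> topspace X. r `` {x} \<in> U} = openin (quotient_topology X r) U"
    using U by (simp add: openin_quotient_topology[OF assms])
qed

text \<open>
  The regular \<open>N\<close>-gon (\<open>N \<ge> 3\<close>) has center \<open>0\<close>. Its edges are numbered counter-clockwise from \<open>1\<close> to \<open>N\<close>
  starting at the vertex \<open>corner N 0\<close>; the \<open>k\<close>-th one carries the label \<open>\<sigma>(k)\<close>.
  A point \<open>z\<close> of the copy \<open>G\<^sub>c\<close> (\<open>c = 1, 2\<close>) is the pair \<open>(c, z)\<close>.
\<close>

definition corner :: "nat \<Rightarrow> nat \<Rightarrow> complex" where
  "corner N k = cis (2 * pi * real k / real N)"

definition polygon :: "nat \<Rightarrow> complex set" where
  "polygon N = convex hull (corner N ` {..<N})"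

definition edge :: "nat \<Rightarrow> nat \<Rightarrow> complex set" where
  "edge N k = closed_segment (corner N (k - 1)) (corner N k)"

definition two_polygons :: "nat \<Rightarrow> (nat \<times> complex) topology" where
  "two_polygons N = sum_topology (\<lambda>_. top_of_set (polygon N)) {1, 2}"

text \<open>
  The \<open>k\<close>-th edges of \<open>G\<^sub>1\<close> (oriented counter-clockwise) and of \<open>G\<^sub>2\<close> (oriented clockwise) have the same
  label and are glued according to orientation. So the surface depends on \<open>\<sigma>\<close> only through the
  labelling of the edges.
\<close>

definition edge_gluing :: "nat \<Rightarrow> ((nat \<times> complex) \<times> (nat \<times> complex)) set" where
  "edge_gluing N =
     {((1, (1 - t) *\<^sub>R corner N (k - 1) + t *\<^sub>R corner N k),
       (2, (1 - t) *\<^sub>R corner N k + t *\<^sub>R corner N (k - 1))) | k t. k \<in> {1..N} \<and> t \<in> {0..1}}"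

definition gluing :: "nat \<Rightarrow> ((nat \<times> complex) \<times> (nat \<times> complex)) set" where
  "gluing N = (edge_gluing N \<union> (edge_gluing N)\<inverse>)\<^sup>* \<inter> ({1, 2} \<times> polygon N) \<times> ({1, 2} \<times> polygon N)"

definition surface :: "nat \<Rightarrow> (nat \<times> complex) set topology" where
  "surface N = quotient_topology (two_polygons N) (gluing N)"

definition image_of :: "nat \<Rightarrow> nat \<Rightarrow> complex set \<Rightarrow> (nat \<times> complex) set set" where
  "image_of N c S = (\<lambda>z. gluing N `` {(c, z)}) ` S"

lemma equiv_gluing: "equiv (topspace (two_polygons N)) (gluing N)"
proof -
  have "topspace (two_polygons N) = {1, 2} \<times> polygon N"
    by (auto simp: two_polygons_def)
  moreover have "sym ((edge_gluing N \<union> (edge_gluing N)\<inverse>)\<^sup>*)"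
    by (intro sym_rtrancl) (auto simp: sym_def)
  ultimately show ?thesis
    by (auto simp: gluing_def equiv_def refl_on_def sym_def trans_def intro: rtrancl_trans)
qed

definition marked_points :: "nat \<Rightarrow> (nat \<times> complex) set set" where
  "marked_points N = (\<Union>c\<in>{1, 2}. image_of N c (corner N ` {..<N}))"

definition arc_curve :: "nat \<Rightarrow> (nat \<Rightarrow> nat) \<Rightarrow> nat \<Rightarrow> (nat \<times> complex) set set" where
  "arc_curve N \<sigma> i = (\<Union>c\<in>{1, 2}. \<Union>k\<in>{k \<in> {1..N}. \<sigma> k = i}. image_of N c (edge N k))"

definition all_arcs :: "nat \<Rightarrow> (nat \<Rightarrow> nat) \<Rightarrow> (nat \<times> complex) set set" where
  "all_arcs N \<sigma> = (\<Union>i\<in>{1..N}. arc_curve N \<sigma> i)"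

definition L_segment :: "nat \<Rightarrow> nat \<Rightarrow> (nat \<times> complex) set set" where
  "L_segment N c = image_of N c (closed_segment 0 (corner N 0))"

section \<open>Admissible curves\<close>

text \<open>From here on the vertices of \<open>Q\<close> are labelled by \<open>1, \<dots>, N\<close> where \<open>N = card (verts Q)\<close>.\<close>

definition P_perms :: "(nat, 'e) pre_digraph \<Rightarrow> (nat \<Rightarrow> nat) set" where
  "P_perms Q = {\<sigma>. \<sigma> permutes verts Q \<and>
     (\<forall>i\<in>verts Q. \<forall>j\<in>verts Q. j > i \<longrightarrow> \<not> (\<exists>a\<in>arcs Q. tail Q a = \<sigma> j \<and> head Q a = \<sigma> i))}"

definition crossings ::
    "nat \<Rightarrow> (nat \<Rightarrow> nat) \<Rightarrow> (real \<Rightarrow> (nat \<times> complex) set) \<Rightarrow> real set" where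
  "crossings N \<sigma> \<eta> = {x \<in> {0<..<1}. \<eta> x \<in> all_arcs N \<sigma>}"

text \<open>
  A curve meeting the marked points only at its ends meets exactly one arc at each crossing.
\<close>

definition crossing_word ::
    "nat \<Rightarrow> (nat \<Rightarrow> nat) \<Rightarrow> (real \<Rightarrow> (nat \<times> complex) set) \<Rightarrow> nat list" where
  "crossing_word N \<sigma> \<eta> =
     map (\<lambda>x. THE i. \<eta> x \<in> arc_curve N \<sigma> i) (sorted_list_of_set (crossings N \<sigma> \<eta>))"

text \<open>
  Transversality of a continuous curve: near the crossing the curve meets the arcs only once and passes
  from one side to the other. The two sides of every arc are the interiors of the two polygons.
\<close>

definition crosses_transversally ::
    "nat \<Rightarrow> (real \<Rightarrow> (nat \<times> complex) set) \<Rightarrow> real \<Rightarrow> bool" where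
  "crosses_transversally N \<eta> x \<longleftrightarrow>
     (\<exists>\<epsilon>>0. {x - \<epsilon>..x + \<epsilon>} \<subseteq> {0..1} \<and> (\<exists>a b. {a, b} = {1, 2}
        \<and> \<eta> ` {x - \<epsilon>..<x} \<subseteq> image_of N a (interior (polygon N))
        \<and> \<eta> ` {x<..x + \<epsilon>} \<subseteq> image_of N b (interior (polygon N))))"

definition admissible ::
    "(nat, 'e) pre_digraph \<Rightarrow> (nat \<Rightarrow> nat) \<Rightarrow> (real \<Rightarrow> (nat \<times> complex) set) \<Rightarrow> bool" where
  "admissible Q \<sigma> \<eta> \<longleftrightarrow> (let N = card (verts Q) in
     pathin (surface N) \<eta>
     \<and> (\<forall>x\<in>{0..1}. \<eta> x \<in> marked_points N \<longleftrightarrow> x \<in> {0, 1})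
     \<and> (\<exists>\<epsilon>>0. \<epsilon> \<le> 1 \<and> \<eta> ` {0..\<epsilon>} \<subseteq> L_segment N 1 \<and> \<eta> ` {1 - \<epsilon>..1} \<subseteq> L_segment N 2)
     \<and> (\<forall>x\<in>{0..1}. \<eta> x \<in> all_arcs N \<sigma> - marked_points N \<longrightarrow> crosses_transversally N \<eta> x)
     \<and> finite (crossings N \<sigma> \<eta>) \<and> crossing_word N \<sigma> \<eta> \<in> reflection_words Q)"

text \<open>
  We collect the curves themselves rather than their isotopy classes; the set of the roots
  attached to them is the same.
\<close>

definition simple_admissible ::
    "(nat, 'e) pre_digraph \<Rightarrow> (nat \<Rightarrow> nat) \<Rightarrow> (real \<Rightarrow> (nat \<times> complex) set) set" where
  "simple_admissible Q \<sigma> = {\<eta>. admissible Q \<sigma> \<eta> \<and>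
     (\<forall>x\<in>{0..1}. \<forall>y\<in>{0..1}. \<eta> x = \<eta> y \<longrightarrow> x = y \<or> {x, y} = {0, 1})}"

definition curve_root ::
    "(nat, 'e) pre_digraph \<Rightarrow> (nat \<Rightarrow> nat) \<Rightarrow> (real \<Rightarrow> (nat \<times> complex) set) \<Rightarrow> nat \<Rightarrow> int" where
  "curve_root Q \<sigma> \<eta> =
     root_of_reflection Q (word_elt Q (crossing_word (card (verts Q)) \<sigma> \<eta>))"

section \<open>The quiver of type D\<close>

definition D_quiver :: "nat \<Rightarrow> (nat, nat \<times> nat) pre_digraph" where
  "D_quiver n =
    \<lparr> verts = {1..n},
      arcs = {(i, i + 1) | i. 1 \<le> i \<and> i + 1 \<le> n - 2} \<union> {(n - 2, n - 1), (n - 2, n)},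
      tail = fst,
      head = snd \<rparr>"

lemma wf_D_quiver: "n \<ge> 4 \<Longrightarrow> wf_digraph (D_quiver n)"
  by (auto simp: D_quiver_def wf_digraph_def)

end

(*
  Both sides are the set of vectors x >= 0 with (x, x) = 2, that is, the positive roots of D_n.

  Curves: a real root has norm 2, so every curve gives such a vector. Conversely each positive root
  is w alpha_i for an explicit word w, and the palindrome w i w^-1 is realised by a simple curve that
  is invariant under the hyperelliptic involution exchanging the two polygons. Such a curve passes
  through the midpoint of the arc T_i, and its pieces are pairwise disjoint chords of the polygons.

  Modules: an indecomposable M with Ext^1(M, M) = 0 has End M = k (Happel and Ringel). When
  End M = k, the kernel of F |-> (F X_a - X_a F)_a on graded linear maps F is one-dimensional, and the
  map is onto iff Ext^1(M, M) = 0. Comparing dimensions, Ext^1(M, M) = 0 iff the dimension vector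
  has norm 2. It remains to write down, for each positive root, a module with End M = k.
*)
theory Submission
  imports Defs "HOL-Library.Function_Algebras"
begin

text \<open>Every admissible order lists 1, ..., n - 2 first, so \<open>P_perms\<close> consists of
  the identity and the exchange of the two sinks n - 1 and n. The exchange serves the roots that
  contain n but not n - 1. The involution is the identity in the coordinates of the two polygons.
  All pieces of a symmetric curve can therefore be drawn in one polygon, and chords of a convex
  polygon are disjoint when their ends do not alternate on the boundary: topology becomes
  inequalities between boundary positions k + t. The obstacle is the prescribed start along
  \<open>L_segment\<close>, which forces a bend in the first piece; the bend is made small enough to
  keep clear of the other chords. On the module side, Ext is given by extensions whose carriers
  consist of functions on the natural numbers, so modules are first put into coordinates. The
  dimension arguments rest on one fact: a homogeneous linear system with fewer equations than
  unknowns has a non-zero solution. Algebraic closedness enters through a single eigenvector, in the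
  passage from rigid modules to bricks.\<close>

section \<open>Chords of a regular polygon\<close>

text \<open>Twice the signed area of the triangle \<open>a b c\<close>: positive when the vertices
  run counter-clockwise, zero when they are collinear. It is affine in each argument, so estimates
  for boundary points reduce to corners.\<close>

definition orient :: "complex \<Rightarrow> complex \<Rightarrow> complex \<Rightarrow> real" where
  "orient a b c = Im (cnj (b - a) * (c - a))"

text \<open>Edges are numbered from 0 and parametrised counter-clockwise in both polygons. The
  gluing reverses the direction, so the parameter \<open>t\<close> on one side is
  \<open>1 - t\<close> on the other.\<close>

definition edge_point :: "nat \<Rightarrow> nat \<Rightarrow> real \<Rightarrow> complex" where
  "edge_point N k t = (1 - t) *\<^sub>R corner N k + t *\<^sub>R corner N (Suc k)"

lemma orient_rotate: "orient a b c = orient b c a"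
  by (simp add: orient_def algebra_simps)

lemma orient_swap: "orient a b c = - orient b a c"
  by (simp add: orient_def algebra_simps)

lemma orient_self [simp]: "orient a b a = 0" "orient a b b = 0" "orient a a b = 0"
  by (simp_all add: orient_def algebra_simps)

lemma orient_affine: "orient a b ((1 - t) *\<^sub>R c + t *\<^sub>R d) = (1 - t) * orient a b c + t * orient a b d"
  by (simp add: orient_def algebra_simps)

lemma orient_eq_inner: "orient a b z = (\<i> * (b - a)) \<bullet> z - (\<i> * (b - a)) \<bullet> a"
  by (simp add: orient_def inner_complex_def algebra_simps)

text \<open>The product form shows the sign: when \<open>a < b < c < a + 2 * pi\<close>, all three
  half differences lie strictly between 0 and pi. It is obtained by writing the area as
  \<open>sin (b - a) + sin (c - b) - sin (c - a)\<close>.\<close>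

lemma orient_cis:
  "orient (cis a) (cis b) (cis c) = 4 * sin ((b - a) / 2) * sin ((c - b) / 2) * sin ((c - a) / 2)"
proof -
  define p q where "p = (b - a) / 2" and "q = (c - b) / 2"
  have b: "b - a = 2 * p" "(b - a) / 2 = p" by (simp_all add: p_def)
  have c: "c - b = 2 * q" "(c - b) / 2 = q" by (simp_all add: q_def)
  have a: "c - a = 2 * (p + q)" "(c - a) / 2 = p + q" using b(1) c(1) by simp_all
  have "orient (cis a) (cis b) (cis c) = sin (b - a) + sin (c - b) - sin (c - a)"
    unfolding orient_def sin_diff by (simp add: algebra_simps)
  also have "\<dots> = (sin (2 * p) + sin (2 * q)) - sin (2 * (p + q))"
    unfolding a b c ..
  also have "sin (2 * p) + sin (2 * q) = 2 * sin (p + q) * cos (p - q)"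
  proof -
    have h: "(2 * p + 2 * q) / 2 = p + q" "(2 * p - 2 * q) / 2 = p - q" by simp_all
    show ?thesis using sin_plus_sin[of "2 * p" "2 * q"] unfolding h .
  qed
  also have "2 * sin (p + q) * cos (p - q) - sin (2 * (p + q)) = 2 * sin (p + q) * (cos (p - q) - cos (p + q))"
    unfolding sin_double by (simp add: algebra_simps)
  also have "cos (p - q) - cos (p + q) = 2 * sin p * sin q" by (simp add: cos_diff cos_add)
  finally show ?thesis by (simp only: a(2) b(2) c(2) mult_ac)
qed

lemma corner_add [simp]: "N > 0 \<Longrightarrow> corner N (N + k) = corner N k"
proof -
  assume "N > 0"
  then have "2 * pi * real (N + k) / real N = 2 * pi + 2 * pi * real k / real N"
    by (simp add: field_simps)
  then show ?thesis unfolding corner_def by (simp flip: cis_mult)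
qed

lemma corner_mod: "corner N (k mod N) = corner N k"
proof (cases "N = 0")
  case False
  have "corner N (N * m + j) = corner N j" for m j
    using False by (induction m) (auto simp: add.assoc)
  from this[of "k div N" "k mod N"] show ?thesis by simp
qed simp

lemma sin_step_pos: "i < j \<Longrightarrow> j < i + N \<Longrightarrow>
    sin ((2 * pi * real j / real N - 2 * pi * real i / real N) / 2) > 0"
proof -
  assume ij: "i < j" "j < i + N"
  have "(2 * pi * real j / real N - 2 * pi * real i / real N) / 2 = pi * (real j - real i) / real N"
    by (simp add: diff_divide_distrib right_diff_distrib)
  moreover have "0 < pi * (real j - real i) / real N" using ij by simp
  moreover have "pi * (real j - real i) / real N < pi"
  proof -
    have "pi * (real j - real i) < pi * real N" using ij by (intro mult_strict_left_mono) auto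
    then show ?thesis using ij by (simp add: divide_less_eq)
  qed
  ultimately show ?thesis using sin_gt_zero by presburger
qed

text \<open>Indices of corners are not reduced modulo \<open>N\<close>. The window
  \<open>c < a + N\<close> expresses the cyclic order, and a corner before \<open>a\<close> enters
  it with its index raised by \<open>N\<close>.\<close>

lemma orient_corner_pos:
  "a < b \<Longrightarrow> b < c \<Longrightarrow> c < a + N \<Longrightarrow> orient (corner N a) (corner N b) (corner N c) > 0"
  unfolding corner_def orient_cis by (intro mult_pos_pos sin_step_pos) auto

lemma orient_corner_nonneg:
  assumes "a \<le> b" "b \<le> c" "c \<le> a + N" "N > 0"
  shows "orient (corner N a) (corner N b) (corner N c) \<ge> 0"
proof (cases "a = b \<or> b = c \<or> c = a + N")
  case True
  then show ?thesis using assms corner_add[of N a] by (auto simp: add.commute)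
next
  case False
  then show ?thesis using assms orient_corner_pos[of a b c N] by linarith
qed

lemma orient_edge_pos:
  assumes "N \<ge> 3" "k < N" "j < N" "j \<noteq> k" "j \<noteq> Suc k mod N"
  shows "orient (corner N k) (corner N (Suc k)) (corner N j) > 0"
proof (cases "j > k")
  case True
  then have "j > Suc k" using assms by (cases "j = Suc k") auto
  then show ?thesis using assms by (intro orient_corner_pos) auto
next
  case False
  have "Suc k < N + j"
  proof (cases "j = 0")
    case True then have "Suc k \<noteq> N" using assms by auto
    then show ?thesis using assms by auto
  qed (use assms in auto)
  then show ?thesis using False assms orient_corner_pos[of k "Suc k" "N + j" N] by simp
qed

lemma orient_edge_nonneg:
  assumes "N \<ge> 3" "k < N"
  shows "orient (corner N k) (corner N (Suc k)) (corner N j) \<ge> 0"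
proof -
  have "corner N j = corner N (j mod N)" by (simp add: corner_mod)
  moreover have "j mod N < N" using assms by simp
  moreover have "corner N (Suc k mod N) = corner N (Suc k)" by (simp add: corner_mod)
  ultimately show ?thesis
    by (metis assms orient_edge_pos less_eq_real_def orient_self(1,2))
qed

lemma orient_edge_point_edge:
  "orient (edge_point N k s) (edge_point N k t) z
     = (t - s) * orient (corner N k) (corner N (Suc k)) z"
  by (simp add: orient_def edge_point_def algebra_simps)

text \<open>Three boundary points in counter-clockwise order, counted from corner 0. By affinity the
  area is a combination of areas at corners with non-negative terms, one of them positive. The
  hypotheses \<open>ne\<close> keep away from collinear triples: three points of one edge, or corner
  0 together with two points of the edge that ends there.\<close>

lemma orient_boundary_pos:
  assumes N: "N \<ge> 3" and k: "k1 \<le> k2" "k2 \<le> k3" "k3 < N"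
    and t: "0 \<le> t1" "t1 < 1" "0 < t2" "t2 < 1" "0 < t3" "t3 < 1"
    and lt: "k1 = k2 \<Longrightarrow> t1 < t2" "k2 = k3 \<Longrightarrow> t2 < t3"
    and ne: "k1 \<noteq> k3" "0 < t1 \<or> k2 \<noteq> k3"
  shows "orient (edge_point N k1 t1) (edge_point N k2 t2) (edge_point N k3 t3) > 0"
proof -
  let ?c = "corner N"
  note nn = orient_corner_nonneg[where N = N]
  consider "k1 < k2" "k2 < k3" | "k1 = k2" "k2 < k3" | "k1 < k2" "k2 = k3" using k ne by linarith
  then show ?thesis
  proof cases
    case 1
    have nn3: "orient (?c a) (?c b) (edge_point N k3 t3) \<ge> 0" if "a \<in> {k1, Suc k1}" "b \<in> {k2, Suc k2}" for a b
      unfolding edge_point_def orient_affine using that 1 k t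
      by (intro add_nonneg_nonneg mult_nonneg_nonneg nn) auto
    have pos3: "orient (?c k1) (?c k2) (edge_point N k3 t3) > 0"
      unfolding edge_point_def orient_affine using 1 k t
      by (intro add_pos_nonneg mult_pos_pos mult_nonneg_nonneg nn orient_corner_pos) auto
    have nn2: "orient (edge_point N k3 t3) (?c a) (edge_point N k2 t2) \<ge> 0" if "a \<in> {k1, Suc k1}" for a
      unfolding edge_point_def[of N k2] orient_affine using that nn3 t
      by (intro add_nonneg_nonneg mult_nonneg_nonneg) (auto simp: orient_rotate[of "edge_point N k3 t3"])
    have pos2: "orient (edge_point N k3 t3) (?c k1) (edge_point N k2 t2) > 0"
      unfolding edge_point_def[of N k2] orient_affine using nn3 pos3 t
      by (intro add_pos_nonneg mult_pos_pos mult_nonneg_nonneg) (auto simp: orient_rotate[of "edge_point N k3 t3"])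
    have "orient (edge_point N k2 t2) (edge_point N k3 t3) (edge_point N k1 t1) > 0"
      unfolding edge_point_def[of N k1] orient_affine using nn2 pos2 t
      by (intro add_pos_nonneg mult_pos_pos mult_nonneg_nonneg) (auto simp: orient_rotate[of "edge_point N k2 t2"])
    then show ?thesis by (simp add: orient_rotate[of "edge_point N k1 t1"])
  next
    case 2
    have "orient (?c k1) (?c (Suc k1)) (edge_point N k3 t3) > 0"
    proof (cases "k3 = Suc k1")
      case True
      then have "Suc k3 \<noteq> k1 + N" using N by auto
      then have "orient (?c k1) (?c (Suc k1)) (?c (Suc k3)) > 0"
        using True N 2 k by (intro orient_corner_pos) auto
      then show ?thesis unfolding edge_point_def orient_affine
        using t True by simp
    next
      case False
      then show ?thesis unfolding edge_point_def orient_affine using 2 k t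
        by (intro add_pos_nonneg mult_pos_pos mult_nonneg_nonneg nn orient_corner_pos) auto
    qed
    then show ?thesis using lt 2 by (simp add: orient_edge_point_edge)
  next
    case 3
    have rot: "orient (?c k2) (?c (Suc k2)) x = orient x (?c k2) (?c (Suc k2))" for x
      by (rule orient_rotate[symmetric])
    have "orient (?c k2) (?c (Suc k2)) (edge_point N k1 t1) > 0"
    proof (cases "Suc k2 = k1 + N")
      case True
      \<comment> \<open>Edge \<open>k2\<close> ends in corner \<open>k1\<close>, so this corner
        contributes nothing. The other end of edge \<open>k1\<close> counts with weight
        \<open>t1\<close>, which is positive by \<open>ne\<close>.\<close>
      then have k1: "k1 = 0" "Suc k2 = N" using k by auto
      have "Suc k1 < k2" using k1 N by auto
      then have "orient (?c k2) (?c (Suc k2)) (?c (Suc k1)) > 0"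
        unfolding rot using N k1 by (intro orient_corner_pos) auto
      moreover have "orient (?c k2) (?c (Suc k2)) (?c k1) = 0"
        using k1 True corner_add[of N 0] N by simp
      ultimately show ?thesis unfolding edge_point_def orient_affine
        using t 3 ne by simp
    next
      case False
      have "orient (?c k2) (?c (Suc k2)) (?c k1) > 0"
        unfolding rot using 3 k False by (intro orient_corner_pos) auto
      moreover have "orient (?c k2) (?c (Suc k2)) (?c (Suc k1)) \<ge> 0"
        unfolding rot using 3 k by (intro nn) auto
      ultimately show ?thesis unfolding edge_point_def orient_affine using t
        by (intro add_pos_nonneg mult_pos_pos mult_nonneg_nonneg)
           simp_all
    qed
    then have "orient (edge_point N k2 t2) (edge_point N k3 t3) (edge_point N k1 t1) > 0"
      using lt 3 by (simp add: orient_edge_point_edge)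
    then show ?thesis by (simp add: orient_rotate[of "edge_point N k1 t1"])
  qed
qed

section \<open>The polygon as a convex set: edges, half-planes and interior\<close>

lemma corner_in_polygon [simp]: "N > 0 \<Longrightarrow> corner N k \<in> polygon N"
  unfolding polygon_def by (metis corner_mod hull_inc imageI lessThan_iff mod_less_divisor)

lemma convex_polygon: "convex (polygon N)" by (simp add: polygon_def)

lemma edge_point_in_polygon: "N > 0 \<Longrightarrow> 0 \<le> t \<Longrightarrow> t \<le> 1 \<Longrightarrow> edge_point N k t \<in> polygon N"
  unfolding edge_point_def by (intro convexD[OF convex_polygon]) auto

lemma polygon_subset_halfplane:
  assumes "N \<ge> 3" "k < N" "z \<in> polygon N"
  shows "orient (corner N k) (corner N (Suc k)) z \<ge> 0"
proof -
  let ?d = "\<i> * (corner N (Suc k) - corner N k)"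
  have "polygon N \<subseteq> {z. ?d \<bullet> z \<ge> ?d \<bullet> corner N k}"
    unfolding polygon_def
  proof (rule hull_minimal)
    show "corner N ` {..<N} \<subseteq> {z. ?d \<bullet> z \<ge> ?d \<bullet> corner N k}"
      using orient_edge_nonneg[OF assms(1,2)] unfolding orient_eq_inner by (auto simp: field_simps)
  qed (rule convex_halfspace_ge)
  then show ?thesis using assms(3) unfolding orient_eq_inner by auto
qed

lemma corner_Suc_neq: "N \<ge> 3 \<Longrightarrow> k < N \<Longrightarrow> corner N (Suc k) \<noteq> corner N k"
  using orient_corner_pos[of k "Suc k" "Suc (Suc k)" N] by auto

lemma interior_polygon_orient_pos:
  assumes "N \<ge> 3" "k < N" "z \<in> interior (polygon N)"
  shows "orient (corner N k) (corner N (Suc k)) z > 0"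
proof -
  let ?d = "\<i> * (corner N (Suc k) - corner N k)"
  have "polygon N \<subseteq> {z. ?d \<bullet> z \<ge> ?d \<bullet> corner N k}"
    using polygon_subset_halfplane[OF assms(1,2)] unfolding orient_eq_inner by auto
  then have "interior (polygon N) \<subseteq> interior {z. ?d \<bullet> z \<ge> ?d \<bullet> corner N k}"
    by (rule interior_mono)
  also have "\<dots> = {z. ?d \<bullet> z > ?d \<bullet> corner N k}"
    using corner_Suc_neq[OF assms(1,2)] by (intro interior_halfspace_ge) simp
  finally show ?thesis using assms(3) unfolding orient_eq_inner by auto
qed

lemma edge_point_notin_interior:
  "N \<ge> 3 \<Longrightarrow> k < N \<Longrightarrow> edge_point N k t \<notin> interior (polygon N)"
  using interior_polygon_orient_pos[of N k "edge_point N k t"] unfolding edge_point_def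
  by (auto simp: orient_affine)

lemma corner_notin_interior: "N \<ge> 3 \<Longrightarrow> corner N k \<notin> interior (polygon N)"
  using edge_point_notin_interior[of N "k mod N" 0] by (simp add: edge_point_def corner_mod)

lemma corner_neq_edge_point:
  assumes "N \<ge> 3" "k < N" "0 < t" "t < 1"
  shows "corner N j \<noteq> edge_point N k t"
proof
  assume eq: "corner N j = edge_point N k t"
  have "orient (corner N k) (corner N (Suc k)) (corner N (j mod N)) = 0"
    unfolding corner_mod eq by (simp add: edge_point_def orient_affine)
  then have "j mod N = k \<or> j mod N = Suc k mod N"
    using orient_edge_pos[of N k "j mod N"] assms by force
  then have "edge_point N k t = corner N k \<or> edge_point N k t = corner N (Suc k)"
    unfolding eq[symmetric] by (metis corner_mod)
  moreover have "edge_point N k t - corner N k = t *\<^sub>R (corner N (Suc k) - corner N k)"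
     "edge_point N k t - corner N (Suc k) = (1 - t) *\<^sub>R (corner N k - corner N (Suc k))"
    by (simp_all add: edge_point_def algebra_simps)
  ultimately show False using assms corner_Suc_neq[of N k] by force
qed

lemma edge_point_eqD:
  assumes "N \<ge> 3" "k < N" "0 < t" "t < 1" "k' < N" "0 \<le> t'" "t' \<le> 1"
    and eq: "edge_point N k t = edge_point N k' t'"
  shows "k' = k" "t' = t"
proof -
  have t': "0 < t'" "t' < 1"
    using corner_neq_edge_point[OF assms(1-4), of k'] corner_neq_edge_point[OF assms(1-4), of "Suc k'"] assms
    by (auto simp: edge_point_def less_le)
  have *: "k1 = k2" if "k1 \<le> k2" "k2 < N" "0 < t1" "t1 < 1" "0 < t2" "t2 < 1"
    "edge_point N k1 t1 = edge_point N k2 t2" for k1 k2 t1 t2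
  proof (rule ccontr)
    assume ne: "k1 \<noteq> k2"
    \<comment> \<open>The auxiliary point at half the parameter completes the two supposedly equal
      points to a triangle of positive area.\<close>
    have "orient (edge_point N k1 (t1/2)) (edge_point N k1 t1) (edge_point N k2 t2) > 0"
      using that ne assms(1) by (intro orient_boundary_pos) auto
    then show False using that by simp
  qed
  show k: "k' = k" using *[of k k' t t'] *[of k' k t' t] eq t' assms by force
  have "(t' - t) *\<^sub>R (corner N (Suc k) - corner N k) = 0"
    using eq k by (simp add: edge_point_def algebra_simps)
  then show "t' = t" using corner_Suc_neq[of N k] assms by auto
qed

lemma triangle_interior:
  assumes "orient a b c \<noteq> 0" "a \<in> S" "b \<in> S" "c \<in> S" "convex S" "0 < x" "0 < y" "0 < z" "x + y + z = 1"
  shows "x *\<^sub>R a + y *\<^sub>R b + z *\<^sub>R c \<in> interior S"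
proof -
  have "\<not> collinear {a, b, c}"
  proof
    assume "collinear {a, b, c}"
    then obtain u where u: "\<forall>x\<in>{a, b, c}. \<forall>y\<in>{a, b, c}. \<exists>r. x - y = r *\<^sub>R u"
      unfolding collinear_def by (elim exE)
    obtain r s where rs: "b - a = r *\<^sub>R u" "c - a = s *\<^sub>R u" using u by (metis insertI1 insertI2)
    have "orient a b c = 0" unfolding orient_def rs by simp
    then show False using assms(1) by simp
  qed
  then have "interior (convex hull {a, b, c}) =
      {v. \<exists>x y z. 0 < x \<and> 0 < y \<and> 0 < z \<and> x + y + z = 1 \<and> x *\<^sub>R a + y *\<^sub>R b + z *\<^sub>R c = v}"
    by (rule interior_convex_hull_3_minimal) simp
  then have "x *\<^sub>R a + y *\<^sub>R b + z *\<^sub>R c \<in> interior (convex hull {a, b, c})"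
    using assms(6-9) by (simp only: mem_Collect_eq) (rule exI[of _ x], rule exI[of _ y], rule exI[of _ z], simp)
  moreover have "convex hull {a, b, c} \<subseteq> S" using assms by (intro hull_minimal) auto
  ultimately show ?thesis by (meson interior_mono subsetD)
qed

text \<open>The ends of edge \<open>k\<close> and the far end of the chord span a non-degenerate
  triangle, in which every inner point of the chord has three positive barycentric coordinates. If
  the triangle were degenerate, both corners of edge \<open>k'\<close> would lie on the line of edge
  \<open>k\<close>, which is impossible for different edges of a polygon with at least three
  corners.\<close>

lemma chord_interior:
  assumes "N \<ge> 3" "k < N" "k' < N" "k \<noteq> k'" "0 < t" "t < 1" "0 < t'" "t' < 1" "0 < u" "u < 1"
  shows "linepath (edge_point N k t) (edge_point N k' t') u \<in> interior (polygon N)"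
proof -
  let ?q = "edge_point N k' t'"
  have "orient (corner N k) (corner N (Suc k)) ?q \<noteq> 0"
  proof
    assume "orient (corner N k) (corner N (Suc k)) ?q = 0"
    then have 0: "(1 - t') * orient (corner N k) (corner N (Suc k)) (corner N k')
        + t' * orient (corner N k) (corner N (Suc k)) (corner N (Suc k')) = 0"
      by (simp add: edge_point_def orient_affine)
    have z: "orient (corner N k) (corner N (Suc k)) (corner N k') = 0"
      "orient (corner N k) (corner N (Suc k)) (corner N (Suc k')) = 0"
      using 0 assms orient_edge_nonneg[OF assms(1,2), of k'] orient_edge_nonneg[OF assms(1,2), of "Suc k'"]
      by (simp_all add: add_nonneg_eq_0_iff)
    have "corner N (Suc k') = corner N (Suc k' mod N)" by (simp only: corner_mod)
    with z(2) have z': "orient (corner N k) (corner N (Suc k)) (corner N (Suc k' mod N)) = 0" by simp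
    have "Suc k' mod N < N" using assms(1) by simp
    then have "Suc k' mod N = k \<or> Suc k' mod N = Suc k mod N"
      using orient_edge_pos[OF assms(1,2)] z' by (metis less_irrefl)
    moreover have "k' = Suc k mod N"
      using orient_edge_pos[OF assms(1-3)] z(1) assms(4) by (metis less_irrefl)
    ultimately consider "Suc k' mod N = k" "k' = Suc k mod N" | "Suc k' mod N = k'" by auto
    then show False
    proof cases
      case 1
      show False
      proof (cases "Suc k < N")
        case True
        then have "k' = Suc k" using 1(2) by simp
        moreover have "Suc (Suc k) = N" if "\<not> Suc (Suc k) < N" using True that by simp
        ultimately show False using 1(1) assms(1) by (cases "Suc (Suc k) < N") auto
      next
        case False
        then have "Suc k = N" using assms(2) by simp
        then show False using 1 assms(1) by auto
      qed
    next
      case 2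
      then show False using assms(1,3) by (cases "Suc k' = N") auto
    qed
  qed
  moreover have "(1 - u) * (1 - t) + (1 - u) * t + u = 1" by (simp add: algebra_simps)
  ultimately have "((1 - u) * (1 - t)) *\<^sub>R corner N k + ((1 - u) * t) *\<^sub>R corner N (Suc k) + u *\<^sub>R ?q
      \<in> interior (polygon N)"
    using assms by (intro triangle_interior edge_point_in_polygon convex_polygon mult_pos_pos)
      (assumption | simp)+
  also have "((1 - u) * (1 - t)) *\<^sub>R corner N k + ((1 - u) * t) *\<^sub>R corner N (Suc k) + u *\<^sub>R ?q
      = linepath (edge_point N k t) ?q u"
    by (simp only: linepath_def edge_point_def[of N k] scaleR_right_distrib scaleR_scaleR)
  finally show ?thesis .
qed

text \<open>The two neighbours of corner 0 have their midpoint at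
  \<open>\<kappa> = cos (2 * pi / N)\<close> on the line of the radius. A point of the radius close
  to the corner therefore has positive barycentric coordinates in the triangle of the corners 0, 1
  and \<open>N - 1\<close>.\<close>

lemma radius_interior:
  assumes "N \<ge> 3"
  obtains d where "0 < d" "d < 1" "\<And>x. 0 < x \<Longrightarrow> x \<le> d \<Longrightarrow> (1 - x) *\<^sub>R corner N 0 \<in> interior (polygon N)"
proof -
  define \<kappa> where "\<kappa> = cos (2 * pi / N)"
  have "\<kappa> < cos 0" unfolding \<kappa>_def
  proof (rule cos_monotone_0_pi)
    show "2 * pi / real N \<le> pi" using assms by (simp add: divide_le_eq)
  qed (use assms in simp_all)
  then have k1: "\<kappa> < 1" by simp
  have c1: "corner N 1 + corner N (N - 1) = (2 * \<kappa>) *\<^sub>R 1"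
  proof -
    have "2 * pi * real (N - 1) / real N = 2 * pi + - (2 * pi / N)" using assms by (simp add: field_simps of_nat_diff)
    then have "corner N (N - 1) = cis (- (2 * pi / N))"
      unfolding corner_def by (simp only: cis_mult[symmetric] cis_2pi mult_1)
    then show ?thesis by (simp add: corner_def \<kappa>_def complex_eq_iff)
  qed
  have o: "orient (corner N 0) (corner N 1) (corner N (N - 1)) > 0"
    using assms by (intro orient_corner_pos) auto
  \<comment> \<open>For \<open>x \<le> (1 - \<kappa>) / 2\<close> the weight
    \<open>y = x / (2 * (1 - \<kappa>))\<close> of each neighbour is at most 1/4, so
    \<open>1 - 2 * y\<close> stays positive. The bound 1/2 keeps \<open>d < 1\<close>.\<close>
  define d where "d = min (1/2) ((1 - \<kappa>) / 2)"
  show ?thesis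
  proof
    show "0 < d" "d < 1" using k1 by (auto simp: d_def)
    fix x assume x: "0 < x" "x \<le> d"
    define w where "w = x / (1 - \<kappa>)"
    define y where "y = w / 2"
    have w: "w * (1 - \<kappa>) = x" using k1 by (simp add: w_def)
    have "x \<le> (1 - \<kappa>) / 2" using x by (simp add: d_def)
    then have y: "0 < y" "y < 1/2" using x k1 by (simp_all add: y_def w_def divide_less_eq)
    have xy: "2 * y * (1 - \<kappa>) = x"
      using w by (simp add: y_def)
    have "(1 - 2 * y) *\<^sub>R corner N 0 + y *\<^sub>R corner N 1 + y *\<^sub>R corner N (N - 1) \<in> interior (polygon N)"
      using o assms y by (intro triangle_interior convex_polygon) simp_all
    also have "(1 - 2 * y) *\<^sub>R corner N 0 + y *\<^sub>R corner N 1 + y *\<^sub>R corner N (N - 1)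
       = (1 - 2 * y) *\<^sub>R corner N 0 + y *\<^sub>R (corner N 1 + corner N (N - 1))" by (simp add: algebra_simps)
    also have "\<dots> = (1 - 2 * y * (1 - \<kappa>)) *\<^sub>R corner N 0"
      unfolding c1 by (simp add: corner_def algebra_simps)
    also note xy
    finally show "(1 - x) *\<^sub>R corner N 0 \<in> interior (polygon N)" .
  qed
qed


section \<open>Curves in the glued surface\<close>

lemma edge_gluing_iff:
  "(a, b) \<in> edge_gluing N \<longleftrightarrow>
     (\<exists>k<N. \<exists>t. 0 \<le> t \<and> t \<le> 1 \<and> a = (1, edge_point N k t) \<and> b = (2, edge_point N k (1 - t)))"
proof
  assume "(a, b) \<in> edge_gluing N"
  then obtain k t where "k \<in> {1..N}" "t \<in> {0..1}"
    "a = (1, (1 - t) *\<^sub>R corner N (k - 1) + t *\<^sub>R corner N k)"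
    "b = (2, (1 - t) *\<^sub>R corner N k + t *\<^sub>R corner N (k - 1))" unfolding edge_gluing_def by auto
  then show "\<exists>k<N. \<exists>t. 0 \<le> t \<and> t \<le> 1 \<and> a = (1, edge_point N k t) \<and> b = (2, edge_point N k (1 - t))"
    by (intro exI[of _ "k - 1"] conjI exI[of _ t]) (auto simp: edge_point_def)
next
  assume "\<exists>k<N. \<exists>t. 0 \<le> t \<and> t \<le> 1 \<and> a = (1, edge_point N k t) \<and> b = (2, edge_point N k (1 - t))"
  then obtain k t where "k < N" "0 \<le> t" "t \<le> 1" "a = (1, edge_point N k t)" "b = (2, edge_point N k (1 - t))"
    by blast
  then show "(a, b) \<in> edge_gluing N"
    unfolding edge_gluing_def mem_Collect_eq
    by (intro exI[of _ "Suc k"] exI[of _ t]) (auto simp: edge_point_def)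
qed

abbreviation glued :: "nat \<Rightarrow> nat \<Rightarrow> complex \<Rightarrow> (nat \<times> complex) set" where
  "glued N c z \<equiv> gluing N `` {(c, z)}"

text \<open>Classes are bounded from above by saturated sets: a set that no elementary gluing enters
  or leaves contains the class of each of its points.\<close>

lemma gluing_class_subset:
  assumes "x \<in> S" "\<And>a b. (a, b) \<in> edge_gluing N \<Longrightarrow> a \<in> S \<longleftrightarrow> b \<in> S"
  shows "gluing N `` {x} \<subseteq> S"
proof
  fix y assume "y \<in> gluing N `` {x}"
  then have "(x, y) \<in> (edge_gluing N \<union> (edge_gluing N)\<inverse>)\<^sup>*" by (auto simp: gluing_def)
  then show "y \<in> S" by induction (use assms in auto)
qed

lemma glued_self: "c \<in> {1, 2} \<Longrightarrow> z \<in> polygon N \<Longrightarrow> (c, z) \<in> glued N c z"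
  by (auto simp: gluing_def)

text \<open>The pair is saturated because an inner edge point determines its edge and its
  parameter.\<close>

lemma glued_edge_point:
  assumes "N \<ge> 3" "k < N" "0 < t" "t < 1"
  shows "glued N 1 (edge_point N k t) = {(1, edge_point N k t), (2, edge_point N k (1 - t))}" (is ?A)
    and "glued N 2 (edge_point N k (1 - t)) = {(1, edge_point N k t), (2, edge_point N k (1 - t))}" (is ?B)
proof -
  let ?S = "{(1, edge_point N k t), (2, edge_point N k (1 - t))}"
  let ?r = "(edge_gluing N \<union> (edge_gluing N)\<inverse>)\<^sup>*"
  have e: "((1, edge_point N k t), (2, edge_point N k (1 - t))) \<in> edge_gluing N"
    using assms unfolding edge_gluing_iff by (intro exI[of _ k] conjI exI[of _ t]) auto
  have cl: "a \<in> ?S \<longleftrightarrow> b \<in> ?S" if ab: "(a, b) \<in> edge_gluing N" for a b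
  proof -
    obtain k' t' where k': "k' < N" "0 \<le> t'" "t' \<le> 1" "a = (1, edge_point N k' t')"
      "b = (2, edge_point N k' (1 - t'))"
      using ab unfolding edge_gluing_iff by blast
    have "edge_point N k' t' = edge_point N k t \<longleftrightarrow> k' = k \<and> t' = t"
      using edge_point_eqD[of N k t k' t'] assms k' by auto
    moreover have "edge_point N k' (1 - t') = edge_point N k (1 - t) \<longleftrightarrow> k' = k \<and> t' = t"
      using edge_point_eqD[of N k "1 - t" k' "1 - t'"] assms k' by auto
    ultimately show ?thesis using k' by auto
  qed
  have "((1, edge_point N k t), (2, edge_point N k (1 - t))) \<in> ?r"
    "((2, edge_point N k (1 - t)), (1, edge_point N k t)) \<in> ?r"
    using e by (auto intro!: r_into_rtrancl)
  then have "?S \<subseteq> glued N 1 (edge_point N k t)" "?S \<subseteq> glued N 2 (edge_point N k (1 - t))"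
    using assms by (auto simp: gluing_def intro!: edge_point_in_polygon)
  moreover have "glued N 1 (edge_point N k t) \<subseteq> ?S" "glued N 2 (edge_point N k (1 - t)) \<subseteq> ?S"
    by (rule gluing_class_subset[OF _ cl]; simp)+
  ultimately show ?A ?B by auto
qed

lemma glued_interior:
  assumes "N \<ge> 3" "c \<in> {1, 2}" "z \<in> interior (polygon N)"
  shows "glued N c z = {(c, z)}"
proof
  show "glued N c z \<subseteq> {(c, z)}"
  proof (rule gluing_class_subset)
    fix a b assume "(a, b) \<in> edge_gluing N"
    then show "a \<in> {(c, z)} \<longleftrightarrow> b \<in> {(c, z)}"
      unfolding edge_gluing_iff using edge_point_notin_interior[OF assms(1)] assms(3) by auto
  qed simp
  show "{(c, z)} \<subseteq> glued N c z" using glued_self assms interior_subset by blast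
qed

text \<open>The corners of both polygons together form a saturated set, since the gluing pairs inner
  points of edges with inner points and ends with ends. This separates the marked points from all
  other points.\<close>

lemma glued_corner_subset:
  assumes "N \<ge> 3"
  shows "glued N c (corner N j) \<subseteq> UNIV \<times> range (corner N)"
proof (rule gluing_class_subset)
  fix a b assume "(a, b) \<in> edge_gluing N"
  then obtain k t where k: "k < N" "0 \<le> t" "t \<le> 1" "a = (1, edge_point N k t)" "b = (2, edge_point N k (1 - t))"
    unfolding edge_gluing_iff by blast
  show "a \<in> UNIV \<times> range (corner N) \<longleftrightarrow> b \<in> UNIV \<times> range (corner N)"
  proof (cases "0 < t \<and> t < 1")
    case True
    then have "edge_point N k t \<noteq> corner N j" "edge_point N k (1 - t) \<noteq> corner N j" for j
      using corner_neq_edge_point[of N k t j] corner_neq_edge_point[of N k "1 - t" j] k assms by auto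
    then show ?thesis using k by auto
  next
    case False
    then have "t = 0 \<or> t = 1" using k by auto
    then show ?thesis using k by (auto simp: edge_point_def)
  qed
qed auto

lemma glued_in_marked_points_iff:
  assumes "N \<ge> 3" "c \<in> {1, 2}" "z \<in> polygon N"
  shows "glued N c z \<in> marked_points N \<longleftrightarrow> z \<in> range (corner N)"
proof
  assume "glued N c z \<in> marked_points N"
  then obtain c' j where "glued N c z = glued N c' (corner N j)"
    unfolding marked_points_def image_of_def by blast
  then have "(c, z) \<in> glued N c' (corner N j)" using glued_self[OF assms(2,3)] by simp
  then have "(c, z) \<in> UNIV \<times> range (corner N)" using glued_corner_subset[OF assms(1)] by (rule subsetD[rotated])
  then show "z \<in> range (corner N)" by (rule SigmaD2)
next
  assume "z \<in> range (corner N)"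
  then obtain j where "z = corner N j" by blast
  then have "z = corner N (j mod N)" by (simp only: corner_mod)
  moreover have "j mod N < N" using assms(1) by simp
  ultimately have "z \<in> corner N ` {..<N}" by (metis imageI lessThan_iff)
  then show "glued N c z \<in> marked_points N"
    using assms(2) unfolding marked_points_def image_of_def by blast
qed

lemma edge_eq: "k < N \<Longrightarrow> edge N (Suc k) = edge_point N k ` {0..1}"
  by (simp add: edge_def edge_point_def closed_segment_image_interval)

lemma in_all_arcs_iff:
  assumes "\<sigma> permutes {1..N}"
  shows "p \<in> all_arcs N \<sigma> \<longleftrightarrow> (\<exists>c\<in>{1, 2}. \<exists>k<N. \<exists>t\<in>{0..1}. p = glued N c (edge_point N k t))"
proof
  assume "p \<in> all_arcs N \<sigma>"
  then obtain c k where k: "c \<in> {1, 2}" "k \<in> {1..N}" "p \<in> image_of N c (edge N k)"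
    unfolding all_arcs_def arc_curve_def by blast
  then obtain j where j: "k = Suc j" "j < N" by (cases k) auto
  then have "\<exists>t\<in>{0..1}. p = glued N c (edge_point N j t)"
    using k(3) unfolding j(1) image_of_def edge_eq[OF j(2)] by blast
  then show "\<exists>c\<in>{1, 2}. \<exists>k<N. \<exists>t\<in>{0..1}. p = glued N c (edge_point N k t)"
    using k(1) j(2) by blast
next
  assume "\<exists>c\<in>{1, 2}. \<exists>k<N. \<exists>t\<in>{0..1}. p = glued N c (edge_point N k t)"
  then obtain c k t where k: "c \<in> {1, 2}" "k < N" "t \<in> {0..1}" "p = glued N c (edge_point N k t)" by blast
  then have "p \<in> image_of N c (edge N (Suc k))" unfolding image_of_def edge_eq[OF k(2)] by blast
  moreover have "Suc k \<in> {k' \<in> {1..N}. \<sigma> k' = \<sigma> (Suc k)}" using k(2) by simp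
  ultimately have "p \<in> arc_curve N \<sigma> (\<sigma> (Suc k))" using k(1) unfolding arc_curve_def by blast
  moreover have "\<sigma> (Suc k) \<in> {1..N}" using permutes_in_image[OF assms] k(2) by simp
  ultimately show "p \<in> all_arcs N \<sigma>" unfolding all_arcs_def by blast
qed

lemma interior_notin_all_arcs:
  assumes "N \<ge> 3" "c \<in> {1, 2}" "z \<in> interior (polygon N)" "\<sigma> permutes {1..N}"
  shows "glued N c z \<notin> all_arcs N \<sigma>"
proof
  assume "glued N c z \<in> all_arcs N \<sigma>"
  then obtain c' k t where k: "c' \<in> {1, 2}" "k < N" "t \<in> {0..1}"
      and eq: "glued N c z = glued N c' (edge_point N k t)"
    unfolding in_all_arcs_iff[OF assms(4)] by blast
  have "edge_point N k t \<in> polygon N" using k assms(1) by (intro edge_point_in_polygon) auto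
  from glued_self[OF k(1) this] have "(c', edge_point N k t) \<in> {(c, z)}"
    unfolding eq[symmetric] glued_interior[OF assms(1-3)] .
  then show False using edge_point_notin_interior[OF assms(1) \<open>k < N\<close>] assms(3) by auto
qed

text \<open>Evaluates the definite description in \<open>crossing_word\<close>: an inner edge point
  lies on a single arc.\<close>

lemma edge_point_in_arc_curve_iff:
  assumes "N \<ge> 3" "k < N" "0 < t" "t < 1" "\<sigma> permutes {1..N}"
  shows "glued N 1 (edge_point N k t) \<in> arc_curve N \<sigma> i \<longleftrightarrow> i = \<sigma> (Suc k)"
proof
  assume "glued N 1 (edge_point N k t) \<in> arc_curve N \<sigma> i"
  then obtain c' k' where k': "c' \<in> {1, 2}" "k' \<in> {1..N}" "\<sigma> k' = i"
      "glued N 1 (edge_point N k t) \<in> image_of N c' (edge N k')"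
    unfolding arc_curve_def by blast
  then obtain j where j: "k' = Suc j" "j < N" by (cases k') auto
  then obtain s where s: "0 \<le> s" "s \<le> 1" "glued N 1 (edge_point N k t) = glued N c' (edge_point N j s)"
    using k' by (auto simp: image_of_def edge_eq)
  have "edge_point N j s \<in> polygon N" using s assms(1) by (intro edge_point_in_polygon) auto
  from glued_self[OF k'(1) this] have "(c', edge_point N j s) \<in> {(1, edge_point N k t), (2, edge_point N k (1 - t))}"
    unfolding s(3)[symmetric] glued_edge_point(1)[OF assms(1-4)] .
  then have "edge_point N k t = edge_point N j s \<or> edge_point N k (1 - t) = edge_point N j s"
    by (elim insertE emptyE) simp_all
  moreover have "0 < 1 - t" "1 - t < 1" using assms by simp_all
  ultimately have "j = k"
    using edge_point_eqD(1)[OF assms(1-4) j(2) s(1,2)] edge_point_eqD(1)[OF assms(1,2) _ _ j(2) s(1,2)] by blast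
  then show "i = \<sigma> (Suc k)" using k'(3) j(1) by simp
next
  assume i: "i = \<sigma> (Suc k)"
  have "edge_point N k t \<in> edge_point N k ` {0..1}" using assms(3,4) by simp
  then have "glued N 1 (edge_point N k t) \<in> image_of N 1 (edge N (Suc k))"
    unfolding image_of_def edge_eq[OF assms(2)] by (rule imageI)
  moreover have "Suc k \<in> {k' \<in> {1..N}. \<sigma> k' = i}" using i assms(2) by simp
  ultimately show "glued N 1 (edge_point N k t) \<in> arc_curve N \<sigma> i"
    unfolding arc_curve_def by blast
qed

text \<open>
  A curve is assembled from \<open>P\<close> pieces, the \<open>l\<close>-th one crossing \<open>G\<^sub>1\<close> if \<open>l\<close> is even and \<open>G\<^sub>2\<close> if \<open>l\<close>
  is odd. Edges are numbered from \<open>0\<close> here.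
\<close>

locale piece_chain =
  fixes N P :: nat and g :: "nat \<Rightarrow> real \<Rightarrow> complex" and kk :: "nat \<Rightarrow> nat" and tt :: "nat \<Rightarrow> real"
  assumes N3: "N \<ge> 3" and P: "even P" "P \<ge> 2"
    and path: "l < P \<Longrightarrow> path (g l)"
    and inj: "l < P \<Longrightarrow> inj_on (g l) {0..1}"
    and inner: "l < P \<Longrightarrow> 0 < u \<Longrightarrow> u < 1 \<Longrightarrow> g l u \<in> interior (polygon N)"
    and ends: "0 < l \<Longrightarrow> l < P \<Longrightarrow> kk l < N" "0 < l \<Longrightarrow> l < P \<Longrightarrow> 0 < tt l" "0 < l \<Longrightarrow> l < P \<Longrightarrow> tt l < 1"
      "0 < l \<Longrightarrow> l < P \<Longrightarrow> g (l - 1) 1 = edge_point N (kk l) (tt l)"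
      "0 < l \<Longrightarrow> l < P \<Longrightarrow> g l 0 = edge_point N (kk l) (1 - tt l)"
    and first: "g 0 0 = corner N 0" and last: "g (P - 1) 1 = corner N 0"
    and seg: "\<exists>\<epsilon>>0. \<epsilon> \<le> 1 \<and> g 0 ` {0..\<epsilon>} \<subseteq> closed_segment 0 (corner N 0)
        \<and> g (P - 1) ` {1 - \<epsilon>..1} \<subseteq> closed_segment 0 (corner N 0)"
    and disj: "l < l' \<Longrightarrow> l' < P \<Longrightarrow> even l = even l' \<Longrightarrow> g l ` {0..1} \<inter> g l' ` {0..1} = {}"
begin

definition side :: "nat \<Rightarrow> nat" where "side l = (if even l then 1 else 2)"

text \<open>Piece \<open>l\<close> is traversed between the times \<open>l / P\<close> and
  \<open>(l + 1) / P\<close>. The minimum takes effect at \<open>x = 1\<close>, where the floor is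
  already \<open>P\<close>.\<close>

definition curve :: "real \<Rightarrow> (nat \<times> complex) set" where
  "curve x = (let l = min (nat \<lfloor>real P * x\<rfloor>) (P - 1) in glued N (side l) (g l (real P * x - real l)))"

lemma P0 [simp]: "P > 0" using P by simp

lemma side_in [simp]: "side l \<in> {1, 2}" by (simp add: side_def)

lemma side_in' [simp]: "side l = Suc 0 \<or> side l = 2" by (simp add: side_def)

lemma side_eq: "side l = side l' \<longleftrightarrow> even l = even l'" by (simp add: side_def)

lemma in_polygon: assumes "l < P" "0 \<le> u" "u \<le> 1" shows "g l u \<in> polygon N"
proof -
  have c: "corner N 0 \<in> polygon N" using N3 by simp
  have e: "edge_point N k t \<in> polygon N" if "0 < t" "t < 1" for k t
    using that N3 by (simp add: edge_point_in_polygon)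
  have "u = 0 \<or> u = 1 \<or> 0 < u \<and> u < 1" using assms by linarith
  then show ?thesis
  proof (elim disjE)
    assume u: "u = 0"
    show ?thesis
    proof (cases "l = 0")
      case False
      then have l: "0 < l" by simp
      show ?thesis unfolding u ends(5)[OF l assms(1)] using ends(2,3)[OF l assms(1)] by (intro e) simp_all
    qed (simp add: u first c)
  next
    assume u: "u = 1"
    show ?thesis
    proof (cases "Suc l < P")
      case True
      have "g l 1 = edge_point N (kk (Suc l)) (tt (Suc l))" using ends(4)[OF zero_less_Suc True] by simp
      then show ?thesis unfolding u using e ends(2,3)[OF zero_less_Suc True] by simp
    next
      case False
      then have "l = P - 1" using assms by simp
      then show ?thesis using last c u by simp
    qed
  next
    assume "0 < u \<and> u < 1"
    then show ?thesis using inner[OF assms(1), of u] interior_subset by blast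
  qed
qed

lemma crossing_class:
  assumes "0 < l" "l < P"
  shows "glued N (side l) (g l 0) = {(side (l - 1), g (l - 1) 1), (side l, g l 0)}"
    and "glued N (side (l - 1)) (g (l - 1) 1) = glued N (side l) (g l 0)"
    and "\<exists>t. 0 < t \<and> t < 1 \<and> glued N (side l) (g l 0) = glued N 1 (edge_point N (kk l) t)"
proof -
  note e = ends[OF assms]
  have l: "even (l - 1) = odd l" using assms by simp
  \<comment> \<open>The parameter of the crossing as seen from the first polygon: piece
    \<open>l - 1\<close> ends there if \<open>l\<close> is odd, piece \<open>l\<close> begins there
    if \<open>l\<close> is even.\<close>
  define t where "t = (if odd l then tt l else 1 - tt l)"
  have t: "0 < t" "t < 1" using e by (auto simp: t_def)
  note c = glued_edge_point[OF N3 e(1) t]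
  have *: "glued N (side l) (g l 0) = {(1, edge_point N (kk l) t), (2, edge_point N (kk l) (1 - t))}
    \<and> glued N (side (l - 1)) (g (l - 1) 1) = {(1, edge_point N (kk l) t), (2, edge_point N (kk l) (1 - t))}
    \<and> {(side (l - 1), g (l - 1) 1), (side l, g l 0)} = {(1, edge_point N (kk l) t), (2, edge_point N (kk l) (1 - t))}"
  proof (cases "odd l")
    case True
    then have "side l = 2" "side (l - 1) = 1" "t = tt l" using l by (simp_all only: side_def t_def if_True if_False simp_thms)
    then show ?thesis using c e(4,5) by (simp only: simp_thms)
  next
    case False
    then have s: "side l = 1" "side (l - 1) = 2" "tt l = 1 - t" using l by (simp_all only: side_def t_def if_True if_False simp_thms diff_diff_eq2 add_diff_cancel_left')
    have "edge_point N (kk l) (1 - tt l) = edge_point N (kk l) t" using s(3) by simp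
    then show ?thesis using c e(4,5) unfolding s by (simp only: insert_commute simp_thms)
  qed
  then show "glued N (side l) (g l 0) = {(side (l - 1), g (l - 1) 1), (side l, g l 0)}"
    "glued N (side (l - 1)) (g (l - 1) 1) = glued N (side l) (g l 0)"
    by (simp_all only:)
  have "glued N (side l) (g l 0) = glued N 1 (edge_point N (kk l) t)"
    using * c(1) by (simp only:)
  then show "\<exists>t. 0 < t \<and> t < 1 \<and> glued N (side l) (g l 0) = glued N 1 (edge_point N (kk l) t)"
    using t by blast
qed

text \<open>The end \<open>u = 1\<close> is included, although \<open>curve\<close> already
  evaluates the next piece at that time: the gluing identifies the two values.\<close>

lemma curve_eq:
  assumes "l < P" "0 \<le> u" "u \<le> 1"
  shows "curve ((real l + u) / real P) = glued N (side l) (g l u)"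
proof (cases "u < 1")
  case True
  have "\<lfloor>real P * ((real l + u) / real P)\<rfloor> = int l" using assms True by simp linarith
  then have "min (nat \<lfloor>real P * ((real l + u) / real P)\<rfloor>) (P - 1) = l" using assms by simp
  then show ?thesis unfolding curve_def by simp
next
  case False
  then have u: "u = 1" using assms by simp
  then have f: "\<lfloor>real P * ((real l + u) / real P)\<rfloor> = int (Suc l)" by simp
  show ?thesis
  proof (cases "Suc l < P")
    case True
    then have "min (nat \<lfloor>real P * ((real l + u) / real P)\<rfloor>) (P - 1) = Suc l" using f by simp
    then have "curve ((real l + u) / real P) = glued N (side (Suc l)) (g (Suc l) 0)"
      unfolding curve_def using u by simp
    then show ?thesis using crossing_class(2)[OF zero_less_Suc True] unfolding u diff_Suc_1 by (rule trans[OF _ sym])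
  next
    case False
    then have "l = P - 1" using assms by simp
    then have "min (nat \<lfloor>real P * ((real l + u) / real P)\<rfloor>) (P - 1) = l" using f by simp
    then show ?thesis unfolding curve_def by simp
  qed
qed

lemma param_cases:
  assumes "x \<in> {0..1}"
  obtains (start) "x = 0" | (fin) "x = 1"
    | (cross) l where "0 < l" "l < P" "x = real l / real P"
    | (inn) l u where "l < P" "0 < u" "u < 1" "x = (real l + u) / real P"
proof -
  define l where "l = nat \<lfloor>real P * x\<rfloor>"
  define u where "u = real P * x - real l"
  have l: "real l = \<lfloor>real P * x\<rfloor>" using assms by (simp add: l_def)
  then have u: "0 \<le> u" "u < 1" unfolding u_def by linarith+
  have x: "x = (real l + u) / real P" by (simp add: u_def)
  have "real P * x \<le> real P" using assms by simp
  then have "real l \<le> real P" unfolding l by linarith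
  then have "l \<le> P" by simp
  consider "l = P" | "l < P" "u = 0" "l = 0" | "l < P" "u = 0" "0 < l" | "l < P" "0 < u"
    using \<open>l \<le> P\<close> u by fastforce
  then show ?thesis
  proof cases
    case 1
    then have "real P \<le> real P * x" using u u_def by linarith
    then have "x \<ge> 1" by simp
    then show ?thesis using fin assms by simp
  next
    case 2 then show ?thesis using start x by simp
  next
    case 3 then show ?thesis using cross[of l] x by simp
  next
    case 4 then show ?thesis using inn[of l u] x u by simp
  qed
qed

lemma curve_start: "curve 0 = glued N 1 (corner N 0)"
  using curve_eq[of 0 0] by (simp add: side_def first)

lemma curve_fin: "curve 1 = glued N 2 (corner N 0)"
  using curve_eq[of "P - 1" 1] P last by (simp add: side_def of_nat_diff)

lemma curve_cross: "0 < l \<Longrightarrow> l < P \<Longrightarrow> curve (real l / real P) = glued N (side l) (g l 0)"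
  using curve_eq[of l 0] by simp

lemma curve_inn: "l < P \<Longrightarrow> 0 < u \<Longrightarrow> u < 1 \<Longrightarrow> curve ((real l + u) / real P) = {(side l, g l u)}"
  using curve_eq[of l u] glued_interior[OF N3 side_in inner] by simp

text \<open>Pasting over finitely many closed time intervals. On each of them the curve is a path in
  the polygon, followed by the inclusion and the quotient map.\<close>

lemma pathin_curve: "pathin (surface N) curve"
proof -
  let ?T = "\<lambda>l. {real l / real P..(real l + 1) / real P}"
  let ?f = "\<lambda>l x. glued N (side l) (g l (real P * x - real l))"
  let ?X = "top_of_set {0..1::real}"
  have unit: "0 \<le> real P * x - real l" "real P * x - real l \<le> 1" if "x \<in> ?T l" for l x
    using that by (simp_all add: pos_divide_le_eq pos_le_divide_eq mult.commute)
  have eq: "curve x = ?f l x" if "l < P" "x \<in> ?T l" for l x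
  proof -
    have "(real l + (real P * x - real l)) / real P = x" by simp
    then show ?thesis using curve_eq[OF that(1) unit[OF that(2)]] by (simp only:)
  qed
  have "continuous_map ?X (surface N) curve"
  proof (rule pasting_lemma_closed[of "{..<P}" _ ?T])
    fix l assume l: "l \<in> {..<P}"
    have "(real l + 1) / real P \<le> 1" using l by simp
    then have "?T l \<subseteq> {0..1}" by auto
    then show "closedin ?X (?T l)" by (simp add: closed_subset)
    have im: "(\<lambda>x. real P * x - real l) ` ?T l \<subseteq> {0..1}"
      using unit by (simp only: image_subset_iff atLeastAtMost_iff[of _ 0 1]) blast
    have lin: "continuous_on (?T l) (\<lambda>x. real P * x - real l)" by (intro continuous_intros)
    have "continuous_on {0..1} (g l)" using path l by (simp add: path_def)
    then have "continuous_on ((\<lambda>x. real P * x - real l) ` ?T l) (g l)" by (rule continuous_on_subset[OF _ im])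
    from continuous_on_compose[OF lin this]
    have "continuous_on (?T l) (\<lambda>x. g l (real P * x - real l))" by (simp add: o_def)
    moreover have "(\<lambda>x. g l (real P * x - real l)) ` ?T l \<subseteq> polygon N"
      using in_polygon unit l by (simp only: image_subset_iff lessThan_iff) blast
    ultimately have "continuous_map (top_of_set (?T l)) (top_of_set (polygon N)) (\<lambda>x. g l (real P * x - real l))"
      by (simp add: image_subset_iff_funcset)
    then have "continuous_map (top_of_set (?T l)) (two_polygons N)
        (Pair (side l) \<circ> (\<lambda>x. g l (real P * x - real l)))"
      unfolding two_polygons_def
      by (rule continuous_map_compose) (rule continuous_map_component_injection, simp)
    then have "continuous_map (top_of_set (?T l)) (surface N)
        ((\<lambda>x. gluing N `` {x}) \<circ> (Pair (side l) \<circ> (\<lambda>x. g l (real P * x - real l))))"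
      unfolding surface_def
      by (rule continuous_map_compose)
        (intro quotient_imp_continuous_map quotient_map_quotient_topology equiv_gluing)
    moreover have "subtopology ?X (?T l) = top_of_set (?T l)"
      unfolding subtopology_subtopology Int_absorb1[OF \<open>?T l \<subseteq> {0..1}\<close>] ..
    ultimately show "continuous_map (subtopology ?X (?T l)) (surface N) (?f l)"
      by (simp add: o_def)
  next
    fix i j x assume "i \<in> {..<P}" "j \<in> {..<P}" "x \<in> topspace ?X \<inter> ?T i \<inter> ?T j"
    then show "?f i x = ?f j x" using eq[of i x] eq[of j x] by auto
  next
    fix x assume "x \<in> topspace ?X"
    then have "x \<in> {0..1}" by simp
    then obtain l where "l < P" "x \<in> {real l / real P..(real l + 1) / real P}"
    proof (cases rule: param_cases)
      case start then show ?thesis using that[of 0] by simp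
    next
      case fin then show ?thesis using that[of "P - 1"] by (simp add: of_nat_diff)
    next
      case (cross l) then show ?thesis using that[of l] by (simp add: divide_right_mono)
    next
      case (inn l u) then show ?thesis using that[of l] by (simp add: divide_right_mono)
    qed
    then show "\<exists>j. j \<in> {..<P} \<and> x \<in> ?T j \<and> curve x = ?f j x" using eq by auto
  qed simp
  then show ?thesis by (simp add: pathin_def)
qed

lemma cross_notin_marked: "0 < l \<Longrightarrow> l < P \<Longrightarrow> curve (real l / real P) \<notin> marked_points N"
  using curve_cross[of l] ends[of l] corner_neq_edge_point[OF N3, of "kk l" "1 - tt l"]
    glued_in_marked_points_iff[OF N3 side_in in_polygon, of l 0 l]
  by auto

lemma inn_notin_marked: "l < P \<Longrightarrow> 0 < u \<Longrightarrow> u < 1 \<Longrightarrow> curve ((real l + u) / real P) \<notin> marked_points N"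
  using curve_eq[of l u] inner[of l u] corner_notin_interior[OF N3]
    glued_in_marked_points_iff[OF N3 side_in in_polygon, of l u l] by auto

lemma curve_marked_iff:
  assumes "x \<in> {0..1}"
  shows "curve x \<in> marked_points N \<longleftrightarrow> x \<in> {0, 1}"
  using assms
proof (cases rule: param_cases)
  case (cross l)
  then show ?thesis using cross_notin_marked[of l] by auto
next
  case (inn l u)
  have "0 < real l + u" "real l + u < real P" using inn by linarith+
  then have "x \<noteq> 0" "x \<noteq> 1" using inn by auto
  then show ?thesis using inn_notin_marked[of l u] inn by auto
qed (use N3 in \<open>auto simp: curve_start curve_fin glued_in_marked_points_iff\<close>)

lemma curve_arcs_iff:
  assumes "x \<in> {0<..<1}" "\<sigma> permutes {1..N}"
  shows "curve x \<in> all_arcs N \<sigma> \<longleftrightarrow> (\<exists>l. 0 < l \<and> l < P \<and> x = real l / real P)"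
proof -
  have "x \<in> {0..1}" using assms by simp
  then show ?thesis
  proof (cases rule: param_cases)
    case (cross l)
    have "curve x \<in> all_arcs N \<sigma>"
      unfolding in_all_arcs_iff[OF assms(2)] cross(3) curve_cross[OF cross(1,2)] ends(5)[OF cross(1,2)]
      using ends[OF cross(1,2)] by (intro bexI[of _ "side l"] exI[of _ "kk l"] conjI bexI[of _ "1 - tt l"]) auto
    then show ?thesis using cross by auto
  next
    case (inn l u)
    have "curve x \<notin> all_arcs N \<sigma>"
      using inn curve_eq[of l u] interior_notin_all_arcs[OF N3 side_in inner assms(2), of l u l] by auto
    moreover have "x \<noteq> real l' / real P" for l'
    proof
      assume "x = real l' / real P"
      then have "real l + u = real l'" using inn by (simp add: field_simps)
      then have "real l < real l'" "real l' < real (Suc l)" using inn by linarith+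
      then show False by simp
    qed
    ultimately show ?thesis by auto
  qed (use assms in auto)
qed

lemma crossings_curve:
  assumes "\<sigma> permutes {1..N}"
  shows "crossings N \<sigma> curve = (\<lambda>l. real l / real P) ` {1..<P}"
proof -
  have "real l / real P \<in> {0<..<1}" if "l \<in> {1..<P}" for l using that by auto
  then show ?thesis
    using curve_arcs_iff[OF _ assms] unfolding crossings_def by (force simp: image_iff Bex_def)
qed

lemma crossing_word_curve:
  assumes "\<sigma> permutes {1..N}"
  shows "crossing_word N \<sigma> curve = map (\<lambda>l. \<sigma> (Suc (kk l))) [1..<P]"
proof -
  have "sorted_list_of_set (crossings N \<sigma> curve) = map (\<lambda>l. real l / real P) [1..<P]"
  proof -
    have "sorted (map (\<lambda>l. real l / real P) [1..<P])" "distinct (map (\<lambda>l. real l / real P) [1..<P])"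
      by (auto simp: sorted_wrt_map distinct_map inj_on_def divide_right_mono intro!: sorted_wrt_mono_rel[OF _ sorted_upt])
    then have "sorted_list_of_set (set (map (\<lambda>l. real l / real P) [1..<P])) = map (\<lambda>l. real l / real P) [1..<P]"
      by (rule sorted_list_of_set.idem_if_sorted_distinct)
    then show ?thesis by (simp add: crossings_curve[OF assms])
  qed
  moreover have "(THE i. curve (real l / real P) \<in> arc_curve N \<sigma> i) = \<sigma> (Suc (kk l))" if l: "0 < l" "l < P" for l
  proof -
    obtain t where t: "0 < t" "t < 1" "curve (real l / real P) = glued N 1 (edge_point N (kk l) t)"
      using crossing_class(3)[OF l] curve_cross[OF l] by auto
    show ?thesis unfolding t(3) edge_point_in_arc_curve_iff[OF N3 ends(1)[OF l] t(1,2) assms] by simp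
  qed
  ultimately show ?thesis by (simp add: crossing_word_def)
qed

lemma transversal_curve:
  assumes l: "0 < l" "l < P"
  shows "crosses_transversally N curve (real l / real P)"
  unfolding crosses_transversally_def
proof (intro exI conjI)
  \<comment> \<open>Half the duration of a piece, so that the neighbourhood meets only the two
    pieces that share the crossing.\<close>
  let ?\<epsilon> = "1 / (2 * real P)"
  let ?x = "real l / real P"
  show "?\<epsilon> > 0" by simp
  show "{?x - ?\<epsilon>..?x + ?\<epsilon>} \<subseteq> {0..1}"
  proof -
    have "real l + 1 \<le> real P" "1 \<le> real l" using l by linarith+
    then show ?thesis by (auto simp: field_simps)
  qed
  show "{side (l - 1), side l} = {1, 2}" using l by (auto simp: side_def)
  show "curve ` {?x - ?\<epsilon>..<?x} \<subseteq> image_of N (side (l - 1)) (interior (polygon N))"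
  proof clarify
    fix x assume x: "x \<in> {?x - ?\<epsilon>..<?x}"
    let ?u = "real P * x - real (l - 1)"
    have "0 < ?u" "?u < 1" using x l by (auto simp: field_simps of_nat_diff)
    moreover have "x = (real (l - 1) + ?u) / real P" by simp
    ultimately show "curve x \<in> image_of N (side (l - 1)) (interior (polygon N))"
      using curve_eq[of "l - 1" ?u] inner[of "l - 1" ?u] l unfolding image_of_def by auto
  qed
  show "curve ` {?x<..?x + ?\<epsilon>} \<subseteq> image_of N (side l) (interior (polygon N))"
  proof clarify
    fix x assume x: "x \<in> {?x<..?x + ?\<epsilon>}"
    let ?u = "real P * x - real l"
    have "0 < ?u" "?u < 1" using x l by (auto simp: field_simps)
    moreover have "x = (real l + ?u) / real P" by simp
    ultimately show "curve x \<in> image_of N (side l) (interior (polygon N))"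
      using curve_eq[of l ?u] inner[of l ?u] l unfolding image_of_def by auto
  qed
qed

text \<open>A crossing is a class with one point in each polygon, and an inner point is a class by
  itself. A double point of the curve would therefore be a common point of two pieces in the same
  polygon, excluded by \<open>disj\<close>, or a double point of one piece, excluded by
  \<open>inj\<close>.\<close>

lemma simple_curve:
  assumes "x \<in> {0..1}" "y \<in> {0..1}" "curve x = curve y"
  shows "x = y \<or> {x, y} = {0, 1}"
proof (cases "x \<in> {0, 1} \<or> y \<in> {0, 1}")
  case True
  then show ?thesis using assms curve_marked_iff[of x] curve_marked_iff[of y] by auto
next
  case False
  have inn_neq: "curve (real l / real P) \<noteq> curve ((real l' + u) / real P)"
    if "0 < l" "l < P" "l' < P" "0 < u" "u < 1" for l l' u
    using that crossing_class(1)[of l] curve_cross[of l] curve_inn[of l' u] by (auto simp: side_def split: if_splits)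
  have cross_neq: "curve (real l / real P) \<noteq> curve (real l' / real P)"
    if l: "0 < l" "l < l'" "l' < P" for l l'
  proof
    assume "curve (real l / real P) = curve (real l' / real P)"
    then have "(side (l' - 1), g (l' - 1) 1) \<in> {(side (l - 1), g (l - 1) 1), (side l, g l 0)}"
      using crossing_class(1)[of l] crossing_class(1)[of l'] curve_cross[of l] curve_cross[of l'] l by auto
    then consider "even (l - 1) = even (l' - 1)" "g (l' - 1) 1 = g (l - 1) 1"
        | "even l = even (l' - 1)" "g (l' - 1) 1 = g l 0" by (auto simp: side_eq)
    then show False
    proof cases
      case 1
      have "g (l - 1) ` {0..1} \<inter> g (l' - 1) ` {0..1} = {}" using 1 l by (intro disj) auto
      moreover have "g (l - 1) 1 \<in> g (l - 1) ` {0..1}" "g (l' - 1) 1 \<in> g (l' - 1) ` {0..1}" by auto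
      ultimately show False using 1(2) by (metis IntI emptyE)
    next
      case 2
      show False
      proof (cases "l = l' - 1")
        \<comment> \<open>Consecutive crossings: the two points are the ends of the single piece
          between them.\<close>
        case True
        then have "g l 1 = g l 0" using 2 by simp
        moreover have "l < P" using l by simp
        ultimately have "(1::real) = 0" using inj_onD[OF inj] by (metis atLeastAtMost_iff order_refl zero_le_one)
        then show False by simp
      next
        case False
        then have "g l ` {0..1} \<inter> g (l' - 1) ` {0..1} = {}" using 2 l by (intro disj) auto
        moreover have "g l 0 \<in> g l ` {0..1}" "g (l' - 1) 1 \<in> g (l' - 1) ` {0..1}" by auto
        ultimately show False using 2(2) by (metis IntI emptyE)
      qed
    qed
  qed
  show ?thesis
    using assms(1)
  proof (cases rule: param_cases)
    case x: (cross l)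
    show ?thesis using assms(2)
    proof (cases rule: param_cases)
      case (cross l')
      then show ?thesis using x cross_neq[of l l'] cross_neq[of l' l] assms(3) by (cases l l' rule: linorder_cases) auto
    next
      case (inn l' u')
      then show ?thesis using x inn_neq[of l l' u'] assms(3) by auto
    qed (use False in auto)
  next
    case x: (inn l u)
    show ?thesis using assms(2)
    proof (cases rule: param_cases)
      case (cross l')
      then show ?thesis using x inn_neq[of l' l u] assms(3) by auto
    next
      case (inn l' u')
      then have eq: "side l = side l'" "g l u = g l' u'"
        using x assms(3) curve_inn[of l u] curve_inn[of l' u'] by auto
      have "l = l'"
      proof (rule ccontr)
        assume "l \<noteq> l'"
        then have "g l ` {0..1} \<inter> g l' ` {0..1} = {}"
          using disj[of l l'] disj[of l' l] eq(1) x inn by (cases "l < l'") (auto simp: side_eq)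
        moreover have "g l u \<in> g l ` {0..1}" "g l' u' \<in> g l' ` {0..1}" using x inn by auto
        ultimately show False using eq(2) by (metis IntI emptyE)
      qed
      then have "u = u'" using inj[of l] eq x inn by (auto simp: inj_on_def)
      then show ?thesis using \<open>l = l'\<close> x inn by simp
    qed (use False in auto)
  qed (use False in auto)
qed

lemma curve_segments:
  "\<exists>\<epsilon>>0. \<epsilon> \<le> 1 \<and> curve ` {0..\<epsilon>} \<subseteq> L_segment N 1 \<and> curve ` {1 - \<epsilon>..1} \<subseteq> L_segment N 2"
proof -
  obtain e where e: "e > 0" "e \<le> 1" "g 0 ` {0..e} \<subseteq> closed_segment 0 (corner N 0)"
    "g (P - 1) ` {1 - e..1} \<subseteq> closed_segment 0 (corner N 0)" using seg by blast
  show ?thesis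
  proof (intro exI[of _ "e / real P"] conjI)
    show "e / real P > 0" "e / real P \<le> 1" using e P by (simp_all add: field_simps)
    show "curve ` {0..e / real P} \<subseteq> L_segment N 1"
    proof clarify
      fix x assume x: "x \<in> {0..e / real P}"
      then have u: "real P * x \<in> {0..e}" by (auto simp: field_simps)
      then have "curve x = glued N 1 (g 0 (real P * x))"
        using curve_eq[of 0 "real P * x"] e by (simp add: side_def)
      moreover have "g 0 (real P * x) \<in> closed_segment 0 (corner N 0)" using e(3) u by blast
      ultimately show "curve x \<in> L_segment N 1" unfolding L_segment_def image_of_def by blast
    qed
    show "curve ` {1 - e / real P..1} \<subseteq> L_segment N 2"
    proof clarify
      fix x assume x: "x \<in> {1 - e / real P..1}"
      let ?u = "real P * x - real (P - 1)"
      have u: "?u \<in> {1 - e..1}"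
      proof -
        have "real P * (1 - e / real P) \<le> real P * x"
          using x by (intro mult_left_mono) auto
        moreover have "real P * x \<le> real P" using x by simp
        moreover have "real P * (1 - e / real P) = real P - e" by (simp add: right_diff_distrib)
        moreover have "real (P - 1) = real P - 1" using P by (simp add: of_nat_diff)
        ultimately show ?thesis by simp
      qed
      moreover have "x = (real (P - 1) + ?u) / real P" by simp
      moreover have "side (P - 1) = 2" using P by (simp add: side_def)
      ultimately have "curve x = glued N 2 (g (P - 1) ?u)"
        using curve_eq[of "P - 1" ?u] e(2) u by simp
      moreover have "g (P - 1) ?u \<in> closed_segment 0 (corner N 0)" using e(4) u by blast
      ultimately show "curve x \<in> L_segment N 2" unfolding L_segment_def image_of_def by blast
    qed
  qed
qed

lemma curve_simple_admissible:
  assumes "card (verts Q) = N" "\<sigma> permutes {1..N}"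
    and "map (\<lambda>l. \<sigma> (Suc (kk l))) [1..<P] \<in> reflection_words Q"
  shows "curve \<in> simple_admissible Q \<sigma>"
proof -
  have "crosses_transversally N curve x"
    if "x \<in> {0..1}" "curve x \<in> all_arcs N \<sigma> - marked_points N" for x
  proof -
    have "x \<in> {0<..<1}" using that curve_marked_iff[of x] by auto
    then show ?thesis using curve_arcs_iff[OF _ assms(2)] that transversal_curve by auto
  qed
  moreover have "finite (crossings N \<sigma> curve)" by (simp add: crossings_curve[OF assms(2)])
  ultimately have "admissible Q \<sigma> curve"
    using pathin_curve curve_marked_iff curve_segments crossing_word_curve[OF assms(2)] assms(3)
    by (simp add: admissible_def assms(1))
  then show ?thesis using simple_curve by (auto simp: simple_admissible_def)
qed

end


section \<open>Simple curves invariant under the hyperelliptic involution\<close>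

definition same_side :: "complex \<Rightarrow> complex \<Rightarrow> complex \<Rightarrow> complex \<Rightarrow> bool" where
  "same_side p q a b \<longleftrightarrow> orient p q a * orient p q b > 0"

lemma same_side_swap: "same_side p q a b \<longleftrightarrow> same_side q p a b"
  unfolding same_side_def orient_swap[of p q] by simp

text \<open>\<open>orient p q\<close> is affine along the segment from \<open>a\<close> to
  \<open>b\<close> and keeps its sign there, while it vanishes on the segment from \<open>p\<close>
  to \<open>q\<close>.\<close>

lemma same_side_disjoint:
  assumes "same_side p q a b"
  shows "closed_segment a b \<inter> closed_segment p q = {}"
proof (rule ccontr)
  assume "closed_segment a b \<inter> closed_segment p q \<noteq> {}"
  then obtain z where z: "z \<in> closed_segment a b" "z \<in> closed_segment p q" by blast
  obtain u where u: "0 \<le> u" "u \<le> 1" "z = (1 - u) *\<^sub>R a + u *\<^sub>R b"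
    using z(1) unfolding closed_segment_def by blast
  obtain v where v: "z = (1 - v) *\<^sub>R p + v *\<^sub>R q"
    using z(2) unfolding closed_segment_def by blast
  have "orient p q z = 0" unfolding v orient_affine by simp
  then have 0: "(1 - u) * orient p q a + u * orient p q b = 0" unfolding u(3) orient_affine .
  from assms consider "orient p q a > 0" "orient p q b > 0" | "orient p q a < 0" "orient p q b < 0"
    unfolding same_side_def zero_less_mult_iff by blast
  then show False
  proof cases
    case 1
    have "(1 - u) * orient p q a \<ge> 0" "u * orient p q b \<ge> 0" using 1 u by simp_all
    then have "(1 - u) * orient p q a = 0" "u * orient p q b = 0" using 0 by linarith+
    then show False using 1 by simp
  next
    case 2
    have "(1 - u) * orient p q a \<le> 0" "u * orient p q b \<le> 0" using 2 u by (simp_all add: mult_nonneg_nonpos)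
    then have "(1 - u) * orient p q a = 0" "u * orient p q b = 0" using 0 by linarith+
    then show False using 2 by simp
  qed
qed

text \<open>A boundary point is located by the number \<open>k + t\<close>, its distance from corner
  0 counted in edges. The hypothesis \<open>t0\<close> admits corner 0, where the curves start, as
  the only corner.\<close>

lemma chord_inside_neg:
  assumes "N \<ge> 3" "k1 < k2" "k2 < N" "k < N" "0 < t1" "t1 < 1" "0 < t2" "t2 < 1" "0 \<le> t" "t < 1"
    and in1: "real k1 + t1 < real k + t" and in2: "real k + t < real k2 + t2" and t0: "0 < t \<or> k = 0"
  shows "orient (edge_point N k1 t1) (edge_point N k2 t2) (edge_point N k t) < 0"
proof -
  have "real k1 < real (Suc k)" "real k < real (Suc k2)" using assms unfolding of_nat_Suc by linarith+
  then have k: "k1 \<le> k" "k \<le> k2" by simp_all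
  have "0 < t"
  proof (rule ccontr)
    assume "\<not> 0 < t"
    then have "real k + t = 0" using t0 assms(9) by simp
    then show False using in1 assms(5) by simp
  qed
  then have "orient (edge_point N k1 t1) (edge_point N k t) (edge_point N k2 t2) > 0"
    using assms k by (intro orient_boundary_pos) simp_all
  then show ?thesis
    using orient_rotate[of "edge_point N k t" "edge_point N k1 t1" "edge_point N k2 t2"]
      orient_swap[of "edge_point N k1 t1" "edge_point N k t" "edge_point N k2 t2"] by linarith
qed

lemma chord_outside_pos:
  assumes "N \<ge> 3" "k1 < k2" "k2 < N" "k < N" "0 < t1" "t1 < 1" "0 < t2" "t2 < 1" "0 \<le> t" "t < 1"
    and out: "real k + t < real k1 + t1 \<or> real k2 + t2 < real k + t" and t0: "0 < t \<or> k = 0"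
  shows "orient (edge_point N k1 t1) (edge_point N k2 t2) (edge_point N k t) > 0"
  using out
proof
  assume o: "real k + t < real k1 + t1"
  then have "real k < real (Suc k1)" using assms unfolding of_nat_Suc by linarith
  then have "k \<le> k1" by simp
  then have "orient (edge_point N k t) (edge_point N k1 t1) (edge_point N k2 t2) > 0"
    using assms o by (intro orient_boundary_pos) simp_all
  then show ?thesis by (simp only: orient_rotate[of "edge_point N k t"])
next
  assume o: "real k2 + t2 < real k + t"
  then have "real k2 < real (Suc k)" using assms unfolding of_nat_Suc by linarith
  then have k: "k2 \<le> k" by simp
  then have "0 < t" using t0 assms(2) by linarith
  then show ?thesis using assms o k by (intro orient_boundary_pos) simp_all
qed

text \<open>The ends of two chords do not alternate on the boundary: \<open>s\<close>,
  \<open>e\<close> are the positions \<open>k + t\<close> of the ends of one chord,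
  \<open>s'\<close>, \<open>e'\<close> those of the other. The strict inequalities also keep the
  ends of different chords apart.\<close>

definition not_interleaved :: "real \<Rightarrow> real \<Rightarrow> real \<Rightarrow> real \<Rightarrow> bool" where
  "not_interleaved s e s' e' \<longleftrightarrow>
     (min s e < s' \<and> s' < max s e \<and> min s e < e' \<and> e' < max s e) \<or>
     ((s' < min s e \<or> max s e < s') \<and> (e' < min s e \<or> max s e < e'))"

lemma not_interleaved_same_side:
  assumes N: "N \<ge> 3" and k: "k1 \<noteq> k2" "k1 < N" "k2 < N" and t: "0 < t1" "t1 < 1" "0 < t2" "t2 < 1"
    and a: "a < N" "0 \<le> u" "u < 1" "0 < u \<or> a = 0" and b: "b < N" "0 \<le> v" "v < 1" "0 < v \<or> b = 0"
    and ni: "not_interleaved (real k1 + t1) (real k2 + t2) (real a + u) (real b + v)"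
  shows "same_side (edge_point N k1 t1) (edge_point N k2 t2) (edge_point N a u) (edge_point N b v)"
proof -
  have *: "same_side (edge_point N k1 t1) (edge_point N k2 t2) (edge_point N a u) (edge_point N b v)"
    if k: "k1 < k2" "k2 < N" and t: "0 < t1" "t1 < 1" "0 < t2" "t2 < 1"
    and ni: "not_interleaved (real k1 + t1) (real k2 + t2) (real a + u) (real b + v)" for k1 k2 t1 t2
  proof -
    have "real (Suc k1) \<le> real k2" using k by linarith
    then have "real k1 + t1 < real k2 + t2" using t unfolding of_nat_Suc by linarith
    then have m: "min (real k1 + t1) (real k2 + t2) = real k1 + t1" "max (real k1 + t1) (real k2 + t2) = real k2 + t2"
      by simp_all
    from ni show ?thesis unfolding not_interleaved_def m
    proof
      assume "real k1 + t1 < real a + u \<and> real a + u < real k2 + t2 \<and> real k1 + t1 < real b + v \<and> real b + v < real k2 + t2"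
      then have "orient (edge_point N k1 t1) (edge_point N k2 t2) (edge_point N a u) < 0"
        "orient (edge_point N k1 t1) (edge_point N k2 t2) (edge_point N b v) < 0"
        by (intro chord_inside_neg N k a b t; simp)+
      then show ?thesis unfolding same_side_def by (rule mult_neg_neg)
    next
      assume "(real a + u < real k1 + t1 \<or> real k2 + t2 < real a + u) \<and> (real b + v < real k1 + t1 \<or> real k2 + t2 < real b + v)"
      then have "orient (edge_point N k1 t1) (edge_point N k2 t2) (edge_point N a u) > 0"
        "orient (edge_point N k1 t1) (edge_point N k2 t2) (edge_point N b v) > 0"
        by (intro chord_outside_pos N k a b t; simp)+
      then show ?thesis unfolding same_side_def by (rule mult_pos_pos)
    qed
  qed
  show ?thesis
  proof (cases "k1 < k2")
    case True
    then show ?thesis using * t k ni by blast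
  next
    case False
    then have "k2 < k1" using k by simp
    moreover have "not_interleaved (real k2 + t2) (real k1 + t1) (real a + u) (real b + v)"
      using ni unfolding not_interleaved_def by (simp only: min.commute[of "real k2 + t2"] max.commute[of "real k2 + t2"])
    ultimately show ?thesis using *[of k2 k1 t2 t1] t k by (simp only: same_side_swap[of "edge_point N k1 t1"])
  qed
qed

text \<open>
  The hyperelliptic involution exchanges the two polygons and fixes the midpoint of every arc. The
  curves used here are invariant under it, and the first half of such a curve runs from the corner \<open>0\<close>
  to the midpoint of the edge \<open>kk m\<close>; it meets the edge \<open>kk l\<close> at the parameter \<open>tt l\<close>.
\<close>

locale arc_data =
  fixes N m :: nat and kk :: "nat \<Rightarrow> nat" and tt :: "nat \<Rightarrow> real"
  assumes N3: "N \<ge> 3" and m: "m \<ge> 1"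
    and kk: "1 \<le> l \<Longrightarrow> l \<le> m \<Longrightarrow> kk l < N"
    and tt: "1 \<le> l \<Longrightarrow> l \<le> m \<Longrightarrow> 0 < tt l" "1 \<le> l \<Longrightarrow> l \<le> m \<Longrightarrow> tt l < 1" and mid: "tt m = 1 / 2"
    and kk_neq: "1 \<le> l \<Longrightarrow> l < m \<Longrightarrow> kk l \<noteq> kk (Suc l)"
    and apart: "l' < l \<Longrightarrow> l < m \<Longrightarrow>
      not_interleaved (real (kk l) + (1 - tt l)) (real (kk (Suc l)) + tt (Suc l))
        (if l' = 0 then 0 else real (kk l') + (1 - tt l')) (real (kk (Suc l')) + tt (Suc l'))"
begin

text \<open>A piece starts at the partner, under the gluing, of the point where the previous piece
  has left the other polygon; this accounts for \<open>1 - tt l\<close>. The first piece starts at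
  the marked point.\<close>

definition S :: "nat \<Rightarrow> complex" where
  "S l = (if l = 0 then corner N 0 else edge_point N (kk l) (1 - tt l))"

definition E :: "nat \<Rightarrow> complex" where "E l = edge_point N (kk (Suc l)) (tt (Suc l))"

lemma same_side_chords:
  assumes "l' < l" "l < m" shows "same_side (S l) (E l) (S l') (E l')"
proof -
  have l: "1 \<le> l" "l \<le> m" "1 \<le> Suc l" "Suc l \<le> m" "1 \<le> Suc l'" "Suc l' \<le> m" using assms by simp_all
  note f = N3 kk_neq[OF l(1) assms(2)] kk[OF l(1,2)] kk[OF l(3,4)]
  have g: "0 < 1 - tt l" "1 - tt l < 1" using tt[OF l(1,2)] by simp_all
  have S: "S l = edge_point N (kk l) (1 - tt l)" using l by (simp add: S_def)
  show ?thesis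
  proof (cases "l' = 0")
    case True
    have S': "S l' = edge_point N 0 0" using True by (simp add: S_def edge_point_def)
    show ?thesis unfolding S S' E_def
    proof (rule not_interleaved_same_side[OF f g tt[OF l(3,4)]])
      show "not_interleaved (real (kk l) + (1 - tt l)) (real (kk (Suc l)) + tt (Suc l)) (real 0 + 0) (real (kk (Suc l')) + tt (Suc l'))"
        using apart[OF assms] True by simp
    qed (use N3 tt[OF l(5,6)] kk[OF l(5,6)] in simp_all)
  next
    case False
    then have l': "1 \<le> l'" "l' \<le> m" using assms by simp_all
    have S': "S l' = edge_point N (kk l') (1 - tt l')" using False by (simp add: S_def)
    show ?thesis unfolding S S' E_def
    proof (rule not_interleaved_same_side[OF f g tt[OF l(3,4)]])
      show "not_interleaved (real (kk l) + (1 - tt l)) (real (kk (Suc l)) + tt (Suc l)) (real (kk l') + (1 - tt l')) (real (kk (Suc l')) + tt (Suc l'))"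
        using apart[OF assms] False by simp
    qed (use N3 tt[OF l(5,6)] kk[OF l(5,6)] tt[OF l'] kk[OF l'] in simp_all)
  qed
qed

text \<open>An admissible curve leaves the marked point along the radius, so the straight first
  chord is replaced by a detour over \<open>(1 - d) *\<^sub>R corner N 0\<close>. To be on a given
  side of a later chord is an open condition that corner 0 satisfies, and there are finitely many
  chords, so a small \<open>d\<close> works for all of them.\<close>

lemma bend_exists:
  obtains d where "0 < d" "d < 1" "\<And>x. 0 < x \<Longrightarrow> x \<le> d \<Longrightarrow> (1 - x) *\<^sub>R corner N 0 \<in> interior (polygon N)"
    "\<And>l. 0 < l \<Longrightarrow> l < m \<Longrightarrow> same_side (S l) (E l) ((1 - d) *\<^sub>R corner N 0) (E 0)"
proof -
  obtain d0 where d0: "0 < d0" "d0 < 1" "\<And>x. 0 < x \<Longrightarrow> x \<le> d0 \<Longrightarrow> (1 - x) *\<^sub>R corner N 0 \<in> interior (polygon N)"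
  proof (rule radius_interior[OF N3])
    fix d assume "0 < d" "d < 1" "\<And>x. 0 < x \<Longrightarrow> x \<le> d \<Longrightarrow> (1 - x) *\<^sub>R corner N 0 \<in> interior (polygon N)"
    then show thesis by (rule that)
  qed
  have "\<forall>\<^sub>F x in at_right 0. \<forall>l\<in>{1..<m}. same_side (S l) (E l) ((1 - x) *\<^sub>R corner N 0) (E 0)"
  proof (rule eventually_ball_finite)
    show "\<forall>l\<in>{1..<m}. \<forall>\<^sub>F x in at_right 0. same_side (S l) (E l) ((1 - x) *\<^sub>R corner N 0) (E 0)"
    proof
      fix l assume l: "l \<in> {1..<m}"
      then have ss: "same_side (S l) (E l) (corner N 0) (E 0)"
        using same_side_chords[of 0 l] by (simp add: S_def)
      let ?f = "\<lambda>x. ((1 - x) * orient (S l) (E l) (corner N 0) + x * orient (S l) (E l) 0) * orient (S l) (E l) (E 0)"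
      have "(?f \<longlongrightarrow> ?f 0) (at_right 0)" by (intro tendsto_intros)
      moreover have "0 < ?f 0" using ss by (simp add: same_side_def)
      ultimately have "\<forall>\<^sub>F x in at_right 0. 0 < ?f x" by (rule order_tendstoD)
      moreover have "?f x = orient (S l) (E l) ((1 - x) *\<^sub>R corner N 0) * orient (S l) (E l) (E 0)" for x
        using orient_affine[of "S l" "E l" x "corner N 0" 0] by simp
      ultimately show "\<forall>\<^sub>F x in at_right 0. same_side (S l) (E l) ((1 - x) *\<^sub>R corner N 0) (E 0)"
        unfolding same_side_def by (simp only:)
    qed
  qed simp
  moreover have "\<forall>\<^sub>F x in at_right 0. x \<in> {0<..<d0}" using d0(1) by (rule eventually_at_right_real)
  ultimately have "\<forall>\<^sub>F x in at_right 0. x \<in> {0<..<d0} \<and>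
      (\<forall>l\<in>{1..<m}. same_side (S l) (E l) ((1 - x) *\<^sub>R corner N 0) (E 0))" by (intro eventually_conj)
  from eventually_happens'[OF trivial_limit_at_right_real this]
  obtain x where "x \<in> {0<..<d0}" "\<forall>l\<in>{1..<m}. same_side (S l) (E l) ((1 - x) *\<^sub>R corner N 0) (E 0)"
    by (elim exE conjE)
  then show ?thesis using d0 by (intro that[of x]) simp_all
qed

definition bend :: real where
  "bend = (SOME d. 0 < d \<and> d < 1 \<and> (\<forall>x. 0 < x \<longrightarrow> x \<le> d \<longrightarrow> (1 - x) *\<^sub>R corner N 0 \<in> interior (polygon N))
     \<and> (\<forall>l. 0 < l \<longrightarrow> l < m \<longrightarrow> same_side (S l) (E l) ((1 - d) *\<^sub>R corner N 0) (E 0)))"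

lemma bend: "0 < bend" "bend < 1"
    "0 < x \<Longrightarrow> x \<le> bend \<Longrightarrow> (1 - x) *\<^sub>R corner N 0 \<in> interior (polygon N)"
    "0 < l \<Longrightarrow> l < m \<Longrightarrow> same_side (S l) (E l) ((1 - bend) *\<^sub>R corner N 0) (E 0)"
proof -
  let ?P = "\<lambda>d. 0 < d \<and> d < 1 \<and> (\<forall>x. 0 < x \<longrightarrow> x \<le> d \<longrightarrow> (1 - x) *\<^sub>R corner N 0 \<in> interior (polygon N))
     \<and> (\<forall>l. 0 < l \<longrightarrow> l < m \<longrightarrow> same_side (S l) (E l) ((1 - d) *\<^sub>R corner N 0) (E 0))"
  obtain d where "?P d"
  proof (rule bend_exists)
    fix d assume "0 < d" "d < 1" "\<And>x. 0 < x \<Longrightarrow> x \<le> d \<Longrightarrow> (1 - x) *\<^sub>R corner N 0 \<in> interior (polygon N)"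
      "\<And>l. 0 < l \<Longrightarrow> l < m \<Longrightarrow> same_side (S l) (E l) ((1 - d) *\<^sub>R corner N 0) (E 0)"
    then have "?P d" by blast
    then show thesis by (rule that)
  qed
  from someI[of ?P, OF this] have p: "?P bend" unfolding bend_def[symmetric] .
  show "0 < bend" using p by (elim conjE)
  show "bend < 1" using p by (elim conjE)
  have p3: "\<forall>x. 0 < x \<longrightarrow> x \<le> bend \<longrightarrow> (1 - x) *\<^sub>R corner N 0 \<in> interior (polygon N)"
    using p by (elim conjE)
  then show "0 < x \<Longrightarrow> x \<le> bend \<Longrightarrow> (1 - x) *\<^sub>R corner N 0 \<in> interior (polygon N)" by blast
  have p4: "\<forall>l. 0 < l \<longrightarrow> l < m \<longrightarrow> same_side (S l) (E l) ((1 - bend) *\<^sub>R corner N 0) (E 0)"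
    using p by (elim conjE)
  then show "0 < l \<Longrightarrow> l < m \<Longrightarrow> same_side (S l) (E l) ((1 - bend) *\<^sub>R corner N 0) (E 0)" by blast
qed

definition q :: complex where "q = (1 - bend) *\<^sub>R corner N 0"

definition h :: "nat \<Rightarrow> real \<Rightarrow> complex" where
  "h l = (if l = 0 then linepath (corner N 0) q +++ linepath q (E 0) else linepath (S l) (E l))"

lemma q_interior: "q \<in> interior (polygon N)" unfolding q_def using bend by simp

lemma E_in_polygon: "l < m \<Longrightarrow> E l \<in> polygon N"
  unfolding E_def using tt[of "Suc l"] N3 by (intro edge_point_in_polygon) simp_all

lemma E_notin_interior: "l < m \<Longrightarrow> E l \<notin> interior (polygon N)"
  unfolding E_def using kk[of "Suc l"] N3 by (intro edge_point_notin_interior) simp_all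

lemma E_neq_corner: "l < m \<Longrightarrow> corner N j \<noteq> E l"
  unfolding E_def using kk[of "Suc l"] tt[of "Suc l"] N3 by (intro corner_neq_edge_point) simp_all

lemma q_segment: "0 \<le> v \<Longrightarrow> v \<le> 1 \<Longrightarrow> linepath (corner N 0) q v = (1 - v * bend) *\<^sub>R corner N 0"
  unfolding linepath_def q_def scaleR_scaleR scaleR_left_distrib[symmetric] by (simp add: algebra_simps)

lemma q_segment_interior: "0 < v \<Longrightarrow> v \<le> 1 \<Longrightarrow> linepath (corner N 0) q v \<in> interior (polygon N)"
  using q_segment[of v] bend(3)[of "v * bend"] bend(1) by (simp add: mult_left_le_one_le)

lemma qE_interior: "0 \<le> v \<Longrightarrow> v < 1 \<Longrightarrow> linepath q (E 0) v \<in> interior (polygon N)"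
proof -
  assume v: "0 \<le> v" "v < 1"
  show ?thesis
  proof (cases "v = 0")
    case True then show ?thesis using q_interior by (simp add: linepath_def)
  next
    case False
    have "q \<noteq> E 0" using q_interior E_notin_interior[of 0] m by (metis less_eq_Suc_le One_nat_def)
    then have "linepath q (E 0) v \<in> open_segment q (E 0)"
      unfolding in_segment linepath_def using v False by (intro conjI exI[of _ v]) simp_all
    moreover have "open_segment q (E 0) \<subseteq> interior (polygon N)"
      using m by (intro in_interior_closure_convex_segment convex_polygon q_interior
        subsetD[OF closure_subset] E_in_polygon) simp
    ultimately show ?thesis by (rule subsetD[rotated])
  qed
qed

lemma h_first_image: "h 0 ` {0..1} = closed_segment (corner N 0) q \<union> closed_segment q (E 0)"
  using path_image_join[of "linepath (corner N 0) q" "linepath q (E 0)"]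
  by (simp add: h_def path_image_def[symmetric])

lemma h_image: "0 < l \<Longrightarrow> h l ` {0..1} = closed_segment (S l) (E l)"
  by (simp add: h_def path_image_def[symmetric])

lemma h_ends: "h l 0 = S l" "h l 1 = E l"
  by (simp_all add: h_def S_def joinpaths_def linepath_def)

lemma h_path: "path (h l)" by (simp add: h_def)

lemma h_interior:
  assumes "l < m" "0 < u" "u < 1" shows "h l u \<in> interior (polygon N)"
proof (cases "l = 0")
  case True
  show ?thesis
  proof (cases "u \<le> 1 / 2")
    case True
    then have "h l u = linepath (corner N 0) q (2 * u)" using \<open>l = 0\<close> by (simp add: h_def joinpaths_def)
    then show ?thesis using q_segment_interior[of "2 * u"] True assms by simp
  next
    case False
    then have "h l u = linepath q (E 0) (2 * u - 1)" using \<open>l = 0\<close> by (simp add: h_def joinpaths_def)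
    then show ?thesis using qE_interior[of "2 * u - 1"] False assms by simp
  qed
next
  case False
  then have l: "1 \<le> l" "l \<le> m" "1 \<le> Suc l" "Suc l \<le> m" using assms by simp_all
  have "linepath (edge_point N (kk l) (1 - tt l)) (edge_point N (kk (Suc l)) (tt (Suc l))) u \<in> interior (polygon N)"
    using kk_neq[OF l(1) assms(1)] kk[OF l(1,2)] kk[OF l(3,4)] tt[OF l(1,2)] tt[OF l(3,4)] assms N3
    by (intro chord_interior) simp_all
  then show ?thesis using False by (simp add: h_def S_def E_def)
qed

text \<open>The bent first piece is the point at issue. If its two segments met outside the bend
  \<open>q\<close>, then \<open>E 0 - q\<close> would be a multiple \<open>\<mu> > 0\<close> of
  \<open>corner N 0 - q\<close>. But \<open>\<mu> < 1\<close> puts \<open>E 0\<close> into the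
  interior, \<open>\<mu> = 1\<close> makes it a corner, and \<open>\<mu> > 1\<close> puts corner 0
  into the interior.\<close>

lemma h_inj: assumes "l < m" shows "inj_on (h l) {0..1}"
proof (cases "l = 0")
  case True
  have "closed_segment (corner N 0) q \<inter> closed_segment q (E 0) \<subseteq> {q}"
  proof
    fix z assume "z \<in> closed_segment (corner N 0) q \<inter> closed_segment q (E 0)"
    then have z: "z \<in> closed_segment (corner N 0) q" "z \<in> closed_segment q (E 0)" by auto
    obtain v where v: "0 \<le> v" "v \<le> 1" "z = (1 - v) *\<^sub>R q + v *\<^sub>R E 0"
      using z(2) unfolding closed_segment_def by blast
    obtain w where w: "0 \<le> w" "w \<le> 1" "z = (1 - w) *\<^sub>R corner N 0 + w *\<^sub>R q"
      using z(1) unfolding closed_segment_def by blast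
    show "z \<in> {q}"
    proof (rule ccontr)
      assume "z \<notin> {q}"
      then have ne: "v \<noteq> 0" "w \<noteq> 1" using v w by auto
      define \<mu> where "\<mu> = (1 - w) / v"
      have \<mu>: "0 < \<mu>" using ne v w by (simp add: \<mu>_def)
      have "v *\<^sub>R (E 0 - q) = (1 - w) *\<^sub>R (corner N 0 - q)"
        using v(3) w(3) by (simp add: algebra_simps)
      then have "(1 / v) *\<^sub>R (v *\<^sub>R (E 0 - q)) = (1 / v) *\<^sub>R ((1 - w) *\<^sub>R (corner N 0 - q))" by (rule arg_cong)
      then have E0: "E 0 - q = \<mu> *\<^sub>R (corner N 0 - q)" using ne by (simp add: \<mu>_def)
      have cq: "corner N 0 - q = bend *\<^sub>R corner N 0" by (simp add: q_def algebra_simps)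
      have m0: "0 < m" using m by simp
      consider "\<mu> < 1" | "\<mu> = 1" | "\<mu> > 1" by linarith
      then show False
      proof cases
        case 1
        have "E 0 = q + \<mu> *\<^sub>R (bend *\<^sub>R corner N 0)" using E0 unfolding cq by (simp add: algebra_simps)
        also have "\<dots> = (1 - bend * (1 - \<mu>)) *\<^sub>R corner N 0" by (simp add: q_def algebra_simps)
        also have "\<dots> \<in> interior (polygon N)" using 1 \<mu> bend(1,2)
          by (intro bend(3)) (simp_all add: mult_left_le)
        finally show False using E_notin_interior[OF m0] by simp
      next
        case 2
        then have "E 0 = corner N 0" using E0 by simp
        then show False using E_neq_corner[OF m0, of 0] by simp
      next
        case 3
        have "(1 / \<mu>) *\<^sub>R (E 0 - q) = (1 / \<mu>) *\<^sub>R (\<mu> *\<^sub>R (corner N 0 - q))" unfolding E0 ..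
        then have "(1 / \<mu>) *\<^sub>R (E 0 - q) = corner N 0 - q" using \<mu> by simp
        then have "corner N 0 = linepath q (E 0) (1 / \<mu>)" by (simp add: linepath_def algebra_simps)
        moreover have "linepath q (E 0) (1 / \<mu>) \<in> interior (polygon N)" using 3 by (intro qE_interior) simp_all
        ultimately show False using corner_notin_interior[OF N3, of 0] by simp
      qed
    qed
  qed
  moreover have "corner N 0 \<noteq> q" using q_interior corner_notin_interior[OF N3, of 0] by metis
  moreover have "q \<noteq> E 0" using q_interior E_notin_interior[of 0] m by (metis less_eq_Suc_le One_nat_def)
  ultimately have "arc (linepath (corner N 0) q +++ linepath q (E 0))"
    by (intro arc_join arc_linepath) simp_all
  then show ?thesis using True by (simp add: h_def arc_def)
next
  case False
  then have "S l \<noteq> E l"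
    using kk_neq[of l] kk[of l] kk[of "Suc l"] tt[of l] tt[of "Suc l"] assms N3
      edge_point_eqD(1)[of N "kk l" "1 - tt l" "kk (Suc l)" "tt (Suc l)"] unfolding S_def E_def
    by (simp only: if_False) force
  then have "arc (linepath (S l) (E l))" by simp
  then show ?thesis using False by (simp add: h_def arc_def)
qed

lemma h_disjoint:
  assumes "l' < l" "l < m" shows "h l' ` {0..1} \<inter> h l ` {0..1} = {}"
proof (cases "l' = 0")
  case False
  then show ?thesis
    using same_side_disjoint[OF same_side_chords[OF assms]] h_image[of l] h_image[of l'] assms by simp
next
  case True
  have 1: "same_side (S l) (E l) (corner N 0) (E 0)"
    using same_side_chords[of 0 l] assms by (simp add: S_def)
  have 2: "same_side (S l) (E l) q (E 0)" unfolding q_def using bend(4)[of l] assms by simp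
  \<comment> \<open>Corner 0 and the bend are both on the side of \<open>E 0\<close>, so both
    segments of the bent piece avoid the chord.\<close>
  have 3: "same_side (S l) (E l) (corner N 0) q"
    using 1 2 unfolding same_side_def zero_less_mult_iff by linarith
  show ?thesis using same_side_disjoint[OF 2] same_side_disjoint[OF 3] h_image[of l] assms True
    by (simp add: h_first_image Int_Un_distrib2)
qed

text \<open>The involution exchanges the polygons and fixes coordinates, so the second half runs
  through the same paths backwards. Path \<open>l\<close> is used once in each polygon, by the
  pieces \<open>l\<close> and \<open>2 * m - 1 - l\<close> of opposite parity; hence all
  \<open>m\<close> paths have to be pairwise disjoint, whatever their parity.\<close>

definition gg :: "nat \<Rightarrow> real \<Rightarrow> complex" where
  "gg l = (if l < m then h l else reversepath (h (2 * m - 1 - l)))"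

lemma gg_image: "gg l ` {0..1} = h (if l < m then l else 2 * m - 1 - l) ` {0..1}"
  by (simp add: gg_def path_image_def[symmetric])

sublocale chain: piece_chain N "2 * m" gg "\<lambda>l. if l \<le> m then kk l else kk (2 * m - l)"
  "\<lambda>l. if l \<le> m then tt l else 1 - tt (2 * m - l)"
proof
  show "3 \<le> N" "even (2 * m)" "2 \<le> 2 * m" using N3 m by simp_all
  show "path (gg l)" if "l < 2 * m" for l by (simp add: gg_def h_path)
  show "inj_on (gg l) {0..1}" if "l < 2 * m" for l
  proof (cases "l < m")
    case False
    have "inj_on (h (2 * m - 1 - l)) {0..1}" using that False by (intro h_inj) simp
    then show ?thesis using False unfolding gg_def reversepath_def inj_on_def
      by (simp only: if_False) (metis (no_types, lifting) atLeastAtMost_iff diff_ge_0_iff_ge diff_left_imp_eq le_add_same_cancel1 diff_le_eq)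
  qed (simp add: gg_def h_inj)
  show "gg l u \<in> interior (polygon N)" if "l < 2 * m" "0 < u" "u < 1" for l u
    using that h_interior[of l u] h_interior[of "2 * m - 1 - l" "1 - u"]
    by (cases "l < m") (simp_all add: gg_def reversepath_def)
  show "(if l \<le> m then kk l else kk (2 * m - l)) < N" if "0 < l" "l < 2 * m" for l
    using that kk[of l] kk[of "2 * m - l"] by (cases "l \<le> m") simp_all
  show "0 < (if l \<le> m then tt l else 1 - tt (2 * m - l))" if "0 < l" "l < 2 * m" for l
    using that tt[of l] tt[of "2 * m - l"] by (cases "l \<le> m") simp_all
  show "(if l \<le> m then tt l else 1 - tt (2 * m - l)) < 1" if "0 < l" "l < 2 * m" for l
    using that tt[of l] tt[of "2 * m - l"] by (cases "l \<le> m") simp_all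
  show "gg (l - 1) 1 = edge_point N (if l \<le> m then kk l else kk (2 * m - l)) (if l \<le> m then tt l else 1 - tt (2 * m - l))"
    if "0 < l" "l < 2 * m" for l
  proof (cases "l \<le> m")
    case True
    then have "l - 1 < m" "Suc (l - 1) = l" using that by simp_all
    then show ?thesis using True by (simp add: gg_def h_ends E_def)
  next
    case False
    then have "\<not> l - 1 < m" "2 * m - 1 - (l - 1) = 2 * m - l" "2 * m - l \<noteq> 0" using that by simp_all
    then show ?thesis using False by (simp add: gg_def reversepath_def h_ends S_def)
  qed
  show "gg l 0 = edge_point N (if l \<le> m then kk l else kk (2 * m - l)) (1 - (if l \<le> m then tt l else 1 - tt (2 * m - l)))"
    if "0 < l" "l < 2 * m" for l
  proof -
    consider "l < m" | "l = m" | "l > m" by linarith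
    then show ?thesis
    proof cases
      case 1
      then show ?thesis using that by (simp add: gg_def h_ends S_def)
    next
      case 2
      \<comment> \<open>The midpoint is the one point of the open edge that the gluing takes to the
        same coordinates, so the reversed path continues the first half here.\<close>
      have "1 - tt m = tt m" using mid by simp
      then have "edge_point N (kk m) (1 - tt m) = edge_point N (kk m) (tt m)" by (simp only:)
      moreover have "Suc (2 * m - 1 - m) = m" using m by simp
      ultimately show ?thesis using 2 by (simp add: gg_def reversepath_def h_ends E_def)
    next
      case 3
      have "Suc (2 * m - 1 - l) = 2 * m - l" using that by simp
      then show ?thesis using 3 by (simp add: gg_def reversepath_def h_ends E_def)
    qed
  qed
  show "gg 0 0 = corner N 0" using m by (simp add: gg_def h_ends S_def)
  have m2: "\<not> 2 * m - Suc 0 < m" using m by linarith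
  show "gg (2 * m - 1) 1 = corner N 0" using m m2 by (simp add: gg_def reversepath_def h_ends S_def)
  have seg: "h 0 x \<in> closed_segment 0 (corner N 0)" if "x \<in> {0..1/2}" for x
  proof -
    have "h 0 x = (1 - 2 * x * bend) *\<^sub>R corner N 0"
      using that q_segment[of "2 * x"] by (simp add: h_def joinpaths_def)
    moreover have "0 \<le> 1 - 2 * x * bend" "1 - 2 * x * bend \<le> 1"
      using that bend(1,2) mult_mono[of "2 * x" 1 bend 1] by simp_all
    ultimately show ?thesis unfolding in_segment by (intro exI[of _ "1 - 2 * x * bend"]) simp
  qed
  have "gg 0 x \<in> closed_segment 0 (corner N 0)" if "x \<in> {0..1/2}" for x
    using seg[OF that] m by (simp add: gg_def)
  moreover have "gg (2 * m - 1) x \<in> closed_segment 0 (corner N 0)" if "x \<in> {1 - 1/2..1}" for x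
    using seg[of "1 - x"] that m2 by (simp add: gg_def reversepath_def)
  ultimately show "\<exists>\<epsilon>>0. \<epsilon> \<le> 1 \<and> gg 0 ` {0..\<epsilon>} \<subseteq> closed_segment 0 (corner N 0)
        \<and> gg (2 * m - 1) ` {1 - \<epsilon>..1} \<subseteq> closed_segment 0 (corner N 0)"
    by (intro exI[of _ "1/2"] conjI image_subsetI) simp_all
  show "gg l ` {0..1} \<inter> gg l' ` {0..1} = {}" if l: "l < l'" "l' < 2 * m" "even l = even l'" for l l'
  proof -
    let ?i = "\<lambda>l. if l < m then l else 2 * m - 1 - l"
    have "?i l < m" "?i l' < m" using l by (auto split: if_splits)
    moreover have "?i l \<noteq> ?i l'"
    proof (cases "l < m \<and> \<not> l' < m")
      case True
      \<comment> \<open>Mirroring changes the parity, so a path is never compared with its own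
        mirror image inside one polygon.\<close>
      have "even (2 * m - 1 - l') = odd l'" using l by simp
      then show ?thesis using True l by (simp only: if_True if_False) metis
    next
      case False
      then show ?thesis using l by auto
    qed
    ultimately show ?thesis
      using h_disjoint[of "?i l" "?i l'"] h_disjoint[of "?i l'" "?i l"] unfolding gg_image
      by (cases "?i l < ?i l'") (simp_all only: Int_commute not_less_iff_gr_or_eq simp_thms)
  qed
qed

lemma mirrored_list:
  "map (\<lambda>l. f (if l \<le> m then kk l else kk (2 * m - l))) [1..<2 * m]
     = map (f \<circ> kk) [1..<m] @ [f (kk m)] @ rev (map (f \<circ> kk) [1..<m])"
proof (rule nth_equalityI)
  fix i assume i: "i < length (map (\<lambda>l. f (if l \<le> m then kk l else kk (2 * m - l))) [1..<2 * m])"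
  consider "Suc i < m" | "Suc i = m" | "Suc i > m" by linarith
  then show "map (\<lambda>l. f (if l \<le> m then kk l else kk (2 * m - l))) [1..<2 * m] ! i
     = (map (f \<circ> kk) [1..<m] @ [f (kk m)] @ rev (map (f \<circ> kk) [1..<m])) ! i"
  proof cases
    case 1
    then have "i < m - 1" by simp
    then show ?thesis using 1 i by (simp add: nth_append)
  next
    case 2
    then have "m - 1 = i" by simp
    then show ?thesis using 2 i by (simp add: nth_append)
  next
    case 3
    then have "\<not> i < m - Suc 0" "i - (m - Suc 0) = Suc (i - m)" "i - m < m - Suc 0"
      "m - Suc (Suc (i - m)) < m - Suc 0" "Suc (m - Suc (Suc (i - m))) = 2 * m - Suc i" using i m by simp_all
    moreover from this have "[Suc 0..<m] ! (m - Suc (Suc (i - m))) = 2 * m - Suc i"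
      by (subst nth_upt) (use m in linarith)+
    moreover have "[Suc 0..<2 * m] ! i = Suc i" using i by (subst nth_upt) simp_all
    ultimately show ?thesis using 3 i m by (simp add: nth_append rev_nth)
  qed
qed (use m in simp)

lemma exists_curve:
  assumes "card (verts Q) = N" "\<sigma> permutes {1..N}"
    and "w = map (\<lambda>l. \<sigma> (Suc (kk l))) [1..<m]"
    and "w @ [\<sigma> (Suc (kk m))] @ rev w \<in> reflection_words Q"
  shows "\<exists>\<eta>\<in>simple_admissible Q \<sigma>. crossing_word N \<sigma> \<eta> = w @ [\<sigma> (Suc (kk m))] @ rev w"
proof -
  have *: "map (\<lambda>l. \<sigma> (Suc (if l \<le> m then kk l else kk (2 * m - l)))) [1..<2 * m]
      = w @ [\<sigma> (Suc (kk m))] @ rev w"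
    using mirrored_list[of "\<lambda>k. \<sigma> (Suc k)"] by (simp add: assms(3) o_def)
  show ?thesis
    using chain.curve_simple_admissible[OF assms(1,2)] chain.crossing_word_curve[OF assms(2)] assms(4)
    unfolding * by blast
qed

end


section \<open>Three families of chords with non-alternating ends\<close>

lemma not_interleaved_outside:
  assumes "s' < s \<and> s' < e \<or> s < s' \<and> e < s'" "e' < s \<and> e' < e \<or> s < e' \<and> e < e'"
  shows "not_interleaved s e s' e'"
  using assms unfolding not_interleaved_def by auto

text \<open>The edges \<open>a\<close>, ..., \<open>b\<close> are crossed counter-clockwise. The
  parameter 1/3 lets chord \<open>l\<close> cut off corner \<open>a + l\<close>, from position
  \<open>a + l - 1/3\<close> to \<open>a + l + 1/3\<close>, or to \<open>a + l + 1/2\<close> when it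
  is the last one. All earlier ends lie before it.\<close>

lemma arc_data_right:
  assumes "N \<ge> 3" "a \<le> b" "b < N"
  shows "arc_data N (b - a + 1) (\<lambda>l. a + l - 1) (\<lambda>l. if l = b - a + 1 then 1 / 2 else 1 / 3)"
proof
  fix l l' assume l: "l' < l" "l < b - a + 1"
  let ?kk = "\<lambda>l. a + l - 1" and ?tt = "\<lambda>l. if l = b - a + 1 then 1 / 2 else 1 / 3 :: real"
  have k: "real (?kk l) = real a + real l - 1" "real (?kk (Suc l)) = real a + real l"
    "real (?kk (Suc l')) = real a + real l'" using l by (simp_all add: of_nat_diff)
  have k': "real (?kk l') = real a + real l' - 1" if "l' \<noteq> 0" using that by (simp add: of_nat_diff)
  have t: "?tt l = 1 / 3" "?tt (Suc l') = 1 / 3" using l by auto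
  have t2: "1 / 3 \<le> ?tt (Suc l)" by simp
  have t': "?tt l' = 1 / 3" using l by simp
  have "real (Suc l') \<le> real l" using l by linarith
  then have ll: "real l' + 1 \<le> real l" by simp
  show "not_interleaved (real (?kk l) + (1 - ?tt l)) (real (?kk (Suc l)) + ?tt (Suc l))
        (if l' = 0 then 0 else real (?kk l') + (1 - ?tt l')) (real (?kk (Suc l')) + ?tt (Suc l'))"
  proof (rule not_interleaved_outside)
    let ?s' = "if l' = 0 then 0 else real (?kk l') + (1 - ?tt l')"
    have "?s' < real (?kk l) + (1 - ?tt l)"
    proof (cases "l' = 0")
      case True
      then show ?thesis unfolding k t using ll by simp
    next
      case False
      then have "?s' = real a + real l' - 1 + (1 - 1/3)" using k' t' by simp
      then show ?thesis unfolding k t using ll by linarith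
    qed
    moreover have "real (?kk l) + (1 - ?tt l) < real (?kk (Suc l)) + ?tt (Suc l)" unfolding k t using t2 by linarith
    ultimately show "?s' < real (?kk l) + (1 - ?tt l) \<and> ?s' < real (?kk (Suc l)) + ?tt (Suc l)
      \<or> real (?kk l) + (1 - ?tt l) < ?s' \<and> real (?kk (Suc l)) + ?tt (Suc l) < ?s'" by linarith
    show "real (?kk (Suc l')) + ?tt (Suc l') < real (?kk l) + (1 - ?tt l)
        \<and> real (?kk (Suc l')) + ?tt (Suc l') < real (?kk (Suc l)) + ?tt (Suc l) \<or>
      real (?kk l) + (1 - ?tt l) < real (?kk (Suc l')) + ?tt (Suc l')
        \<and> real (?kk (Suc l)) + ?tt (Suc l) < real (?kk (Suc l')) + ?tt (Suc l')"
      unfolding k t using ll t2 by linarith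
  qed
qed (use assms in auto)

text \<open>The edges \<open>N - 1\<close>, ..., \<open>i\<close> are crossed clockwise, and the
  parameter 2/3 lets chord \<open>l\<close> cut off corner \<open>N - l\<close>. Earlier ends lie
  after it, except for the start at corner 0, which has position 0 and lies before it.\<close>

lemma arc_data_left:
  assumes "N \<ge> 3" "i < N"
  shows "arc_data N (N - i) (\<lambda>l. N - l) (\<lambda>l. if l = N - i then 1 / 2 else 2 / 3)"
proof
  fix l l' assume l: "l' < l" "l < N - i"
  let ?kk = "\<lambda>l. N - l" and ?tt = "\<lambda>l. if l = N - i then 1 / 2 else 2 / 3 :: real"
  have k: "real (?kk l) = real N - real l" "real (?kk (Suc l)) = real N - real l - 1"
    "real (?kk (Suc l')) = real N - real l' - 1" "real (?kk l') = real N - real l'"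
    using l by (simp_all add: of_nat_diff)
  have t: "?tt l = 2 / 3" "?tt (Suc l') = 2 / 3" "?tt l' = 2 / 3" using l by auto
  have t2: "0 < ?tt (Suc l)" "?tt (Suc l) \<le> 2 / 3" by simp_all
  have "real (Suc l') \<le> real l" using l by linarith
  then have ll: "real l' + 1 \<le> real l" by simp
  have "real (Suc l) \<le> real N" using l by linarith
  then have lN: "real l + 1 \<le> real N" by simp
  show "not_interleaved (real (?kk l) + (1 - ?tt l)) (real (?kk (Suc l)) + ?tt (Suc l))
        (if l' = 0 then 0 else real (?kk l') + (1 - ?tt l')) (real (?kk (Suc l')) + ?tt (Suc l'))"
  proof (rule not_interleaved_outside)
    show "(if l' = 0 then 0 else real (?kk l') + (1 - ?tt l')) < real (?kk l) + (1 - ?tt l) \<and>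
      (if l' = 0 then 0 else real (?kk l') + (1 - ?tt l')) < real (?kk (Suc l)) + ?tt (Suc l) \<or>
      real (?kk l) + (1 - ?tt l) < (if l' = 0 then 0 else real (?kk l') + (1 - ?tt l')) \<and>
      real (?kk (Suc l)) + ?tt (Suc l) < (if l' = 0 then 0 else real (?kk l') + (1 - ?tt l'))"
    proof (cases "l' = 0")
      case True
      have "0 < real N - real l + (1 - 2 / 3)" "0 < real N - real l - 1 + ?tt (Suc l)" using lN t2 by linarith+
      then show ?thesis unfolding k t if_P[OF True] by blast
    next
      case False
      show ?thesis unfolding k t if_not_P[OF False] using ll t2 by linarith
    qed
    show "real (?kk (Suc l')) + ?tt (Suc l') < real (?kk l) + (1 - ?tt l)
        \<and> real (?kk (Suc l')) + ?tt (Suc l') < real (?kk (Suc l)) + ?tt (Suc l) \<or>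
      real (?kk l) + (1 - ?tt l) < real (?kk (Suc l')) + ?tt (Suc l')
        \<and> real (?kk (Suc l)) + ?tt (Suc l) < real (?kk (Suc l')) + ?tt (Suc l')"
      unfolding k t using ll t2 by linarith
  qed
qed (use assms in auto)

text \<open>The edges \<open>J\<close>, ..., \<open>N - 3\<close> are crossed counter-clockwise;
  then the curve turns over to \<open>N - 1\<close> and crosses everything down to \<open>I\<close>
  clockwise. The second run passes the corners of the first again. Its parameter 4/5 gives chords
  from 1/5 after a corner to 1/5 before it, nested inside the chords of the first run, which reach
  2/5 to either side.\<close>

lemma arc_data_turn:
  assumes "I < J" "J + 3 \<le> N" and r: "r = N - 2 - J"
  shows "arc_data N (r + (N - I)) (\<lambda>l. if l \<le> r then J + l - 1 else N - (l - r))
    (\<lambda>l. if l \<le> r then 2 / 5 else if l = r + (N - I) then 1 / 2 else 4 / 5)"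
proof
  let ?m = "r + (N - I)"
  let ?kk = "\<lambda>l. if l \<le> r then J + l - 1 else N - (l - r)"
    and ?tt = "\<lambda>l. if l \<le> r then 2 / 5 else if l = r + (N - I) then 1 / 2 else 4 / 5 :: real"
  have r1: "1 \<le> r" "r + J + 2 = N" using assms by simp_all
  fix l l' assume l: "l' < l" "l < ?m"
  let ?s = "real (?kk l) + (1 - ?tt l)" and ?e = "real (?kk (Suc l)) + ?tt (Suc l)"
  let ?s' = "if l' = 0 then 0 else real (?kk l') + (1 - ?tt l')"
    and ?e' = "real (?kk (Suc l')) + ?tt (Suc l')"
  have s_right: "real (?kk j) + (1 - ?tt j) = real (J + j) - 2 / 5" if "1 \<le> j" "j \<le> r" for j
    using that by (simp add: of_nat_diff)
  have e_right: "real (?kk (Suc j)) + ?tt (Suc j) = real (J + j) + 2 / 5" if "j < r" for j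
    using that by simp
  have s_left: "real (?kk (r + p)) + (1 - ?tt (r + p)) = real (N - p) + 1 / 5" if "1 \<le> p" "r + p < ?m" for p
    using that by simp
  have e_left: "real (?kk (Suc (r + p))) + ?tt (Suc (r + p)) = real (N - p) - 1 / 5" if "Suc (r + p) < ?m" for p
    using that r1 by (simp add: of_nat_diff)
  have e_last: "real (?kk (Suc (r + p))) + ?tt (Suc (r + p)) = real (N - p) - 1 / 2" "N - p = Suc I" if "Suc (r + p) = ?m" for p
  proof -
    show *: "N - p = Suc I" using that assms(1,2) by linarith
    have "\<not> Suc (r + p) \<le> r" "N - (Suc (r + p) - r) = I" using * by simp_all
    then have "?kk (Suc (r + p)) = I" "?tt (Suc (r + p)) = 1 / 2" using that by (simp_all only: if_False if_True simp_thms)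
    then show "real (?kk (Suc (r + p))) + ?tt (Suc (r + p)) = real (N - p) - 1 / 2" unfolding * by simp
  qed
  define ss ee ss' ee' where "ss = ?s" and "ee = ?e" and "ss' = ?s'" and "ee' = ?e'"
  have "not_interleaved ss ee ss' ee'"
  proof (cases "l \<le> r")
    case True
    have s: "ss = real (J + l) - 2 / 5" unfolding ss_def using s_right[of l] True l by simp
    have e: "real (J + l) + 2 / 5 \<le> ee"
    proof (cases "l < r")
      case True then show ?thesis unfolding ee_def using e_right by simp
    next
      case False
      then have "l = r" using True by simp
      have "ee = real (N - 0) - 1 / 5" unfolding ee_def using e_left[of 0] \<open>l = r\<close> r1 assms by simp
      moreover have "real (J + r) + 2 = real N" using r1 by linarith
      ultimately show ?thesis using \<open>l = r\<close> by simp
    qed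
    have "J + l' + 1 \<le> J + l" using l by simp
    then have ll: "real (J + l') + 1 \<le> real (J + l)" by linarith
    have e': "ee' = real (J + l') + 2 / 5" unfolding ee'_def using e_right[of l'] l True by simp
    have s': "ss' \<le> real (J + l')"
    proof (cases "l' = 0")
      case False
      then show ?thesis unfolding ss'_def using s_right[of l'] l True by simp
    qed (simp add: ss'_def)
    show ?thesis using s e ll e' s' by (intro not_interleaved_outside) linarith+
  next
    case False
    define p where "p = l - r"
    have p: "1 \<le> p" "l = r + p" using False by (simp_all add: p_def)
    have s: "ss = real (N - p) + 1 / 5" unfolding ss_def using s_left[of p] p l by simp
    \<comment> \<open>The last chord ends at a midpoint, 1/2 before its corner, which would break
      the nesting. This happens at corner \<open>Suc I\<close>, which lies below all corners cut off
      by the first run because \<open>I < J\<close>.\<close>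
    have e: "ee = real (N - p) - 1 / 5 \<or> ee = real (N - p) - 1 / 2 \<and> N - p = Suc I"
    proof (cases "Suc (r + p) = ?m")
      case True
      show ?thesis using e_last[OF True] unfolding ee_def p(2) by blast
    next
      case False
      then have "Suc (r + p) < ?m" using l p(2) by linarith
      then show ?thesis using e_left[of p] unfolding ee_def p(2) by blast
    qed
    have Np: "1 \<le> N - p" using p l by simp
    then have Np': "1 \<le> real (N - p)" by linarith
    have right: "x < ss \<and> x < ee \<or> ss < x \<and> ee < x"
      if x: "x = real (J + j) + 2 / 5 \<or> x = real (J + j) - 2 / 5 \<and> 1 \<le> j" for x j
    proof (cases "N - p \<le> J + j")
      case True
      then have ge: "real (N - p) \<le> real (J + j)" by linarith
      show ?thesis
      proof (cases "x = real (J + j) + 2 / 5")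
        case True
        then show ?thesis using s e ge by linarith
      next
        case False
        then have x': "x = real (J + j) - 2 / 5" "1 \<le> j" using x by auto
        consider "N - p = J + j" | "N - p + 1 \<le> J + j" using \<open>N - p \<le> J + j\<close> by linarith
        then show ?thesis
        proof cases
          case 1
          then have "N - p \<noteq> Suc I" using assms x' by simp
          then have "ee = real (N - p) - 1 / 5" using e by blast
          moreover have "real (N - p) = real (J + j)" using 1 by (rule arg_cong)
          ultimately show ?thesis using s x'(1) by linarith
        next
          case 2
          then have "real (N - p) + 1 \<le> real (J + j)" by linarith
          then show ?thesis using s e x' by linarith
        qed
      qed
    next
      case False
      then have "J + j + 1 \<le> N - p" by simp
      then have le: "real (J + j) + 1 \<le> real (N - p)" by linarith
      have "N - p \<noteq> Suc I" using False assms by simp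
      then have "ee = real (N - p) - 1 / 5" using e by blast
      moreover have "x \<le> real (J + j) + 2 / 5" using x by linarith
      ultimately show ?thesis using s le by linarith
    qed
    have left: "real (N - p') + 1 / 5 > ss \<and> real (N - p') + 1 / 5 > ee" "real (N - p') - 1 / 5 > ss \<and> real (N - p') - 1 / 5 > ee"
      if "p' < p" for p'
    proof -
      have "N - p + 1 \<le> N - p'" using that p l by simp
      then have "real (N - p) + 1 \<le> real (N - p')" by linarith
      then show "real (N - p') + 1 / 5 > ss \<and> real (N - p') + 1 / 5 > ee" "real (N - p') - 1 / 5 > ss \<and> real (N - p') - 1 / 5 > ee"
        using s e by linarith+
    qed
    show ?thesis
    proof (rule not_interleaved_outside)
      show "ss' < ss \<and> ss' < ee \<or> ss < ss' \<and> ee < ss'"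
      proof (cases "l' = 0")
        case True
        then have "ss' = 0" by (simp add: ss'_def)
        then show ?thesis using s e Np' by linarith
      next
        case nz: False
        show ?thesis
        proof (cases "l' \<le> r")
          case True
          then have "ss' = real (J + l') - 2 / 5" unfolding ss'_def using s_right[of l'] nz by simp
          then show ?thesis using nz by (intro right[of _ l']) simp
        next
          case False
          define p' where "p' = l' - r"
          have p': "1 \<le> p'" "l' = r + p'" "p' < p" using False l p by (simp_all add: p'_def)
          have "ss' = real (N - p') + 1 / 5" using s_left[of p'] l nz p'(1) unfolding ss'_def p'(2) by simp
          then show ?thesis using left(1)[OF p'(3)] by linarith
        qed
      qed
      show "ee' < ss \<and> ee' < ee \<or> ss < ee' \<and> ee < ee'"
      proof (cases "l' < r")
        case True
        have "ee' = real (J + l') + 2 / 5" unfolding ee'_def using e_right[OF True] .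
        then show ?thesis by (intro right[of _ l'] disjI1)
      next
        case False
        define p' where "p' = l' - r"
        have p': "l' = r + p'" "p' < p" using False l p by (simp_all add: p'_def)
        have "Suc (r + p') < ?m" using p' l p by linarith
        then have "ee' = real (N - p') - 1 / 5" using e_left[of p'] unfolding ee'_def p'(1) by blast
        then show ?thesis using left(2)[OF p'(2)] by linarith
      qed
    qed
  qed
  then show "not_interleaved ?s ?e ?s' ?e'" unfolding ss_def ee_def ss'_def ee'_def .
next
  fix l assume l: "1 \<le> l" "l \<le> r + (N - I)"
  show "(if l \<le> r then J + l - 1 else N - (l - r)) < N"
  proof (cases "l \<le> r")
    case True
    then show ?thesis using assms l by simp
  next
    case False
    then have "0 < l - r" "0 < N" using assms by simp_all
    then show ?thesis using False by simp
  qed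
  show "0 < (if l \<le> r then 2 / 5 else if l = r + (N - I) then 1 / 2 else 4 / 5 :: real)"
    "(if l \<le> r then 2 / 5 else if l = r + (N - I) then 1 / 2 else 4 / 5 :: real) < 1" by simp_all
next
  fix l assume l: "1 \<le> l" "l < r + (N - I)"
  consider "Suc l \<le> r" | "l = r" | "r < l" by linarith
  then show "(if l \<le> r then J + l - 1 else N - (l - r)) \<noteq> (if Suc l \<le> r then J + Suc l - 1 else N - (Suc l - r))"
  proof cases
    case 1
    then show ?thesis using l by simp
  next
    case 2
    have "J + r - 1 \<noteq> N - 1" using assms l 2 by linarith
    then show ?thesis using 2 by simp
  next
    case 3
    have "N - (l - r) \<noteq> N - (Suc l - r)" using 3 l by linarith
    then show ?thesis using 3 by simp
  qed
qed (use assms in simp_all)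


section \<open>Roots of norm two\<close>

definition sym_form :: "('v, 'e) pre_digraph \<Rightarrow> ('v \<Rightarrow> int) \<Rightarrow> ('v \<Rightarrow> int) \<Rightarrow> int" where
  "sym_form Q x y = (\<Sum>i\<in>verts Q. \<Sum>j\<in>verts Q. x i * cartan Q i j * y j)"

lemma cartan_sym: "cartan Q i j = cartan Q j i"
proof -
  have "{a \<in> arcs Q. tail Q a = i \<and> head Q a = j \<or> tail Q a = j \<and> head Q a = i}
      = {a \<in> arcs Q. tail Q a = j \<and> head Q a = i \<or> tail Q a = i \<and> head Q a = j}" by blast
  then show ?thesis by (simp add: cartan_def)
qed

lemma sym_form_sym: "sym_form Q x y = sym_form Q y x"
  unfolding sym_form_def
  by (subst sum.swap) (simp add: cartan_sym[of Q] mult.commute mult.left_commute)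

lemma sym_form_lin: "sym_form Q x (\<lambda>k. y k + c * z k) = sym_form Q x y + c * sym_form Q x z"
  unfolding sym_form_def by (simp add: sum.distrib sum_distrib_left algebra_simps)

lemma sym_form_lin': "sym_form Q (\<lambda>k. y k + c * z k) x = sym_form Q y x + c * sym_form Q z x"
  using sym_form_lin[of Q x y c z] by (simp add: sym_form_sym[of Q x])

lemma sym_form_scale: "sym_form Q x (\<lambda>k. c * z k) = c * sym_form Q x z"
  using sym_form_lin[of Q x "\<lambda>_. 0" c z] by (simp add: sym_form_def)

locale finite_quiver = fixes Q :: "('v, 'e) pre_digraph" assumes fin: "finite (verts Q)"
begin

lemma simple_root_row:
  assumes "i \<in> verts Q"
  shows "(\<Sum>j\<in>verts Q. x j * cartan Q i j) = sym_form Q (simple_root i) x"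
proof -
  have "sym_form Q (simple_root i) x = (\<Sum>k\<in>verts Q. if k = i then (\<Sum>j\<in>verts Q. x j * cartan Q i j) else 0)"
    unfolding sym_form_def simple_root_def by (intro sum.cong refl) (simp add: mult.commute)
  then show ?thesis using assms fin by simp
qed

lemma simple_reflection_eq:
  "i \<in> verts Q \<Longrightarrow> simple_reflection Q i x = (\<lambda>k. x k + (- sym_form Q (simple_root i) x) * simple_root i k)"
  unfolding simple_reflection_def by (simp add: simple_root_row)

lemma simple_root_norm: "i \<in> verts Q \<Longrightarrow> sym_form Q (simple_root i) (simple_root i) = 2"
proof -
  assume i: "i \<in> verts Q"
  have "(\<Sum>j\<in>verts Q. simple_root i j * cartan Q i j) = (\<Sum>j\<in>verts Q. if j = i then 2 else 0)"
    by (intro sum.cong refl) (simp add: simple_root_def cartan_def)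
  then show ?thesis using simple_root_row[OF i, of "simple_root i"] i fin by simp
qed

lemma simple_reflection_form:
  assumes "i \<in> verts Q"
  shows "sym_form Q (simple_reflection Q i x) (simple_reflection Q i y) = sym_form Q x y"
  unfolding simple_reflection_eq[OF assms] sym_form_lin sym_form_lin' simple_root_norm[OF assms]
  using sym_form_sym[of Q x "simple_root i"] by (simp add: algebra_simps)

lemma simple_reflection_involution:
  assumes "i \<in> verts Q"
  shows "simple_reflection Q i (simple_reflection Q i x) = x"
  unfolding simple_reflection_eq[OF assms] sym_form_lin simple_root_norm[OF assms]
  by (rule ext) (simp add: algebra_simps)

lemma simple_reflection_lin:
  assumes "i \<in> verts Q"
  shows "simple_reflection Q i (\<lambda>k. x k + c * y k) = (\<lambda>k. simple_reflection Q i x k + c * simple_reflection Q i y k)"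
  unfolding simple_reflection_eq[OF assms] sym_form_lin by (rule ext) (simp add: algebra_simps)

lemma simple_reflection_off: "k \<notin> verts Q \<Longrightarrow> i \<in> verts Q \<Longrightarrow> simple_reflection Q i x k = x k"
  by (auto simp: simple_reflection_def simple_root_def)

lemma word_elt_Nil [simp]: "word_elt Q [] = id" by (simp add: word_elt_def)

lemma word_elt_Cons [simp]: "word_elt Q (i # u) = simple_reflection Q i \<circ> word_elt Q u"
  by (simp add: word_elt_def)

lemma word_elt_append: "word_elt Q (u @ v) = word_elt Q u \<circ> word_elt Q v"
  by (induction u) (simp_all add: o_assoc)

lemma word_elt_lin:
  "set u \<subseteq> verts Q \<Longrightarrow> word_elt Q u (\<lambda>k. x k + c * y k) = (\<lambda>k. word_elt Q u x k + c * word_elt Q u y k)"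
  by (induction u) (simp_all add: simple_reflection_lin)

lemma word_elt_form: "set u \<subseteq> verts Q \<Longrightarrow> sym_form Q (word_elt Q u x) (word_elt Q u y) = sym_form Q x y"
  by (induction u) (simp_all add: simple_reflection_form)

lemma word_elt_off: "set u \<subseteq> verts Q \<Longrightarrow> k \<notin> verts Q \<Longrightarrow> word_elt Q u x k = x k"
  by (induction u) (simp_all add: simple_reflection_off)

lemma word_elt_rev: "set u \<subseteq> verts Q \<Longrightarrow> word_elt Q u (word_elt Q (rev u) x) = x"
  by (induction u arbitrary: x) (simp_all add: word_elt_append simple_reflection_involution)

lemma word_elt_inverse:
  assumes "set u \<subseteq> verts Q"
  shows "inv_into UNIV (word_elt Q u) = word_elt Q (rev u)"
proof (rule inv_unique_comp)
  show "word_elt Q u \<circ> word_elt Q (rev u) = id" using word_elt_rev[OF assms] by (simp add: fun_eq_iff)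
  show "word_elt Q (rev u) \<circ> word_elt Q u = id" using word_elt_rev[of "rev u"] assms by (simp add: fun_eq_iff)
qed

lemma weyl_groupE:
  assumes "w \<in> weyl_group Q" obtains u where "set u \<subseteq> verts Q" "w = word_elt Q u"
  using assms unfolding weyl_group_def by auto

text \<open>Words preserve the form, so the conjugate of a simple reflection is the reflection in
  the image of the simple root. In particular it depends on this image alone.\<close>

lemma conj_reflection_apply:
  assumes u: "set u \<subseteq> verts Q" and i: "i \<in> verts Q"
  shows "conj_reflection Q (word_elt Q u) i x
    = (\<lambda>k. x k + (- sym_form Q (word_elt Q u (simple_root i)) x) * word_elt Q u (simple_root i) k)"
proof -
  let ?w = "word_elt Q u"
  let ?y = "word_elt Q (rev u) x"
  have x: "?w ?y = x" by (rule word_elt_rev[OF u])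
  have "conj_reflection Q ?w i x = ?w (simple_reflection Q i ?y)"
    by (simp add: conj_reflection_def word_elt_inverse[OF u])
  also have "\<dots> = (\<lambda>k. ?w ?y k + (- sym_form Q (simple_root i) ?y) * ?w (simple_root i) k)"
    unfolding simple_reflection_eq[OF i] by (rule word_elt_lin[OF u])
  also have "sym_form Q (simple_root i) ?y = sym_form Q (?w (simple_root i)) (?w ?y)"
    by (simp add: word_elt_form[OF u])
  finally show ?thesis unfolding x .
qed

lemma palindrome_reflection:
  assumes "set u \<subseteq> verts Q"
  shows "word_elt Q (u @ [i] @ rev u) = conj_reflection Q (word_elt Q u) i"
  by (simp add: word_elt_append conj_reflection_def word_elt_inverse[OF assms] o_assoc)

lemma root_norm:
  "set u \<subseteq> verts Q \<Longrightarrow> i \<in> verts Q \<Longrightarrow> sym_form Q (word_elt Q u (simple_root i)) (word_elt Q u (simple_root i)) = 2"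
  by (simp add: word_elt_form simple_root_norm)

text \<open>Let \<open>b\<close> and \<open>b'\<close> be positive roots of the same reflection.
  Applying it to \<open>b\<close> gives \<open>2 b = c b'\<close> with \<open>c = (b', b)\<close>,
  and pairing with \<open>b\<close> gives \<open>c\<^sup>2 = 4\<close>. The value
  \<open>c = - 2\<close> would mean \<open>b = - b'\<close>, impossible for non-negative vectors of
  norm 2.\<close>

lemma root_of_reflection_eq:
  assumes u: "set u \<subseteq> verts Q" and i: "i \<in> verts Q" and b: "b = word_elt Q u (simple_root i)"
    and pos: "\<And>v. b v \<ge> 0"
  shows "root_of_reflection Q (conj_reflection Q (word_elt Q u) i) = b"
  unfolding root_of_reflection_def
proof (rule the_equality)
  show "(\<forall>v. 0 \<le> b v) \<and> (\<exists>w\<in>weyl_group Q. \<exists>ia\<in>verts Q. b = w (simple_root ia) \<and>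
      conj_reflection Q (word_elt Q u) i = conj_reflection Q w ia)"
    using pos u i b unfolding weyl_group_def by blast
next
  fix b' assume b': "(\<forall>v. 0 \<le> b' v) \<and> (\<exists>w\<in>weyl_group Q. \<exists>ia\<in>verts Q. b' = w (simple_root ia) \<and>
      conj_reflection Q (word_elt Q u) i = conj_reflection Q w ia)"
  then obtain w j where w: "w \<in> weyl_group Q" "j \<in> verts Q" "b' = w (simple_root j)"
      "conj_reflection Q (word_elt Q u) i = conj_reflection Q w j" by blast
  obtain u' where u': "set u' \<subseteq> verts Q" "w = word_elt Q u'" using w(1) by (rule weyl_groupE)
  have nb: "sym_form Q b b = 2" unfolding b by (rule root_norm[OF u i])
  have nb': "sym_form Q b' b' = 2" unfolding w(3) u'(2) by (rule root_norm[OF u'(1) w(2)])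
  define c where "c = sym_form Q b' b"
  have "(\<lambda>k. b k + (- sym_form Q b b) * b k) = (\<lambda>k. b k + (- c) * b' k)"
    using fun_cong[OF w(4), of b] unfolding u'(2) conj_reflection_apply[OF u i] conj_reflection_apply[OF u'(1) w(2)]
    by (simp only: b[symmetric] w(3)[unfolded u'(2), symmetric] c_def)
  then have eq: "2 * b k = c * b' k" for k using nb by (metis (no_types, lifting) add_left_cancel minus_mult_left neg_equal_iff_equal)
  have "(\<lambda>k. 2 * b k) = (\<lambda>k. c * b' k)" using eq by (rule ext)
  then have "sym_form Q b' (\<lambda>k. 2 * b k) = sym_form Q b' (\<lambda>k. c * b' k)" by (rule arg_cong)
  then have "2 * c = c * 2" unfolding sym_form_scale nb' c_def .
  have "(\<lambda>k. 2 * b k) = (\<lambda>k. c * b' k)" using eq by (rule ext)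
  then have "sym_form Q b (\<lambda>k. 2 * b k) = sym_form Q b (\<lambda>k. c * b' k)" by (rule arg_cong)
  then have "4 = c * c" unfolding sym_form_scale nb using sym_form_sym[of Q b b'] by (simp add: c_def)
  then have "(c - 2) * (c + 2) = 0" by (simp add: algebra_simps)
  then consider "c = 2" | "c = - 2" by fastforce
  then show "b' = b"
  proof cases
    case 1
    then show ?thesis using eq by (auto simp: fun_eq_iff)
  next
    case 2
    have "b k = 0" for k
    proof -
      have "b k = - b' k" using eq[of k] 2 by simp
      moreover have "0 \<le> b' k" using b' by blast
      ultimately show ?thesis using pos[of k] by linarith
    qed
    then have "sym_form Q b b = 0" by (simp add: sym_form_def)
    then show ?thesis using nb by simp
  qed
qed

text \<open>The hypothesis \<open>sign\<close> says that vectors of norm 2 have coefficients of one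
  sign. With it, the definite description in \<open>root_of_reflection\<close> picks out a root for
  every reflection.\<close>

lemma root_of_reflection_norm:
  assumes sign: "\<And>x. sym_form Q x x = 2 \<Longrightarrow> (\<And>k. k \<notin> verts Q \<Longrightarrow> x k = 0) \<Longrightarrow> (\<forall>k. 0 \<le> x k) \<or> (\<forall>k. x k \<le> 0)"
    and t: "t \<in> reflections Q"
  shows "(\<forall>k. 0 \<le> root_of_reflection Q t k) \<and> (\<forall>k. k \<notin> verts Q \<longrightarrow> root_of_reflection Q t k = 0)
    \<and> sym_form Q (root_of_reflection Q t) (root_of_reflection Q t) = 2"
proof -
  obtain w i where w: "w \<in> weyl_group Q" "i \<in> verts Q" "t = conj_reflection Q w i"
    using t unfolding reflections_def by blast
  obtain u where u: "set u \<subseteq> verts Q" "w = word_elt Q u" using w(1) by (rule weyl_groupE)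
  let ?b = "\<lambda>u. word_elt Q u (simple_root i)"
  have off: "?b u k = 0" if "set u \<subseteq> verts Q" "k \<notin> verts Q" for u k
    using word_elt_off[OF that, of "simple_root i"] that(2) w(2) by (auto simp: simple_root_def)
  note norm = root_norm[OF u(1) w(2)]
  consider "\<forall>k. 0 \<le> ?b u k" | "\<forall>k. ?b u k \<le> 0" using sign[OF norm off[OF u(1)]] by blast
  then show ?thesis
  proof cases
    case 1
    have "root_of_reflection Q t = ?b u"
      unfolding w(3) u(2) by (rule root_of_reflection_eq[OF u(1) w(2) refl]) (use 1 in blast)
    then show ?thesis using 1 off[OF u(1)] norm by simp
  next
    case 2
    \<comment> \<open>Appending \<open>i\<close> negates the root and leaves the reflection
      unchanged.\<close>
    let ?u = "u @ [i]"
    have u': "set ?u \<subseteq> verts Q" using u(1) w(2) by simp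
    have "simple_reflection Q i (simple_root i) = (\<lambda>k. 0 + (- 1) * simple_root i k)"
      unfolding simple_reflection_eq[OF w(2)] simple_root_norm[OF w(2)] by (rule ext) simp
    then have b': "?b ?u = (\<lambda>k. word_elt Q u (\<lambda>_. 0) k + (- 1) * ?b u k)"
      by (simp only: word_elt_append word_elt_Cons word_elt_Nil o_apply id_apply comp_id word_elt_lin[OF u(1)])
    have "word_elt Q u (\<lambda>_. 0) = (\<lambda>k. 0 :: int)"
      using u(1) by (induction u) (simp_all add: simple_reflection_def)
    then have neg: "?b ?u = (\<lambda>k. - ?b u k)" using b' by simp
    have "t = conj_reflection Q (word_elt Q ?u) i"
    proof
      fix x
      have "sym_form Q (\<lambda>k. - ?b u k) x = - sym_form Q (?b u) x"
        unfolding sym_form_def by (simp add: sum_negf)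
      then show "t x = conj_reflection Q (word_elt Q ?u) i x"
        unfolding w(3) u(2) conj_reflection_apply[OF u(1) w(2)] conj_reflection_apply[OF u' w(2)] neg by simp
    qed
    then have "root_of_reflection Q t = ?b ?u"
      using root_of_reflection_eq[OF u' w(2) refl] 2 neg by simp
    then show ?thesis using 2 off[OF u(1)] root_norm[OF u' w(2)] neg by simp
  qed
qed

end


section \<open>The roots of type D\<close>

lemma D_verts [simp]: "verts (D_quiver n) = {1..n}" by (simp add: D_quiver_def)

lemma D_tail_head [simp]: "tail (D_quiver n) a = fst a" "head (D_quiver n) a = snd a"
  by (simp_all add: D_quiver_def)

lemma D_arcs_iff:
  "(i, j) \<in> arcs (D_quiver n) \<longleftrightarrow> (1 \<le> i \<and> j = i + 1 \<and> i + 1 \<le> n - 2) \<or> (i = n - 2 \<and> (j = n - 1 \<or> j = n))"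
  by (auto simp: D_quiver_def)

interpretation D: finite_quiver "D_quiver n" for n by standard simp

lemma D_cartan:
  assumes "n \<ge> 4"
  shows "cartan (D_quiver n) i j
    = (if i = j then 2 else if (i, j) \<in> arcs (D_quiver n) \<or> (j, i) \<in> arcs (D_quiver n) then - 1 else 0)"
proof (cases "i = j")
  case False
  let ?S = "{a \<in> arcs (D_quiver n). tail (D_quiver n) a = i \<and> head (D_quiver n) a = j
      \<or> tail (D_quiver n) a = j \<and> head (D_quiver n) a = i}"
  have S: "?S = {(i, j), (j, i)} \<inter> arcs (D_quiver n)" by auto
  have "\<not> ((i, j) \<in> arcs (D_quiver n) \<and> (j, i) \<in> arcs (D_quiver n))"
    using assms by (auto simp: D_arcs_iff)
  then consider "(i, j) \<in> arcs (D_quiver n)" "?S = {(i, j)}" | "(j, i) \<in> arcs (D_quiver n)" "?S = {(j, i)}"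
    | "(i, j) \<notin> arcs (D_quiver n)" "(j, i) \<notin> arcs (D_quiver n)" "?S = {}"
    unfolding S by blast
  moreover have c: "cartan (D_quiver n) i j = - int (card ?S)" using False by (simp only: cartan_def if_False)
  ultimately show ?thesis
  proof cases
    case 1
    show ?thesis unfolding c 1(2) using 1(1) False by simp
  next
    case 2
    show ?thesis unfolding c 2(2) using 2(1) False by simp
  next
    case 3
    show ?thesis unfolding c 3(3) using 3(1,2) False by simp
  qed
qed (simp add: cartan_def)

text \<open>The sum of the coefficients at the neighbours of \<open>i\<close>. For
  \<open>i = 1\<close> it includes \<open>x 0\<close>, the coefficient at a vertex that does not
  exist; this is the reason for the assumption \<open>x 0 = 0\<close> in the lemmas below.\<close>

definition D_nb :: "nat \<Rightarrow> (nat \<Rightarrow> int) \<Rightarrow> nat \<Rightarrow> int" where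
  "D_nb n x i = (if i \<le> n - 3 then x (i - 1) + x (i + 1)
     else if i = n - 2 then x (n - 3) + x (n - 1) + x n else x (n - 2))"

lemma D_row:
  assumes n: "n \<ge> 4" and i: "i \<in> {1..n}" and x0: "x 0 = 0"
  shows "(\<Sum>j\<in>{1..n}. x j * cartan (D_quiver n) i j) = 2 * x i - D_nb n x i"
proof -
  let ?A = "{j \<in> {1..n}. (i, j) \<in> arcs (D_quiver n) \<or> (j, i) \<in> arcs (D_quiver n)}"
  have ne: "i \<notin> ?A" using n by (auto simp: D_arcs_iff)
  have "x j * cartan (D_quiver n) i j = (if j = i then 2 * x i else 0) - (if j \<in> ?A then x j else 0)"
    if "j \<in> {1..n}" for j
    using that ne unfolding D_cartan[OF n] by auto
  then have "(\<Sum>j\<in>{1..n}. x j * cartan (D_quiver n) i j)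
     = (\<Sum>j\<in>{1..n}. (if j = i then 2 * x i else 0) - (if j \<in> ?A then x j else 0))" by (rule sum.cong[OF refl])
  also have "\<dots> = 2 * x i - (\<Sum>j\<in>{1..n}. if j \<in> ?A then x j else 0)"
    using i by (simp add: sum_subtractf)
  also have "(\<Sum>j\<in>{1..n}. if j \<in> ?A then x j else 0) = (\<Sum>j\<in>{1..n} \<inter> ?A. x j)"
    by (rule sum.inter_restrict[symmetric]) simp
  also have "{1..n} \<inter> ?A = ?A" by blast
  also have "(\<Sum>j\<in>?A. x j) = D_nb n x i"
  proof -
    have i': "1 \<le> i" "i \<le> n" using i by simp_all
    consider "i = 1" | "2 \<le> i" "i \<le> n - 3" | "i = n - 2" | "i = n - 1" | "i = n"
      using i n unfolding atLeastAtMost_iff by linarith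
    then show ?thesis
    proof cases
      case 1
      have "?A = {2}"
      proof (rule Set.set_eqI)
        fix j
        show "j \<in> ?A \<longleftrightarrow> j \<in> {2}"
          unfolding mem_Collect_eq D_arcs_iff insert_iff empty_iff atLeastAtMost_iff
          using 1 n i' by presburger
      qed
      then show ?thesis using 1 n x0 by (simp add: D_nb_def numeral_2_eq_2)
    next
      case 2
      have "?A = {i - 1, i + 1}"
      proof (rule Set.set_eqI)
        fix j
        have f: "i + 1 \<le> n - 2" "i \<noteq> n - 2" "i \<noteq> n - 1" "i \<noteq> n" using 2 n by linarith+
        have g1: "i = j + 1 \<longleftrightarrow> j = i - 1" using 2 by linarith
        have g2: "j + 1 \<le> n - 2" if "j = i - 1" using f that by linarith
        have g3: "1 \<le> j \<and> j \<le> n" if "j = i - 1 \<or> j = i + 1" using that 2 n by linarith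
        show "j \<in> ?A \<longleftrightarrow> j \<in> {i - 1, i + 1}"
          unfolding mem_Collect_eq D_arcs_iff insert_iff empty_iff atLeastAtMost_iff
          using f g1 g2 g3 i' by blast
      qed
      then show ?thesis using 2 by (simp add: D_nb_def)
    next
      case 3
      have "?A = {n - 3, n - 1, n}"
      proof (rule Set.set_eqI)
        fix j
        show "j \<in> ?A \<longleftrightarrow> j \<in> {n - 3, n - 1, n}"
          unfolding mem_Collect_eq D_arcs_iff insert_iff empty_iff atLeastAtMost_iff
          using 3 n i' by presburger
      qed
      moreover have "n - 3 \<noteq> n - 1" "n - 3 \<noteq> n" "n - 1 \<noteq> n" "\<not> n - 2 \<le> n - 3" using n by linarith+
      ultimately show ?thesis using 3 by (simp add: D_nb_def)
    next
      case 4
      have "?A = {n - 2}"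
      proof (rule Set.set_eqI)
        fix j
        show "j \<in> ?A \<longleftrightarrow> j \<in> {n - 2}"
          unfolding mem_Collect_eq D_arcs_iff insert_iff empty_iff atLeastAtMost_iff
          using 4 n i' by presburger
      qed
      moreover have "n - 1 \<noteq> n - 2" "\<not> n - 1 \<le> n - 3" using n by linarith+
      ultimately show ?thesis using 4 by (simp add: D_nb_def)
    next
      case 5
      have "?A = {n - 2}"
      proof (rule Set.set_eqI)
        fix j
        show "j \<in> ?A \<longleftrightarrow> j \<in> {n - 2}"
          unfolding mem_Collect_eq D_arcs_iff insert_iff empty_iff atLeastAtMost_iff
          using 5 n i' by presburger
      qed
      moreover have "n \<noteq> n - 2" "\<not> n \<le> n - 3" using n by linarith+
      ultimately show ?thesis using 5 by (simp add: D_nb_def)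
    qed
  qed
  finally show ?thesis .
qed

lemma D_simple_reflection:
  assumes "n \<ge> 4" "i \<in> {1..n}" "x 0 = 0"
  shows "simple_reflection (D_quiver n) i x = x(i := D_nb n x i - x i)"
proof
  fix k
  have "(\<Sum>j\<in>verts (D_quiver n). x j * cartan (D_quiver n) i j) = 2 * x i - D_nb n x i"
    using D_row[of n i x, OF assms] by simp
  then show "simple_reflection (D_quiver n) i x k = (x(i := D_nb n x i - x i)) k"
    by (simp add: simple_reflection_def simple_root_def)
qed

definition D_coord :: "nat \<Rightarrow> (nat \<Rightarrow> int) \<Rightarrow> nat \<Rightarrow> int" where
  "D_coord n x k = (if k \<le> n - 2 then x k - x (k - 1)
     else if k = n - 1 then x (n - 1) + x n - x (n - 2) else x n - x (n - 1))"

text \<open>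
  In the coordinates with \<open>\<alpha>\<^sub>i = \<epsilon>\<^sub>i - \<epsilon>\<^sub>i\<^sub>+\<^sub>1\<close> for \<open>i < n\<close> and \<open>\<alpha>\<^sub>n = \<epsilon>\<^sub>n\<^sub>-\<^sub>1 + \<epsilon>\<^sub>n\<close> the form is the standard one.
\<close>

lemma D_form_coord:
  assumes n: "n \<ge> 4" and x0: "x 0 = 0"
  shows "sym_form (D_quiver n) x x = (\<Sum>k\<in>{1..n}. (D_coord n x k)\<^sup>2)"
proof -
  define M where "M = n - 2"
  have M: "n = Suc (Suc M)" "2 \<le> M" using n by (simp_all add: M_def)
  have split: "(\<Sum>k\<in>{1..n}. f k) = (\<Sum>k\<in>{1..M}. f k) + f (Suc M) + f (Suc (Suc M))" for f :: "nat \<Rightarrow> int"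
    using M by simp
  have split': "(\<Sum>k\<in>{1..M}. f k) = (\<Sum>k\<in>{1..M - 1}. f k) + f M" for f :: "nat \<Rightarrow> int"
    using M by (cases M) simp_all
  have "sym_form (D_quiver n) x x = (\<Sum>i\<in>{1..n}. x i * (2 * x i - D_nb n x i))"
    unfolding sym_form_def D_verts
  proof (rule sum.cong[OF refl])
    fix i assume "i \<in> {1..n}"
    from D_row[of n i x, OF n this x0] show "(\<Sum>j = 1..n. x i * cartan (D_quiver n) i j * x j) = x i * (2 * x i - D_nb n x i)"
      unfolding mult.assoc sum_distrib_left[symmetric] by (simp only: mult.commute)
  qed
  also have "\<dots> = (\<Sum>i\<in>{1..M - 1}. x i * (2 * x i - (x (i - 1) + x (i + 1))))
      + x M * (2 * x M - (x (M - 1) + x (Suc M) + x (Suc (Suc M))))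
      + x (Suc M) * (2 * x (Suc M) - x M) + x (Suc (Suc M)) * (2 * x (Suc (Suc M)) - x M)"
  proof -
    have "(\<Sum>i\<in>{1..M - 1}. x i * (2 * x i - D_nb n x i)) = (\<Sum>i\<in>{1..M - 1}. x i * (2 * x i - (x (i - 1) + x (i + 1))))"
      using M by (intro sum.cong refl) (auto simp: D_nb_def)
    moreover have "D_nb n x M = x (M - 1) + x (Suc M) + x (Suc (Suc M))"
      "D_nb n x (Suc M) = x M" "D_nb n x (Suc (Suc M)) = x M"
    proof -
      have "\<not> M \<le> n - 3" "M = n - 2" "n - 3 = M - 1" "n - 1 = Suc M" using M by linarith+
      then have "D_nb n x M = x (n - 3) + x (n - 1) + x n" "x (n - 3) = x (M - 1)" "x (n - 1) = x (Suc M)"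
        by (simp_all only: D_nb_def if_False if_True simp_thms)
      moreover have "x n = x (Suc (Suc M))" unfolding M(1) ..
      ultimately show "D_nb n x M = x (M - 1) + x (Suc M) + x (Suc (Suc M))" by linarith
      have "\<not> Suc M \<le> n - 3" "Suc M \<noteq> n - 2" "n - 2 = M" using M by linarith+
      then show "D_nb n x (Suc M) = x M" unfolding D_nb_def by (simp only: if_False)
      have "\<not> Suc (Suc M) \<le> n - 3" "Suc (Suc M) \<noteq> n - 2" "n - 2 = M" using M by linarith+
      then show "D_nb n x (Suc (Suc M)) = x M" unfolding D_nb_def by (simp only: if_False)
    qed
    ultimately show ?thesis unfolding split split' by simp
  qed
  also have "(\<Sum>i\<in>{1..M - 1}. x i * (2 * x i - (x (i - 1) + x (i + 1))))
      = (\<Sum>i\<in>{1..M}. (x i - x (i - 1))\<^sup>2) - (x M)\<^sup>2 + x M * x (M - 1)"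
  proof -
    \<comment> \<open>Squares are completed along the chain from its outer end: each vertex turns
      its term into a square and passes a correction on to the next.\<close>
    have "(\<Sum>i\<in>{1..m}. x i * (2 * x i - (x (i - 1) + x (i + 1))))
      = (\<Sum>i\<in>{1..Suc m}. (x i - x (i - 1))\<^sup>2) - (x (Suc m))\<^sup>2 + x (Suc m) * x m" for m
      by (induction m) (simp_all add: x0 power2_eq_square algebra_simps)
    from this[of "M - 1"] show ?thesis using M by simp
  qed
  also have "(\<Sum>i\<in>{1..M}. (x i - x (i - 1))\<^sup>2) - (x M)\<^sup>2 + x M * x (M - 1)
      + x M * (2 * x M - (x (M - 1) + x (Suc M) + x (Suc (Suc M))))
      + x (Suc M) * (2 * x (Suc M) - x M) + x (Suc (Suc M)) * (2 * x (Suc (Suc M)) - x M)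
    = (\<Sum>i\<in>{1..M}. (x i - x (i - 1))\<^sup>2) + (x (Suc M) + x (Suc (Suc M)) - x M)\<^sup>2 + (x (Suc (Suc M)) - x (Suc M))\<^sup>2"
    by (simp add: power2_eq_square algebra_simps)
  also have "\<dots> = (\<Sum>k\<in>{1..n}. (D_coord n x k)\<^sup>2)"
  proof -
    have "(\<Sum>k\<in>{1..M}. (D_coord n x k)\<^sup>2) = (\<Sum>i\<in>{1..M}. (x i - x (i - 1))\<^sup>2)"
      using M by (intro sum.cong refl) (simp add: D_coord_def)
    moreover have "D_coord n x (Suc M) = x (Suc M) + x (Suc (Suc M)) - x M"
      "D_coord n x (Suc (Suc M)) = x (Suc (Suc M)) - x (Suc M)"
      using M by (simp_all add: D_coord_def)
    ultimately show ?thesis unfolding split by simp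
  qed
  finally show ?thesis .
qed

text \<open>Twice the Tits form of the quiver. Norm 2 thus means that the sum of the squares exceeds
  the sum of the products along the arrows by one, the same count that decides whether a brick is
  rigid.\<close>

lemma D_form_euler:
  assumes n: "n \<ge> 4"
  shows "sym_form (D_quiver n) x x = 2 * ((\<Sum>i\<in>{1..n}. (x i)\<^sup>2) - (\<Sum>(i, j)\<in>arcs (D_quiver n). x i * x j))"
proof -
  let ?A = "arcs (D_quiver n)"
  have sub: "?A \<subseteq> {1..n} \<times> {1..n}" using n by (auto simp: D_quiver_def)
  have nb: "\<not> ((i, j) \<in> ?A \<and> (j, i) \<in> ?A)" "(i, i) \<notin> ?A" for i j using n by (auto simp: D_arcs_iff)
  have c: "x i * cartan (D_quiver n) i j * x j = (if i = j then 2 * (x i)\<^sup>2 else 0)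
      - (if (i, j) \<in> ?A then x i * x j else 0) - (if (j, i) \<in> ?A then x j * x i else 0)" for i j
    unfolding D_cartan[OF n] using nb(1)[of i j] nb(2)[of i] by (auto simp: power2_eq_square)
  have s: "(\<Sum>i\<in>{1..n}. \<Sum>j\<in>{1..n}. if (i, j) \<in> ?A then x i * x j else 0) = (\<Sum>(i, j)\<in>?A. x i * x j)"
  proof -
    have "(\<Sum>i\<in>{1..n}. \<Sum>j\<in>{1..n}. if (i, j) \<in> ?A then x i * x j else 0)
        = (\<Sum>p\<in>{1..n} \<times> {1..n}. if p \<in> ?A then x (fst p) * x (snd p) else 0)"
      by (simp add: sum.cartesian_product case_prod_beta)
    also have "\<dots> = (\<Sum>p\<in>{1..n} \<times> {1..n} \<inter> ?A. x (fst p) * x (snd p))"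
      by (rule sum.inter_restrict[symmetric]) simp
    also have "{1..n} \<times> {1..n} \<inter> ?A = ?A" using sub by blast
    finally show ?thesis by (simp add: case_prod_beta)
  qed
  have s': "(\<Sum>i\<in>{1..n}. \<Sum>j\<in>{1..n}. if (j, i) \<in> ?A then x j * x i else 0) = (\<Sum>(i, j)\<in>?A. x i * x j)"
    by (subst sum.swap) (rule s)
  have d: "(\<Sum>i\<in>{1..n}. \<Sum>j\<in>{1..n}. if i = j then 2 * (x i)\<^sup>2 else 0) = 2 * (\<Sum>i\<in>{1..n}. (x i)\<^sup>2)"
    by (simp add: sum_distrib_left)
  have "2 * a - b - b = 2 * (a - b)" for a b :: int by simp
  then show ?thesis unfolding sym_form_def D_verts c sum_subtractf s s' d by (simp only:)
qed

section \<open>The vectors of norm two\<close>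

definition rootA :: "nat \<Rightarrow> nat \<Rightarrow> nat \<Rightarrow> int" where
  "rootA i j = (\<lambda>k. if i \<le> k \<and> k \<le> j then 1 else 0)"

definition rootB :: "nat \<Rightarrow> nat \<Rightarrow> nat \<Rightarrow> int" where
  "rootB n i = (\<lambda>k. if i \<le> k \<and> k \<le> n - 2 \<or> k = n then 1 else 0)"

definition rootD :: "nat \<Rightarrow> nat \<Rightarrow> nat \<Rightarrow> nat \<Rightarrow> int" where
  "rootD n i j = (\<lambda>k. if i \<le> k \<and> k \<le> n then (if j \<le> k \<and> k \<le> n - 2 then 2 else 1) else 0)"

text \<open>In the orthonormal coordinates, \<open>rootA i j\<close> is
  \<open>e_i - e_(j+1)\<close>, \<open>rootB n i\<close> is \<open>e_i + e_n\<close> and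
  \<open>rootD n i j\<close> is \<open>e_i + e_j\<close>. Together these are the positive roots of
  D_n.\<close>

definition D_roots :: "nat \<Rightarrow> (nat \<Rightarrow> int) set" where
  "D_roots n = {rootA i j | i j. 1 \<le> i \<and> i \<le> j \<and> j \<le> n - 1} \<union> {rootB n i | i. 1 \<le> i \<and> i \<le> n - 1}
     \<union> {rootD n i j | i j. 1 \<le> i \<and> i < j \<and> j \<le> n - 1}"

lemma D_roots_mem:
  "1 \<le> i \<Longrightarrow> i \<le> j \<Longrightarrow> j \<le> n - 1 \<Longrightarrow> rootA i j \<in> D_roots n"
  "1 \<le> i \<Longrightarrow> i \<le> n - 1 \<Longrightarrow> rootB n i \<in> D_roots n"
  "1 \<le> i \<Longrightarrow> i < j \<Longrightarrow> j \<le> n - 1 \<Longrightarrow> rootD n i j \<in> D_roots n"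
  unfolding D_roots_def by blast+

text \<open>Three non-zero integer squares exceed the sum 2, and a single one is impossible because
  2 is not a square.\<close>

lemma two_units:
  fixes y :: "nat \<Rightarrow> int"
  assumes "(\<Sum>k\<in>{1..n}. (y k)\<^sup>2) = 2"
  obtains a b where "1 \<le> a" "a < b" "b \<le> n" "\<bar>y a\<bar> = 1" "\<bar>y b\<bar> = 1"
    "\<And>k. 1 \<le> k \<Longrightarrow> k \<le> n \<Longrightarrow> k \<noteq> a \<Longrightarrow> k \<noteq> b \<Longrightarrow> y k = 0"
proof -
  let ?S = "{k \<in> {1..n}. y k \<noteq> 0}"
  have sum: "(\<Sum>k\<in>?S. (y k)\<^sup>2) = 2"
    unfolding assms[symmetric] by (rule sum.mono_neutral_left) auto
  have ge1: "1 \<le> (y k)\<^sup>2" if "k \<in> ?S" for k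
    using that by (simp add: int_one_le_iff_zero_less)
  have "(\<Sum>k\<in>?S. 1) \<le> (\<Sum>k\<in>?S. (y k)\<^sup>2)" by (rule sum_mono) (rule ge1)
  then have "int (card ?S) \<le> 2" using sum by simp
  then consider "card ?S = 0" | "card ?S = 1" | "card ?S = 2" by linarith
  then show ?thesis
  proof cases
    case 1
    then have "?S = {}" by simp
    then show ?thesis using sum by (simp only: sum.empty)
  next
    case 2
    then obtain a where "?S = {a}" by (rule card_1_singletonE)
    then have "(y a)\<^sup>2 = 2" using sum by (simp only: sum.insert_remove) simp
    moreover define z where "z = \<bar>y a\<bar>"
    ultimately have z: "z * z = 2" "0 \<le> z" by (simp_all add: power2_eq_square)
    have "z = 0 \<or> z = 1 \<or> 2 * 2 \<le> z * z" using z(2) mult_mono[of 2 z 2 z] by linarith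
    then show ?thesis using z(1) by auto
  next
    case 3
    then obtain a' b' where ab': "?S = {a', b'}" "a' \<noteq> b'" unfolding card_2_iff by blast
    obtain a b where ab: "?S = {a, b}" "a < b"
    proof (cases "a' < b'")
      case True then show ?thesis using that ab' by blast
    next
      case False
      then have "b' < a'" using ab'(2) by simp
      moreover have "?S = {b', a'}" using ab'(1) by (simp only: insert_commute)
      ultimately show ?thesis using that by blast
    qed
    have "(y a)\<^sup>2 + (y b)\<^sup>2 = 2" using sum ab(2) unfolding ab(1) by simp
    moreover have "a \<in> ?S" "b \<in> ?S" unfolding ab(1) by simp_all
    ultimately have "(y a)\<^sup>2 = 1" "(y b)\<^sup>2 = 1" using ge1[of a] ge1[of b] by linarith+
    then have "\<bar>y a\<bar> = 1" "\<bar>y b\<bar> = 1" by (auto simp: power2_eq_1_iff)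
    moreover have "y k = 0" if "1 \<le> k" "k \<le> n" "k \<noteq> a" "k \<noteq> b" for k
    proof -
      have "k \<notin> ?S" unfolding ab(1) using that by simp
      then show ?thesis using that by simp
    qed
    moreover have "1 \<le> a" "b \<le> n" using \<open>a \<in> ?S\<close> \<open>b \<in> ?S\<close> by simp_all
    ultimately show ?thesis using that[of a b] ab(2) by blast
  qed
qed

text \<open>Inverts the change of coordinates. Up to \<open>n - 2\<close> the coefficient
  \<open>x k\<close> is a partial sum of the coordinates; the last two coefficients are determined
  by their sum and their difference. The coordinate at \<open>a\<close> is normalised to 1, and
  \<open>e\<close> is the sign at \<open>b\<close>.\<close>

lemma D_root_of_coords:
  assumes n: "n \<ge> 4" and off: "\<And>k. k \<notin> {1..n} \<Longrightarrow> x k = 0"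
    and ab: "1 \<le> a" "a < b" "b \<le> n" and ya: "D_coord n x a = 1" and yb: "\<bar>D_coord n x b\<bar> = 1"
    and yk: "\<And>k. 1 \<le> k \<Longrightarrow> k \<le> n \<Longrightarrow> k \<noteq> a \<Longrightarrow> k \<noteq> b \<Longrightarrow> D_coord n x k = 0"
  shows "x \<in> D_roots n"
proof -
  define e where "e = D_coord n x b"
  have e: "e = 1 \<or> e = - 1" using yb unfolding e_def by linarith
  have x0: "x 0 = 0" using off by simp
  have y: "D_coord n x k = (if k = a then 1 else 0) + (if k = b then e else 0)" if "1 \<le> k" "k \<le> n" for k
    using that yk[of k] ya ab by (auto simp: e_def)
  have xk: "x k = (if a \<le> k then 1 else 0) + (if b \<le> k then e else 0)" if "k \<le> n - 2" for k
    using that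
  proof (induction k)
    case 0
    then show ?case using ab x0 by simp
  next
    case (Suc k)
    have "D_coord n x (Suc k) = x (Suc k) - x k" using Suc.prems by (simp add: D_coord_def)
    then have "x (Suc k) = x k + D_coord n x (Suc k)" by simp
    also have "\<dots> = (if a \<le> Suc k then 1 else 0) + (if b \<le> Suc k then e else 0)"
    proof -
      have "D_coord n x (Suc k) = (if Suc k = a then 1 else 0) + (if Suc k = b then e else 0)"
        by (rule y) (use Suc.prems in linarith)+
      moreover have "x k = (if a \<le> k then 1 else 0) + (if b \<le> k then e else 0)" using Suc by simp
      ultimately show ?thesis by (auto simp: le_Suc_eq)
    qed
    finally show ?case .
  qed
  have n1: "x (n - 1) + x n = x (n - 2) + D_coord n x (n - 1)" "x n - x (n - 1) = D_coord n x n"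
  proof -
    have "\<not> n - 1 \<le> n - 2" "\<not> n \<le> n - 2" "n \<noteq> n - 1" using n by linarith+
    then show "x (n - 1) + x n = x (n - 2) + D_coord n x (n - 1)" "x n - x (n - 1) = D_coord n x n"
      by (simp_all only: D_coord_def if_False if_True simp_thms)
  qed
  have lo: "x k = (if a \<le> k then 1 else 0) + (if b \<le> k then e else 0)" if "k < n - 1" for k using xk that by simp
  have hi: "x k = 0" if "k > n" for k using off that by simp
  have ext: "x = f" if "\<And>k. k < n - 1 \<Longrightarrow> x k = f k" "x (n - 1) = f (n - 1)" "x n = f n" "\<And>k. k > n \<Longrightarrow> f k = 0" for f
  proof
    fix k
    consider "k < n - 1" | "k = n - 1" | "k = n" | "k > n" by linarith
    then show "x k = f k" by cases (use that hi in simp_all)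
  qed
  consider "b \<le> n - 2" | "b = n - 1" | "b = n" using ab by linarith
  then show ?thesis
  proof cases
    case 1
    have y': "D_coord n x (n - 1) = 0" "D_coord n x n = 0" using 1 ab n by (auto intro!: yk)
    have x2: "x (n - 2) = 1 + e" using xk[of "n - 2"] 1 ab by simp
    have t: "2 * x n = 1 + e" "x (n - 1) = x n" using n1 y' x2 by linarith+
    from e show ?thesis
    proof
      assume "e = 1"
      then have x: "x = rootD n a b"
        using t 1 ab n lo by (intro ext) (auto simp: rootD_def)
      show ?thesis unfolding x using ab n \<open>b \<le> n - 2\<close> by (intro D_roots_mem) linarith+
    next
      assume "e = - 1"
      then have x: "x = rootA a (b - 1)"
        using t 1 ab n lo by (intro ext) (auto simp: rootA_def)
      show ?thesis unfolding x using ab n \<open>b \<le> n - 2\<close> by (intro D_roots_mem) linarith+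
    qed
  next
    case 2
    have y': "D_coord n x (n - 1) = e" "D_coord n x n = 0" using 2 ab n by (auto simp: y)
    have x2: "x (n - 2) = 1" 
    proof -
      have "a \<le> n - 2" "\<not> b \<le> n - 2" using 2 ab n by linarith+
      then show ?thesis using xk[of "n - 2"] by simp
    qed
    have t: "2 * x n = 1 + e" "x (n - 1) = x n" using n1 y' x2 by linarith+
    from e show ?thesis
    proof
      assume "e = 1"
      then have x: "x = rootD n a (n - 1)"
        using t 2 ab n lo by (intro ext) (auto simp: rootD_def)
      show ?thesis unfolding x using ab n \<open>b = n - 1\<close> by (intro D_roots_mem) linarith+
    next
      assume "e = - 1"
      then have x: "x = rootA a (n - 2)"
        using t 2 ab n lo by (intro ext) (auto simp: rootA_def)
      show ?thesis unfolding x using ab n \<open>b = n - 1\<close> by (intro D_roots_mem) linarith+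
    qed
  next
    case 3
    have y': "D_coord n x (n - 1) = (if a = n - 1 then 1 else 0)" "D_coord n x n = e" using 3 ab n by (auto simp: y)
    have x2: "x (n - 2) = (if a = n - 1 then 0 else 1)" using xk[of "n - 2"] 3 ab n by auto
    have t: "x (n - 1) + x n = 1" "x n - x (n - 1) = e" using n1 y' x2 by auto
    from e show ?thesis
    proof
      assume "e = 1"
      then have "x n = 1" "x (n - 1) = 0" using t by linarith+
      then have x: "x = rootB n a"
        using 3 ab n lo by (intro ext) (auto simp: rootB_def)
      show ?thesis unfolding x using ab n \<open>b = n\<close> by (intro D_roots_mem) linarith+
    next
      assume "e = - 1"
      then have "x n = 0" "x (n - 1) = 1" using t by linarith+
      then have x: "x = rootA a (n - 1)"
        using 3 ab n lo by (intro ext) (auto simp: rootA_def)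
      show ?thesis unfolding x using ab n \<open>b = n\<close> by (intro D_roots_mem) linarith+
    qed
  qed
qed

lemma D_roots_nonneg: "x \<in> D_roots n \<Longrightarrow> 0 \<le> x k"
  by (auto simp: D_roots_def rootA_def rootB_def rootD_def)

lemma D_form_two:
  assumes n: "n \<ge> 4" and off: "\<And>k. k \<notin> {1..n} \<Longrightarrow> x k = 0" and two: "sym_form (D_quiver n) x x = 2"
  shows "x \<in> D_roots n \<or> (\<lambda>k. - x k) \<in> D_roots n"
proof -
  have x0: "x 0 = 0" using off by simp
  have sq: "(\<Sum>k\<in>{1..n}. (D_coord n x k)\<^sup>2) = 2" using two D_form_coord[of n x, OF n x0] by simp
  obtain a b where ab: "1 \<le> a" "a < b" "b \<le> n" "\<bar>D_coord n x a\<bar> = 1" "\<bar>D_coord n x b\<bar> = 1"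
    "\<And>k. 1 \<le> k \<Longrightarrow> k \<le> n \<Longrightarrow> k \<noteq> a \<Longrightarrow> k \<noteq> b \<Longrightarrow> D_coord n x k = 0"
  proof (rule two_units[OF sq])
    fix a b assume "1 \<le> a" "a < b" "b \<le> n" "\<bar>D_coord n x a\<bar> = 1" "\<bar>D_coord n x b\<bar> = 1"
      "\<And>k. 1 \<le> k \<Longrightarrow> k \<le> n \<Longrightarrow> k \<noteq> a \<Longrightarrow> k \<noteq> b \<Longrightarrow> D_coord n x k = 0"
    then show thesis by (rule that)
  qed
  have neg: "D_coord n (\<lambda>k. - x k) k = - D_coord n x k" for k by (simp add: D_coord_def)
  from ab(4) consider "D_coord n x a = 1" | "D_coord n (\<lambda>k. - x k) a = 1" unfolding neg by linarith
  then show ?thesis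
  proof cases
    case 1
    then show ?thesis using D_root_of_coords[OF n off ab(1-3) 1 ab(5,6)] by blast
  next
    case 2
    have "(\<lambda>k. - x k) \<in> D_roots n"
      using off ab(5,6) by (intro D_root_of_coords[OF n _ ab(1-3) 2]) (simp_all add: neg)
    then show ?thesis ..
  qed
qed

lemma D_nonneg_form_two:
  assumes n: "n \<ge> 4" and off: "\<And>k. k \<notin> {1..n} \<Longrightarrow> x k = 0" and two: "sym_form (D_quiver n) x x = 2"
    and pos: "\<And>k. 0 \<le> x k"
  shows "x \<in> D_roots n"
proof (rule ccontr)
  assume "x \<notin> D_roots n"
  then have "(\<lambda>k. - x k) \<in> D_roots n" using D_form_two[OF n off two] by blast
  from D_roots_nonneg[OF this] have "x k = 0" for k using pos[of k] by (simp add: order_antisym)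
  then show False using two by (simp add: sym_form_def)
qed

lemma D_sign:
  assumes "n \<ge> 4" "sym_form (D_quiver n) x x = 2" "\<And>k. k \<notin> {1..n} \<Longrightarrow> x k = 0"
  shows "(\<forall>k. 0 \<le> x k) \<or> (\<forall>k. x k \<le> 0)"
  using D_form_two[OF assms(1,3,2)] D_roots_nonneg[of x n] D_roots_nonneg[of "\<lambda>k. - x k" n] by auto


section \<open>Curves for the roots of type D\<close>

lemma D_reflect:
  assumes "n \<ge> 4" "i \<in> {1..n}" "x 0 = 0" "D_nb n x i - x i = c" "\<And>k. k \<noteq> i \<Longrightarrow> x k = y k" "y i = c"
  shows "simple_reflection (D_quiver n) i x = y"
  unfolding D_simple_reflection[of n i x, OF assms(1-3)] using assms(4-6) by (auto simp: fun_eq_iff)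

lemma root_step_A:
  assumes "n \<ge> 4" "1 \<le> i" "i < j" "j \<le> n - 1"
  shows "simple_reflection (D_quiver n) i (rootA (Suc i) j) = rootA i j"
proof (rule D_reflect)
  \<comment> \<open>Removes the truncated subtractions in \<open>D_nb\<close>, so that
    \<open>auto\<close> can compare the indices.\<close>
  obtain k0 i0 where n0: "n = k0 + 4" and i0: "i = Suc i0"
    using assms(1,2) by (metis One_nat_def Suc_le_D add.commute le_Suc_ex)
  show "D_nb n (rootA (Suc i) j) i - rootA (Suc i) j i = 1"
    using assms unfolding n0 i0 D_nb_def rootA_def by auto
qed (use assms in \<open>auto simp: rootA_def\<close>)

lemma word_A:
  assumes "n \<ge> 4" "1 \<le> i" "i \<le> j" "j \<le> n - 1"
  shows "word_elt (D_quiver n) [i..<j] (simple_root j) = rootA i j"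
  using assms(3,2)
proof (induction rule: inc_induct)
  case base
  then show ?case by (auto simp: simple_root_def rootA_def fun_eq_iff)
next
  case (step i)
  then show ?case using root_step_A[OF assms(1), of i j] assms(4) by (simp add: upt_rec[of i])
qed

lemma root_step_B:
  assumes "n \<ge> 4" "1 \<le> i" "i \<le> n - 2"
  shows "simple_reflection (D_quiver n) i (rootB n (Suc i)) = rootB n i"
proof (rule D_reflect)
  obtain k0 i0 where n0: "n = k0 + 4" and i0: "i = Suc i0"
    using assms(1,2) by (metis One_nat_def Suc_le_D add.commute le_Suc_ex)
  show "D_nb n (rootB n (Suc i)) i - rootB n (Suc i) i = 1"
    using assms unfolding n0 i0 D_nb_def rootB_def by auto
qed (use assms in \<open>auto simp: rootB_def\<close>)

lemma word_B:
  assumes "n \<ge> 4" "1 \<le> i" "i \<le> n - 1"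
  shows "word_elt (D_quiver n) [i..<n - 1] (simple_root n) = rootB n i"
  using assms(3,2)
proof (induction rule: inc_induct)
  case base
  then show ?case using assms by (auto simp: simple_root_def rootB_def fun_eq_iff)
next
  case (step i)
  then show ?case using root_step_B[OF assms(1), of i] by (simp add: upt_rec[of i])
qed

lemma root_step_up:
  assumes "n \<ge> 4" "1 \<le> i" "i \<le> k" "Suc k \<le> n - 1"
  shows "simple_reflection (D_quiver n) (Suc k) (rootA i k) = rootA i (Suc k)"
proof (rule D_reflect)
  obtain k0 i0 where n0: "n = k0 + 4" and i0: "i = Suc i0"
    using assms(1,2) by (metis One_nat_def Suc_le_D add.commute le_Suc_ex)
  show "D_nb n (rootA i k) (Suc k) - rootA i k (Suc k) = 1"
    using assms unfolding n0 D_nb_def rootA_def by auto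
qed (use assms in \<open>auto simp: rootA_def\<close>)

lemma word_up:
  assumes "n \<ge> 4" "1 \<le> i" "i \<le> k" "k \<le> n - 1"
  shows "word_elt (D_quiver n) (rev [Suc i..<Suc k]) (simple_root i) = rootA i k"
  using assms(3,4)
proof (induction rule: dec_induct)
  case base
  then show ?case by (auto simp: simple_root_def rootA_def fun_eq_iff)
next
  case (step k)
  then show ?case using root_step_up[OF assms(1,2), of k] by simp
qed

lemma word_C:
  assumes "n \<ge> 4" "1 \<le> i" "i \<le> n - 2"
  shows "word_elt (D_quiver n) (rev [Suc i..<Suc n]) (simple_root i) = rootD n i (n - 1)"
proof -
  have "rev [Suc i..<Suc n] = n # rev [Suc i..<Suc (n - 1)]" using assms by simp
  moreover have "simple_reflection (D_quiver n) n (rootA i (n - 1)) = rootD n i (n - 1)"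
  proof (rule D_reflect)
    obtain k0 where n0: "n = k0 + 4" using assms(1) by (metis add.commute le_Suc_ex)
    show "D_nb n (rootA i (n - 1)) n - rootA i (n - 1) n = 1"
      using assms unfolding n0 D_nb_def rootA_def by auto
  qed (use assms in \<open>auto simp: rootA_def rootD_def\<close>)
  ultimately show ?thesis using word_up[OF assms(1,2), of "n - 1"] assms by simp
qed

lemma root_step_D:
  assumes "n \<ge> 4" "1 \<le> i" "i < j" "j \<le> n - 2"
  shows "simple_reflection (D_quiver n) j (rootD n i (Suc j)) = rootD n i j"
proof (rule D_reflect)
  obtain k0 where n0: "n = k0 + 4" using assms(1) by (metis add.commute le_Suc_ex)
  obtain j0 where j0: "j = Suc j0" using assms(3) by (cases j) simp_all
  show "D_nb n (rootD n i (Suc j)) j - rootD n i (Suc j) j = 2"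
    using assms unfolding n0 j0 D_nb_def rootD_def by auto
qed (use assms in \<open>auto simp: rootD_def\<close>)

text \<open>A word acts from its right end. The right block builds \<open>e_i + e_(n-1)\<close>,
  whose coefficients from \<open>i\<close> to \<open>n\<close> are 1; then the letters
  \<open>n - 2\<close>, ..., \<open>j\<close> act in this order, each raising one coefficient from 1
  to 2. Read from the left, the word lists the arcs crossed in \<open>arc_data_turn\<close>.\<close>

lemma word_D:
  assumes "n \<ge> 4" "1 \<le> i" "i < j" "j \<le> n - 1"
  shows "word_elt (D_quiver n) ([j..<n - 1] @ rev [Suc i..<Suc n]) (simple_root i) = rootD n i j"
  using assms(4,3)
proof (induction rule: inc_induct)
  case base
  then show ?case using word_C[OF assms(1,2)] by simp
next
  case (step j)
  then show ?case using root_step_D[OF assms(1,2), of j] by (simp add: upt_rec[of j])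
qed

text \<open>The middle letter \<open>i\<close> of the palindrome is the arc through whose midpoint
  the curve passes. The first half \<open>w\<close> of the word carries the simple root of that
  letter to \<open>b\<close>.\<close>

lemma curve_of_root:
  assumes n: "n \<ge> 4" and \<sigma>: "\<sigma> \<in> P_perms (D_quiver n)" and "arc_data n m kk tt"
    and w: "map (\<lambda>l. \<sigma> (Suc (kk l))) [1..<m] = w" and i: "\<sigma> (Suc (kk m)) = i"
    and root: "word_elt (D_quiver n) w (simple_root i) = b" and pos: "\<And>k. 0 \<le> b k"
    and adj: "distinct_adj (w @ [i] @ rev w)"
  shows "\<exists>\<eta>\<in>simple_admissible (D_quiver n) \<sigma>. curve_root (D_quiver n) \<sigma> \<eta> = b"
proof -
  interpret arc_data n m kk tt by fact
  let ?Q = "D_quiver n"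
  have perm: "\<sigma> permutes {1..n}" using \<sigma> by (simp add: P_perms_def)
  have lab: "\<sigma> (Suc (kk l)) \<in> {1..n}" if "1 \<le> l" "l \<le> m" for l
    using kk[OF that] permutes_in_image[OF perm] by simp
  have wv: "set w \<subseteq> verts ?Q" unfolding w[symmetric] using lab by auto
  have iv: "i \<in> verts ?Q" unfolding i[symmetric] using lab[of m] m by simp
  have pal: "word_elt ?Q (w @ [i] @ rev w) = conj_reflection ?Q (word_elt ?Q w) i"
    by (rule D.palindrome_reflection[OF wv])
  have "word_elt ?Q w \<in> weyl_group ?Q" using wv unfolding weyl_group_def by (intro imageI in_listsI) blast
  then have "conj_reflection ?Q (word_elt ?Q w) i \<in> reflections ?Q" using iv unfolding reflections_def by blast
  moreover have "w @ [i] @ rev w \<in> words ?Q" using wv iv adj unfolding words_def by auto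
  ultimately have "w @ [i] @ rev w \<in> reflection_words ?Q"
    unfolding reflection_words_def words_of_def using pal by blast
  then obtain \<eta> where \<eta>: "\<eta> \<in> simple_admissible ?Q \<sigma>" "crossing_word n \<sigma> \<eta> = w @ [i] @ rev w"
    using exists_curve[of ?Q \<sigma> w] perm w i by auto
  have "curve_root ?Q \<sigma> \<eta> = b"
    unfolding curve_root_def using \<eta>(2) pal D.root_of_reflection_eq[OF wv iv root[symmetric] pos] by simp
  then show ?thesis using \<eta>(1) by blast
qed

lemma P_perms_id: "n \<ge> 4 \<Longrightarrow> id \<in> P_perms (D_quiver n)"
  by (auto simp: P_perms_def permutes_id D_arcs_iff)

text \<open>The vertices \<open>n - 1\<close> and \<open>n\<close> are not joined by an arrow, so
  either may come first. With \<open>n\<close> first, the edges of 1, ..., \<open>n - 2\<close>,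
  \<open>n\<close> are consecutive, as \<open>rootB\<close> requires.\<close>

lemma P_perms_swap:
  assumes n: "n \<ge> 4" shows "Transposition.transpose (n - 1) n \<in> P_perms (D_quiver n)"
proof -
  let ?\<sigma> = "Transposition.transpose (n - 1) n"
  have "?\<sigma> permutes {1..n}" using n by (intro permutes_swap_id) simp_all
  moreover have "(?\<sigma> j, ?\<sigma> i) \<notin> arcs (D_quiver n)" if "i \<in> {1..n}" "j \<in> {1..n}" "i < j" for i j
  proof
    assume a: "(?\<sigma> j, ?\<sigma> i) \<in> arcs (D_quiver n)"
    then have "?\<sigma> j \<le> n - 2" "?\<sigma> j < ?\<sigma> i" using n unfolding D_arcs_iff by auto
    moreover from this have "?\<sigma> j = j" using n by (auto simp: Transposition.transpose_def split: if_splits)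
    ultimately show False using that n by (auto simp: Transposition.transpose_def split: if_splits)
  qed
  ultimately show ?thesis unfolding P_perms_def by auto
qed

lemma map_Suc_add_upt: "map (\<lambda>l. Suc (a + l - 1)) [1..<m] = [Suc a..<a + m]"
  by (rule nth_equalityI) simp_all

lemma map_diff_upt: "m \<le> Suc n \<Longrightarrow> map (\<lambda>l. Suc (n - l)) [1..<m] = rev [n + 2 - m..<Suc n]"
proof (rule nth_equalityI)
  assume m: "m \<le> Suc n"
  show "length (map (\<lambda>l. Suc (n - l)) [1..<m]) = length (rev [n + 2 - m..<Suc n])"
    using m by (simp del: upt_Suc)
  fix i assume "i < length (map (\<lambda>l. Suc (n - l)) [1..<m])"
  then have i: "Suc i < m" by simp
  have "rev [n + 2 - m..<Suc n] ! i = [n + 2 - m..<Suc n] ! (Suc n - (n + 2 - m) - Suc i)"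
    using i m by (subst rev_nth) (simp_all del: upt_Suc)
  also have "\<dots> = (n + 2 - m) + (Suc n - (n + 2 - m) - Suc i)"
    using i m by (intro nth_upt) linarith
  also have "\<dots> = Suc (n - Suc i)" using i m by linarith
  finally have "rev [n + 2 - m..<Suc n] ! i = Suc (n - Suc i)" .
  moreover have "map (\<lambda>l. Suc (n - l)) [1..<m] ! i = Suc (n - Suc i)" using i nth_upt[of 1 i m] by simp
  ultimately show "map (\<lambda>l. Suc (n - l)) [1..<m] ! i = rev [n + 2 - m..<Suc n] ! i" by (simp only:)
qed

lemma distinct_adj_palindrome:
  assumes "distinct_adj (w @ [i])" shows "distinct_adj (w @ [i] @ rev w)"
proof -
  have "distinct_adj ([i] @ rev w)" using assms distinct_adj_rev[of "w @ [i]"] by simp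
  then show ?thesis using assms by (auto simp: distinct_adj_append_iff)
qed

lemma distinct_imp_distinct_adj: "distinct xs \<Longrightarrow> distinct_adj xs"
  by (induction xs rule: induct_list012) auto

lemma D_root_curve:
  assumes n: "n \<ge> 4" and b: "b \<in> D_roots n"
  shows "\<exists>\<sigma>\<in>P_perms (D_quiver n). \<exists>\<eta>\<in>simple_admissible (D_quiver n) \<sigma>. curve_root (D_quiver n) \<sigma> \<eta> = b"
proof -
  note pos = D_roots_nonneg[OF b]
  consider (A) i j where "1 \<le> i" "i \<le> j" "j \<le> n - 1" "b = rootA i j"
    | (B) i where "1 \<le> i" "i \<le> n - 1" "b = rootB n i"
    | (C) i where "1 \<le> i" "i \<le> n - 2" "b = rootD n i (n - 1)"
    | (D) i j where "1 \<le> i" "i < j" "j \<le> n - 2" "b = rootD n i j"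
  proof -
    from b consider "\<exists>i j. 1 \<le> i \<and> i \<le> j \<and> j \<le> n - 1 \<and> b = rootA i j" | "\<exists>i. 1 \<le> i \<and> i \<le> n - 1 \<and> b = rootB n i"
      | "\<exists>i j. 1 \<le> i \<and> i < j \<and> j \<le> n - 1 \<and> b = rootD n i j" unfolding D_roots_def by blast
    then show ?thesis
    proof cases
      case 3
      then obtain i j where ij: "1 \<le> i" "i < j" "j \<le> n - 1" "b = rootD n i j" by blast
      show ?thesis
      proof (cases "j = n - 1")
        case True
        then have "i \<le> n - 2" using ij by linarith
        then show ?thesis using C ij True by blast
      next
        case False
        then have "j \<le> n - 2" using ij by linarith
        then show ?thesis using D ij by blast
      qed
    qed (use A B in blast)+
  qed
  then show ?thesis
  proof cases
    case A
    let ?m = "j - 1 - (i - 1) + 1"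
    have "arc_data n ?m (\<lambda>l. i - 1 + l - 1) (\<lambda>l. if l = ?m then 1 / 2 else 1 / 3)"
      by (rule arc_data_right) (use A n in linarith)+
    moreover have "map (\<lambda>l. id (Suc (i - 1 + l - 1))) [1..<?m] = [i..<j]"
      using map_Suc_add_upt[of "i - 1" ?m] A by simp
    moreover have "id (Suc (i - 1 + ?m - 1)) = j" using A by simp
    moreover have "distinct_adj ([i..<j] @ [j] @ rev [i..<j])"
      by (intro distinct_adj_palindrome distinct_imp_distinct_adj) simp
    ultimately show ?thesis
      using curve_of_root[OF n P_perms_id[OF n] _ _ _ word_A[OF n A(1-3)]] pos A(4) P_perms_id[OF n] by blast
  next
    \<comment> \<open>These roots skip vertex \<open>n - 1\<close>, or consist of \<open>n\<close>
      alone. In the exchanged order the edge in position \<open>n - 1\<close> carries the label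
      \<open>n\<close> and follows that of \<open>n - 2\<close>.\<close>
    case B
    let ?m = "n - 2 - (i - 1) + 1" and ?\<sigma> = "Transposition.transpose (n - 1) n"
    have m: "i - 1 + ?m = n - 1" using B n by linarith
    have i1: "Suc (i - 1) = i" using B by simp
    have "arc_data n ?m (\<lambda>l. i - 1 + l - 1) (\<lambda>l. if l = ?m then 1 / 2 else 1 / 3)"
      by (rule arc_data_right) (use B n in linarith)+
    moreover have "map (\<lambda>l. ?\<sigma> (Suc (i - 1 + l - 1))) [1..<?m] = [i..<n - 1]"
    proof -
      have "map (\<lambda>l. ?\<sigma> (Suc (i - 1 + l - 1))) [1..<?m] = map ?\<sigma> (map (\<lambda>l. Suc (i - 1 + l - 1)) [1..<?m])"
        by simp
      also have "\<dots> = map ?\<sigma> [i..<n - 1]" unfolding map_Suc_add_upt m i1 ..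
      also have "\<dots> = map id [i..<n - 1]"
        by (intro map_cong refl) (auto simp: Transposition.transpose_def)
      finally show ?thesis by simp
    qed
    moreover have "?\<sigma> (Suc (i - 1 + ?m - 1)) = n" unfolding m using n by (simp add: Suc_diff_Suc numeral_2_eq_2)
    moreover have "distinct_adj ([i..<n - 1] @ [n] @ rev [i..<n - 1])"
    proof (intro distinct_adj_palindrome distinct_imp_distinct_adj)
      have "n \<notin> set [i..<n - 1]" by (simp only: set_upt atLeastLessThan_iff) linarith
      then show "distinct ([i..<n - 1] @ [n])" by (simp only: distinct_append distinct_upt) simp
    qed
    ultimately show ?thesis
      using curve_of_root[OF n P_perms_swap[OF n] _ _ _ word_B[OF n B(1,2)]] pos B(3) P_perms_swap[OF n] by blast
  next
    case C
    let ?m = "n - (i - 1)"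
    have "arc_data n ?m (\<lambda>l. n - l) (\<lambda>l. if l = ?m then 1 / 2 else 2 / 3)"
      by (rule arc_data_left) (use C n in linarith)+
    moreover have "map (\<lambda>l. id (Suc (n - l))) [1..<?m] = rev [Suc i..<Suc n]"
    proof -
      have "n + 2 - ?m = Suc i" "?m \<le> Suc n" using C n by linarith+
      then show ?thesis using map_diff_upt[of ?m n] by simp
    qed
    moreover have "id (Suc (n - ?m)) = i" using C n by simp
    moreover have "distinct_adj (rev [Suc i..<Suc n] @ [i] @ rev (rev [Suc i..<Suc n]))"
      by (intro distinct_adj_palindrome distinct_imp_distinct_adj) auto
    ultimately show ?thesis
      using curve_of_root[OF n P_perms_id[OF n] _ _ _ word_C[OF n C(1,2)]] pos C(3) P_perms_id[OF n] by blast
  next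
    case D
    \<comment> \<open>Edges are numbered from 0, so \<open>j\<close> and \<open>i\<close> become
      \<open>J = j - 1\<close> and \<open>I = i - 1\<close> in \<open>arc_data_turn\<close>.\<close>
    define r where "r = n - 2 - (j - 1)"
    define m where "m = r + (n - (i - 1))"
    have r: "r + j = n - 1" "1 \<le> r" unfolding r_def using D n by linarith+
    have m: "m + i = r + n + 1" unfolding m_def using D n by linarith
    let ?kk = "\<lambda>l. if l \<le> r then j - 1 + l - 1 else n - (l - r)"
    let ?w = "[j..<n - 1] @ rev [Suc i..<Suc n]"
    have "arc_data n m ?kk (\<lambda>l. if l \<le> r then 2 / 5 else if l = m then 1 / 2 else 4 / 5)"
      unfolding m_def by (rule arc_data_turn) (use D n r_def in linarith)+
    moreover have "map (\<lambda>l. id (Suc (?kk l))) [1..<m] = ?w"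
    proof (rule nth_equalityI)
      have "m - 1 = (n - 1 - j) + (Suc n - Suc i)" using D n r m by linarith
      then show "length (map (\<lambda>l. id (Suc (?kk l))) [1..<m]) = length ?w" by (simp del: upt_Suc)
      fix q assume "q < length (map (\<lambda>l. id (Suc (?kk l))) [1..<m])"
      then have q: "Suc q < m" by simp
      then have lhs: "map (\<lambda>l. id (Suc (?kk l))) [1..<m] ! q = Suc (?kk (Suc q))"
        using nth_upt[of 1 q m] by simp
      have len: "length [j..<n - 1] = r" using r by simp
      show "map (\<lambda>l. id (Suc (?kk l))) [1..<m] ! q = ?w ! q"
      proof (cases "q < r")
        case True
        then have "?w ! q = [j..<n - 1] ! q" unfolding nth_append len by (simp only: if_True)
        also have "\<dots> = j + q" using True r by (intro nth_upt) linarith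
        also have "\<dots> = Suc (j - 1 + Suc q - 1)" using D by linarith
        finally have "?w ! q = Suc (j - 1 + Suc q - 1)" .
        moreover have "Suc q \<le> r" using True by simp
        ultimately show ?thesis unfolding lhs by (simp only: if_True)
      next
        case False
        then have "?w ! q = rev [Suc i..<Suc n] ! (q - r)" unfolding nth_append len by (simp only: if_False)
        also have "\<dots> = [Suc i..<Suc n] ! (Suc n - Suc i - Suc (q - r))"
          using q False m by (subst rev_nth) (simp_all del: upt_Suc, linarith?)
        also have "\<dots> = Suc i + (Suc n - Suc i - Suc (q - r))"
          using q False m D by (intro nth_upt) linarith
        also have "\<dots> = Suc (n - (Suc q - r))" using q False m by linarith
        finally have "?w ! q = Suc (n - (Suc q - r))" .
        moreover have "\<not> Suc q \<le> r" using False by simp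
        ultimately show ?thesis unfolding lhs by (simp only: if_False)
      qed
    qed
    moreover have "id (Suc (?kk m)) = i"
    proof -
      have "\<not> m \<le> r" "Suc (n - (m - r)) = i" using D n m by linarith+
      then show ?thesis by (simp only: if_False id_apply)
    qed
    \<comment> \<open>The letters \<open>j\<close>, ..., \<open>n - 2\<close> occur in both runs, so
      distinctness is available only run by run. The first run is extended by the letter
      \<open>n\<close> with which the second begins.\<close>
    moreover have "distinct_adj (?w @ [i] @ rev ?w)"
    proof (rule distinct_adj_palindrome)
      have "n \<notin> set [j..<n - 1]" by (simp only: set_upt atLeastLessThan_iff) linarith
      then have "distinct_adj ([j..<n - 1] @ [n])"
        by (intro distinct_imp_distinct_adj) (simp only: distinct_append distinct_upt, simp)
      moreover have "distinct_adj (rev [Suc i..<Suc n] @ [i])"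
        by (rule distinct_imp_distinct_adj) (simp only: distinct_append distinct_upt distinct_rev set_rev set_upt, simp)
      moreover have "rev [Suc i..<Suc n] @ [i] = n # (rev [Suc i..<n] @ [i])" using D n by simp
      ultimately show "distinct_adj (?w @ [i])"
        unfolding append_assoc by (simp only: distinct_adj_append_iff list.sel list.simps append_Nil)
    qed
    moreover have "word_elt (D_quiver n) ?w (simple_root i) = rootD n i j"
      by (rule word_D[OF n D(1,2)]) (use D in linarith)
    ultimately show ?thesis
      using curve_of_root[OF n P_perms_id[OF n]] pos D(4) P_perms_id[OF n] by blast
  qed
qed


section \<open>Linear maps in coordinates\<close>

text \<open>The space \<open>k^S\<close> as functions on the whole index type that vanish off
  \<open>S\<close>. Linear maps are total functions too; \<open>lin_on\<close> constrains them on
  this space, and maps are compared there.\<close>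

definition coords :: "'i set \<Rightarrow> ('i \<Rightarrow> 'k::zero) set" where
  "coords S = {f. \<forall>i. i \<notin> S \<longrightarrow> f i = 0}"

definition unit_at :: "'i \<Rightarrow> 'i \<Rightarrow> 'k::zero_neq_one" where
  "unit_at s = (\<lambda>i. if i = s then 1 else 0)"

definition lin_on :: "'i set \<Rightarrow> 'j set \<Rightarrow> (('i \<Rightarrow> 'k::field) \<Rightarrow> ('j \<Rightarrow> 'k)) \<Rightarrow> bool" where
  "lin_on S T F \<longleftrightarrow> (\<forall>x\<in>coords S. F x \<in> coords T)
     \<and> (\<forall>x\<in>coords S. \<forall>y\<in>coords S. F (\<lambda>i. x i + y i) = (\<lambda>j. F x j + F y j))
     \<and> (\<forall>c. \<forall>x\<in>coords S. F (\<lambda>i. c * x i) = (\<lambda>j. c * F x j))"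

lemma coords_zero [simp]: "(\<lambda>_. 0) \<in> coords S" by (simp add: coords_def)

lemma coords_add: "x \<in> coords S \<Longrightarrow> y \<in> coords S \<Longrightarrow> (\<lambda>i. x i + y i :: 'k::field) \<in> coords S"
  by (simp add: coords_def)

lemma coords_scale: "x \<in> coords S \<Longrightarrow> (\<lambda>i. c * x i :: 'k::field) \<in> coords S"
  by (simp add: coords_def)

lemma coords_diff: "x \<in> coords S \<Longrightarrow> y \<in> coords S \<Longrightarrow> (\<lambda>i. x i - y i :: 'k::field) \<in> coords S"
  by (simp add: coords_def)

lemma coords_unit: "s \<in> S \<Longrightarrow> unit_at s \<in> coords S"
  by (auto simp: coords_def unit_at_def)

lemma coords_mono: "S \<subseteq> S' \<Longrightarrow> x \<in> coords S \<Longrightarrow> x \<in> coords S'"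
  by (auto simp: coords_def)

lemma coords_off: "x \<in> coords S \<Longrightarrow> i \<notin> S \<Longrightarrow> x i = 0"
  by (simp add: coords_def)

lemma lin_onD:
  assumes "lin_on S T F"
  shows "x \<in> coords S \<Longrightarrow> F x \<in> coords T"
    and "x \<in> coords S \<Longrightarrow> y \<in> coords S \<Longrightarrow> F (\<lambda>i. x i + y i) = (\<lambda>j. F x j + F y j)"
    and "x \<in> coords S \<Longrightarrow> F (\<lambda>i. c * x i) = (\<lambda>j. c * F x j)"
  using assms unfolding lin_on_def by blast+

lemma lin_onI:
  assumes "\<And>x. x \<in> coords S \<Longrightarrow> F x \<in> coords T"
    and "\<And>x y. x \<in> coords S \<Longrightarrow> y \<in> coords S \<Longrightarrow> F (\<lambda>i. x i + y i) = (\<lambda>j. F x j + F y j)"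
    and "\<And>c x. x \<in> coords S \<Longrightarrow> F (\<lambda>i. c * x i) = (\<lambda>j. c * F x j)"
  shows "lin_on S T F"
  unfolding lin_on_def using assms by blast

lemma lin_on_zero: "lin_on S T F \<Longrightarrow> F (\<lambda>_. 0) = (\<lambda>_. 0)"
  using lin_onD(3)[of S T F "\<lambda>_. 0" 0] by simp

lemma lin_on_diff:
  assumes "lin_on S T F" "x \<in> coords S" "y \<in> coords S"
  shows "F (\<lambda>i. x i - y i) = (\<lambda>j. F x j - F y j)"
proof -
  have "F (\<lambda>i. x i + (- 1) * y i) = (\<lambda>j. F x j + F (\<lambda>i. (- 1) * y i) j)"
    by (rule lin_onD(2)[OF assms(1,2) coords_scale[OF assms(3)]])
  also have "F (\<lambda>i. (- 1) * y i) = (\<lambda>j. (- 1) * F y j)" by (rule lin_onD(3)[OF assms(1,3)])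
  finally show ?thesis by simp
qed

lemma lin_on_sum:
  assumes F: "lin_on S T F" and "finite I" "\<And>k. k \<in> I \<Longrightarrow> x k \<in> coords S"
  shows "(\<lambda>i. \<Sum>k\<in>I. c k * x k i) \<in> coords S" "F (\<lambda>i. \<Sum>k\<in>I. c k * x k i) = (\<lambda>j. \<Sum>k\<in>I. c k * F (x k) j)"
proof -
  have "(\<lambda>i. \<Sum>k\<in>I. c k * x k i) \<in> coords S \<and> F (\<lambda>i. \<Sum>k\<in>I. c k * x k i) = (\<lambda>j. \<Sum>k\<in>I. c k * F (x k) j)"
    using assms(2,3)
  proof (induction I rule: finite_induct)
    case empty
    then show ?case by (simp add: lin_on_zero[OF F])
  next
    case (insert k I)
    let ?y = "\<lambda>i. \<Sum>k\<in>I. c k * x k i"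
    have y: "?y \<in> coords S" "F ?y = (\<lambda>j. \<Sum>k\<in>I. c k * F (x k) j)" using insert by auto
    have xk: "x k \<in> coords S" using insert by simp
    have eq: "(\<lambda>i. \<Sum>k\<in>insert k I. c k * x k i) = (\<lambda>i. c k * x k i + ?y i)" using insert by simp
    have "F (\<lambda>i. c k * x k i + ?y i) = (\<lambda>j. F (\<lambda>i. c k * x k i) j + F ?y j)"
      by (rule lin_onD(2)[OF F coords_scale[OF xk] y(1)])
    then show ?case unfolding eq y(2) lin_onD(3)[OF F xk]
      using insert coords_add[OF coords_scale[OF xk] y(1)] by simp
  qed
  then show "(\<lambda>i. \<Sum>k\<in>I. c k * x k i) \<in> coords S" "F (\<lambda>i. \<Sum>k\<in>I. c k * x k i) = (\<lambda>j. \<Sum>k\<in>I. c k * F (x k) j)"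
    by blast+
qed

lemma coords_expand:
  fixes x :: "'s \<Rightarrow> 'k::field"
  assumes "finite S" "x \<in> coords S"
  shows "x = (\<lambda>i. \<Sum>s\<in>S. x s * unit_at s i)"
proof
  fix i
  have "(\<Sum>s\<in>S. x s * unit_at s i) = (\<Sum>s\<in>S. if s = i then x s else 0)"
    by (intro sum.cong refl) (auto simp: unit_at_def)
  then show "x i = (\<Sum>s\<in>S. x s * unit_at s i)" using assms by (simp add: coords_def)
qed

lemma lin_on_eq_on_units:
  fixes F G :: "('s \<Rightarrow> 'k::field) \<Rightarrow> ('t \<Rightarrow> 'k)"
  assumes "lin_on S T F" "lin_on S T G" "finite S" "\<And>s. s \<in> S \<Longrightarrow> F (unit_at s) = G (unit_at s)"
    and x: "x \<in> coords S"
  shows "F x = G x"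
proof -
  have "F (\<lambda>i. \<Sum>s\<in>S. x s * unit_at s i) = G (\<lambda>i. \<Sum>s\<in>S. x s * unit_at s i)"
    using lin_on_sum(2)[OF assms(1,3), of unit_at x] lin_on_sum(2)[OF assms(2,3), of unit_at x] assms(4)
    by (simp add: coords_unit)
  then show ?thesis using coords_expand[OF assms(3) x] by simp
qed

text \<open>Gaussian elimination, by induction on the equations: equation \<open>t\<close> is either
  trivial or serves to eliminate one unknown. The dimension arguments that follow rest on this
  lemma.\<close>

lemma underdetermined:
  fixes F :: "('s \<Rightarrow> 'k::field) \<Rightarrow> ('t \<Rightarrow> 'k)"
  assumes "finite T" "finite S" "card T < card S" "lin_on S T F"
  shows "\<exists>x\<in>coords S. x \<noteq> (\<lambda>_. 0) \<and> F x = (\<lambda>_. 0)"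
  using assms
proof (induction T arbitrary: S F rule: finite_induct)
  case empty
  then have "S \<noteq> {}" by auto
  then obtain s where "s \<in> S" by blast
  moreover have "unit_at s \<noteq> (\<lambda>_. 0 :: 'k)" by (auto simp: unit_at_def fun_eq_iff)
  moreover have "F (unit_at s) = (\<lambda>_. 0)"
    using lin_onD(1)[OF empty(3) coords_unit[OF \<open>s \<in> S\<close>]] by (auto simp: coords_def)
  moreover have "unit_at s \<in> coords S" by (rule coords_unit[OF \<open>s \<in> S\<close>])
  ultimately show ?case by (intro bexI[of _ "unit_at s"] conjI)
next
  case (insert t T)
  note F = insert.prems(3)
  show ?case
  proof (cases "\<forall>x\<in>coords S. F x t = 0")
    case True
    have "lin_on S T F"
    proof (rule lin_onI)
      fix x :: "'s \<Rightarrow> 'k" assume x: "x \<in> coords S"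
      show "F x \<in> coords T" using lin_onD(1)[OF F x] True x by (auto simp: coords_def)
    qed (rule lin_onD[OF F]; assumption)+
    then show ?thesis using insert by simp
  next
    case False
    have "\<exists>s0\<in>S. F (unit_at s0) t \<noteq> 0"
    proof (rule ccontr)
      assume n: "\<not> (\<exists>s0\<in>S. F (unit_at s0) t \<noteq> 0)"
      obtain x where x: "x \<in> coords S" "F x t \<noteq> 0" using False by blast
      have "F x = (\<lambda>j. \<Sum>s\<in>S. x s * F (unit_at s) j)"
        using lin_on_sum(2)[OF F insert.prems(1), of unit_at x] coords_expand[OF insert.prems(1) x(1)]
        by (simp add: coords_unit)
      then have "F x t = (\<Sum>s\<in>S. x s * F (unit_at s) t)" by (rule fun_cong)
      also have "\<dots> = 0" using n by (intro sum.neutral) simp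
      finally show False using x by simp
    qed
    then obtain s0 where s0: "s0 \<in> S" "F (unit_at s0) t \<noteq> 0" by blast
    define c where "c = F (unit_at s0) t"
    let ?S = "S - {s0}"
    \<comment> \<open>Adjusts the unknown \<open>s0\<close> so that equation \<open>t\<close> holds.
      Substituting this leaves a system with unknowns \<open>S - {s0}\<close> and equations
      \<open>T\<close>.\<close>
    define p where "p x = (\<lambda>i. x i - (F x t / c) * unit_at s0 i)" for x
    have sub: "x \<in> coords ?S \<Longrightarrow> x \<in> coords S" for x :: "'s \<Rightarrow> 'k" by (rule coords_mono) auto
    have pS: "p x \<in> coords S" if "x \<in> coords S" for x
      unfolding p_def by (intro coords_diff that coords_scale coords_unit s0)
    have Fp: "F (p x) = (\<lambda>j. F x j - (F x t / c) * F (unit_at s0) j)" if "x \<in> coords S" for x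
      unfolding p_def using lin_on_diff[OF F that coords_scale[OF coords_unit[OF s0(1)]], of "F x t / c"]
        lin_onD(3)[OF F coords_unit[OF s0(1)], of "F x t / c"] by simp
    have "lin_on ?S T (\<lambda>x. F (p x))"
    proof (rule lin_onI)
      fix x :: "'s \<Rightarrow> 'k" assume x: "x \<in> coords ?S"
      have "F (p x) t = 0" unfolding Fp[OF sub[OF x]] using s0 by (simp add: c_def)
      then show "F (p x) \<in> coords T" using lin_onD(1)[OF F pS[OF sub[OF x]]] by (auto simp: coords_def)
      show "F (p (\<lambda>i. a * x i)) = (\<lambda>j. a * F (p x) j)" for a
        unfolding Fp[OF sub[OF x]] Fp[OF coords_scale[OF sub[OF x]]] lin_onD(3)[OF F sub[OF x]]
        by (simp add: algebra_simps)
      fix y :: "'s \<Rightarrow> 'k" assume y: "y \<in> coords ?S"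
      show "F (p (\<lambda>i. x i + y i)) = (\<lambda>j. F (p x) j + F (p y) j)"
        unfolding Fp[OF sub[OF x]] Fp[OF sub[OF y]] Fp[OF coords_add[OF sub[OF x] sub[OF y]]]
          lin_onD(2)[OF F sub[OF x] sub[OF y]]
        by (simp add: algebra_simps add_divide_distrib)
    qed
    moreover have "card T < card ?S" using insert s0 by simp
    ultimately obtain x where x: "x \<in> coords ?S" "x \<noteq> (\<lambda>_. 0)" "F (p x) = (\<lambda>_. 0)"
      using insert.IH[of ?S "\<lambda>x. F (p x)"] insert.prems(1) by blast
    obtain i where i: "x i \<noteq> 0" using x(2) by (auto simp: fun_eq_iff)
    then have "i \<noteq> s0" using coords_off[OF x(1)] by auto
    \<comment> \<open>Only the unknown \<open>s0\<close> is adjusted, so a non-zero coordinate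
      elsewhere survives.\<close>
    then have "p x i \<noteq> 0" using i by (simp add: p_def unit_at_def)
    then have "p x \<noteq> (\<lambda>_. 0)" by auto
    then show ?thesis using pS[OF sub[OF x(1)]] x(3) by blast
  qed
qed

text \<open>The right-hand side \<open>h\<close> becomes the column of an additional unknown
  \<open>None\<close>. A non-trivial solution of the enlarged homogeneous system is non-zero at
  \<open>None\<close> by injectivity, and dividing by that value solves
  \<open>F x = h\<close>.\<close>

lemma injective_imp_surjective:
  fixes F :: "('s \<Rightarrow> 'k::field) \<Rightarrow> ('t \<Rightarrow> 'k)"
  assumes "finite S" "finite T" "card T \<le> card S" and F: "lin_on S T F"
    and inj: "\<And>x. x \<in> coords S \<Longrightarrow> F x = (\<lambda>_. 0) \<Longrightarrow> x = (\<lambda>_. 0)" and h: "h \<in> coords T"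
  shows "\<exists>x\<in>coords S. F x = h"
proof -
  let ?S = "insert None (Some ` S)"
  define G where "G f = (\<lambda>j. F (\<lambda>i. f (Some i)) j - f None * h j)" for f
  have sub: "(\<lambda>i. f (Some i)) \<in> coords S" if "f \<in> coords ?S" for f :: "'s option \<Rightarrow> 'k"
    using that by (auto simp: coords_def)
  have "lin_on ?S T G"
  proof (rule lin_onI)
    fix f :: "'s option \<Rightarrow> 'k" assume f: "f \<in> coords ?S"
    show "G f \<in> coords T" unfolding G_def
      by (rule coords_diff[OF lin_onD(1)[OF F sub[OF f]] coords_scale[OF h]])
    show "G (\<lambda>i. c * f i) = (\<lambda>j. c * G f j)" for c
      unfolding G_def lin_onD(3)[OF F sub[OF f]] by (simp add: algebra_simps)
    fix f' :: "'s option \<Rightarrow> 'k" assume f': "f' \<in> coords ?S"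
    show "G (\<lambda>i. f i + f' i) = (\<lambda>j. G f j + G f' j)"
      unfolding G_def lin_onD(2)[OF F sub[OF f] sub[OF f']] by (simp add: algebra_simps)
  qed
  moreover have "card ?S = Suc (card S)" using assms(1) by (simp add: card_image card_insert_if)
  ultimately obtain f where f: "f \<in> coords ?S" "f \<noteq> (\<lambda>_. 0)" "G f = (\<lambda>_. 0)"
    using underdetermined[of T ?S G] assms by auto
  let ?x = "\<lambda>i. f (Some i)"
  have eq: "F ?x = (\<lambda>j. f None * h j)" using f(3) by (simp add: G_def fun_eq_iff)
  have nz: "f None \<noteq> 0"
  proof
    assume 0: "f None = 0"
    then have "?x = (\<lambda>_. 0)" using inj[OF sub[OF f(1)]] eq by simp
    then have "f i = 0" for i using 0 by (cases i) (auto simp: fun_eq_iff)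
    then show False using f(2) by auto
  qed
  have "F (\<lambda>i. (1 / f None) * ?x i) = h"
    unfolding lin_onD(3)[OF F sub[OF f(1)]] eq using nz by simp
  then show ?thesis using coords_scale[OF sub[OF f(1)]] by blast
qed

text \<open>If \<open>T\<close> were larger than \<open>S\<close>, a non-trivial combination of
  chosen preimages of the unit vectors would vanish, although \<open>F\<close> maps it to a non-zero
  vector.\<close>

lemma surjective_card_le:
  fixes F :: "('s \<Rightarrow> 'k::field) \<Rightarrow> ('t \<Rightarrow> 'k)"
  assumes "finite S" "finite T" and F: "lin_on S T F"
    and surj: "\<And>h. h \<in> coords T \<Longrightarrow> \<exists>x\<in>coords S. F x = h"
  shows "card T \<le> card S"
proof (rule ccontr)
  assume "\<not> card T \<le> card S"
  have "\<exists>g. \<forall>t\<in>T. g t \<in> coords S \<and> F (g t) = unit_at t"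
    using surj[OF coords_unit] by (intro bchoice) blast
  then obtain g where g: "\<And>t. t \<in> T \<Longrightarrow> g t \<in> coords S" "\<And>t. t \<in> T \<Longrightarrow> F (g t) = unit_at t" by blast
  let ?G = "\<lambda>h i. \<Sum>t\<in>T. h t * g t i"
  have "lin_on T S ?G"
  proof (rule lin_onI)
    show "?G h \<in> coords S" for h by (rule lin_on_sum(1)[OF F assms(2) g(1)])
  qed (simp_all add: sum.distrib distrib_right sum_distrib_left mult.assoc)
  then obtain h where h: "h \<in> coords T" "h \<noteq> (\<lambda>_. 0)" "?G h = (\<lambda>_. 0)"
    using underdetermined[of S T ?G] assms \<open>\<not> card T \<le> card S\<close> by auto
  have "F (?G h) = (\<lambda>j. \<Sum>t\<in>T. h t * F (g t) j)" by (rule lin_on_sum(2)[OF F assms(2) g(1)])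
  also have "\<dots> = (\<lambda>j. \<Sum>t\<in>T. h t * unit_at t j)" using g(2) by simp
  also have "\<dots> = h" using coords_expand[OF assms(2) h(1)] by simp
  finally show False using h(2,3) lin_on_zero[OF F] by simp
qed

text \<open>The rank formula for a kernel that is the line through \<open>u\<close>. Setting one
  coordinate \<open>s\<close> with \<open>u s \<noteq> 0\<close> to zero makes \<open>F\<close>
  injective and does not change its image.\<close>

lemma surjective_iff_card:
  fixes F :: "('s \<Rightarrow> 'k::field) \<Rightarrow> ('t \<Rightarrow> 'k)"
  assumes fin: "finite S" "finite T" and F: "lin_on S T F"
    and u: "u \<in> coords S" "u \<noteq> (\<lambda>_. 0)" "F u = (\<lambda>_. 0)"
    and ker: "\<And>x. x \<in> coords S \<Longrightarrow> F x = (\<lambda>_. 0) \<Longrightarrow> \<exists>c. x = (\<lambda>i. c * u i)"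
  shows "(\<forall>h\<in>coords T. \<exists>x\<in>coords S. F x = h) \<longleftrightarrow> card S = card T + 1"
proof -
  obtain s where s: "u s \<noteq> 0" using u(2) by (auto simp: fun_eq_iff)
  then have sS: "s \<in> S" using u(1) by (auto simp: coords_def)
  let ?S = "S - {s}"
  have sub: "x \<in> coords ?S \<Longrightarrow> x \<in> coords S" for x :: "'s \<Rightarrow> 'k" by (rule coords_mono) auto
  have F': "lin_on ?S T F" using F sub unfolding lin_on_def by blast
  have inj: "x = (\<lambda>_. 0)" if x: "x \<in> coords ?S" "F x = (\<lambda>_. 0)" for x
  proof -
    obtain c where c: "x = (\<lambda>i. c * u i)" using ker[OF sub[OF x(1)] x(2)] by blast
    have "x s = 0" by (rule coords_off[OF x(1)]) simp
    then have "c = 0" using s c by simp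
    then show ?thesis using c by simp
  qed
  have card: "card S = card ?S + 1" using card_Suc_Diff1[OF fin(1) sS] by simp
  have le: "card ?S \<le> card T"
  proof (rule ccontr)
    assume "\<not> card ?S \<le> card T"
    then show False using underdetermined[OF fin(2) _ _ F'] fin(1) inj by fastforce
  qed
  show ?thesis
  proof
    assume surj: "\<forall>h\<in>coords T. \<exists>x\<in>coords S. F x = h"
    have "\<exists>x\<in>coords ?S. F x = h" if h: "h \<in> coords T" for h
    proof -
      obtain x where x: "x \<in> coords S" "F x = h" using surj h by blast
      let ?y = "\<lambda>i. x i - (x s / u s) * u i"
      have "F ?y = h"
        using lin_on_diff[OF F x(1) coords_scale[OF u(1)], of "x s / u s"] lin_onD(3)[OF F u(1), of "x s / u s"] u(3) x(2)
        by simp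
      moreover have "?y \<in> coords S" by (rule coords_diff[OF x(1) coords_scale[OF u(1)]])
      then have "?y \<in> coords ?S" using s by (auto simp: coords_def)
      ultimately show ?thesis by blast
    qed
    then have "card T \<le> card ?S" using fin by (intro surjective_card_le[OF _ _ F']) auto
    then show "card S = card T + 1" using le card by simp
  next
    assume "card S = card T + 1"
    then have "card T \<le> card ?S" using card by simp
    have "\<exists>x\<in>coords ?S. F x = h" if "h \<in> coords T" for h
      by (rule injective_imp_surjective[OF _ fin(2) \<open>card T \<le> card ?S\<close> F' inj that]) (simp_all add: fin(1))
    then show "\<forall>h\<in>coords T. \<exists>x\<in>coords S. F x = h" using sub by blast
  qed
qed

text \<open>The map \<open>?r\<close> cuts vectors down to \<open>S\<close>. Composing with it turns
  \<open>F\<close> into a linear map on the whole function space, where a linear right inverse on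
  the image of \<open>coords S\<close> exists.\<close>

lemma generalized_inverse:
  assumes "finite S" and F: "lin_on S S (F :: ('i \<Rightarrow> 'k::field) \<Rightarrow> _)"
  shows "\<exists>g. lin_on S S g \<and> (\<forall>x\<in>coords S. F (g (F x)) = F x)"
proof -
  let ?sc = "\<lambda>(c::'k) (x::'i \<Rightarrow> 'k) i. c * x i"
  let ?r = "\<lambda>x i. if i \<in> S then x i else (0::'k)"
  interpret v: vector_space ?sc by standard (simp_all add: fun_eq_iff algebra_simps)
  interpret vp: vector_space_pair ?sc ?sc ..
  have r: "?r x \<in> coords S" for x by (simp add: coords_def)
  have rid: "?r x = x" if "x \<in> coords S" for x using that by (auto simp: coords_def fun_eq_iff)
  have radd: "?r (x + y) = (\<lambda>i. ?r x i + ?r y i)" for x y by (auto simp: fun_eq_iff)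
  have rsc: "?r (?sc c x) = (\<lambda>i. c * ?r x i)" for c x by (auto simp: fun_eq_iff)
  have lin: "Vector_Spaces.linear ?sc ?sc (\<lambda>x. F (?r x))"
    unfolding Vector_Spaces.linear_iff
  proof (intro conjI allI v.vector_space_axioms)
    fix x y :: "'i \<Rightarrow> 'k" and c :: 'k
    show "F (?r (x + y)) = F (?r x) + F (?r y)"
      unfolding radd lin_onD(2)[OF F r r] by (simp add: fun_eq_iff)
    show "F (?r (?sc c x)) = ?sc c (F (?r x))" unfolding rsc lin_onD(3)[OF F r] ..
  qed
  have sub: "v.subspace (coords S)"
    unfolding v.subspace_def by (auto simp: coords_def)
  obtain g where g: "g ` UNIV \<subseteq> coords S" "Vector_Spaces.linear ?sc ?sc g"
    "\<forall>y\<in>(\<lambda>x. F (?r x)) ` coords S. F (?r (g y)) = y"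
    using vp.linear_exists_right_inverse_on[OF lin sub] by blast
  interpret g: Vector_Spaces.linear ?sc ?sc g by (rule g(2))
  have "lin_on S S g"
  proof (rule lin_onI)
    show "g x \<in> coords S" for x using g(1) by blast
    show "g (\<lambda>i. x i + y i) = (\<lambda>j. g x j + g y j)" for x y using g.add[of x y] by (simp add: plus_fun_def)
    show "g (\<lambda>i. c * x i) = (\<lambda>j. c * g x j)" for c x using g.scale[of c x] by simp
  qed
  moreover have "F (g (F x)) = F x" if x: "x \<in> coords S" for x
  proof -
    have "F x \<in> (\<lambda>x. F (?r x)) ` coords S" using x rid[OF x] by (metis (mono_tags, lifting) imageI)
    then have "F (?r (g (F x))) = F x" using g(3) by blast
    moreover have "?r (g (F x)) = g (F x)" using g(1) by (intro rid) blast
    ultimately show ?thesis by simp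
  qed
  ultimately show ?thesis by blast
qed

section \<open>Powers of a linear operator: Fitting decomposition and eigenvectors\<close>

lemma lin_on_compow:
  assumes F: "lin_on S S F" shows "lin_on S S (F ^^ n)"
proof (induction n)
  case 0
  show ?case by (rule lin_onI) simp_all
next
  case (Suc n)
  show ?case
    by (rule lin_onI) (simp_all add: lin_onD[OF F] lin_onD[OF Suc])
qed

text \<open>The powers with exponents 0, ..., \<open>N\<close> are \<open>N + 1\<close> elements of
  a space of matrices of dimension \<open>N = card (S \<times> S)\<close>.\<close>

lemma powers_dependent:
  assumes fin: "finite S" and F: "lin_on S S (F :: ('i \<Rightarrow> 'k::field) \<Rightarrow> _)"
  shows "\<exists>N (c :: nat \<Rightarrow> 'k). (\<exists>n\<le>N. c n \<noteq> 0) \<and>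
    (\<forall>x\<in>coords S. (\<lambda>i. \<Sum>n\<le>N. c n * (F ^^ n) x i) = (\<lambda>_. 0))"
proof -
  let ?N = "card (S \<times> S)"
  let ?T = "S \<times> S"
  let ?G = "\<lambda>(c::nat \<Rightarrow> 'k) (i, s). if (i, s) \<in> ?T then \<Sum>n\<le>?N. c n * (F ^^ n) (unit_at s) i else 0"
  have "lin_on {..?N} ?T ?G"
  proof (rule lin_onI)
    show "?G c \<in> coords ?T" for c by (auto simp: coords_def)
  qed (auto simp: fun_eq_iff sum.distrib distrib_right sum_distrib_left mult.assoc)
  moreover have "card ?T < card {..?N}" by simp
  ultimately obtain c where c: "c \<in> coords {..?N}" "c \<noteq> (\<lambda>_. 0)" "?G c = (\<lambda>_. 0)"
    using underdetermined[of ?T "{..?N}" ?G] fin by auto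
  have lin: "lin_on S S (\<lambda>x i. \<Sum>n\<le>?N. c n * (F ^^ n) x i)"
  proof (rule lin_onI)
    note P = lin_onD[OF lin_on_compow[OF F]]
    show "(\<lambda>i. \<Sum>n\<le>?N. c n * (F ^^ n) x i) \<in> coords S" if "x \<in> coords S" for x
      using P(1)[OF that] by (auto simp: coords_def)
    show "(\<lambda>i. \<Sum>n\<le>?N. c n * (F ^^ n) (\<lambda>i. x i + y i) i)
      = (\<lambda>j. (\<Sum>n\<le>?N. c n * (F ^^ n) x j) + (\<Sum>n\<le>?N. c n * (F ^^ n) y j))"
      if "x \<in> coords S" "y \<in> coords S" for x y
      unfolding P(2)[OF that] by (simp add: distrib_left sum.distrib)
    show "(\<lambda>i. \<Sum>n\<le>?N. c n * (F ^^ n) (\<lambda>i. a * x i) i) = (\<lambda>j. a * (\<Sum>n\<le>?N. c n * (F ^^ n) x j))"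
      if "x \<in> coords S" for a x
      unfolding P(3)[OF that] by (simp add: sum_distrib_left mult.left_commute)
  qed
  have zero: "lin_on S S (\<lambda>_ _. 0 :: 'k)" by (rule lin_onI) simp_all
  have "(\<lambda>i. \<Sum>n\<le>?N. c n * (F ^^ n) x i) = (\<lambda>_. 0)" if "x \<in> coords S" for x
  proof (rule lin_on_eq_on_units[OF lin zero fin _ that])
    fix s assume s: "s \<in> S"
    show "(\<lambda>i. \<Sum>n\<le>?N. c n * (F ^^ n) (unit_at s) i) = (\<lambda>_. 0)"
    proof
      fix i
      show "(\<Sum>n\<le>?N. c n * (F ^^ n) (unit_at s) i) = 0"
      proof (cases "i \<in> S")
        case True
        then show ?thesis using fun_cong[OF c(3), of "(i, s)"] s by simp
      next
        case False
        then show ?thesis using lin_onD(1)[OF lin coords_unit[OF s]] by (auto simp: coords_def)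
      qed
    qed
  qed
  moreover have "\<exists>n\<le>?N. c n \<noteq> 0"
  proof -
    obtain n where "c n \<noteq> 0" using c(2) by (auto simp: fun_eq_iff)
    moreover have "n \<le> ?N" using c(1) \<open>c n \<noteq> 0\<close> by (auto simp: coords_def)
    ultimately show ?thesis by blast
  qed
  ultimately have "(\<exists>n\<le>?N. c n \<noteq> 0) \<and>
    (\<forall>x\<in>coords S. (\<lambda>i. \<Sum>n\<le>?N. c n * (F ^^ n) x i) = (\<lambda>_. 0))" by blast
  then show ?thesis by (intro exI)
qed

text \<open>Let \<open>m\<close> be the lowest exponent in a linear relation between powers of
  \<open>F\<close>. Dividing by its coefficient gives \<open>F^m = F^(m+1) e\<close> with a
  polynomial \<open>e\<close> in \<open>F\<close>, and by iteration
  \<open>F^m = F^(m+l) e^l\<close>. For \<open>G = F^(m+1)\<close> and \<open>g = e^(m+1)\<close>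
  this yields \<open>G G g = G = g G G\<close>, so that kernel and image of \<open>G\<close> are
  complementary. The exponent \<open>m + 1\<close> that is returned is positive.\<close>

lemma Fitting_operator:
  assumes fin: "finite S" and F: "lin_on S S (F :: ('i \<Rightarrow> 'k::field) \<Rightarrow> _)"
  obtains m g where "lin_on S S g" "\<And>x. x \<in> coords S \<Longrightarrow> (F ^^ m) ((F ^^ m) (g x)) = (F ^^ m) x"
    "\<And>x. x \<in> coords S \<Longrightarrow> g ((F ^^ m) ((F ^^ m) x)) = (F ^^ m) x"
    "0 < m"
proof -
  obtain N and c :: "nat \<Rightarrow> 'k" where Nc: "(\<exists>n\<le>N. c n \<noteq> 0) \<and>
    (\<forall>x\<in>coords S. (\<lambda>i. \<Sum>n\<le>N. c n * (F ^^ n) x i) = (\<lambda>_. 0))"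
    using powers_dependent[OF fin F] by (elim exE)
  note ex = conjunct1[OF Nc] and c = conjunct2[OF Nc]
  define m where "m = (LEAST n. c n \<noteq> 0)"
  have cm: "c m \<noteq> 0" using ex unfolding m_def by (metis (mono_tags, lifting) LeastI)
  have mN: "m \<le> N" using ex unfolding m_def by (metis (mono_tags, lifting) Least_le order_trans)
  have low: "c n = 0" if "n < m" for n using that not_less_Least unfolding m_def by blast
  \<comment> \<open>The coefficients of the polynomial \<open>e\<close>, found by solving the
    relation for its lowest power.\<close>
  define d where "d n = - c (Suc m + n) / c m" for n
  define e where "e = (\<lambda>x i. \<Sum>n<N - m. d n * (F ^^ n) x i)"
  note P = lin_onD[OF lin_on_compow[OF F]]
  have Fe: "(F ^^ l) (e x) = (\<lambda>i. \<Sum>n<N - m. d n * (F ^^ (l + n)) x i)" "e x \<in> coords S" if x: "x \<in> coords S" for l x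
    using lin_on_sum[OF lin_on_compow[OF F, of l], of "{..<N - m}" "\<lambda>n. (F ^^ n) x" d] P(1)[OF x]
    unfolding e_def by (simp_all add: funpow_add)
  have eF: "e ((F ^^ l) x) = (F ^^ l) (e x)" if x: "x \<in> coords S" for l x
  proof -
    have h: "(F ^^ n) ((F ^^ l) x) = (F ^^ (l + n)) x" for n
      unfolding add.commute[of l n] funpow_add o_apply ..
    have "e ((F ^^ l) x) = (\<lambda>i. \<Sum>n<N - m. d n * (F ^^ (l + n)) x i)" unfolding e_def h ..
    then show ?thesis unfolding Fe(1)[OF x] .
  qed
  have lin_e: "lin_on S S e"
  proof (rule lin_onI)
    show "e (\<lambda>i. x i + y i) = (\<lambda>j. e x j + e y j)" if "x \<in> coords S" "y \<in> coords S" for x y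
      unfolding e_def P(2)[OF that] by (simp add: distrib_left sum.distrib)
    show "e (\<lambda>i. a * x i) = (\<lambda>j. a * e x j)" if "x \<in> coords S" for a x
      unfolding e_def P(3)[OF that] by (simp add: sum_distrib_left mult.left_commute)
  qed (rule Fe(2))
  have key: "(F ^^ Suc m) (e x) = (F ^^ m) x" if x: "x \<in> coords S" for x
  proof
    fix i
    have "(\<Sum>n\<le>N. c n * (F ^^ n) x i) = 0" using bspec[OF c x] by (rule fun_cong)
    also have "{..N} = {..<m} \<union> {m} \<union> {Suc m..<Suc m + (N - m)}" using mN by auto
    also have "(\<Sum>n\<in>{..<m} \<union> {m} \<union> {Suc m..<Suc m + (N - m)}. c n * (F ^^ n) x i)
      = c m * (F ^^ m) x i + (\<Sum>n\<in>{Suc m..<Suc m + (N - m)}. c n * (F ^^ n) x i)"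
      using low by (subst sum.union_disjoint, auto)+
    also have "(\<Sum>n\<in>{Suc m..<Suc m + (N - m)}. c n * (F ^^ n) x i)
      = (\<Sum>n<N - m. c (Suc m + n) * (F ^^ (Suc m + n)) x i)"
      by (rule sum.reindex_bij_witness[of _ "\<lambda>n. Suc m + n" "\<lambda>n. n - Suc m"]) auto
    finally have "c m * (F ^^ m) x i = - (\<Sum>n<N - m. c (Suc m + n) * (F ^^ (Suc m + n)) x i)"
      by (simp only: eq_neg_iff_add_eq_0)
    then have "(F ^^ m) x i = (\<Sum>n<N - m. d n * (F ^^ (Suc m + n)) x i)"
      using cm unfolding d_def by (simp add: sum_negf sum_divide_distrib[symmetric] field_simps)
    then show "(F ^^ Suc m) (e x) i = (F ^^ m) x i" unfolding Fe(1)[OF x] by simp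
  qed
  have pow: "(F ^^ (m + l)) ((e ^^ l) x) = (F ^^ m) x \<and> (e ^^ l) x \<in> coords S" if x: "x \<in> coords S" for l x
  proof (induction l)
    case (Suc l)
    have z: "(e ^^ l) x \<in> coords S" using Suc by simp
    have idx: "m + Suc l = l + Suc m" "l + m = m + l" by simp_all
    have "(F ^^ (m + Suc l)) ((e ^^ Suc l) x) = (F ^^ l) ((F ^^ Suc m) (e ((e ^^ l) x)))"
      unfolding idx(1) funpow_add o_apply by simp
    also have "\<dots> = (F ^^ l) ((F ^^ m) ((e ^^ l) x))" unfolding key[OF z] ..
    also have "\<dots> = (F ^^ (m + l)) ((e ^^ l) x)" unfolding idx(2)[symmetric] funpow_add o_apply ..
    finally show ?case using Suc Fe(2)[OF z] by simp
  qed (simp add: x)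
  have comm: "(e ^^ l) ((F ^^ k) x) = (F ^^ k) ((e ^^ l) x)" if x: "x \<in> coords S" for l k x
  proof (induction l)
    case (Suc l)
    then show ?case using eF[of "(e ^^ l) x" k] pow[OF x, of l] by simp
  qed simp
  show ?thesis
  proof (rule that[of "e ^^ Suc m" "Suc m"])
    show "lin_on S S (e ^^ Suc m)" by (rule lin_on_compow[OF lin_e])
    fix x :: "'i \<Rightarrow> 'k" assume x: "x \<in> coords S"
    have "(F ^^ Suc m) ((F ^^ Suc m) ((e ^^ Suc m) x)) = F ((F ^^ (m + Suc m)) ((e ^^ Suc m) x))"
      by (simp only: funpow_add o_apply funpow.simps)
    also have "\<dots> = (F ^^ Suc m) x"
      unfolding conjunct1[OF pow[OF x]] by (simp only: o_apply funpow.simps)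
    finally show r: "(F ^^ Suc m) ((F ^^ Suc m) ((e ^^ Suc m) x)) = (F ^^ Suc m) x" .
    have "(e ^^ Suc m) ((F ^^ Suc m) ((F ^^ Suc m) x)) = (F ^^ Suc m) ((F ^^ Suc m) ((e ^^ Suc m) x))"
      unfolding comm[OF P(1)[OF x]] comm[OF x] ..
    then show "(e ^^ Suc m) ((F ^^ Suc m) ((F ^^ Suc m) x)) = (F ^^ Suc m) x" unfolding r .
  qed (rule zero_less_Suc)
qed

text \<open>Induction on the degree of a polynomial that annihilates \<open>x\<close>. If
  \<open>l\<close> is a root and \<open>p = (X - l) q\<close>, then \<open>F - l\<close> kills the
  vector \<open>q(F) x\<close>. This vector is an eigenvector unless it is zero, and in that case
  \<open>q\<close> annihilates \<open>x\<close>.\<close>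

lemma eigenvector_of_annihilator:
  fixes F :: "('i \<Rightarrow> 'k::alg_closed_field) \<Rightarrow> ('i \<Rightarrow> 'k)"
  assumes F: "lin_on S S F" and x: "x \<in> coords S" "x \<noteq> (\<lambda>_. 0)"
  shows "p \<noteq> 0 \<Longrightarrow> degree p \<le> N \<Longrightarrow> (\<lambda>i. \<Sum>n\<le>N. coeff p n * (F ^^ n) x i) = (\<lambda>_. 0)
    \<Longrightarrow> \<exists>l y. y \<in> coords S \<and> y \<noteq> (\<lambda>_. 0) \<and> F y = (\<lambda>i. l * y i)"
proof (induction N arbitrary: p)
  case 0
  have "coeff p 0 \<noteq> 0" using 0(1,2) by (metis le_zero_eq leading_coeff_0_iff)
  moreover have "coeff p 0 * x i = 0" for i using fun_cong[OF 0(3), of i] by simp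
  ultimately show ?case using x(2) by auto
next
  case (Suc N)
  show ?case
  proof (cases "degree p = 0")
    case True
    then have c: "coeff p 0 \<noteq> 0" "\<And>n. n > 0 \<Longrightarrow> coeff p n = 0"
      using Suc.prems(1) by (metis leading_coeff_0_iff, simp add: coeff_eq_0)
    have "coeff p 0 * x i = 0" for i
    proof -
      have "(\<Sum>n\<le>Suc N. coeff p n * (F ^^ n) x i) = (\<Sum>n\<in>{0}. coeff p n * (F ^^ n) x i)"
        by (rule sum.mono_neutral_right) (auto simp: c)
      then show ?thesis using fun_cong[OF Suc.prems(3), of i] by simp
    qed
    then show ?thesis using x(2) c by auto
  next
    case False
    then obtain l where "poly p l = 0" using alg_closed_imp_poly_has_root[of p] by auto
    then obtain q where q: "p = [:- l, 1:] * q" unfolding poly_eq_0_iff_dvd by (elim dvdE)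
    have q0: "q \<noteq> 0" using Suc.prems(1) q by auto
    have "degree p = Suc (degree q)" unfolding q using q0 by (subst degree_mult_eq) auto
    then have dq: "degree q \<le> N" using Suc.prems(2) by simp
    have cp: "coeff p n = (case n of 0 \<Rightarrow> 0 | Suc k \<Rightarrow> coeff q k) - l * coeff q n" for n
      unfolding q by (simp add: coeff_pCons algebra_simps split: nat.split)
    let ?y = "\<lambda>i. \<Sum>n\<le>N. coeff q n * (F ^^ n) x i"
    have P: "(F ^^ n) x \<in> coords S" for n using lin_onD(1)[OF lin_on_compow[OF F] x(1)] .
    have y: "?y \<in> coords S" "F ?y = (\<lambda>i. \<Sum>n\<le>N. coeff q n * (F ^^ Suc n) x i)"
      using lin_on_sum[OF F, of "{..N}" "\<lambda>n. (F ^^ n) x" "coeff q"] P by simp_all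
    have "F ?y i = l * ?y i" for i
    proof -
      have "0 = (\<Sum>n\<le>Suc N. coeff p n * (F ^^ n) x i)" using fun_cong[OF Suc.prems(3), of i] by simp
      also have "\<dots> = (\<Sum>n\<le>Suc N. (case n of 0 \<Rightarrow> 0 | Suc k \<Rightarrow> coeff q k) * (F ^^ n) x i)
          - l * (\<Sum>n\<le>Suc N. coeff q n * (F ^^ n) x i)"
        unfolding cp by (simp only: left_diff_distrib sum_subtractf sum_distrib_left mult.assoc)
      also have "(\<Sum>n\<le>Suc N. (case n of 0 \<Rightarrow> 0 | Suc k \<Rightarrow> coeff q k) * (F ^^ n) x i)
          = (\<Sum>n\<le>N. coeff q n * (F ^^ Suc n) x i)"
        by (subst sum.atMost_Suc_shift) simp
      also have "(\<Sum>n\<le>Suc N. coeff q n * (F ^^ n) x i) = ?y i"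
        using dq by (simp add: coeff_eq_0)
      finally show ?thesis unfolding y(2) by simp
    qed
    then have Fy: "F ?y = (\<lambda>i. l * ?y i)" by (rule ext)
    show ?thesis
    proof (cases "?y = (\<lambda>_. 0)")
      case True
      then show ?thesis using Suc.IH[OF q0 dq] by blast
    next
      case False
      then show ?thesis using y(1) Fy by blast
    qed
  qed
qed

lemma eigenvector_exists:
  fixes F :: "('i \<Rightarrow> 'k::alg_closed_field) \<Rightarrow> ('i \<Rightarrow> 'k)"
  assumes fin: "finite S" and ne: "S \<noteq> {}" and F: "lin_on S S F"
  obtains l y where "y \<in> coords S" "y \<noteq> (\<lambda>_. 0)" "F y = (\<lambda>i. l * y i)"
proof -
  obtain s where s: "s \<in> S" using ne by blast
  have x: "unit_at s \<in> coords S" "unit_at s \<noteq> (\<lambda>_. 0 :: 'k)"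
    using coords_unit[OF s] by (auto simp: unit_at_def fun_eq_iff)
  obtain N and c :: "nat \<Rightarrow> 'k" where Nc: "(\<exists>n\<le>N. c n \<noteq> 0) \<and>
    (\<forall>x\<in>coords S. (\<lambda>i. \<Sum>n\<le>N. c n * (F ^^ n) x i) = (\<lambda>_. 0))"
    using powers_dependent[OF fin F] by (elim exE)
  note ex = conjunct1[OF Nc] and c = conjunct2[OF Nc]
  define p where "p = (\<Sum>n\<le>N. monom (c n) n)"
  have cp: "coeff p n = (if n \<le> N then c n else 0)" for n
    unfolding p_def by (simp add: coeff_sum)
  have "p \<noteq> 0"
  proof
    assume "p = 0"
    then have "c n = 0" if "n \<le> N" for n using cp[of n] that by simp
    then show False using ex by auto
  qed
  moreover have "degree p \<le> N" by (rule degree_le) (simp add: cp)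
  moreover have "(\<lambda>i. \<Sum>n\<le>N. coeff p n * (F ^^ n) (unit_at s) i) = (\<lambda>_. 0)"
    using bspec[OF c x(1)] by (simp add: cp)
  ultimately have "\<exists>l y. y \<in> coords S \<and> y \<noteq> (\<lambda>_. 0) \<and> F y = (\<lambda>i. l * y i)"
    by (rule eigenvector_of_annihilator[OF F x])
  then show ?thesis using that by (elim exE conjE)
qed


section \<open>Modules over a path algebra\<close>

definition path_mono :: "'p \<Rightarrow> 'k::zero \<Rightarrow> 'p \<Rightarrow> 'k" where
  "path_mono p c = (\<lambda>r. if r = p then c else 0)"

definition arrow_elt :: "('v, 'e) pre_digraph \<Rightarrow> 'e \<Rightarrow> ('v, 'e) qpath \<Rightarrow> 'k::field" where
  "arrow_elt Q a = path_mono (tail Q a, [a], head Q a) 1"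

locale pa_quiver =
  fixes Q :: "('v, 'e) pre_digraph"
  assumes wf: "wf_digraph Q" and fin: "finite (verts Q)"
begin

abbreviation PA :: "(('v, 'e) qpath \<Rightarrow> 'k::field) ring" where "PA \<equiv> path_algebra Q"

lemma PA_ring: "ring (PA :: (('v, 'e) qpath \<Rightarrow> 'k::field) ring)" by (rule ring_path_algebra[OF wf fin])

lemma PA_carrier: "f \<in> carrier PA \<longleftrightarrow> finite {p. f p \<noteq> 0} \<and> (\<forall>p. f p \<noteq> 0 \<longrightarrow> p \<in> qpaths Q)"
  by (auto simp: path_algebra_def)

lemma PA_mult: "f \<otimes>\<^bsub>PA\<^esub> g = (\<lambda>r. \<Sum>(p, q)\<in>factorizations Q r. f p * g q)"
  by (simp add: path_algebra_def)

lemma PA_add: "f \<oplus>\<^bsub>PA\<^esub> g = (\<lambda>p. f p + g p)" by (simp add: path_algebra_def)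

lemma PA_zero: "\<zero>\<^bsub>PA\<^esub> = (\<lambda>p. 0)" by (simp add: path_algebra_def)

lemma PA_one: "\<one>\<^bsub>PA\<^esub> = (\<lambda>p. if \<exists>v\<in>verts Q. p = (v, [], v) then 1 else 0)" by (simp add: path_algebra_def)

lemma PA_one_closed: "\<one>\<^bsub>PA\<^esub> \<in> carrier PA"
proof -
  interpret ring "PA :: (('v, 'e) qpath \<Rightarrow> 'k::field) ring" by (rule PA_ring)
  show "(\<one>\<^bsub>PA\<^esub> :: ('v, 'e) qpath \<Rightarrow> 'k) \<in> carrier PA" by (rule one_closed)
qed

lemma scalar_mult:
  assumes f: "(f :: ('v, 'e) qpath \<Rightarrow> 'k::field) \<in> carrier PA"
  shows "scalar_elt Q c \<otimes>\<^bsub>PA\<^esub> f = (\<lambda>p. c * f p)" "f \<otimes>\<^bsub>PA\<^esub> scalar_elt Q c = (\<lambda>p. c * f p)"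
proof -
  interpret ring "PA :: (('v, 'e) qpath \<Rightarrow> 'k::field) ring" by (rule PA_ring)
  show "scalar_elt Q c \<otimes>\<^bsub>PA\<^esub> f = (\<lambda>p. c * f p)"
  proof
    fix r
    have "(scalar_elt Q c \<otimes>\<^bsub>PA\<^esub> f) r = c * (\<one>\<^bsub>PA\<^esub> \<otimes>\<^bsub>PA\<^esub> f) r"
      unfolding PA_mult scalar_elt_def by (simp add: sum_distrib_left case_prod_beta mult.assoc)
    then show "(scalar_elt Q c \<otimes>\<^bsub>PA\<^esub> f) r = c * f r" using l_one[OF f] by simp
  qed
  show "f \<otimes>\<^bsub>PA\<^esub> scalar_elt Q c = (\<lambda>p. c * f p)"
  proof
    fix r
    have "(f \<otimes>\<^bsub>PA\<^esub> scalar_elt Q c) r = c * (f \<otimes>\<^bsub>PA\<^esub> \<one>\<^bsub>PA\<^esub>) r"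
      unfolding PA_mult scalar_elt_def by (simp add: sum_distrib_left case_prod_beta mult.left_commute)
    then show "(f \<otimes>\<^bsub>PA\<^esub> scalar_elt Q c) r = c * f r" using r_one[OF f] by simp
  qed
qed

lemma PA_scale_closed:
  assumes "(f :: ('v, 'e) qpath \<Rightarrow> 'k::field) \<in> carrier PA" shows "(\<lambda>p. c * f p) \<in> carrier PA"
proof -
  have "{p. c * f p \<noteq> 0} \<subseteq> {p. f p \<noteq> 0}" by auto
  then show ?thesis using assms unfolding PA_carrier by (auto intro: finite_subset)
qed

lemma scalar_closed: "(scalar_elt Q c :: ('v, 'e) qpath \<Rightarrow> 'k::field) \<in> carrier PA"
  unfolding scalar_elt_def by (rule PA_scale_closed[OF PA_one_closed])

lemma scalar_add: "scalar_elt Q (c + d :: 'k::field) = scalar_elt Q c \<oplus>\<^bsub>PA\<^esub> scalar_elt Q d"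
  by (simp add: PA_add scalar_elt_def distrib_right)

lemma scalar_times: "scalar_elt Q c \<otimes>\<^bsub>PA\<^esub> scalar_elt Q d = scalar_elt Q (c * d :: 'k::field)"
  unfolding scalar_mult(1)[OF scalar_closed] by (simp add: scalar_elt_def mult.assoc)

lemma scalar_zero: "scalar_elt Q (0 :: 'k::field) = \<zero>\<^bsub>PA\<^esub>"
  by (simp add: scalar_elt_def PA_zero)

lemma mono_closed: "p \<in> qpaths Q \<Longrightarrow> (path_mono p c :: ('v, 'e) qpath \<Rightarrow> 'k::field) \<in> carrier PA"
proof -
  have "{r. path_mono p c r \<noteq> 0} \<subseteq> {p}" by (auto simp: path_mono_def)
  then show "p \<in> qpaths Q \<Longrightarrow> path_mono p c \<in> carrier PA"
    unfolding PA_carrier by (auto simp: path_mono_def intro: finite_subset)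
qed

lemma mono_mult:
  assumes "p \<in> qpaths Q" "q \<in> qpaths Q"
  shows "(path_mono p c :: ('v, 'e) qpath \<Rightarrow> 'k::field) \<otimes>\<^bsub>PA\<^esub> path_mono q d
    = (if src p = trg q then path_mono (src q, arrs q @ arrs p, trg p) (c * d) else (\<lambda>_. 0))"
proof
  fix r
  have "(path_mono p c \<otimes>\<^bsub>PA\<^esub> path_mono q d) r = (\<Sum>x\<in>factorizations Q r. if x = (p, q) then c * d else 0)"
    unfolding PA_mult by (intro sum.cong refl) (auto simp: path_mono_def case_prod_beta prod_eq_iff)
  also have "\<dots> = (if (p, q) \<in> factorizations Q r then c * d else 0)"
    using finite_factorizations[OF fin, of r] by simp
  also have "(p, q) \<in> factorizations Q r \<longleftrightarrow> src p = trg q \<and> r = (src q, arrs q @ arrs p, trg p)"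
    using assms by (auto simp: factorizations_def)
  finally show "(path_mono p c \<otimes>\<^bsub>PA\<^esub> path_mono q d) r
    = (if src p = trg q then path_mono (src q, arrs q @ arrs p, trg p) (c * d) else (\<lambda>_. 0)) r"
    by (auto simp: path_mono_def)
qed

lemma trivial_path: "v \<in> verts Q \<Longrightarrow> (v, [], v) \<in> qpaths Q"
  by (simp add: qpaths_def pre_digraph.awalk_def pre_digraph.cas.simps)

lemma arrow_path: "a \<in> arcs Q \<Longrightarrow> (tail Q a, [a], head Q a) \<in> qpaths Q"
  using wf by (simp add: qpaths_def pre_digraph.awalk_def pre_digraph.cas.simps wf_digraph_def)

lemma vertex_idempotent_eq: "vertex_idempotent v = path_mono (v, [], v) 1"
  by (simp add: vertex_idempotent_def path_mono_def)

lemma vertex_idempotent_closed: "v \<in> verts Q \<Longrightarrow> (vertex_idempotent v :: ('v, 'e) qpath \<Rightarrow> 'k::field) \<in> carrier PA"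
  unfolding vertex_idempotent_eq by (intro mono_closed trivial_path)

lemma arrow_elt_closed: "a \<in> arcs Q \<Longrightarrow> (arrow_elt Q a :: ('v, 'e) qpath \<Rightarrow> 'k::field) \<in> carrier PA"
  unfolding arrow_elt_def by (intro mono_closed arrow_path)

lemma arrow_idempotent:
  assumes "a \<in> arcs Q"
  shows "vertex_idempotent (head Q a) \<otimes>\<^bsub>PA\<^esub> arrow_elt Q a = (arrow_elt Q a :: ('v, 'e) qpath \<Rightarrow> 'k::field)"
    "arrow_elt Q a \<otimes>\<^bsub>PA\<^esub> vertex_idempotent (tail Q a) = (arrow_elt Q a :: ('v, 'e) qpath \<Rightarrow> 'k::field)"
proof -
  have v: "head Q a \<in> verts Q" "tail Q a \<in> verts Q" using assms wf by (simp_all add: wf_digraph_def)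
  show "vertex_idempotent (head Q a) \<otimes>\<^bsub>PA\<^esub> arrow_elt Q a = (arrow_elt Q a :: ('v, 'e) qpath \<Rightarrow> 'k::field)"
    unfolding vertex_idempotent_eq arrow_elt_def mono_mult[OF trivial_path[OF v(1)] arrow_path[OF assms]] by simp
  show "arrow_elt Q a \<otimes>\<^bsub>PA\<^esub> vertex_idempotent (tail Q a) = (arrow_elt Q a :: ('v, 'e) qpath \<Rightarrow> 'k::field)"
    unfolding vertex_idempotent_eq arrow_elt_def mono_mult[OF arrow_path[OF assms] trivial_path[OF v(2)]] by simp
qed

text \<open>Induction on the support, which reduces statements about algebra elements to multiples
  of single paths.\<close>

lemma PA_induct [consumes 1, case_names zero mono]:
  fixes f :: "('v, 'e) qpath \<Rightarrow> 'k::field"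
  assumes f: "f \<in> carrier PA" and z: "P (\<lambda>_. 0)"
    and m: "\<And>p c g. p \<in> qpaths Q \<Longrightarrow> g \<in> carrier PA \<Longrightarrow> P g \<Longrightarrow> P (path_mono p c \<oplus>\<^bsub>PA\<^esub> g)"
  shows "P f"
proof -
  have "finite S \<Longrightarrow> {p. f p \<noteq> 0} \<subseteq> S \<Longrightarrow> f \<in> carrier PA \<Longrightarrow> P f" for S and f :: "('v, 'e) qpath \<Rightarrow> 'k"
  proof (induction S arbitrary: f rule: finite_induct)
    case empty
    then have "f = (\<lambda>_. 0)" by auto
    then show ?case using z by simp
  next
    case (insert p S)
    show ?case
    proof (cases "f p = 0")
      case True
      then have "{p. f p \<noteq> 0} \<subseteq> S" using insert.prems by auto
      then show ?thesis using insert.prems(2) by (rule insert.IH)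
    next
      case False
      then have p: "p \<in> qpaths Q" using insert.prems(2) unfolding PA_carrier by blast
      let ?g = "f(p := 0)"
      have "{r. ?g r \<noteq> 0} \<subseteq> {r. f r \<noteq> 0}" by auto
      then have g: "?g \<in> carrier PA" using insert.prems(2) unfolding PA_carrier by (auto intro: finite_subset)
      have gS: "{r. ?g r \<noteq> 0} \<subseteq> S" using insert.prems by auto
      have "P ?g" by (rule insert.IH[OF gS g])
      then have "P (path_mono p (f p) \<oplus>\<^bsub>PA\<^esub> ?g)" by (rule m[OF p g])
      moreover have "path_mono p (f p) \<oplus>\<^bsub>PA\<^esub> ?g = f"
        unfolding PA_add path_mono_def by (rule ext) simp
      ultimately show ?thesis by simp
    qed
  qed
  from this[OF _ subset_refl f] show ?thesis using f unfolding PA_carrier by blast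
qed

end

locale pa_module = pa_quiver Q for Q :: "('v, 'e) pre_digraph" +
  fixes E :: "(('v, 'e) qpath \<Rightarrow> 'k::field, 'b) module"
  assumes E: "left_module (path_algebra Q) E"
begin

lemma group: "abelian_group E" using E by (simp add: left_module_def)

sublocale abelian_group E by (rule group)

abbreviation sc :: "'k \<Rightarrow> 'b \<Rightarrow> 'b" where "sc c x \<equiv> scalar_elt Q c \<odot>\<^bsub>E\<^esub> x"

lemmas act_closed = left_module.smult_closed[OF E]
lemmas act_add_left = left_module.smult_l_distr[OF E]
lemmas act_add_right = left_module.smult_r_distr[OF E]
lemmas act_assoc = left_module.smult_assoc[OF E]
lemmas act_one = left_module.smult_one[OF E]

lemma idem_zero: "y \<in> carrier E \<Longrightarrow> y \<oplus>\<^bsub>E\<^esub> y = y \<Longrightarrow> y = \<zero>\<^bsub>E\<^esub>"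
  by simp

lemma act_zero_left: "x \<in> carrier E \<Longrightarrow> (\<lambda>_. 0) \<odot>\<^bsub>E\<^esub> x = \<zero>\<^bsub>E\<^esub>"
proof -
  assume x: "x \<in> carrier E"
  have z: "(\<lambda>_. 0) \<in> carrier PA" by (simp add: PA_carrier)
  have "(\<lambda>_. 0) \<odot>\<^bsub>E\<^esub> x \<oplus>\<^bsub>E\<^esub> (\<lambda>_. 0) \<odot>\<^bsub>E\<^esub> x = (\<lambda>_. 0) \<odot>\<^bsub>E\<^esub> x"
    using act_add_left[OF z z x] by (simp add: PA_add)
  then show ?thesis using idem_zero[OF act_closed[OF z x]] by blast
qed

lemma act_zero_right: "a \<in> carrier PA \<Longrightarrow> a \<odot>\<^bsub>E\<^esub> \<zero>\<^bsub>E\<^esub> = \<zero>\<^bsub>E\<^esub>"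
proof -
  assume a: "a \<in> carrier PA"
  have "a \<odot>\<^bsub>E\<^esub> \<zero>\<^bsub>E\<^esub> \<oplus>\<^bsub>E\<^esub> a \<odot>\<^bsub>E\<^esub> \<zero>\<^bsub>E\<^esub> = a \<odot>\<^bsub>E\<^esub> \<zero>\<^bsub>E\<^esub>"
    using act_add_right[OF a zero_closed zero_closed] by simp
  then show ?thesis using idem_zero[OF act_closed[OF a zero_closed]] by blast
qed

lemma sc_closed: "x \<in> carrier E \<Longrightarrow> sc c x \<in> carrier E" by (rule act_closed[OF scalar_closed])

lemma sc_add: "x \<in> carrier E \<Longrightarrow> sc (c + d) x = sc c x \<oplus>\<^bsub>E\<^esub> sc d x"
  unfolding scalar_add by (rule act_add_left[OF scalar_closed scalar_closed])

lemma sc_sc: "x \<in> carrier E \<Longrightarrow> sc c (sc d x) = sc (c * d) x"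
  unfolding scalar_times[symmetric] by (rule act_assoc[OF scalar_closed scalar_closed, symmetric])

lemma sc_zero: "x \<in> carrier E \<Longrightarrow> sc 0 x = \<zero>\<^bsub>E\<^esub>"
  unfolding scalar_zero PA_zero by (rule act_zero_left)

lemma sc_zero_right: "sc c \<zero>\<^bsub>E\<^esub> = \<zero>\<^bsub>E\<^esub>" by (rule act_zero_right[OF scalar_closed])

lemma act_sc: "a \<in> carrier PA \<Longrightarrow> x \<in> carrier E \<Longrightarrow> a \<odot>\<^bsub>E\<^esub> sc c x = sc c (a \<odot>\<^bsub>E\<^esub> x)"
  unfolding act_assoc[OF _ scalar_closed, symmetric] act_assoc[OF scalar_closed, symmetric]
  by (simp only: scalar_mult)

lemma act_mono:
  assumes "p \<in> qpaths Q" "x \<in> carrier E"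
  shows "path_mono p c \<odot>\<^bsub>E\<^esub> x = sc c (path_mono p 1 \<odot>\<^bsub>E\<^esub> x)"
proof -
  have "scalar_elt Q c \<otimes>\<^bsub>PA\<^esub> path_mono p 1 = path_mono p c"
    unfolding scalar_mult(1)[OF mono_closed[OF assms(1)]] by (auto simp: path_mono_def)
  then show ?thesis using act_assoc[OF scalar_closed mono_closed[OF assms(1)] assms(2), of c 1] by simp
qed

lemma act_vertex:
  assumes "v \<in> verts Q" "w \<in> verts Q" "x \<in> carrier E"
  shows "vertex_idempotent v \<odot>\<^bsub>E\<^esub> (vertex_idempotent w \<odot>\<^bsub>E\<^esub> x)
    = (if v = w then vertex_idempotent w \<odot>\<^bsub>E\<^esub> x else \<zero>\<^bsub>E\<^esub>)"
proof -
  have "vertex_idempotent v \<odot>\<^bsub>E\<^esub> (vertex_idempotent w \<odot>\<^bsub>E\<^esub> x)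
      = (vertex_idempotent v \<otimes>\<^bsub>PA\<^esub> vertex_idempotent w) \<odot>\<^bsub>E\<^esub> x"
    by (rule act_assoc[OF vertex_idempotent_closed[OF assms(1)] vertex_idempotent_closed[OF assms(2)] assms(3), symmetric])
  also have "(vertex_idempotent v :: ('v, 'e) qpath \<Rightarrow> 'k) \<otimes>\<^bsub>PA\<^esub> vertex_idempotent w = (if v = w then vertex_idempotent w else (\<lambda>_. 0))"
    unfolding vertex_idempotent_eq mono_mult[OF trivial_path[OF assms(1)] trivial_path[OF assms(2)]] by simp
  finally show ?thesis using act_zero_left[OF assms(3)] by simp
qed

lemma act_arrow:
  assumes "a \<in> arcs Q" "x \<in> carrier E"
  shows "vertex_idempotent (head Q a) \<odot>\<^bsub>E\<^esub> (arrow_elt Q a \<odot>\<^bsub>E\<^esub> x) = arrow_elt Q a \<odot>\<^bsub>E\<^esub> x"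
    "arrow_elt Q a \<odot>\<^bsub>E\<^esub> (vertex_idempotent (tail Q a) \<odot>\<^bsub>E\<^esub> x) = arrow_elt Q a \<odot>\<^bsub>E\<^esub> x"
proof -
  have v: "head Q a \<in> verts Q" "tail Q a \<in> verts Q" using assms wf by (simp_all add: wf_digraph_def)
  note c = vertex_idempotent_closed[OF v(1)] vertex_idempotent_closed[OF v(2)] arrow_elt_closed[OF assms(1)]
  show "vertex_idempotent (head Q a) \<odot>\<^bsub>E\<^esub> (arrow_elt Q a \<odot>\<^bsub>E\<^esub> x) = arrow_elt Q a \<odot>\<^bsub>E\<^esub> x"
    unfolding act_assoc[OF c(1,3) assms(2), symmetric] arrow_idempotent[OF assms(1)] ..
  show "arrow_elt Q a \<odot>\<^bsub>E\<^esub> (vertex_idempotent (tail Q a) \<odot>\<^bsub>E\<^esub> x) = arrow_elt Q a \<odot>\<^bsub>E\<^esub> x"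
    unfolding act_assoc[OF c(3,2) assms(2), symmetric] arrow_idempotent[OF assms(1)] ..
qed

text \<open>The unit of the algebra is the sum of the vertex idempotents; \<open>?o S\<close> is the
  partial sum over \<open>S\<close>.\<close>

lemma vertices_separate:
  assumes "x \<in> carrier E" "y \<in> carrier E"
    and "\<And>v. v \<in> verts Q \<Longrightarrow> vertex_idempotent v \<odot>\<^bsub>E\<^esub> x = vertex_idempotent v \<odot>\<^bsub>E\<^esub> y"
  shows "x = y"
proof -
  let ?o = "\<lambda>S p. if \<exists>v\<in>S. p = (v, [], v) then 1 else (0::'k)"
  have "finite S \<Longrightarrow> S \<subseteq> verts Q \<Longrightarrow> ?o S \<in> carrier PA \<and> ?o S \<odot>\<^bsub>E\<^esub> x = ?o S \<odot>\<^bsub>E\<^esub> y" for S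
  proof (induction S rule: finite_induct)
    case empty
    show ?case using act_zero_left[OF assms(1)] act_zero_left[OF assms(2)] by (simp add: PA_carrier)
  next
    case (insert v S)
    then have v: "v \<in> verts Q" and o: "?o S \<in> carrier PA" "?o S \<odot>\<^bsub>E\<^esub> x = ?o S \<odot>\<^bsub>E\<^esub> y" by auto
    have eq: "?o (insert v S) = vertex_idempotent v \<oplus>\<^bsub>PA\<^esub> ?o S"
      using insert(2) by (auto simp: PA_add vertex_idempotent_def fun_eq_iff)
    have "?o (insert v S) \<odot>\<^bsub>E\<^esub> x = ?o (insert v S) \<odot>\<^bsub>E\<^esub> y"
      unfolding eq act_add_left[OF vertex_idempotent_closed[OF v] o(1) assms(1)]
        act_add_left[OF vertex_idempotent_closed[OF v] o(1) assms(2)] assms(3)[OF v] o(2) ..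
    moreover have "?o (insert v S) \<in> carrier PA"
    proof -
      interpret ring "PA :: (('v, 'e) qpath \<Rightarrow> 'k) ring" by (rule PA_ring)
      show ?thesis unfolding eq by (rule add.m_closed[OF vertex_idempotent_closed[OF v] o(1)])
    qed
    ultimately show ?case by blast
  qed
  from this[OF fin subset_refl] have "\<one>\<^bsub>PA\<^esub> \<odot>\<^bsub>E\<^esub> x = \<one>\<^bsub>PA\<^esub> \<odot>\<^bsub>E\<^esub> y" unfolding PA_one by blast
  then show ?thesis using act_one assms(1,2) by simp
qed

lemma additive_finsum:
  assumes E': "abelian_group E'" and "\<phi> \<in> carrier E \<rightarrow> carrier E'"
    and "\<And>x y. x \<in> carrier E \<Longrightarrow> y \<in> carrier E \<Longrightarrow> \<phi> (x \<oplus>\<^bsub>E\<^esub> y) = \<phi> x \<oplus>\<^bsub>E'\<^esub> \<phi> y"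
    and "finite I" "f \<in> I \<rightarrow> carrier E"
  shows "\<phi> (finsum E f I) = finsum E' (\<lambda>i. \<phi> (f i)) I"
proof -
  interpret E': abelian_group E' by (rule E')
  have "\<phi> \<zero>\<^bsub>E\<^esub> \<oplus>\<^bsub>E'\<^esub> \<phi> \<zero>\<^bsub>E\<^esub> = \<phi> \<zero>\<^bsub>E\<^esub>" using assms(3)[OF zero_closed zero_closed] by simp
  moreover have "\<phi> \<zero>\<^bsub>E\<^esub> \<in> carrier E'" using assms(2) zero_closed by blast
  ultimately have z: "\<phi> \<zero>\<^bsub>E\<^esub> = \<zero>\<^bsub>E'\<^esub>" by simp
  show ?thesis using assms(4,5)
  proof (induction I rule: finite_induct)
    case empty
    then show ?case using z by simp
  next
    case (insert i I)
    then have f: "f \<in> I \<rightarrow> carrier E" "f i \<in> carrier E" by auto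
    have g: "(\<lambda>i. \<phi> (f i)) \<in> I \<rightarrow> carrier E'" "\<phi> (f i) \<in> carrier E'" using f assms(2) by auto
    show ?case
      unfolding finsum_insert[OF insert(1,2) f] E'.finsum_insert[OF insert(1,2) g]
        assms(3)[OF f(2) finsum_closed[OF f(1)]] insert.IH[OF f(1)] ..
  qed
qed

text \<open>Scalars, vertex idempotents and arrows generate the path algebra: a non-trivial path is
  an arrow followed by a shorter path, and a general element is a combination of paths.\<close>

lemma hom_on_generators:
  fixes E' :: "(('v, 'e) qpath \<Rightarrow> 'k, 'c) module"
  assumes E': "left_module PA E'" and h: "h \<in> carrier E \<rightarrow> carrier E'"
    and add: "\<And>x y. x \<in> carrier E \<Longrightarrow> y \<in> carrier E \<Longrightarrow> h (x \<oplus>\<^bsub>E\<^esub> y) = h x \<oplus>\<^bsub>E'\<^esub> h y"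
    and scal: "\<And>c x. x \<in> carrier E \<Longrightarrow> h (sc c x) = scalar_elt Q c \<odot>\<^bsub>E'\<^esub> h x"
    and vert: "\<And>v x. v \<in> verts Q \<Longrightarrow> x \<in> carrier E \<Longrightarrow> h (vertex_idempotent v \<odot>\<^bsub>E\<^esub> x) = vertex_idempotent v \<odot>\<^bsub>E'\<^esub> h x"
    and arr: "\<And>a x. a \<in> arcs Q \<Longrightarrow> x \<in> carrier E \<Longrightarrow> h (arrow_elt Q a \<odot>\<^bsub>E\<^esub> x) = arrow_elt Q a \<odot>\<^bsub>E'\<^esub> h x"
  shows "h \<in> left_module_hom PA E E'"
proof -
  interpret E': pa_module Q E' by (rule pa_module.intro[OF pa_quiver_axioms pa_module_axioms.intro[OF E']])
  have hc: "x \<in> carrier E \<Longrightarrow> h x \<in> carrier E'" for x using h by blast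
  have path: "\<forall>x\<in>carrier E. h (path_mono (u, as, v) 1 \<odot>\<^bsub>E\<^esub> x) = path_mono (u, as, v) 1 \<odot>\<^bsub>E'\<^esub> h x"
    if "(u, as, v) \<in> qpaths Q" for u as v
    using that
  proof (induction as arbitrary: u)
    case Nil
    then have "u = v" "v \<in> verts Q" by (auto simp: qpaths_def pre_digraph.awalk_def pre_digraph.cas.simps)
    then show ?case using vert unfolding vertex_idempotent_eq by simp
  next
    case (Cons a as)
    have a: "a \<in> arcs Q" "tail Q a = u" "(head Q a, as, v) \<in> qpaths Q"
      using Cons.prems wf by (auto simp: qpaths_def pre_digraph.awalk_def pre_digraph.cas.simps wf_digraph_def)
    have eq: "(path_mono (u, a # as, v) 1 :: ('v, 'e) qpath \<Rightarrow> 'k) = path_mono (head Q a, as, v) 1 \<otimes>\<^bsub>PA\<^esub> arrow_elt Q a"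
      unfolding arrow_elt_def mono_mult[OF a(3) arrow_path[OF a(1)]] using a(2) by simp
    note c = mono_closed[OF a(3)] arrow_elt_closed[OF a(1)]
    show ?case
    proof
      fix x assume x: "x \<in> carrier E"
      have "h (path_mono (u, a # as, v) 1 \<odot>\<^bsub>E\<^esub> x) = h (path_mono (head Q a, as, v) 1 \<odot>\<^bsub>E\<^esub> (arrow_elt Q a \<odot>\<^bsub>E\<^esub> x))"
        unfolding eq act_assoc[OF c x] ..
      also have "\<dots> = path_mono (head Q a, as, v) 1 \<odot>\<^bsub>E'\<^esub> h (arrow_elt Q a \<odot>\<^bsub>E\<^esub> x)"
        using Cons.IH[OF a(3)] act_closed[OF c(2) x] by blast
      also have "\<dots> = path_mono (u, a # as, v) 1 \<odot>\<^bsub>E'\<^esub> h x"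
        unfolding arr[OF a(1) x] eq E'.act_assoc[OF c hc[OF x]] ..
      finally show "h (path_mono (u, a # as, v) 1 \<odot>\<^bsub>E\<^esub> x) = path_mono (u, a # as, v) 1 \<odot>\<^bsub>E'\<^esub> h x" .
    qed
  qed
  have all: "\<forall>x\<in>carrier E. h (f \<odot>\<^bsub>E\<^esub> x) = f \<odot>\<^bsub>E'\<^esub> h x" if "f \<in> carrier PA" for f
    using that
  proof (induction rule: PA_induct)
    case zero
    have "h \<zero>\<^bsub>E\<^esub> = \<zero>\<^bsub>E'\<^esub>"
      using scal[OF zero_closed, of 0] sc_zero[OF zero_closed] E'.sc_zero[OF hc[OF zero_closed]] by simp
    then show ?case using act_zero_left E'.act_zero_left hc by simp
  next
    case (mono p c g)
    show ?case
    proof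
      fix x assume x: "x \<in> carrier E"
      note pc = mono_closed[OF mono(1)]
      obtain u as v where p: "p = (u, as, v)" by (cases p)
      have px: "path_mono p 1 \<odot>\<^bsub>E\<^esub> x \<in> carrier E" by (rule act_closed[OF pc x])
      have "h ((path_mono p c \<oplus>\<^bsub>PA\<^esub> g) \<odot>\<^bsub>E\<^esub> x) = h (sc c (path_mono p 1 \<odot>\<^bsub>E\<^esub> x)) \<oplus>\<^bsub>E'\<^esub> h (g \<odot>\<^bsub>E\<^esub> x)"
        unfolding act_add_left[OF pc mono(2) x] act_mono[OF mono(1) x, of c]
        by (rule add[OF sc_closed[OF px] act_closed[OF mono(2) x]])
      also have "\<dots> = scalar_elt Q c \<odot>\<^bsub>E'\<^esub> (path_mono p 1 \<odot>\<^bsub>E'\<^esub> h x) \<oplus>\<^bsub>E'\<^esub> g \<odot>\<^bsub>E'\<^esub> h x"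
        using scal[OF px, of c] path[of u as v] mono(1,3) x unfolding p by simp
      also have "\<dots> = (path_mono p c \<oplus>\<^bsub>PA\<^esub> g) \<odot>\<^bsub>E'\<^esub> h x"
        unfolding E'.act_add_left[OF pc mono(2) hc[OF x]] E'.act_mono[OF mono(1) hc[OF x], of c] ..
      finally show "h ((path_mono p c \<oplus>\<^bsub>PA\<^esub> g) \<odot>\<^bsub>E\<^esub> x) = (path_mono p c \<oplus>\<^bsub>PA\<^esub> g) \<odot>\<^bsub>E'\<^esub> h x" .
    qed
  qed
  show ?thesis unfolding left_module_hom_def using h add all by blast
qed

end


section \<open>Representations with a basis\<close>

definition restr :: "nat set \<Rightarrow> (nat \<Rightarrow> 'v) \<Rightarrow> 'v \<Rightarrow> (nat \<Rightarrow> 'k::zero) \<Rightarrow> nat \<Rightarrow> 'k" where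
  "restr B vt v x = (\<lambda>i. if i \<in> B \<and> vt i = v then x i else 0)"

text \<open>The restrictions on both sides cut a map of the whole space down to one from the tail
  space to the head space. In this way every family of linear maps defines a representation.\<close>

definition arrow_op :: "('v, 'e) pre_digraph \<Rightarrow> nat set \<Rightarrow> (nat \<Rightarrow> 'v) \<Rightarrow> ('e \<Rightarrow> (nat \<Rightarrow> 'k::zero) \<Rightarrow> nat \<Rightarrow> 'k)
    \<Rightarrow> 'e \<Rightarrow> (nat \<Rightarrow> 'k) \<Rightarrow> nat \<Rightarrow> 'k" where
  "arrow_op Q B vt X a x = restr B vt (head Q a) (X a (restr B vt (tail Q a) x))"

definition path_op :: "('v, 'e) pre_digraph \<Rightarrow> nat set \<Rightarrow> (nat \<Rightarrow> 'v) \<Rightarrow> ('e \<Rightarrow> (nat \<Rightarrow> 'k::zero) \<Rightarrow> nat \<Rightarrow> 'k)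
    \<Rightarrow> ('v, 'e) qpath \<Rightarrow> (nat \<Rightarrow> 'k) \<Rightarrow> nat \<Rightarrow> 'k" where
  "path_op Q B vt X p x = foldl (\<lambda>y a. arrow_op Q B vt X a y) (restr B vt (src p) x) (arrs p)"

text \<open>
  The representation with basis \<open>B\<close>, the basis vector \<open>i\<close> sitting at the vertex \<open>vt i\<close>, as a module.
\<close>

definition std_module :: "('v, 'e) pre_digraph \<Rightarrow> nat set \<Rightarrow> (nat \<Rightarrow> 'v) \<Rightarrow> ('e \<Rightarrow> (nat \<Rightarrow> 'k::field) \<Rightarrow> nat \<Rightarrow> 'k)
    \<Rightarrow> ('v, 'e, 'k) kQ_module" where
  "std_module Q B vt X = \<lparr> carrier = coords B, mult = (\<lambda>_ _. undefined), one = undefined,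
     zero = (\<lambda>_. 0), add = (\<lambda>x y i. x i + y i),
     smult = (\<lambda>f x i. \<Sum>p | f p \<noteq> 0. f p * path_op Q B vt X p x i) \<rparr>"

lemma std_module_simps [simp]:
  "carrier (std_module Q B vt X) = coords B"
  "\<zero>\<^bsub>std_module Q B vt X\<^esub> = (\<lambda>_. 0)"
  "x \<oplus>\<^bsub>std_module Q B vt X\<^esub> y = (\<lambda>i. x i + y i)"
  by (simp_all add: std_module_def)

lemma restr_restr: "restr B vt v (restr B vt w x) = (if v = w then restr B vt v x else (\<lambda>_. 0))"
  by (auto simp: restr_def fun_eq_iff)

lemma restr_lin: "lin_on B B (restr B vt v :: (nat \<Rightarrow> 'k::field) \<Rightarrow> _)"
  by (rule lin_onI) (auto simp: restr_def coords_def fun_eq_iff)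

lemma restr_zero [simp]: "restr B vt v (\<lambda>_. 0) = (\<lambda>_. 0)" by (simp add: restr_def)

locale std_quiver = pa_quiver Q for Q :: "('v, 'e) pre_digraph" +
  fixes B :: "nat set" and vt :: "nat \<Rightarrow> 'v" and X :: "'e \<Rightarrow> (nat \<Rightarrow> 'k::field) \<Rightarrow> nat \<Rightarrow> 'k"
  assumes finB: "finite B" and vtB: "i \<in> B \<Longrightarrow> vt i \<in> verts Q"
    and X_lin: "a \<in> arcs Q \<Longrightarrow> lin_on B B (X a)"
begin

abbreviation "res \<equiv> (restr B vt :: 'v \<Rightarrow> (nat \<Rightarrow> 'k) \<Rightarrow> _)"
abbreviation "Xa \<equiv> arrow_op Q B vt X"
abbreviation "Pp \<equiv> path_op Q B vt X"
abbreviation "M \<equiv> std_module Q B vt X"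

lemma arrow_lin: "a \<in> arcs Q \<Longrightarrow> lin_on B B (Xa a)"
proof -
  assume a: "a \<in> arcs Q"
  note R = lin_onD[OF restr_lin] and X = lin_onD[OF X_lin[OF a]]
  show ?thesis
    unfolding arrow_op_def
    by (rule lin_onI) (simp_all only: R X)
qed

lemma foldl_lin:
  "set as \<subseteq> arcs Q \<Longrightarrow> lin_on B B F \<Longrightarrow> lin_on B B (\<lambda>x. foldl (\<lambda>y a. Xa a y) (F x) as)"
proof (induction as arbitrary: F)
  case Nil
  then show ?case by simp
next
  case (Cons a as)
  note A = lin_onD[OF arrow_lin[of a]] and F = lin_onD[OF Cons.prems(2)]
  have a: "a \<in> arcs Q" "set as \<subseteq> arcs Q" using Cons.prems(1) by simp_all
  have "lin_on B B (\<lambda>x. Xa a (F x))"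
    by (rule lin_onI) (simp_all only: A[OF a(1)] F)
  from Cons.IH[OF a(2) this] show ?case by simp
qed

lemma path_arcs: "p \<in> qpaths Q \<Longrightarrow> set (arrs p) \<subseteq> arcs Q"
  by (simp add: qpaths_iff pre_digraph.awalk_def)

lemma path_lin: "p \<in> qpaths Q \<Longrightarrow> lin_on B B (Pp p)"
  unfolding path_op_def by (rule foldl_lin[OF path_arcs restr_lin])

lemma foldl_supported:
  "pre_digraph.cas Q u as w \<Longrightarrow> res u y = y \<Longrightarrow>
     res w (foldl (\<lambda>y a. Xa a y) y as) = foldl (\<lambda>y a. Xa a y) y as"
proof (induction as arbitrary: u y)
  case Nil
  then show ?case by (simp add: pre_digraph.cas.simps)
next
  case (Cons a as)
  have "pre_digraph.cas Q (head Q a) as w" using Cons.prems(1) by (simp add: pre_digraph.cas.simps)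
  moreover have "res (head Q a) (Xa a y) = Xa a y" unfolding arrow_op_def restr_restr by simp
  ultimately show ?case using Cons.IH by simp
qed

lemma path_op_supported: "p \<in> qpaths Q \<Longrightarrow> res (trg p) (Pp p x) = Pp p x"
  unfolding path_op_def qpaths_iff pre_digraph.awalk_def
  by (rule foldl_supported[of "src p"]) (simp_all add: restr_restr)

lemma foldl_zero: "set as \<subseteq> arcs Q \<Longrightarrow> foldl (\<lambda>y a. Xa a y) (\<lambda>_. 0) as = (\<lambda>_. 0)"
proof (induction as)
  case (Cons a as)
  then show ?case using lin_on_zero[OF arrow_lin[of a]] by simp
qed simp

lemma path_op_compose:
  assumes "p \<in> qpaths Q" "q \<in> qpaths Q"
  shows "Pp p (Pp q x) = (if src p = trg q then Pp (src q, arrs q @ arrs p, trg p) x else (\<lambda>_. 0))"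
proof (cases "src p = trg q")
  case True
  have "res (src p) (Pp q x) = Pp q x" unfolding True by (rule path_op_supported[OF assms(2)])
  then show ?thesis using True unfolding path_op_def[of Q B vt X p] by (simp add: path_op_def)
next
  case False
  have "res (src p) (Pp q x) = res (src p) (res (trg q) (Pp q x))" unfolding path_op_supported[OF assms(2)] ..
  also have "\<dots> = (\<lambda>_. 0)" using False by (simp add: restr_restr)
  finally show ?thesis using False foldl_zero[OF path_arcs[OF assms(1)]]
    unfolding path_op_def[of Q B vt X p] by simp
qed

text \<open>Elements with different supports are compared by summing over a common finite set that
  contains both supports.\<close>

lemma act_sup:
  assumes "finite S" "{p. f p \<noteq> 0} \<subseteq> S"
  shows "(f \<odot>\<^bsub>M\<^esub> x) = (\<lambda>i. \<Sum>p\<in>S. f p * Pp p x i)"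
proof
  fix i
  have "(\<Sum>p | f p \<noteq> 0. f p * Pp p x i) = (\<Sum>p\<in>S. f p * Pp p x i)"
    by (rule sum.mono_neutral_left[OF assms]) simp
  then show "(f \<odot>\<^bsub>M\<^esub> x) i = (\<Sum>p\<in>S. f p * Pp p x i)" by (simp add: std_module_def)
qed

lemma act_path_mono: "path_mono p c \<odot>\<^bsub>M\<^esub> x = (\<lambda>i. c * Pp p x i)"
  by (subst act_sup[of "{p}"]) (auto simp: path_mono_def)

lemma act_zero: "(\<lambda>_. 0) \<odot>\<^bsub>M\<^esub> x = (\<lambda>_. 0)"
  by (subst act_sup[of "{}"]) simp_all

lemma act_plus:
  assumes "f \<in> carrier PA" "g \<in> carrier PA"
  shows "(f \<oplus>\<^bsub>PA\<^esub> g) \<odot>\<^bsub>M\<^esub> x = (\<lambda>i. (f \<odot>\<^bsub>M\<^esub> x) i + (g \<odot>\<^bsub>M\<^esub> x) i)"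
proof -
  let ?S = "{p. f p \<noteq> 0} \<union> {p. g p \<noteq> 0}"
  have S: "finite ?S" using assms unfolding PA_carrier by simp
  have sub: "{p. (f \<oplus>\<^bsub>PA\<^esub> g) p \<noteq> 0} \<subseteq> ?S" "{p. f p \<noteq> 0} \<subseteq> ?S" "{p. g p \<noteq> 0} \<subseteq> ?S"
    by (auto simp: PA_add)
  show ?thesis unfolding act_sup[OF S sub(1)] act_sup[OF S sub(2)] act_sup[OF S sub(3)]
    by (simp add: PA_add distrib_right sum.distrib)
qed

lemma act_lin: "f \<in> carrier PA \<Longrightarrow> lin_on B B (\<lambda>x. f \<odot>\<^bsub>M\<^esub> x)"
proof -
  assume f: "f \<in> carrier PA"
  have fin': "finite {p. f p \<noteq> 0}" and P: "\<And>p. p \<in> {p. f p \<noteq> 0} \<Longrightarrow> lin_on B B (Pp p)"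
    using f path_lin unfolding PA_carrier by auto
  show ?thesis unfolding act_sup[OF fin' subset_refl]
  proof (rule lin_onI)
    fix x :: "nat \<Rightarrow> 'k" assume x: "x \<in> coords B"
    show "(\<lambda>i. \<Sum>p | f p \<noteq> 0. f p * Pp p x i) \<in> coords B"
      using lin_onD(1)[OF P x] by (auto simp: coords_def intro!: sum.neutral)
    show "(\<lambda>i. \<Sum>p | f p \<noteq> 0. f p * Pp p (\<lambda>i. c * x i) i) = (\<lambda>i. c * (\<Sum>p | f p \<noteq> 0. f p * Pp p x i))" for c
      unfolding sum_distrib_left by (intro ext sum.cong refl) (simp add: lin_onD(3)[OF P x])
    fix y :: "nat \<Rightarrow> 'k" assume y: "y \<in> coords B"
    show "(\<lambda>i. \<Sum>p | f p \<noteq> 0. f p * Pp p (\<lambda>i. x i + y i) i)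
      = (\<lambda>i. (\<Sum>p | f p \<noteq> 0. f p * Pp p x i) + (\<Sum>p | f p \<noteq> 0. f p * Pp p y i))"
      unfolding sum.distrib[symmetric] by (intro ext sum.cong refl) (simp add: lin_onD(2)[OF P x y] distrib_left)
  qed
qed

lemma PA_mult_zero: "(\<lambda>_. 0) \<otimes>\<^bsub>PA\<^esub> g = (\<lambda>_. 0 :: 'k)" "g \<otimes>\<^bsub>PA\<^esub> (\<lambda>_. 0) = (\<lambda>_. 0 :: 'k)"
  unfolding PA_mult by (simp_all add: case_prod_beta)

lemma act_mult:
  assumes f: "f \<in> carrier PA" and g: "g \<in> carrier PA" and x: "x \<in> coords B"
  shows "(f \<otimes>\<^bsub>PA\<^esub> g) \<odot>\<^bsub>M\<^esub> x = f \<odot>\<^bsub>M\<^esub> (g \<odot>\<^bsub>M\<^esub> x)"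
proof -
  interpret R: ring "PA :: (('v, 'e) qpath \<Rightarrow> 'k) ring" by (rule PA_ring)
  have mono: "(path_mono p c \<otimes>\<^bsub>PA\<^esub> g) \<odot>\<^bsub>M\<^esub> x = path_mono p c \<odot>\<^bsub>M\<^esub> (g \<odot>\<^bsub>M\<^esub> x)"
    if p: "p \<in> qpaths Q" for p c
    using g
  proof (induction rule: PA_induct)
    case zero
    show ?case unfolding PA_mult_zero act_zero act_path_mono lin_on_zero[OF path_lin[OF p]] by simp
  next
    case (mono q d h)
    note P = path_lin[OF p] and Pq = path_lin[OF mono(1)]
    have y: "Pp q x \<in> coords B" by (rule lin_onD(1)[OF Pq x])
    have hx: "h \<odot>\<^bsub>M\<^esub> x \<in> coords B" by (rule lin_onD(1)[OF act_lin[OF mono(2)] x])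
    note c1 = mono_closed[OF p, of c] and c2 = mono_closed[OF mono(1), of d]
    have "(path_mono p c \<otimes>\<^bsub>PA\<^esub> path_mono q d) \<odot>\<^bsub>M\<^esub> x = (\<lambda>i. c * (d * Pp p (Pp q x) i))"
      unfolding mono_mult[OF p mono(1)] path_op_compose[OF p mono(1)]
      by (cases "src p = trg q") (simp_all add: act_path_mono act_zero mult.assoc)
    then have "(path_mono p c \<otimes>\<^bsub>PA\<^esub> (path_mono q d \<oplus>\<^bsub>PA\<^esub> h)) \<odot>\<^bsub>M\<^esub> x
        = (\<lambda>i. c * (d * Pp p (Pp q x) i) + c * Pp p (h \<odot>\<^bsub>M\<^esub> x) i)"
      unfolding R.r_distr[OF c2 mono(2) c1] act_plus[OF R.m_closed[OF c1 c2] R.m_closed[OF c1 mono(2)]] mono(3)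
      by (simp add: act_path_mono)
    also have "\<dots> = path_mono p c \<odot>\<^bsub>M\<^esub> ((path_mono q d \<oplus>\<^bsub>PA\<^esub> h) \<odot>\<^bsub>M\<^esub> x)"
      unfolding act_plus[OF c2 mono(2)] act_path_mono lin_onD(2)[OF P coords_scale[OF y] hx] lin_onD(3)[OF P y]
      by (simp add: distrib_left)
    finally show ?case .
  qed
  have gx: "g \<odot>\<^bsub>M\<^esub> x \<in> coords B" by (rule lin_onD(1)[OF act_lin[OF g] x])
  show ?thesis using f
  proof (induction rule: PA_induct)
    case zero
    show ?case unfolding PA_mult_zero act_zero ..
  next
    case m: (mono p c h)
    note c1 = mono_closed[OF m(1), of c]
    show ?case
      unfolding R.l_distr[OF c1 m(2) g] act_plus[OF R.m_closed[OF c1 g] R.m_closed[OF m(2) g]]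
        act_plus[OF c1 m(2)] m(3) mono[OF m(1)] ..
  qed
qed

lemma act_unit:
  assumes x: "x \<in> coords B" shows "\<one>\<^bsub>PA\<^esub> \<odot>\<^bsub>M\<^esub> x = x"
proof
  fix i
  have "{p. \<one>\<^bsub>PA\<^esub> p \<noteq> (0::'k)} \<subseteq> (\<lambda>v. (v, [], v)) ` verts Q" by (auto simp: PA_one split: if_splits)
  then have "(\<one>\<^bsub>PA\<^esub> \<odot>\<^bsub>M\<^esub> x) i = (\<Sum>p\<in>(\<lambda>v. (v, [], v)) ` verts Q. \<one>\<^bsub>PA\<^esub> p * Pp p x i)"
    using act_sup[of "(\<lambda>v. (v, [], v)) ` verts Q" "\<one>\<^bsub>PA\<^esub>" x] fin by simp
  also have "\<dots> = (\<Sum>v\<in>verts Q. res v x i)"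
    by (subst sum.reindex) (auto simp: inj_on_def PA_one path_op_def intro!: sum.cong)
  also have "\<dots> = x i"
  proof (cases "i \<in> B")
    case True
    have "(\<Sum>v\<in>verts Q. res v x i) = (\<Sum>v\<in>verts Q. if v = vt i then x i else 0)"
      using True by (intro sum.cong refl) (auto simp: restr_def)
    then show ?thesis using fin vtB[OF True] by simp
  next
    case False
    then show ?thesis using coords_off[OF x] by (simp add: restr_def)
  qed
  finally show "(\<one>\<^bsub>PA\<^esub> \<odot>\<^bsub>M\<^esub> x) i = x i" .
qed

lemma std_left_module: "left_module PA M"
proof (intro left_module.intro left_module_axioms.intro)
  show "ring (PA :: (('v, 'e) qpath \<Rightarrow> 'k) ring)" by (rule PA_ring)
  show "abelian_group M"
  proof (rule abelian_groupI)
    fix x assume "x \<in> carrier M"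
    then have "(\<lambda>i. (- 1) * x i) \<in> carrier M" using coords_scale[of x B "- 1"] by simp
    then show "\<exists>y\<in>carrier M. y \<oplus>\<^bsub>M\<^esub> x = \<zero>\<^bsub>M\<^esub>" by (rule bexI[rotated]) simp
  qed (simp_all add: coords_add add_ac)
  fix a b :: "('v, 'e) qpath \<Rightarrow> 'k" and x y :: "nat \<Rightarrow> 'k"
  show "a \<odot>\<^bsub>M\<^esub> x \<in> carrier M" if "a \<in> carrier PA" "x \<in> carrier M"
    using lin_onD(1)[OF act_lin[OF that(1)]] that(2) by simp
  show "(a \<oplus>\<^bsub>PA\<^esub> b) \<odot>\<^bsub>M\<^esub> x = a \<odot>\<^bsub>M\<^esub> x \<oplus>\<^bsub>M\<^esub> b \<odot>\<^bsub>M\<^esub> x" if "a \<in> carrier PA" "b \<in> carrier PA"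
    unfolding act_plus[OF that] by simp
  show "a \<odot>\<^bsub>M\<^esub> (x \<oplus>\<^bsub>M\<^esub> y) = a \<odot>\<^bsub>M\<^esub> x \<oplus>\<^bsub>M\<^esub> a \<odot>\<^bsub>M\<^esub> y"
    if "a \<in> carrier PA" "x \<in> carrier M" "y \<in> carrier M"
    using lin_onD(2)[OF act_lin[OF that(1)]] that(2,3) by simp
  show "(a \<otimes>\<^bsub>PA\<^esub> b) \<odot>\<^bsub>M\<^esub> x = a \<odot>\<^bsub>M\<^esub> (b \<odot>\<^bsub>M\<^esub> x)"
    if "a \<in> carrier PA" "b \<in> carrier PA" "x \<in> carrier M"
    using act_mult[OF that(1,2)] that(3) by simp
  show "\<one>\<^bsub>PA\<^esub> \<odot>\<^bsub>M\<^esub> x = x" if "x \<in> carrier M"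
    using act_unit that by simp
qed

sublocale Mod: pa_module Q M
  by (rule pa_module.intro[OF pa_quiver_axioms pa_module_axioms.intro[OF std_left_module]])

lemma act_scalar: "x \<in> coords B \<Longrightarrow> scalar_elt Q c \<odot>\<^bsub>M\<^esub> x = (\<lambda>i. c * x i)"
proof -
  assume x: "x \<in> coords B"
  have f: "finite {p. \<one>\<^bsub>PA\<^esub> p \<noteq> (0::'k)}" using PA_one_closed unfolding PA_carrier by blast
  have s: "{p. (scalar_elt Q c :: ('v, 'e) qpath \<Rightarrow> 'k) p \<noteq> 0} \<subseteq> {p. \<one>\<^bsub>PA\<^esub> p \<noteq> (0::'k)}"
    by (auto simp: scalar_elt_def)
  have "scalar_elt Q c \<odot>\<^bsub>M\<^esub> x = (\<lambda>i. c * (\<one>\<^bsub>PA\<^esub> \<odot>\<^bsub>M\<^esub> x) i)"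
    unfolding act_sup[OF f s] act_sup[OF f subset_refl] by (simp add: scalar_elt_def sum_distrib_left mult.assoc)
  then show ?thesis unfolding act_unit[OF x] .
qed

lemma act_vertex: "vertex_idempotent v \<odot>\<^bsub>M\<^esub> x = res v x"
  unfolding vertex_idempotent_eq act_path_mono by (simp add: path_op_def)

lemma act_arrow: "arrow_elt Q a \<odot>\<^bsub>M\<^esub> x = Xa a x"
  unfolding arrow_elt_def act_path_mono by (simp add: path_op_def arrow_op_def restr_restr)

lemma std_submodule:
  assumes W: "W \<subseteq> coords B" "(\<lambda>_. 0) \<in> W"
    and add: "\<And>x y. x \<in> W \<Longrightarrow> y \<in> W \<Longrightarrow> (\<lambda>i. x i + y i) \<in> W"
    and scale: "\<And>c x. x \<in> W \<Longrightarrow> (\<lambda>i. c * x i) \<in> W"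
    and vert: "\<And>v x. v \<in> verts Q \<Longrightarrow> x \<in> W \<Longrightarrow> res v x \<in> W"
    and arr: "\<And>a x. a \<in> arcs Q \<Longrightarrow> x \<in> W \<Longrightarrow> Xa a x \<in> W"
  shows "left_submodule PA M W"
proof -
  have fold: "set as \<subseteq> arcs Q \<Longrightarrow> y \<in> W \<Longrightarrow> foldl (\<lambda>y a. Xa a y) y as \<in> W" for as y
    by (induction as arbitrary: y) (simp_all add: arr)
  have path: "Pp p x \<in> W" if "p \<in> qpaths Q" "x \<in> W" for p x
    unfolding path_op_def
  proof (rule fold[OF path_arcs[OF that(1)]])
    have "src p \<in> verts Q" using that(1) by (simp add: qpaths_iff pre_digraph.awalk_def)
    then show "res (src p) x \<in> W" by (rule vert[OF _ that(2)])
  qed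
  have "f \<odot>\<^bsub>M\<^esub> x \<in> W" if "f \<in> carrier PA" "x \<in> W" for f x
    using that(1)
  proof (induction rule: PA_induct)
    case zero
    show ?case unfolding act_zero by (rule W(2))
  next
    case (mono p c g)
    show ?case unfolding act_plus[OF mono_closed[OF mono(1)] mono(2)] act_path_mono
      by (intro add scale path mono that)
  qed
  then show ?thesis unfolding left_submodule_def using W add by simp
qed

lemma std_hom:
  fixes E :: "(('v, 'e) qpath \<Rightarrow> 'k, 'c) module"
  assumes E: "left_module PA E" and h: "h \<in> coords B \<rightarrow> carrier E"
    and add: "\<And>x y. x \<in> coords B \<Longrightarrow> y \<in> coords B \<Longrightarrow> h (\<lambda>i. x i + y i) = h x \<oplus>\<^bsub>E\<^esub> h y"
    and scale: "\<And>c x. x \<in> coords B \<Longrightarrow> h (\<lambda>i. c * x i) = scalar_elt Q c \<odot>\<^bsub>E\<^esub> h x"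
    and vert: "\<And>v x. v \<in> verts Q \<Longrightarrow> x \<in> coords B \<Longrightarrow> h (res v x) = vertex_idempotent v \<odot>\<^bsub>E\<^esub> h x"
    and arr: "\<And>a x. a \<in> arcs Q \<Longrightarrow> x \<in> coords B \<Longrightarrow> h (Xa a x) = arrow_elt Q a \<odot>\<^bsub>E\<^esub> h x"
  shows "h \<in> left_module_hom PA M E"
proof (rule Mod.hom_on_generators[OF E])
  show "h \<in> carrier M \<rightarrow> carrier E" using h by simp
  show "h (x \<oplus>\<^bsub>M\<^esub> y) = h x \<oplus>\<^bsub>E\<^esub> h y" if "x \<in> carrier M" "y \<in> carrier M" for x y
    using add that by simp
  show "h (scalar_elt Q c \<odot>\<^bsub>M\<^esub> x) = scalar_elt Q c \<odot>\<^bsub>E\<^esub> h x" if "x \<in> carrier M" for c x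
    using scale[of x c] that act_scalar[of x c] by simp
  show "h (vertex_idempotent v \<odot>\<^bsub>M\<^esub> x) = vertex_idempotent v \<odot>\<^bsub>E\<^esub> h x" if "v \<in> verts Q" "x \<in> carrier M" for v x
    using vert that act_vertex[of v x] by simp
  show "h (arrow_elt Q a \<odot>\<^bsub>M\<^esub> x) = arrow_elt Q a \<odot>\<^bsub>E\<^esub> h x" if "a \<in> arcs Q" "x \<in> carrier M" for a x
    using arr that act_arrow[of a x] by simp
qed

lemma std_vertex_space: "vertex_space M v = coords {i \<in> B. vt i = v}"
proof
  show "vertex_space M v \<subseteq> coords {i \<in> B. vt i = v}"
    unfolding vertex_space_def act_vertex by (auto simp: restr_def coords_def)
  show "coords {i \<in> B. vt i = v} \<subseteq> vertex_space M v"
  proof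
    fix x :: "nat \<Rightarrow> 'k" assume x: "x \<in> coords {i \<in> B. vt i = v}"
    then have "x \<in> coords B" "res v x = x" by (auto simp: coords_def restr_def fun_eq_iff)
    then show "x \<in> vertex_space M v" unfolding vertex_space_def act_vertex by (metis imageI std_module_simps(1))
  qed
qed

lemma std_finsum:
  assumes "finite I" "\<And>j. j \<in> I \<Longrightarrow> f j \<in> coords B"
  shows "finsum M f I = (\<lambda>i. \<Sum>j\<in>I. f j i)"
  using assms
proof (induction I rule: finite_induct)
  case empty
  show ?case using Mod.finsum_empty by simp
next
  case (insert j I)
  have "f \<in> I \<rightarrow> carrier M" "f j \<in> carrier M" using insert by auto
  from Mod.finsum_insert[OF insert(1,2) this] show ?case using insert by simp
qed

lemma std_dimension_vector:
  "has_dimension_vector Q M (\<lambda>v. card {i \<in> B. vt i = v})"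
proof -
  have "has_dimension Q M (coords {i \<in> B. vt i = v}) (card {i \<in> B. vt i = v})" for v
  proof -
    let ?S = "{i \<in> B. vt i = v}" and ?d = "card {i \<in> B. vt i = v}"
    have S: "finite ?S" using finB by simp
    obtain e where e: "bij_betw e {..<?d} ?S" using ex_bij_betw_nat_finite[OF S] by (auto simp: atLeast0LessThan)
    have eS: "e j \<in> ?S" if "j < ?d" for j using e that by (auto simp: bij_betw_def)
    let ?b = "\<lambda>j. unit_at (e j) :: nat \<Rightarrow> 'k"
    have b: "?b j \<in> coords ?S" if "j < ?d" for j by (rule coords_unit[OF eS[OF that]])
    have bB: "?b j \<in> coords B" if "j < ?d" for j
      using eS[OF that] by (intro coords_unit) blast
    have sum: "finsum M (\<lambda>j. scalar_elt Q (c j) \<odot>\<^bsub>M\<^esub> ?b j) {..<?d} = (\<lambda>i. \<Sum>j<?d. c j * ?b j i)" for c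
    proof -
      have eq: "scalar_elt Q (c j) \<odot>\<^bsub>M\<^esub> ?b j = (\<lambda>i. c j * ?b j i)" if "j < ?d" for j
        by (rule act_scalar[OF bB[OF that]])
      have "finsum M (\<lambda>j. scalar_elt Q (c j) \<odot>\<^bsub>M\<^esub> ?b j) {..<?d} = (\<lambda>i. \<Sum>j<?d. (scalar_elt Q (c j) \<odot>\<^bsub>M\<^esub> ?b j) i)"
      proof (rule std_finsum)
        fix j assume "j \<in> {..<?d}"
        then have j: "j < ?d" by blast
        show "scalar_elt Q (c j) \<odot>\<^bsub>M\<^esub> ?b j \<in> coords B"
          unfolding eq[OF j] by (rule coords_scale[OF bB[OF j]])
      qed (rule finite_lessThan)
      also have "\<dots> = (\<lambda>i. \<Sum>j<?d. c j * ?b j i)"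
        by (intro ext sum.cong refl) (simp add: eq)
      finally show ?thesis .
    qed
    have val: "(\<Sum>j<?d. c j * ?b j (e k)) = c k" if "k < ?d" for c k
    proof -
      have "(\<Sum>j<?d. c j * ?b j (e k)) = (\<Sum>j<?d. if j = k then c j else 0)"
        using e that by (intro sum.cong refl) (auto simp: unit_at_def bij_betw_def inj_on_def)
      then show ?thesis using that by simp
    qed
    show ?thesis unfolding has_dimension_def
    proof (intro exI[of _ ?b] conjI ballI)
      show "?b ` {..<?d} \<subseteq> coords ?S" using b by auto
      fix x :: "nat \<Rightarrow> 'k" assume x: "x \<in> coords ?S"
      show "\<exists>!c. c \<in> {..<?d} \<rightarrow>\<^sub>E UNIV
          \<and> x = finsum M (\<lambda>j. scalar_elt Q (c j) \<odot>\<^bsub>M\<^esub> ?b j) {..<?d}"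
        unfolding sum
      proof (rule ex1I[of _ "restrict (\<lambda>j. x (e j)) {..<?d}"])
        have "x i = (\<Sum>j<?d. restrict (\<lambda>j. x (e j)) {..<?d} j * ?b j i)" for i
        proof (cases "i \<in> ?S")
          case True
          then obtain k where k: "k < ?d" "i = e k" using e by (auto simp: bij_betw_def)
          show ?thesis unfolding k(2) val[OF k(1)] using k(1) by simp
        next
          case False
          then have "?b j i = 0" if "j < ?d" for j using eS[OF that] by (auto simp: unit_at_def)
          then have "(\<Sum>j<?d. restrict (\<lambda>j. x (e j)) {..<?d} j * ?b j i) = 0" by (intro sum.neutral) simp
          then show ?thesis using coords_off[OF x False] by simp
        qed
        then show "restrict (\<lambda>j. x (e j)) {..<?d} \<in> {..<?d} \<rightarrow>\<^sub>E UNIV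
            \<and> x = (\<lambda>i. \<Sum>j<?d. restrict (\<lambda>j. x (e j)) {..<?d} j * ?b j i)"
          by (intro conjI ext restrict_PiE_iff[THEN iffD2] ballI UNIV_I)
        fix c assume c: "c \<in> {..<?d} \<rightarrow>\<^sub>E UNIV \<and> x = (\<lambda>i. \<Sum>j<?d. c j * ?b j i)"
        show "c = restrict (\<lambda>j. x (e j)) {..<?d}"
        proof
          fix k
          show "c k = restrict (\<lambda>j. x (e j)) {..<?d} k"
          proof (cases "k < ?d")
            case True
            have "x (e k) = (\<Sum>j<?d. c j * ?b j (e k))" using conjunct2[OF c] by (rule fun_cong)
            also have "\<dots> = c k" by (rule val[OF True])
            finally have "x (e k) = c k" .
            moreover have "restrict (\<lambda>j. x (e j)) {..<?d} k = x (e k)" using True by (simp only: restrict_apply lessThan_iff if_True)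
            ultimately show ?thesis by (rule trans[OF sym sym])
          next
            case False
            then have k: "k \<notin> {..<?d}" by simp
            show ?thesis unfolding PiE_arb[OF conjunct1[OF c] k] restrict_apply if_not_P[OF k] ..
          qed
        qed
      qed
    qed
  qed
  moreover have "card {i \<in> B. vt i = v} = 0" if "v \<notin> verts Q" for v
  proof -
    have "{i \<in> B. vt i = v} = {}" using vtB that by auto
    then show ?thesis by (simp only: card.empty)
  qed
  ultimately show ?thesis unfolding has_dimension_vector_def std_vertex_space by blast
qed

end

text \<open>Homogeneous vectors \<open>z i\<close> of a module, and the graded linear map
  \<open>theta\<close> that takes the unit vector at \<open>i\<close> to \<open>z i\<close>. It
  respects vertices but in general not arrows. It serves as a linear section of an extension and as
  a coordinate map for a module.\<close>

locale theta_map = pa_module Q E for Q :: "('v, 'e) pre_digraph" and E :: "(('v, 'e) qpath \<Rightarrow> 'k::field, 'b) module" +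
  fixes B :: "nat set" and vt :: "nat \<Rightarrow> 'v" and z :: "nat \<Rightarrow> 'b"
  assumes finB: "finite B" and z: "i \<in> B \<Longrightarrow> z i \<in> carrier E"
    and zv: "i \<in> B \<Longrightarrow> v \<in> verts Q \<Longrightarrow> vertex_idempotent v \<odot>\<^bsub>E\<^esub> z i = (if v = vt i then z i else \<zero>\<^bsub>E\<^esub>)"
begin

definition theta :: "(nat \<Rightarrow> 'k) \<Rightarrow> 'b" where "theta x = finsum E (\<lambda>i. sc (x i) (z i)) B"

lemma term_closed: "(\<lambda>i. sc (x i) (z i)) \<in> B \<rightarrow> carrier E" using sc_closed z by blast

lemma theta_closed: "theta x \<in> carrier E" unfolding theta_def by (rule finsum_closed[OF term_closed])

lemma theta_add: "theta (\<lambda>i. x i + y i) = theta x \<oplus>\<^bsub>E\<^esub> theta y"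
proof -
  have "theta (\<lambda>i. x i + y i) = finsum E (\<lambda>i. sc (x i) (z i) \<oplus>\<^bsub>E\<^esub> sc (y i) (z i)) B"
    unfolding theta_def
  proof (rule finsum_cong')
    show "(\<lambda>i. sc (x i) (z i) \<oplus>\<^bsub>E\<^esub> sc (y i) (z i)) \<in> B \<rightarrow> carrier E" using term_closed by blast
  qed (simp_all add: sc_add z)
  then show ?thesis unfolding theta_def using finsum_addf[OF term_closed[of x] term_closed[of y]] by simp
qed

lemma theta_act:
  assumes a: "a \<in> carrier PA" shows "a \<odot>\<^bsub>E\<^esub> theta x = finsum E (\<lambda>i. sc (x i) (a \<odot>\<^bsub>E\<^esub> z i)) B"
proof -
  have "a \<odot>\<^bsub>E\<^esub> theta x = finsum E (\<lambda>i. a \<odot>\<^bsub>E\<^esub> sc (x i) (z i)) B"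
    unfolding theta_def
    by (rule additive_finsum[OF group _ _ finB term_closed]) (auto intro: act_closed[OF a] act_add_right[OF a])
  also have "\<dots> = finsum E (\<lambda>i. sc (x i) (a \<odot>\<^bsub>E\<^esub> z i)) B"
    by (rule finsum_cong') (auto simp: act_sc[OF a] z intro!: sc_closed act_closed[OF a])
  finally show ?thesis .
qed

lemma theta_scale: "theta (\<lambda>i. c * x i) = sc c (theta x)"
proof -
  have "finsum E (\<lambda>i. sc (x i) (sc c (z i))) B = finsum E (\<lambda>i. sc (c * x i) (z i)) B"
    by (rule finsum_cong') (auto simp: sc_sc z mult.commute intro!: sc_closed)
  then show ?thesis unfolding theta_act[OF scalar_closed] unfolding theta_def by (rule sym)
qed

lemma theta_vertex: "v \<in> verts Q \<Longrightarrow> theta (restr B vt v x) = vertex_idempotent v \<odot>\<^bsub>E\<^esub> theta x"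
proof -
  assume v: "v \<in> verts Q"
  have "finsum E (\<lambda>i. sc (x i) (vertex_idempotent v \<odot>\<^bsub>E\<^esub> z i)) B = finsum E (\<lambda>i. sc (restr B vt v x i) (z i)) B"
  proof (rule finsum_cong')
    fix i assume "i \<in> B"
    then show "sc (x i) (vertex_idempotent v \<odot>\<^bsub>E\<^esub> z i) = sc (restr B vt v x i) (z i)"
      using v by (simp add: zv restr_def sc_zero z sc_zero_right)
  qed (simp_all add: term_closed)
  then show ?thesis unfolding theta_act[OF vertex_idempotent_closed[OF v]] unfolding theta_def by (rule sym)
qed

end


section \<open>Rigid representations and bricks\<close>

context std_quiver
begin

definition graded :: "((nat \<Rightarrow> 'k) \<Rightarrow> nat \<Rightarrow> 'k) \<Rightarrow> bool" where
  "graded F \<longleftrightarrow> lin_on B B F \<and> (\<forall>v\<in>verts Q. \<forall>x\<in>coords B. F (res v x) = res v (F x))"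

definition endo :: "((nat \<Rightarrow> 'k) \<Rightarrow> nat \<Rightarrow> 'k) \<Rightarrow> bool" where
  "endo F \<longleftrightarrow> graded F \<and> (\<forall>a\<in>arcs Q. \<forall>x\<in>coords B. F (Xa a x) = Xa a (F x))"

text \<open>An element of the direct sum, over the arrows, of the spaces of linear maps from the
  tail space to the head space.\<close>

definition arrow_family :: "('e \<Rightarrow> (nat \<Rightarrow> 'k) \<Rightarrow> nat \<Rightarrow> 'k) \<Rightarrow> bool" where
  "arrow_family H \<longleftrightarrow> (\<forall>a\<in>arcs Q. lin_on B B (H a) \<and>
     (\<forall>x\<in>coords B. H a (res (tail Q a) x) = H a x \<and> res (head Q a) (H a x) = H a x))"

text \<open>Surjectivity of the map whose kernel is \<open>endo\<close>: the differences
  \<open>F X_a - X_a F\<close> can be prescribed arbitrarily.\<close>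

definition rigid :: bool where
  "rigid \<longleftrightarrow> (\<forall>H. arrow_family H \<longrightarrow>
     (\<exists>F. graded F \<and> (\<forall>a\<in>arcs Q. \<forall>x\<in>coords B. F (Xa a x) = (\<lambda>i. Xa a (F x) i + H a x i))))"

definition brick :: bool where
  "brick \<longleftrightarrow> (\<forall>F. endo F \<longrightarrow> (\<exists>c. \<forall>x\<in>coords B. F x = (\<lambda>i. c * x i)))"

lemma gradedD:
  assumes "graded F"
  shows "lin_on B B F" "v \<in> verts Q \<Longrightarrow> x \<in> coords B \<Longrightarrow> F (res v x) = res v (F x)"
  using assms by (simp_all add: graded_def)

lemma endoD:
  assumes "endo F"
  shows "lin_on B B F" "v \<in> verts Q \<Longrightarrow> x \<in> coords B \<Longrightarrow> F (res v x) = res v (F x)"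
    "a \<in> arcs Q \<Longrightarrow> x \<in> coords B \<Longrightarrow> F (Xa a x) = Xa a (F x)"
  using assms by (simp_all add: graded_def endo_def)

lemma arrow_familyD:
  assumes "arrow_family H" "a \<in> arcs Q"
  shows "lin_on B B (H a)" "x \<in> coords B \<Longrightarrow> H a (res (tail Q a) x) = H a x"
    "x \<in> coords B \<Longrightarrow> res (head Q a) (H a x) = H a x"
  using assms by (simp_all add: arrow_family_def)

lemma arrow_verts: "a \<in> arcs Q \<Longrightarrow> head Q a \<in> verts Q" "a \<in> arcs Q \<Longrightarrow> tail Q a \<in> verts Q"
  using wf by (simp_all add: wf_digraph_def)

lemma Xa_tail: "Xa a (res (tail Q a) x) = Xa a x"
  by (simp add: arrow_op_def restr_restr)

lemma Xa_head: "res (head Q a) (Xa a x) = Xa a x"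
  by (simp add: arrow_op_def restr_restr)

lemma res_closed: "x \<in> coords B \<Longrightarrow> res v x \<in> coords B"
  by (rule lin_onD(1)[OF restr_lin])

lemma homD:
  fixes E :: "(('v, 'e) qpath \<Rightarrow> 'k, 'c) module"
  assumes h: "h \<in> left_module_hom PA M E"
  shows "x \<in> coords B \<Longrightarrow> h x \<in> carrier E"
    "x \<in> coords B \<Longrightarrow> y \<in> coords B \<Longrightarrow> h (\<lambda>i. x i + y i) = h x \<oplus>\<^bsub>E\<^esub> h y"
    "x \<in> coords B \<Longrightarrow> h (\<lambda>i. c * x i) = scalar_elt Q c \<odot>\<^bsub>E\<^esub> h x"
    "v \<in> verts Q \<Longrightarrow> x \<in> coords B \<Longrightarrow> h (res v x) = vertex_idempotent v \<odot>\<^bsub>E\<^esub> h x"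
    "a \<in> arcs Q \<Longrightarrow> x \<in> coords B \<Longrightarrow> h (Xa a x) = arrow_elt Q a \<odot>\<^bsub>E\<^esub> h x"
proof -
  have cl: "\<And>x. x \<in> coords B \<Longrightarrow> h x \<in> carrier E" using h unfolding left_module_hom_def by auto
  have act: "\<And>f x. f \<in> carrier PA \<Longrightarrow> x \<in> coords B \<Longrightarrow> h (f \<odot>\<^bsub>M\<^esub> x) = f \<odot>\<^bsub>E\<^esub> h x"
    using h unfolding left_module_hom_def by auto
  have ad: "\<And>x y. x \<in> coords B \<Longrightarrow> y \<in> coords B \<Longrightarrow> h (\<lambda>i. x i + y i) = h x \<oplus>\<^bsub>E\<^esub> h y"
    using h unfolding left_module_hom_def by auto
  show "x \<in> coords B \<Longrightarrow> h x \<in> carrier E" by (rule cl)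
  show "x \<in> coords B \<Longrightarrow> y \<in> coords B \<Longrightarrow> h (\<lambda>i. x i + y i) = h x \<oplus>\<^bsub>E\<^esub> h y" by (rule ad)
  show "x \<in> coords B \<Longrightarrow> h (\<lambda>i. c * x i) = scalar_elt Q c \<odot>\<^bsub>E\<^esub> h x"
    using act[OF scalar_closed] by (simp only: act_scalar)
  show "v \<in> verts Q \<Longrightarrow> x \<in> coords B \<Longrightarrow> h (res v x) = vertex_idempotent v \<odot>\<^bsub>E\<^esub> h x"
    using act[OF vertex_idempotent_closed] by (simp only: act_vertex)
  show "a \<in> arcs Q \<Longrightarrow> x \<in> coords B \<Longrightarrow> h (Xa a x) = arrow_elt Q a \<odot>\<^bsub>E\<^esub> h x"
    using act[OF arrow_elt_closed] by (simp only: act_arrow)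
qed

lemma submoduleD:
  assumes W: "left_submodule PA M W"
  shows "x \<in> W \<Longrightarrow> x \<in> coords B" "(\<lambda>_. 0) \<in> W"
    "x \<in> W \<Longrightarrow> y \<in> W \<Longrightarrow> (\<lambda>i. x i + y i) \<in> W"
    "x \<in> W \<Longrightarrow> (\<lambda>i. c * x i) \<in> W"
    "v \<in> verts Q \<Longrightarrow> x \<in> W \<Longrightarrow> res v x \<in> W"
    "a \<in> arcs Q \<Longrightarrow> x \<in> W \<Longrightarrow> Xa a x \<in> W"
proof -
  have cl: "\<And>x. x \<in> W \<Longrightarrow> x \<in> coords B" using W unfolding left_submodule_def by auto
  have act: "\<And>f x. f \<in> carrier PA \<Longrightarrow> x \<in> W \<Longrightarrow> f \<odot>\<^bsub>M\<^esub> x \<in> W"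
    using W unfolding left_submodule_def by auto
  show "x \<in> W \<Longrightarrow> x \<in> coords B" by (rule cl)
  show "(\<lambda>_. 0) \<in> W" "x \<in> W \<Longrightarrow> y \<in> W \<Longrightarrow> (\<lambda>i. x i + y i) \<in> W"
    using W unfolding left_submodule_def by auto
  show "x \<in> W \<Longrightarrow> (\<lambda>i. c * x i) \<in> W"
    using act[OF scalar_closed] cl act_scalar by metis
  show "v \<in> verts Q \<Longrightarrow> x \<in> W \<Longrightarrow> res v x \<in> W"
    using act[OF vertex_idempotent_closed] by (simp only: act_vertex)
  show "a \<in> arcs Q \<Longrightarrow> x \<in> W \<Longrightarrow> Xa a x \<in> W"
    using act[OF arrow_elt_closed] by (simp only: act_arrow)
qed

text \<open>The projection onto \<open>X\<close> along \<open>Y\<close> is an endomorphism, hence a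
  scalar \<open>c\<close>. It is the identity on \<open>X\<close> and zero on \<open>Y\<close>, so
  \<open>c = 0\<close> kills \<open>X\<close> and any other value kills \<open>Y\<close>.\<close>

lemma brick_imp_indecomposable:
  assumes brick and ne: "B \<noteq> {}"
  shows "indecomposable PA M"
  unfolding indecomposable_def
proof (intro conjI allI impI)
  obtain i where i: "i \<in> B" using ne by blast
  have "(unit_at i :: nat \<Rightarrow> 'k) \<noteq> (\<lambda>_. 0)" by (auto simp: unit_at_def fun_eq_iff)
  then show "carrier M \<noteq> {\<zero>\<^bsub>M\<^esub>}" using coords_unit[OF i, where ?'b = 'k] by auto
  fix X Y assume "left_submodule PA M X \<and> left_submodule PA M Y \<and> X \<inter> Y = {\<zero>\<^bsub>M\<^esub>}
      \<and> {x \<oplus>\<^bsub>M\<^esub> y |x y. x \<in> X \<and> y \<in> Y} = carrier M"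
  then have X: "left_submodule PA M X" and Y: "left_submodule PA M Y" and int: "X \<inter> Y = {\<lambda>_. 0}"
    and sum: "{(\<lambda>i. x i + y i) |x y. x \<in> X \<and> y \<in> Y} = coords B" by auto
  note Xd = submoduleD[OF X] and Yd = submoduleD[OF Y]
  have uniq: "a = a'" if "a \<in> X" "a' \<in> X" "b \<in> Y" "b' \<in> Y" and e: "\<And>i. a i + b i = a' i + b' i" for a a' b b'
  proof -
    have "(\<lambda>i. a i + (- 1) * a' i) \<in> X" "(\<lambda>i. b' i + (- 1) * b i) \<in> Y"
      using Xd(3)[OF that(1) Xd(4)[OF that(2)]] Yd(3)[OF that(4) Yd(4)[OF that(3)]] by blast+
    moreover have "(\<lambda>i. a i + (- 1) * a' i) = (\<lambda>i. b' i + (- 1) * b i)"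
    proof
      fix i show "a i + (- 1) * a' i = b' i + (- 1) * b i" using e[of i] by (simp add: algebra_simps)
    qed
    ultimately have "(\<lambda>i. a i + (- 1) * a' i) \<in> X \<inter> Y" by simp
    then have "(\<lambda>i. a i + (- 1) * a' i) = (\<lambda>_. 0)" unfolding int by blast
    then have "a i + (- 1) * a' i = 0" for i by (rule fun_cong)
    then show ?thesis by (simp add: fun_eq_iff)
  qed
  define P where "P x = (SOME a. a \<in> X \<and> (\<exists>b\<in>Y. x = (\<lambda>i. a i + b i)))" for x
  have P: "P x = a" if "a \<in> X" "b \<in> Y" "x = (\<lambda>i. a i + b i)" for x a b
    unfolding P_def
  proof (rule some_equality)
    show "a \<in> X \<and> (\<exists>b\<in>Y. x = (\<lambda>i. a i + b i))" using that by blast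
    fix a' assume a': "a' \<in> X \<and> (\<exists>b\<in>Y. x = (\<lambda>i. a' i + b i))"
    then obtain b' where b': "b' \<in> Y" "x = (\<lambda>i. a' i + b' i)" by blast
    show "a' = a"
      by (rule uniq[OF conjunct1[OF a'] that(1) b'(1) that(2)]) (use b'(2) that(3) in \<open>metis\<close>)
  qed
  have dec: "\<exists>a\<in>X. \<exists>b\<in>Y. x = (\<lambda>i. a i + b i)" if "x \<in> coords B" for x
    using that unfolding sum[symmetric] by blast
  have "endo P"
    unfolding endo_def graded_def
  proof (intro conjI ballI lin_onI)
    fix x :: "nat \<Rightarrow> 'k" assume "x \<in> coords B"
    then obtain a b where x: "a \<in> X" "b \<in> Y" "x = (\<lambda>i. a i + b i)" using dec by blast
    note ac = Xd(1)[OF x(1)] and bc = Yd(1)[OF x(2)]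
    show "P x \<in> coords B" unfolding P[OF x] by (rule ac)
    show "P (\<lambda>i. c * x i) = (\<lambda>i. c * P x i)" for c
      unfolding P[OF x]
      by (rule P[OF Xd(4)[OF x(1)] Yd(4)[OF x(2)]]) (simp add: x(3) distrib_left)
    show "P (res v x) = res v (P x)" if "v \<in> verts Q" for v
      unfolding P[OF x]
      by (rule P[OF Xd(5)[OF that x(1)] Yd(5)[OF that x(2)]]) (simp only: x(3) lin_onD(2)[OF restr_lin ac bc])
    show "P (Xa e x) = Xa e (P x)" if "e \<in> arcs Q" for e
      unfolding P[OF x]
      by (rule P[OF Xd(6)[OF that x(1)] Yd(6)[OF that x(2)]]) (simp only: x(3) lin_onD(2)[OF arrow_lin[OF that] ac bc])
    fix y :: "nat \<Rightarrow> 'k" assume "y \<in> coords B"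
    then obtain a' b' where y: "a' \<in> X" "b' \<in> Y" "y = (\<lambda>i. a' i + b' i)" using dec by blast
    show "P (\<lambda>i. x i + y i) = (\<lambda>i. P x i + P y i)"
      unfolding P[OF x] P[OF y]
      by (rule P[OF Xd(3)[OF x(1) y(1)] Yd(3)[OF x(2) y(2)]]) (simp add: x(3) y(3) add_ac)
  qed
  then obtain c where c: "\<And>x. x \<in> coords B \<Longrightarrow> P x = (\<lambda>i. c * x i)"
    using \<open>brick\<close> unfolding brick_def by blast
  have PX: "P x = x" if "x \<in> X" for x by (rule P[OF that Yd(2)]) simp
  have PY: "P y = (\<lambda>_. 0)" if "y \<in> Y" for y by (rule P[OF Xd(2) that]) simp
  show "X = {\<zero>\<^bsub>M\<^esub>} \<or> Y = {\<zero>\<^bsub>M\<^esub>}"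
  proof (cases "c = 0")
    case True
    have "x = (\<lambda>_. 0)" if "x \<in> X" for x
    proof -
      have "P x = (\<lambda>_. 0)" unfolding c[OF Xd(1)[OF that]] True by simp
      then show ?thesis by (rule trans[OF sym[OF PX[OF that]]])
    qed
    then have "X = {\<lambda>_. 0}" using Xd(2) by blast
    then show ?thesis by simp
  next
    case False
    have "y = (\<lambda>_. 0)" if "y \<in> Y" for y
    proof -
      have "(\<lambda>i. c * y i) = (\<lambda>_. 0)" by (rule trans[OF sym[OF c[OF Yd(1)[OF that]]] PY[OF that]])
      then have "c * y i = 0" for i by (rule fun_cong)
      then show ?thesis using False by (simp add: fun_eq_iff)
    qed
    then have "Y = {\<lambda>_. 0}" using Yd(2) by blast
    then show ?thesis by simp
  qed
qed

text \<open>Preimages of the unit vectors are made homogeneous by applying vertex idempotents. The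
  resulting section is linear and graded, but need not commute with the arrows.\<close>

lemma theta_section:
  fixes E :: "(('v, 'e) qpath \<Rightarrow> 'k, 'c) module"
  assumes E: "left_module PA E" and g: "g \<in> left_module_hom PA E M" and surj: "g ` carrier E = coords B"
  obtains z where "theta_map Q E B vt z" "\<And>x. x \<in> coords B \<Longrightarrow> g (theta_map.theta Q E B z x) = x"
proof -
  interpret E: pa_module Q E by (rule pa_module.intro[OF pa_quiver_axioms pa_module_axioms.intro[OF E]])
  have gact: "\<And>f x. f \<in> carrier PA \<Longrightarrow> x \<in> carrier E \<Longrightarrow> g (f \<odot>\<^bsub>E\<^esub> x) = f \<odot>\<^bsub>M\<^esub> g x"
    and gc: "\<And>x. x \<in> carrier E \<Longrightarrow> g x \<in> coords B"
    and gadd: "\<And>x y. x \<in> carrier E \<Longrightarrow> y \<in> carrier E \<Longrightarrow> g (x \<oplus>\<^bsub>E\<^esub> y) = g x \<oplus>\<^bsub>M\<^esub> g y"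
    using g unfolding left_module_hom_def by auto
  have "\<exists>w\<in>carrier E. g w = unit_at i" if "i \<in> B" for i
    using coords_unit[OF that, where ?'b = 'k] unfolding surj[symmetric] by force
  then obtain w where w: "\<And>i. i \<in> B \<Longrightarrow> w i \<in> carrier E" "\<And>i. i \<in> B \<Longrightarrow> g (w i) = unit_at i" by metis
  define z where "z i = vertex_idempotent (vt i) \<odot>\<^bsub>E\<^esub> w i" for i
  have zc: "z i \<in> carrier E" if "i \<in> B" for i
    unfolding z_def by (rule E.act_closed[OF vertex_idempotent_closed[OF vtB[OF that]] w(1)[OF that]])
  have gz: "g (z i) = unit_at i" if "i \<in> B" for i
  proof -
    have "g (z i) = res (vt i) (unit_at i)"
      unfolding z_def gact[OF vertex_idempotent_closed[OF vtB[OF that]] w(1)[OF that]] w(2)[OF that] act_vertex ..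
    also have "\<dots> = unit_at i" using that by (auto simp: restr_def unit_at_def fun_eq_iff)
    finally show ?thesis .
  qed
  have th: "theta_map Q E B vt z"
  proof (unfold_locales, rule finB, erule zc)
    fix i v assume "i \<in> B" "v \<in> verts Q"
    then show "vertex_idempotent v \<odot>\<^bsub>E\<^esub> z i = (if v = vt i then z i else \<zero>\<^bsub>E\<^esub>)"
      unfolding z_def using E.act_vertex[OF _ vtB w(1), of v i] by simp
  qed
  interpret th: theta_map Q E B vt z by (rule th)
  have "g (th.theta x) = x" if x: "x \<in> coords B" for x
  proof -
    have eq: "g (E.sc (x i) (z i)) = (\<lambda>k. x i * unit_at i k)" if "i \<in> B" for i
      unfolding gact[OF scalar_closed zc[OF that]] gz[OF that] by (rule act_scalar[OF coords_unit[OF that]])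
    have "g (th.theta x) = finsum M (\<lambda>i. g (E.sc (x i) (z i))) B"
      unfolding th.theta_def
      by (rule E.additive_finsum[OF Mod.group _ gadd finB th.term_closed]) (use gc in auto)
    also have "\<dots> = (\<lambda>k. \<Sum>i\<in>B. g (E.sc (x i) (z i)) k)"
      by (rule std_finsum[OF finB gc[OF E.sc_closed[OF zc]]])
    also have "\<dots> = (\<lambda>k. \<Sum>i\<in>B. x i * unit_at i k)" by (intro ext sum.cong refl) (simp only: eq)
    also have "\<dots> = x" by (rule coords_expand[OF finB x, symmetric])
    finally show ?thesis .
  qed
  then show thesis by (rule that[OF th])
qed

text \<open>\<open>H a\<close> measures, pulled back along \<open>f\<close>, how far the graded
  section \<open>theta\<close> is from commuting with the arrow \<open>a\<close>. Rigidity provides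
  \<open>F\<close> with \<open>F X_a = X_a F + H a\<close>, and then \<open>theta + f F\<close> is a
  section of modules.\<close>

lemma rigid_imp_Ext1_zero:
  assumes rigid shows "Ext1_zero Q M M"
  unfolding Ext1_zero_def
proof (intro allI impI)
  fix E :: "('v, 'e, 'k) kQ_module" and f g
  assume "left_module PA E \<and> short_exact PA M f E g M"
  then have E: "left_module PA E" and f: "f \<in> left_module_hom PA M E" and g: "g \<in> left_module_hom PA E M"
    and inj: "inj_on f (coords B)" and surj: "g ` carrier E = coords B"
    and ker: "f ` coords B = {x \<in> carrier E. g x = (\<lambda>_. 0)}" unfolding short_exact_def by auto
  interpret E: pa_module Q E by (rule pa_module.intro[OF pa_quiver_axioms pa_module_axioms.intro[OF E]])
  obtain z where th: "theta_map Q E B vt z" and gth: "\<And>x. x \<in> coords B \<Longrightarrow> g (theta_map.theta Q E B z x) = x"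
  proof (rule theta_section[OF E g surj])
    fix z assume "theta_map Q E B vt z" "\<And>x. x \<in> coords B \<Longrightarrow> g (theta_map.theta Q E B z x) = x"
    then show thesis by (rule that)
  qed
  interpret th: theta_map Q E B vt z by (rule th)
  let ?t = th.theta
  note fD = homD[OF f]
  have gact: "\<And>f x. f \<in> carrier PA \<Longrightarrow> x \<in> carrier E \<Longrightarrow> g (f \<odot>\<^bsub>E\<^esub> x) = f \<odot>\<^bsub>M\<^esub> g x"
    and gc: "\<And>x. x \<in> carrier E \<Longrightarrow> g x \<in> coords B"
    and gadd: "\<And>x y. x \<in> carrier E \<Longrightarrow> y \<in> carrier E \<Longrightarrow> g (x \<oplus>\<^bsub>E\<^esub> y) = (\<lambda>i. g x i + g y i)"
    using g unfolding left_module_hom_def by auto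
  have gneg: "g (\<ominus>\<^bsub>E\<^esub> y) = (\<lambda>i. - g y i)" if y: "y \<in> carrier E" for y
  proof -
    have "g \<zero>\<^bsub>E\<^esub> = (\<lambda>_. 0)"
      using gact[OF scalar_closed[of 0] E.zero_closed] act_scalar[OF gc[OF E.zero_closed], of 0]
        E.sc_zero[OF E.zero_closed] by simp
    then have "(\<lambda>i. g (\<ominus>\<^bsub>E\<^esub> y) i + g y i) = (\<lambda>_. 0)"
      using gadd[OF E.a_inv_closed[OF y] y] E.l_neg[OF y] by simp
    then have "g (\<ominus>\<^bsub>E\<^esub> y) i + g y i = 0" for i by (rule fun_cong)
    then show ?thesis by (simp add: fun_eq_iff eq_neg_iff_add_eq_0)
  qed
  have ex: "\<exists>h\<in>coords B. ?t (Xa a x) \<oplus>\<^bsub>E\<^esub> f h = arrow_elt Q a \<odot>\<^bsub>E\<^esub> ?t x"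
    if a: "a \<in> arcs Q" and x: "x \<in> coords B" for a x
  proof -
    note c1 = th.theta_closed[of "Xa a x"] and c2 = E.act_closed[OF arrow_elt_closed[OF a] th.theta_closed[of x]]
    let ?d = "\<ominus>\<^bsub>E\<^esub> ?t (Xa a x) \<oplus>\<^bsub>E\<^esub> arrow_elt Q a \<odot>\<^bsub>E\<^esub> ?t x"
    have "g ?d = (\<lambda>i. - Xa a x i + Xa a x i)"
      unfolding gadd[OF E.a_inv_closed[OF c1] c2] gneg[OF c1] gth[OF lin_onD(1)[OF arrow_lin[OF a] x]]
        gact[OF arrow_elt_closed[OF a] th.theta_closed] gth[OF x] act_arrow ..
    then have "?d \<in> f ` coords B" unfolding ker using c1 c2 by simp
    then obtain h where h: "h \<in> coords B" "?d = f h" by blast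
    have "?t (Xa a x) \<oplus>\<^bsub>E\<^esub> f h = arrow_elt Q a \<odot>\<^bsub>E\<^esub> ?t x"
      unfolding h(2)[symmetric] using E.r_neg2[OF c1 c2] by simp
    then show ?thesis using h(1) by blast
  qed
  \<comment> \<open>The value is unique because \<open>f\<close> is injective. Linearity and
    homogeneity of \<open>H a\<close> are read off from \<open>Huniq\<close>.\<close>
  define H where "H a x = (SOME h. h \<in> coords B \<and> ?t (Xa a x) \<oplus>\<^bsub>E\<^esub> f h = arrow_elt Q a \<odot>\<^bsub>E\<^esub> ?t x)" for a x
  have H: "H a x \<in> coords B" "?t (Xa a x) \<oplus>\<^bsub>E\<^esub> f (H a x) = arrow_elt Q a \<odot>\<^bsub>E\<^esub> ?t x"
    if "a \<in> arcs Q" "x \<in> coords B" for a x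
    using someI_ex[OF ex[OF that, unfolded Bex_def]] unfolding H_def by blast+
  have Huniq: "H a x = h" if a: "a \<in> arcs Q" and x: "x \<in> coords B" and h: "h \<in> coords B"
    and e: "?t (Xa a x) \<oplus>\<^bsub>E\<^esub> f h = arrow_elt Q a \<odot>\<^bsub>E\<^esub> ?t x" for a x h
  proof -
    have "?t (Xa a x) \<oplus>\<^bsub>E\<^esub> f (H a x) = ?t (Xa a x) \<oplus>\<^bsub>E\<^esub> f h" using H(2)[OF a x] e by simp
    then have "f (H a x) = f h"
      using E.r_neg1[OF th.theta_closed fD(1)[OF H(1)[OF a x]]] E.r_neg1[OF th.theta_closed fD(1)[OF h]] by metis
    then show ?thesis using inj H(1)[OF a x] h by (simp add: inj_on_def)
  qed
  have "arrow_family H"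
    unfolding arrow_family_def
  proof (intro ballI conjI lin_onI)
    fix a and x :: "nat \<Rightarrow> 'k" assume a: "a \<in> arcs Q" and x: "x \<in> coords B"
    note A = lin_onD[OF arrow_lin[OF a]] and ac = arrow_elt_closed[OF a]
    note Hx = H[OF a x]
    show "H a x \<in> coords B" by (rule Hx(1))
    show "H a (\<lambda>i. c * x i) = (\<lambda>i. c * H a x i)" for c
      by (rule Huniq[OF a coords_scale[OF x] coords_scale[OF Hx(1)]])
        (simp only: A(3)[OF x] th.theta_scale fD(3)[OF Hx(1)] E.act_sc[OF ac th.theta_closed] Hx(2)[symmetric]
          E.act_add_right[OF scalar_closed th.theta_closed fD(1)[OF Hx(1)]])
    show "H a (res (tail Q a) x) = H a x"
      by (rule Huniq[OF a res_closed[OF x] Hx(1)])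
        (simp only: Xa_tail Hx(2) th.theta_vertex[OF arrow_verts(2)[OF a]] E.act_arrow(2)[OF a th.theta_closed])
    show "res (head Q a) (H a x) = H a x"
    proof (rule Huniq[OF a x res_closed[OF Hx(1)], symmetric])
      note v = arrow_verts(1)[OF a]
      have "?t (Xa a x) \<oplus>\<^bsub>E\<^esub> f (res (head Q a) (H a x))
          = vertex_idempotent (head Q a) \<odot>\<^bsub>E\<^esub> ?t (Xa a x) \<oplus>\<^bsub>E\<^esub> vertex_idempotent (head Q a) \<odot>\<^bsub>E\<^esub> f (H a x)"
        unfolding th.theta_vertex[OF v, symmetric] Xa_head fD(4)[OF v Hx(1)] ..
      also have "\<dots> = arrow_elt Q a \<odot>\<^bsub>E\<^esub> ?t x"
        unfolding E.act_add_right[OF vertex_idempotent_closed[OF v] th.theta_closed fD(1)[OF Hx(1)], symmetric] Hx(2)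
        by (rule E.act_arrow(1)[OF a th.theta_closed])
      finally show "?t (Xa a x) \<oplus>\<^bsub>E\<^esub> f (res (head Q a) (H a x)) = arrow_elt Q a \<odot>\<^bsub>E\<^esub> ?t x" .
    qed
    fix y :: "nat \<Rightarrow> 'k" assume y: "y \<in> coords B"
    note Hy = H[OF a y]
    note cl = th.theta_closed fD(1)[OF Hx(1)] fD(1)[OF Hy(1)]
    show "H a (\<lambda>i. x i + y i) = (\<lambda>i. H a x i + H a y i)"
    proof (rule Huniq[OF a coords_add[OF x y] coords_add[OF Hx(1) Hy(1)]])
      have "?t (Xa a (\<lambda>i. x i + y i)) \<oplus>\<^bsub>E\<^esub> f (\<lambda>i. H a x i + H a y i)
          = (?t (Xa a x) \<oplus>\<^bsub>E\<^esub> ?t (Xa a y)) \<oplus>\<^bsub>E\<^esub> (f (H a x) \<oplus>\<^bsub>E\<^esub> f (H a y))"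
        unfolding A(2)[OF x y] th.theta_add fD(2)[OF Hx(1) Hy(1)] ..
      also have "\<dots> = (?t (Xa a x) \<oplus>\<^bsub>E\<^esub> f (H a x)) \<oplus>\<^bsub>E\<^esub> (?t (Xa a y) \<oplus>\<^bsub>E\<^esub> f (H a y))"
        using cl by (simp add: E.a_ac)
      also have "\<dots> = arrow_elt Q a \<odot>\<^bsub>E\<^esub> ?t (\<lambda>i. x i + y i)"
        unfolding Hx(2) Hy(2) th.theta_add by (rule E.act_add_right[OF ac th.theta_closed th.theta_closed, symmetric])
      finally show "?t (Xa a (\<lambda>i. x i + y i)) \<oplus>\<^bsub>E\<^esub> f (\<lambda>i. H a x i + H a y i) = arrow_elt Q a \<odot>\<^bsub>E\<^esub> ?t (\<lambda>i. x i + y i)" .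
    qed
  qed
  then obtain F where F: "graded F"
    "\<And>a x. a \<in> arcs Q \<Longrightarrow> x \<in> coords B \<Longrightarrow> F (Xa a x) = (\<lambda>i. Xa a (F x) i + H a x i)"
    using \<open>rigid\<close> unfolding rigid_def by blast
  note Fl = lin_onD[OF gradedD(1)[OF F(1)]] and Fg = gradedD(2)[OF F(1)]
  let ?s = "\<lambda>x. ?t x \<oplus>\<^bsub>E\<^esub> f (F x)"
  have "?s \<in> left_module_hom PA M E"
  proof (rule std_hom[OF E])
    show "?s \<in> coords B \<rightarrow> carrier E" using th.theta_closed fD(1) Fl(1) by blast
    fix x :: "nat \<Rightarrow> 'k" assume x: "x \<in> coords B"
    note Fx = Fl(1)[OF x] and fFx = fD(1)[OF Fl(1)[OF x]]
    show "?s (\<lambda>i. c * x i) = scalar_elt Q c \<odot>\<^bsub>E\<^esub> ?s x" for c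
      unfolding E.act_add_right[OF scalar_closed th.theta_closed fFx] Fl(3)[OF x] fD(3)[OF Fx] th.theta_scale ..
    show "?s (res v x) = vertex_idempotent v \<odot>\<^bsub>E\<^esub> ?s x" if v: "v \<in> verts Q" for v
      unfolding E.act_add_right[OF vertex_idempotent_closed[OF v] th.theta_closed fFx] Fg[OF v x] fD(4)[OF v Fx] th.theta_vertex[OF v] ..
    show "?s (Xa a x) = arrow_elt Q a \<odot>\<^bsub>E\<^esub> ?s x" if a: "a \<in> arcs Q" for a
    proof -
      note c = fD(1)[OF H(1)[OF a x]] and AF = lin_onD(1)[OF arrow_lin[OF a] Fx]
      have "?s (Xa a x) = ?t (Xa a x) \<oplus>\<^bsub>E\<^esub> (f (Xa a (F x)) \<oplus>\<^bsub>E\<^esub> f (H a x))"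
        unfolding F(2)[OF a x] fD(2)[OF AF H(1)[OF a x]] ..
      also have "\<dots> = (?t (Xa a x) \<oplus>\<^bsub>E\<^esub> f (H a x)) \<oplus>\<^bsub>E\<^esub> f (Xa a (F x))"
        using th.theta_closed c fD(1)[OF AF] by (simp add: E.a_ac)
      also have "\<dots> = arrow_elt Q a \<odot>\<^bsub>E\<^esub> ?s x"
        unfolding H(2)[OF a x] fD(5)[OF a Fx] by (rule E.act_add_right[OF arrow_elt_closed[OF a] th.theta_closed fFx, symmetric])
      finally show ?thesis .
    qed
    fix y :: "nat \<Rightarrow> 'k" assume y: "y \<in> coords B"
    show "?s (\<lambda>i. x i + y i) = ?s x \<oplus>\<^bsub>E\<^esub> ?s y"
      unfolding th.theta_add Fl(2)[OF x y] fD(2)[OF Fx Fl(1)[OF y]]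
      using th.theta_closed fFx fD(1)[OF Fl(1)[OF y]] by (simp add: E.a_ac)
  qed
  moreover have "g (?s x) = x" if x: "x \<in> coords B" for x
  proof -
    have fF: "f (F x) \<in> carrier E \<and> g (f (F x)) = (\<lambda>_. 0)" using ker Fl(1)[OF x] by blast
    show ?thesis unfolding gadd[OF th.theta_closed conjunct1[OF fF]] gth[OF x] conjunct2[OF fF] by simp
  qed
  ultimately show "\<exists>s\<in>left_module_hom PA M E. \<forall>x\<in>carrier M. g (s x) = x" by (intro bexI[of _ ?s]) simp_all
qed

end


text \<open>Direct sums inside functions on the natural numbers: the two summands occupy the even
  and the odd positions.\<close>

definition lower :: "(nat \<Rightarrow> 'k) \<Rightarrow> nat \<Rightarrow> 'k" where "lower x = (\<lambda>i. x (2 * i))"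
definition upper :: "(nat \<Rightarrow> 'k) \<Rightarrow> nat \<Rightarrow> 'k" where "upper x = (\<lambda>i. x (Suc (2 * i)))"
definition join :: "(nat \<Rightarrow> 'k) \<Rightarrow> (nat \<Rightarrow> 'k) \<Rightarrow> nat \<Rightarrow> 'k" where
  "join x y = (\<lambda>k. if even k then x (k div 2) else y (k div 2))"

lemma lower_join [simp]: "lower (join x y) = x" and upper_join [simp]: "upper (join x y) = y"
  by (simp_all add: lower_def upper_def join_def)

lemma join_parts: "join (lower z) (upper z) = z"
  unfolding join_def lower_def upper_def
proof
  fix k show "(if even k then z (2 * (k div 2)) else z (Suc (2 * (k div 2)))) = z k" by simp
qed

lemma join_eqI: "lower z = x \<Longrightarrow> upper z = y \<Longrightarrow> z = join x y"
  using join_parts[of z] by simp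

lemma lower_upper_add:
  "lower (\<lambda>i. x i + y i) = (\<lambda>i. lower x i + lower y i)" "upper (\<lambda>i. x i + y i) = (\<lambda>i. upper x i + upper y i)"
  "lower (\<lambda>i. c * x i) = (\<lambda>i. c * lower x i)" "upper (\<lambda>i. c * x i) = (\<lambda>i. c * upper x i)"
  by (simp_all add: lower_def upper_def)

lemma join_add:
  "join (\<lambda>i. x i + x' i) (\<lambda>i. y i + y' i) = (\<lambda>i. join x y i + join x' y' i)"
  "join (\<lambda>i. c * x i) (\<lambda>i. c * y i) = (\<lambda>i. c * join x y i)"
  by (rule join_eqI[symmetric]; simp add: lower_upper_add)+

context std_quiver
begin

text \<open>\<open>H\<close> defines an extension of \<open>M\<close> by itself, in which the arrow
  \<open>a\<close> acts on pairs by \<open>(x, y) \<mapsto> (X_a x + H_a y, X_a y)\<close>. A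
  section has the form \<open>(F, id)\<close>, and that it commutes with the arrows means
  \<open>F X_a = X_a F + H_a\<close>.\<close>

lemma Ext1_zero_imp_rigid:
  assumes ext: "Ext1_zero Q M M" shows rigid
  unfolding rigid_def
proof (intro allI impI)
  fix H assume H: "arrow_family H"
  note HD = arrow_familyD[OF H]
  define BE where "BE = {k. k div 2 \<in> B}"
  define vE where "vE k = vt (k div 2)" for k
  define XE where "XE a z = join (\<lambda>i. Xa a (lower z) i + H a (upper z) i) (Xa a (upper z))" for a z
  have BE: "BE \<subseteq> (\<lambda>i. 2 * i) ` B \<union> (\<lambda>i. Suc (2 * i)) ` B"
  proof
    fix k assume k: "k \<in> BE"
    have "k = 2 * (k div 2) \<or> k = Suc (2 * (k div 2))" by presburger
    then show "k \<in> (\<lambda>i. 2 * i) ` B \<union> (\<lambda>i. Suc (2 * i)) ` B" using k unfolding BE_def by blast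
  qed
  have j: "join x y \<in> coords BE" if "x \<in> coords B" "y \<in> coords B" for x y :: "nat \<Rightarrow> 'k"
    using that by (simp add: coords_def BE_def join_def)
  have lo: "lower z \<in> coords B" "upper z \<in> coords B" if "z \<in> coords BE" for z :: "nat \<Rightarrow> 'k"
    using that by (simp_all add: coords_def BE_def lower_def upper_def)
  have XEl: "lin_on BE BE (XE a)" if a: "a \<in> arcs Q" for a
  proof (rule lin_onI)
    note A = lin_onD[OF arrow_lin[OF a]] and Hl = lin_onD[OF HD(1)[OF a]]
    fix z :: "nat \<Rightarrow> 'k" assume z: "z \<in> coords BE"
    note l = lo[OF z]
    show "XE a z \<in> coords BE" unfolding XE_def by (intro j coords_add A(1) Hl(1) l)
    show "XE a (\<lambda>i. c * z i) = (\<lambda>i. c * XE a z i)" for c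
      unfolding XE_def lower_upper_add A(3)[OF l(1)] A(3)[OF l(2)] Hl(3)[OF l(2)]
        distrib_left[symmetric] join_add ..
    fix z' :: "nat \<Rightarrow> 'k" assume z': "z' \<in> coords BE"
    note l' = lo[OF z']
    show "XE a (\<lambda>i. z i + z' i) = (\<lambda>i. XE a z i + XE a z' i)"
      unfolding XE_def lower_upper_add A(2)[OF l(1) l'(1)] A(2)[OF l(2) l'(2)] Hl(2)[OF l(2) l'(2)] join_add[symmetric]
      by (simp add: add_ac)
  qed
  interpret E: std_quiver Q BE vE XE
  proof
    show "finite BE" by (rule finite_subset[OF BE]) (use finB in simp)
    show "i \<in> BE \<Longrightarrow> vE i \<in> verts Q" for i unfolding BE_def vE_def using vtB by simp
  qed (rule XEl)
  have resE: "E.res v z = join (res v (lower z)) (res v (upper z))" for v z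
    by (rule join_eqI) (auto simp: restr_def lower_def upper_def BE_def vE_def fun_eq_iff)
  have arrE: "E.Xa a z = join (\<lambda>i. Xa a (lower z) i + H a (upper z) i) (Xa a (upper z))"
    if a: "a \<in> arcs Q" and z: "z \<in> coords BE" for a z
  proof -
    note A = lin_onD[OF arrow_lin[OF a]] and Hl = lin_onD[OF HD(1)[OF a]] and l = lo[OF z]
    note R = lin_onD[OF restr_lin[of B vt "head Q a"]]
    have "E.Xa a z = join (res (head Q a) (\<lambda>i. Xa a (lower z) i + H a (upper z) i)) (res (head Q a) (Xa a (upper z)))"
      unfolding arrow_op_def[of Q BE] resE XE_def lower_join upper_join Xa_tail HD(2)[OF a l(2)] ..
    also have "\<dots> = join (\<lambda>i. Xa a (lower z) i + H a (upper z) i) (Xa a (upper z))"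
      unfolding R(2)[OF A(1)[OF l(1)] Hl(1)[OF l(2)]] Xa_head HD(3)[OF a l(2)] ..
    finally show ?thesis .
  qed
  let ?f = "\<lambda>x :: nat \<Rightarrow> 'k. join x (\<lambda>_. 0)"
  have f: "?f \<in> left_module_hom PA M E.M"
  proof (rule std_hom[OF E.std_left_module])
    show "?f \<in> coords B \<rightarrow> carrier E.M" using j by simp
    fix x :: "nat \<Rightarrow> 'k" assume x: "x \<in> coords B"
    note jx = j[OF x coords_zero]
    show "?f (\<lambda>i. c * x i) = scalar_elt Q c \<odot>\<^bsub>E.M\<^esub> ?f x" for c
      unfolding E.act_scalar[OF jx] join_add[symmetric] by simp
    show "?f (res v x) = vertex_idempotent v \<odot>\<^bsub>E.M\<^esub> ?f x" for v
      unfolding E.act_vertex resE by simp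
    show "?f (Xa a x) = arrow_elt Q a \<odot>\<^bsub>E.M\<^esub> ?f x" if a: "a \<in> arcs Q" for a
      unfolding E.act_arrow arrE[OF a jx] lower_join upper_join
        lin_on_zero[OF HD(1)[OF a]] lin_on_zero[OF arrow_lin[OF a]] by simp
    fix y :: "nat \<Rightarrow> 'k" assume y: "y \<in> coords B"
    show "?f (\<lambda>i. x i + y i) = ?f x \<oplus>\<^bsub>E.M\<^esub> ?f y"
      unfolding std_module_simps join_add[symmetric] by simp
  qed
  let ?g = "upper :: (nat \<Rightarrow> 'k) \<Rightarrow> nat \<Rightarrow> 'k"
  have g: "?g \<in> left_module_hom PA E.M M"
  proof (rule E.std_hom[OF std_left_module])
    show "?g \<in> coords BE \<rightarrow> carrier M" using lo by simp
    fix x :: "nat \<Rightarrow> 'k" assume x: "x \<in> coords BE"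
    show "upper (\<lambda>i. c * x i) = scalar_elt Q c \<odot>\<^bsub>M\<^esub> upper x" for c
      unfolding act_scalar[OF lo(2)[OF x]] lower_upper_add ..
    show "upper (E.res v x) = vertex_idempotent v \<odot>\<^bsub>M\<^esub> upper x" for v
      unfolding act_vertex resE by simp
    show "upper (E.Xa a x) = arrow_elt Q a \<odot>\<^bsub>M\<^esub> upper x" if "a \<in> arcs Q" for a
      unfolding act_arrow arrE[OF that x] by simp
    fix y :: "nat \<Rightarrow> 'k" assume y: "y \<in> coords BE"
    show "upper (\<lambda>i. x i + y i) = upper x \<oplus>\<^bsub>M\<^esub> upper y"
      unfolding std_module_simps lower_upper_add ..
  qed
  have "short_exact PA M ?f E.M ?g M"
    unfolding short_exact_def std_module_simps
  proof (intro conjI f g)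
    show "inj_on ?f (coords B)" by (metis inj_onI lower_join)
    show "?g ` coords BE = coords B"
    proof
      show "?g ` coords BE \<subseteq> coords B" using lo by blast
      show "coords B \<subseteq> ?g ` coords BE"
      proof
        fix y :: "nat \<Rightarrow> 'k" assume "y \<in> coords B"
        from j[OF coords_zero this] show "y \<in> ?g ` coords BE" by (metis image_eqI upper_join)
      qed
    qed
    show "?f ` coords B = {x \<in> coords BE. ?g x = (\<lambda>_. 0)}"
    proof
      show "?f ` coords B \<subseteq> {x \<in> coords BE. ?g x = (\<lambda>_. 0)}" using j by auto
      show "{x \<in> coords BE. ?g x = (\<lambda>_. 0)} \<subseteq> ?f ` coords B"
      proof
        fix z :: "nat \<Rightarrow> 'k" assume z: "z \<in> {x \<in> coords BE. ?g x = (\<lambda>_. 0)}"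
        then have "z = ?f (lower z)" by (intro join_eqI) simp_all
        then show "z \<in> ?f ` coords B" using z lo(1) by blast
      qed
    qed
  qed
  then obtain s where s: "s \<in> left_module_hom PA M E.M" and us: "\<And>x. x \<in> coords B \<Longrightarrow> upper (s x) = x"
    using ext E.std_left_module unfolding Ext1_zero_def std_module_simps by blast
  note sD = homD[OF s, unfolded std_module_simps]
  have sj: "s x = join (lower (s x)) x" if "x \<in> coords B" for x
    by (rule join_eqI[OF refl us[OF that]])
  let ?F = "\<lambda>x. lower (s x)"
  show "\<exists>F. graded F \<and> (\<forall>a\<in>arcs Q. \<forall>x\<in>coords B. F (Xa a x) = (\<lambda>i. Xa a (F x) i + H a x i))"
    unfolding graded_def
  proof (intro exI[of _ ?F] conjI ballI lin_onI)
    fix x :: "nat \<Rightarrow> 'k" assume x: "x \<in> coords B"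
    note sx = sD(1)[OF x]
    show "?F x \<in> coords B" by (rule lo(1)[OF sx])
    show "?F (\<lambda>i. c * x i) = (\<lambda>i. c * ?F x i)" for c
      unfolding sD(3)[OF x] E.act_scalar[OF sx] lower_upper_add ..
    show "?F (res v x) = res v (?F x)" if "v \<in> verts Q" for v
      unfolding sD(4)[OF that x] E.act_vertex resE by simp
    show "?F (Xa a x) = (\<lambda>i. Xa a (?F x) i + H a x i)" if "a \<in> arcs Q" for a
      unfolding sD(5)[OF that x] E.act_arrow arrE[OF that sx] us[OF x] by simp
    fix y :: "nat \<Rightarrow> 'k" assume y: "y \<in> coords B"
    show "?F (\<lambda>i. x i + y i) = (\<lambda>i. ?F x i + ?F y i)"
      unfolding sD(2)[OF x y] lower_upper_add ..
  qed
qed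

end

section \<open>Transport along isomorphisms and coordinates for finite-dimensional modules\<close>

lemma left_module_hom_comp:
  assumes "f \<in> left_module_hom R L M" "g \<in> left_module_hom R M N"
  shows "(\<lambda>x. g (f x)) \<in> left_module_hom R L N"
  using assms unfolding left_module_hom_def by (auto simp: Pi_iff)

lemma left_module_hom_inv:
  assumes L: "left_module R L" and h: "h \<in> left_module_hom R L M" and b: "bij_betw h (carrier L) (carrier M)"
  shows "inv_into (carrier L) h \<in> left_module_hom R M L"
proof -
  interpret left_module R L by (rule L)
  let ?i = "inv_into (carrier L) h"
  have inj: "inj_on h (carrier L)" and im: "h ` carrier L = carrier M" using b by (auto simp: bij_betw_def)
  have ic: "?i y \<in> carrier L" if "y \<in> carrier M" for y using inv_into_into[of y h "carrier L"] that im by simp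
  have hi: "h (?i y) = y" if "y \<in> carrier M" for y using f_inv_into_f[of y h "carrier L"] that im by simp
  have ih: "?i (h x) = x" if "x \<in> carrier L" for x by (rule inv_into_f_f[OF inj that])
  have hadd: "h (x \<oplus>\<^bsub>L\<^esub> y) = h x \<oplus>\<^bsub>M\<^esub> h y" if "x \<in> carrier L" "y \<in> carrier L" for x y
    using h that unfolding left_module_hom_def by blast
  have hact: "h (a \<odot>\<^bsub>L\<^esub> x) = a \<odot>\<^bsub>M\<^esub> h x" if "a \<in> carrier R" "x \<in> carrier L" for a x
    using h that unfolding left_module_hom_def by blast
  have "?i (x \<oplus>\<^bsub>M\<^esub> y) = ?i x \<oplus>\<^bsub>L\<^esub> ?i y" if "x \<in> carrier M" "y \<in> carrier M" for x y
    using ih[OF M.a_closed[OF ic[OF that(1)] ic[OF that(2)]]] unfolding hadd[OF ic[OF that(1)] ic[OF that(2)]] hi[OF that(1)] hi[OF that(2)] .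
  moreover have "?i (a \<odot>\<^bsub>M\<^esub> x) = a \<odot>\<^bsub>L\<^esub> ?i x" if "a \<in> carrier R" "x \<in> carrier M" for a x
    using ih[OF smult_closed[OF that(1) ic[OF that(2)]]] unfolding hact[OF that(1) ic[OF that(2)]] hi[OF that(2)] .
  ultimately show ?thesis unfolding left_module_hom_def using ic by blast
qed

text \<open>An extension of \<open>L\<close> by \<open>L\<close> becomes one of \<open>M\<close> by
  \<open>M\<close> with the same middle term: compose \<open>f\<close> with the inverse of
  \<open>h\<close>, and \<open>g\<close> with \<open>h\<close>.\<close>

lemma iso_Ext1_zero:
  fixes L M :: "('v, 'e, 'k::field) kQ_module"
  assumes L: "left_module (path_algebra Q) L" and M: "left_module (path_algebra Q) M"
    and h: "h \<in> left_module_hom (path_algebra Q) L M"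
    and b: "bij_betw h (carrier L) (carrier M)" and ext: "Ext1_zero Q M M"
  shows "Ext1_zero Q L L"
  unfolding Ext1_zero_def
proof (intro allI impI)
  let ?R = "path_algebra Q :: (('v, 'e) qpath \<Rightarrow> 'k) ring"
  fix E :: "('v, 'e, 'k) kQ_module" and f g
  assume E: "left_module ?R E \<and> short_exact ?R L f E g L"
  let ?i = "inv_into (carrier L) h"
  have inj: "inj_on h (carrier L)" and im: "h ` carrier L = carrier M" using b by (auto simp: bij_betw_def)
  have bi: "bij_betw ?i (carrier M) (carrier L)" by (rule bij_betw_inv_into[OF b])
  note i = left_module_hom_inv[OF L h b]
  have f: "f \<in> left_module_hom ?R L E" "g \<in> left_module_hom ?R E L" "inj_on f (carrier L)" "g ` carrier E = carrier L"
    "f ` carrier L = {x \<in> carrier E. g x = \<zero>\<^bsub>L\<^esub>}" using E unfolding short_exact_def by auto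
  interpret L: left_module ?R L by (rule L)
  interpret M: left_module ?R M by (rule M)
  have hc: "x \<in> carrier L \<Longrightarrow> h x \<in> carrier M" for x using h unfolding left_module_hom_def by blast
  have gc: "x \<in> carrier E \<Longrightarrow> g x \<in> carrier L" for x using f(2) unfolding left_module_hom_def by blast
  have hadd: "h (x \<oplus>\<^bsub>L\<^esub> y) = h x \<oplus>\<^bsub>M\<^esub> h y" if "x \<in> carrier L" "y \<in> carrier L" for x y
    using h that unfolding left_module_hom_def by blast
  have "h \<zero>\<^bsub>L\<^esub> \<oplus>\<^bsub>M\<^esub> h \<zero>\<^bsub>L\<^esub> = h \<zero>\<^bsub>L\<^esub>" using hadd[OF L.M.zero_closed L.M.zero_closed] by simp
  then have h0: "h \<zero>\<^bsub>L\<^esub> = \<zero>\<^bsub>M\<^esub>" using hc[OF L.M.zero_closed] by simp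
  have "short_exact ?R M (\<lambda>x. f (?i x)) E (\<lambda>x. h (g x)) M"
    unfolding short_exact_def
  proof (intro conjI left_module_hom_comp[OF i f(1)] left_module_hom_comp[OF f(2) h])
    show "inj_on (\<lambda>x. f (?i x)) (carrier M)"
      using comp_inj_on[of ?i "carrier M" f] bi f(3) by (simp add: bij_betw_def o_def)
    show "(\<lambda>x. h (g x)) ` carrier E = carrier M"
      unfolding im[symmetric] f(4)[symmetric] by (simp add: image_image)
    have "(\<lambda>x. f (?i x)) ` carrier M = f ` (?i ` carrier M)" by (simp add: image_image)
    also have "?i ` carrier M = carrier L" using bi by (simp add: bij_betw_def)
    also have "f ` carrier L = {x \<in> carrier E. h (g x) = \<zero>\<^bsub>M\<^esub>}"
      unfolding f(5) h0[symmetric] using inj gc L.M.zero_closed by (auto simp: inj_on_def)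
    finally show "(\<lambda>x. f (?i x)) ` carrier M = {x \<in> carrier E. h (g x) = \<zero>\<^bsub>M\<^esub>}" .
  qed
  then obtain s where s: "s \<in> left_module_hom ?R M E" "\<And>x. x \<in> carrier M \<Longrightarrow> h (g (s x)) = x"
    using ext E unfolding Ext1_zero_def by blast
  have sc: "x \<in> carrier M \<Longrightarrow> s x \<in> carrier E" for x using s(1) unfolding left_module_hom_def by blast
  show "\<exists>s\<in>left_module_hom ?R L E. \<forall>x\<in>carrier L. g (s x) = x"
  proof (intro bexI[of _ "\<lambda>x. s (h x)"] ballI left_module_hom_comp[OF h s(1)])
    fix x assume x: "x \<in> carrier L"
    show "g (s (h x)) = x"
      by (rule inj_onD[OF inj s(2)[OF hc[OF x]] gc[OF sc[OF hc[OF x]]] x])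
  qed
qed

lemma iso_indecomposable:
  assumes L: "left_module R L" and M: "left_module R M" and h: "h \<in> left_module_hom R L M"
    and b: "bij_betw h (carrier L) (carrier M)" and ind: "indecomposable R M"
  shows "indecomposable R L"
  unfolding indecomposable_def
proof (intro conjI allI impI)
  interpret L: left_module R L by (rule L)
  interpret M: left_module R M by (rule M)
  have inj: "inj_on h (carrier L)" and im: "h ` carrier L = carrier M" using b by (auto simp: bij_betw_def)
  have hc: "x \<in> carrier L \<Longrightarrow> h x \<in> carrier M" for x using im by blast
  have hadd: "h (x \<oplus>\<^bsub>L\<^esub> y) = h x \<oplus>\<^bsub>M\<^esub> h y" if "x \<in> carrier L" "y \<in> carrier L" for x y
    using h that unfolding left_module_hom_def by blast
  have hact: "h (a \<odot>\<^bsub>L\<^esub> x) = a \<odot>\<^bsub>M\<^esub> h x" if "a \<in> carrier R" "x \<in> carrier L" for a x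
    using h that unfolding left_module_hom_def by blast
  have "h \<zero>\<^bsub>L\<^esub> \<oplus>\<^bsub>M\<^esub> h \<zero>\<^bsub>L\<^esub> = h \<zero>\<^bsub>L\<^esub>" using hadd[OF L.M.zero_closed L.M.zero_closed] by simp
  then have h0: "h \<zero>\<^bsub>L\<^esub> = \<zero>\<^bsub>M\<^esub>" using hc[OF L.M.zero_closed] by simp
  show "carrier L \<noteq> {\<zero>\<^bsub>L\<^esub>}"
  proof
    assume "carrier L = {\<zero>\<^bsub>L\<^esub>}"
    then have "carrier M = {\<zero>\<^bsub>M\<^esub>}" using im h0 by simp
    then show False using ind by (simp add: indecomposable_def)
  qed
  have sub: "left_submodule R M (h ` X)" if "left_submodule R L X" for X
  proof -
    have X: "X \<subseteq> carrier L" "\<zero>\<^bsub>L\<^esub> \<in> X" "\<And>x y. x \<in> X \<Longrightarrow> y \<in> X \<Longrightarrow> x \<oplus>\<^bsub>L\<^esub> y \<in> X"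
      "\<And>a x. a \<in> carrier R \<Longrightarrow> x \<in> X \<Longrightarrow> a \<odot>\<^bsub>L\<^esub> x \<in> X" using that unfolding left_submodule_def by auto
    show ?thesis unfolding left_submodule_def
    proof (intro conjI ballI)
      show "h ` X \<subseteq> carrier M" using X(1) hc by blast
      show "\<zero>\<^bsub>M\<^esub> \<in> h ` X" using X(2) h0 by (metis imageI)
      fix y assume "y \<in> h ` X"
      then obtain x where x: "x \<in> X" "y = h x" by blast
      have xc: "x \<in> carrier L" using X(1) x(1) by blast
      show "a \<odot>\<^bsub>M\<^esub> y \<in> h ` X" if "a \<in> carrier R" for a
        unfolding x(2) hact[OF that xc, symmetric] using X(4)[OF that x(1)] by (rule imageI)
      fix y' assume "y' \<in> h ` X"
      then obtain x' where x': "x' \<in> X" "y' = h x'" by blast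
      have xc': "x' \<in> carrier L" using X(1) x'(1) by blast
      show "y \<oplus>\<^bsub>M\<^esub> y' \<in> h ` X"
        unfolding x(2) x'(2) hadd[OF xc xc', symmetric] using X(3)[OF x(1) x'(1)] by (rule imageI)
    qed
  qed
  fix X Y assume XY: "left_submodule R L X \<and> left_submodule R L Y \<and> X \<inter> Y = {\<zero>\<^bsub>L\<^esub>}
      \<and> {x \<oplus>\<^bsub>L\<^esub> y |x y. x \<in> X \<and> y \<in> Y} = carrier L"
  have Xc: "X \<subseteq> carrier L" and Yc: "Y \<subseteq> carrier L" using XY unfolding left_submodule_def by auto
  have "h ` X \<inter> h ` Y = {\<zero>\<^bsub>M\<^esub>}"
    unfolding inj_on_image_Int[OF inj Xc Yc, symmetric] h0[symmetric] using XY by simp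
  moreover have "{x \<oplus>\<^bsub>M\<^esub> y |x y. x \<in> h ` X \<and> y \<in> h ` Y} = carrier M"
  proof
    show "{x \<oplus>\<^bsub>M\<^esub> y |x y. x \<in> h ` X \<and> y \<in> h ` Y} \<subseteq> carrier M" using Xc Yc hc by auto
    show "carrier M \<subseteq> {x \<oplus>\<^bsub>M\<^esub> y |x y. x \<in> h ` X \<and> y \<in> h ` Y}"
    proof
      fix w assume "w \<in> carrier M"
      then obtain z where z: "z \<in> carrier L" "w = h z" using im by blast
      then have "z \<in> {x \<oplus>\<^bsub>L\<^esub> y |x y. x \<in> X \<and> y \<in> Y}" using XY by simp
      then obtain x y where "x \<in> X" "y \<in> Y" "w = h (x \<oplus>\<^bsub>L\<^esub> y)" using z(2) by blast
      moreover from this have "w = h x \<oplus>\<^bsub>M\<^esub> h y" using hadd Xc Yc by blast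
      ultimately show "w \<in> {x \<oplus>\<^bsub>M\<^esub> y |x y. x \<in> h ` X \<and> y \<in> h ` Y}" by blast
    qed
  qed
  ultimately have "h ` X = {\<zero>\<^bsub>M\<^esub>} \<or> h ` Y = {\<zero>\<^bsub>M\<^esub>}"
    using ind sub XY unfolding indecomposable_def by blast
  moreover have "Z = {\<zero>\<^bsub>L\<^esub>}" if "Z \<subseteq> carrier L" "h ` Z = {\<zero>\<^bsub>M\<^esub>}" for Z
    using that h0 inj L.M.zero_closed inj_on_image_eq_iff[OF inj that(1), of "{\<zero>\<^bsub>L\<^esub>}"] by simp
  ultimately show "X = {\<zero>\<^bsub>L\<^esub>} \<or> Y = {\<zero>\<^bsub>L\<^esub>}" using Xc Yc by blast
qed

context pa_quiver
begin

text \<open>The vertex idempotents split the module, so bases of the vertex spaces together form a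
  basis. With its elements as the vectors \<open>z\<close>, the map \<open>theta\<close> is
  bijective, and the arrows are transported along it to coordinates.\<close>

lemma finite_dimensional_std:
  fixes M' :: "('v, 'e, 'k::field) kQ_module"
  assumes M': "left_module PA M'" and dim: "has_dimension_vector Q M' m"
  obtains B vt and X :: "'e \<Rightarrow> (nat \<Rightarrow> 'k) \<Rightarrow> nat \<Rightarrow> 'k" and h
  where "std_quiver Q B vt X" "h \<in> left_module_hom PA (std_module Q B vt X) M'"
    "bij_betw h (coords B) (carrier M')" "\<And>v. v \<in> verts Q \<Longrightarrow> card {i \<in> B. vt i = v} = m v"
proof -
  interpret E: pa_module Q M' by (rule pa_module.intro[OF pa_quiver_axioms pa_module_axioms.intro[OF M']])
  have "\<forall>v\<in>verts Q. \<exists>b. b ` {..<m v} \<subseteq> vertex_space M' v \<and> (\<forall>x\<in>vertex_space M' v.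
      \<exists>!c. c \<in> {..<m v} \<rightarrow>\<^sub>E UNIV \<and> x = finsum M' (\<lambda>j. E.sc (c j) (b j)) {..<m v})"
    using dim unfolding has_dimension_vector_def has_dimension_def by blast
  from bchoice[OF this] obtain b where b0: "\<forall>v\<in>verts Q. b v ` {..<m v} \<subseteq> vertex_space M' v \<and> (\<forall>x\<in>vertex_space M' v.
      \<exists>!c. c \<in> {..<m v} \<rightarrow>\<^sub>E UNIV \<and> x = finsum M' (\<lambda>j. E.sc (c j) (b v j)) {..<m v})" by (elim exE)
  have b: "b v ` {..<m v} \<subseteq> vertex_space M' v"
    and basis: "x \<in> vertex_space M' v \<Longrightarrow>
      \<exists>!c. c \<in> {..<m v} \<rightarrow>\<^sub>E UNIV \<and> x = finsum M' (\<lambda>j. E.sc (c j) (b v j)) {..<m v}"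
    if "v \<in> verts Q" for v x using bspec[OF b0 that] by simp_all
  let ?S = "SIGMA v:verts Q. {..<m v}"
  \<comment> \<open>The pairs of a vertex and a basis index are numbered, because the carriers
    consist of functions on the natural numbers.\<close>
  define B where "B = {0..<card ?S}"
  have "finite ?S" using fin by simp
  then obtain e where e: "bij_betw e B ?S" using ex_bij_betw_nat_finite unfolding B_def by blast
  define vt where "vt i = fst (e i)" for i
  define z where "z i = b (vt i) (snd (e i))" for i
  define e' where "e' = inv_into B e"
  have eB: "vt i \<in> verts Q" "snd (e i) < m (vt i)" if "i \<in> B" for i
    using bij_betwE[OF e] that unfolding vt_def by (auto simp: mem_Sigma_iff split: prod.splits)
  have e': "e' (v, j) \<in> B" "e (e' (v, j)) = (v, j)" if "v \<in> verts Q" "j < m v" for v j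
  proof -
    have "(v, j) \<in> e ` B" using e that by (simp add: bij_betw_def)
    then show "e' (v, j) \<in> B" "e (e' (v, j)) = (v, j)"
      unfolding e'_def by (rule inv_into_into, rule f_inv_into_f)
  qed
  have e'e: "e' (e i) = i" if "i \<in> B" for i
    unfolding e'_def using e that by (simp add: bij_betw_def inv_into_f_f)
  have zv: "z i \<in> vertex_space M' (vt i)" if "i \<in> B" for i
    using b[OF eB(1)[OF that]] eB(2)[OF that] unfolding z_def by blast
  have zb: "z (e' (v, j)) = b v j" if "v \<in> verts Q" "j < m v" for v j
    unfolding z_def vt_def e'(2)[OF that] by simp
  have zw: "\<exists>w\<in>carrier M'. z i = vertex_idempotent (vt i) \<odot>\<^bsub>M'\<^esub> w" if "i \<in> B" for i
    using zv[OF that] unfolding vertex_space_def by blast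
  have zc: "z i \<in> carrier M'" if "i \<in> B" for i
    using zw[OF that] E.act_closed[OF vertex_idempotent_closed[OF eB(1)[OF that]]] by metis
  have bc: "b v j \<in> carrier M'" if "v \<in> verts Q" "j < m v" for v j
    using zc[OF e'(1)[OF that]] unfolding zb[OF that] .
  interpret th: theta_map Q M' B vt z
  proof
    show "finite B" unfolding B_def by simp
    show "z i \<in> carrier M'" if "i \<in> B" for i by (rule zc[OF that])
    fix i v assume i: "i \<in> B" and v: "v \<in> verts Q"
    obtain w where w: "w \<in> carrier M'" "z i = vertex_idempotent (vt i) \<odot>\<^bsub>M'\<^esub> w" using zw[OF i] by blast
    show "vertex_idempotent v \<odot>\<^bsub>M'\<^esub> z i = (if v = vt i then z i else \<zero>\<^bsub>M'\<^esub>)"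
      unfolding w(2) E.act_vertex[OF v eB(1)[OF i] w(1)] ..
  qed
  let ?t = th.theta
  \<comment> \<open>The component of \<open>theta x\<close> at \<open>v\<close> is an expansion in
    the basis \<open>b v\<close>: uniqueness of the coefficients gives injectivity of
    \<open>theta\<close>, their existence surjectivity.\<close>
  have part: "vertex_idempotent v \<odot>\<^bsub>M'\<^esub> ?t x = finsum M' (\<lambda>j. E.sc (x (e' (v, j))) (b v j)) {..<m v}"
    if v: "v \<in> verts Q" for v x
  proof -
    let ?N = "{i \<in> B. vt i = v}"
    have im: "(\<lambda>j. e' (v, j)) ` {..<m v} = ?N"
    proof
      show "(\<lambda>j. e' (v, j)) ` {..<m v} \<subseteq> ?N" using e'[OF v] unfolding vt_def by auto
      show "?N \<subseteq> (\<lambda>j. e' (v, j)) ` {..<m v}"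
      proof
        fix i assume i: "i \<in> ?N"
        then have "i = e' (v, snd (e i))" using e'e[of i] unfolding vt_def by (metis (mono_tags, lifting) mem_Collect_eq prod.collapse)
        then show "i \<in> (\<lambda>j. e' (v, j)) ` {..<m v}" using i eB(2)[of i] by blast
      qed
    qed
    have inj: "inj_on (\<lambda>j. e' (v, j)) {..<m v}"
      by (rule inj_on_inverseI[where g = "\<lambda>i. snd (e i)"]) (simp add: e'(2)[OF v])
    have split: "B = ?N \<union> (B - ?N)" by blast
    let ?y = "restr B vt v x"
    let ?g = "\<lambda>i. E.sc (?y i) (z i)"
    have g: "?g \<in> B \<rightarrow> carrier M'" by (rule th.term_closed)
    have "vertex_idempotent v \<odot>\<^bsub>M'\<^esub> ?t x = finsum M' ?g B"
      unfolding th.theta_vertex[OF v, symmetric] unfolding th.theta_def ..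
    also have "\<dots> = finsum M' ?g (?N \<union> (B - ?N))" using split by simp
    also have "\<dots> = finsum M' ?g ?N \<oplus>\<^bsub>M'\<^esub> finsum M' ?g (B - ?N)"
      using g by (intro E.finsum_Un_disjoint) (auto simp: B_def)
    also have "finsum M' ?g (B - ?N) = finsum M' (\<lambda>_. \<zero>\<^bsub>M'\<^esub>) (B - ?N)"
      by (rule E.finsum_cong') (auto simp: restr_def E.sc_zero zc)
    also have "\<dots> = \<zero>\<^bsub>M'\<^esub>" by (rule E.finsum_zero)
    also have "finsum M' ?g ?N \<oplus>\<^bsub>M'\<^esub> \<zero>\<^bsub>M'\<^esub> = finsum M' ?g ?N"
      using g by (intro E.r_zero E.finsum_closed) auto
    also have "\<dots> = finsum M' (\<lambda>j. ?g (e' (v, j))) {..<m v}"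
      unfolding im[symmetric]
      by (rule E.finsum_reindex[OF _ inj]) (use g im in auto)
    also have "\<dots> = finsum M' (\<lambda>j. E.sc (x (e' (v, j))) (b v j)) {..<m v}"
    proof (rule E.finsum_cong'[OF refl])
      show "(\<lambda>j. E.sc (x (e' (v, j))) (b v j)) \<in> {..<m v} \<rightarrow> carrier M'"
      proof
        fix j assume "j \<in> {..<m v}"
        then show "E.sc (x (e' (v, j))) (b v j) \<in> carrier M'" using E.sc_closed[OF bc[OF v]] by simp
      qed
      fix j assume "j \<in> {..<m v}"
      then have j: "j < m v" by simp
      have "?y (e' (v, j)) = x (e' (v, j))" using e'[OF v j] by (simp add: restr_def vt_def)
      then show "E.sc (?y (e' (v, j))) (z (e' (v, j))) = E.sc (x (e' (v, j))) (b v j)"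
        unfolding zb[OF v j] by simp
    qed
    finally show ?thesis .
  qed
  have vs: "vertex_idempotent v \<odot>\<^bsub>M'\<^esub> y \<in> vertex_space M' v" if "y \<in> carrier M'" for v y
    using that unfolding vertex_space_def by blast
  have inj: "inj_on ?t (coords B)"
  proof (rule inj_onI)
    fix x y :: "nat \<Rightarrow> 'k" assume x: "x \<in> coords B" and y: "y \<in> coords B" and eq: "?t x = ?t y"
    have "x i = y i" if i: "i \<in> B" for i
    proof -
      let ?v = "vt i"
      note v = eB(1)[OF i]
      let ?c = "\<lambda>x. restrict (\<lambda>j. x (e' (?v, j))) {..<m ?v}"
      have c: "?c x \<in> {..<m ?v} \<rightarrow>\<^sub>E UNIV \<and> vertex_idempotent ?v \<odot>\<^bsub>M'\<^esub> ?t x = finsum M' (\<lambda>j. E.sc (?c x j) (b ?v j)) {..<m ?v}" for x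
        unfolding part[OF v]
      proof (intro conjI E.finsum_cong'[OF refl])
        show "(\<lambda>j. E.sc (?c x j) (b ?v j)) \<in> {..<m ?v} \<rightarrow> carrier M'" using E.sc_closed[OF bc[OF v]] by blast
      qed simp_all
      have "?c x = ?c y"
        using basis[OF v vs[OF th.theta_closed]] c[of x] c[of y] unfolding eq by blast
      then have "?c x (snd (e i)) = ?c y (snd (e i))" by simp
      then show ?thesis using eB(2)[OF i] e'e[OF i] unfolding vt_def by simp
    qed
    then show "x = y" using coords_off[OF x] coords_off[OF y] by (metis ext)
  qed
  have surj: "?t ` coords B = carrier M'"
  proof
    show "?t ` coords B \<subseteq> carrier M'" using th.theta_closed by blast
    show "carrier M' \<subseteq> ?t ` coords B"
    proof
      fix y assume y: "y \<in> carrier M'"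
      have "\<forall>v\<in>verts Q. \<exists>c. vertex_idempotent v \<odot>\<^bsub>M'\<^esub> y = finsum M' (\<lambda>j. E.sc (c j) (b v j)) {..<m v}"
        using basis[OF _ vs[OF y]] by blast
      from bchoice[OF this] obtain c where c0: "\<forall>v\<in>verts Q.
          vertex_idempotent v \<odot>\<^bsub>M'\<^esub> y = finsum M' (\<lambda>j. E.sc (c v j) (b v j)) {..<m v}" by (elim exE)
      note c = bspec[OF c0]
      define x where "x i = (if i \<in> B then c (fst (e i)) (snd (e i)) else 0)" for i
      have "?t x = y"
      proof (rule E.vertices_separate[OF th.theta_closed y])
        fix v assume v: "v \<in> verts Q"
        show "vertex_idempotent v \<odot>\<^bsub>M'\<^esub> ?t x = vertex_idempotent v \<odot>\<^bsub>M'\<^esub> y"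
          unfolding part[OF v] c[OF v]
        proof (rule E.finsum_cong'[OF refl])
          show "(\<lambda>j. E.sc (c v j) (b v j)) \<in> {..<m v} \<rightarrow> carrier M'" using E.sc_closed[OF bc[OF v]] by blast
          fix j assume "j \<in> {..<m v}"
          then show "E.sc (x (e' (v, j))) (b v j) = E.sc (c v j) (b v j)"
            unfolding x_def using e'[OF v] by simp
        qed
      qed
      moreover have "x \<in> coords B" unfolding coords_def x_def by simp
      ultimately show "y \<in> ?t ` coords B" by blast
    qed
  qed
  define X where "X a x = inv_into (coords B) ?t (arrow_elt Q a \<odot>\<^bsub>M'\<^esub> ?t x)" for a x
  have X: "X a x \<in> coords B" "?t (X a x) = arrow_elt Q a \<odot>\<^bsub>M'\<^esub> ?t x" if "a \<in> arcs Q" for a x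
  proof -
    have "arrow_elt Q a \<odot>\<^bsub>M'\<^esub> ?t x \<in> ?t ` coords B"
      unfolding surj by (rule E.act_closed[OF arrow_elt_closed[OF that] th.theta_closed])
    then show "X a x \<in> coords B" "?t (X a x) = arrow_elt Q a \<odot>\<^bsub>M'\<^esub> ?t x"
      unfolding X_def by (rule inv_into_into, rule f_inv_into_f)
  qed
  have Xu: "X a x = y" if "a \<in> arcs Q" "y \<in> coords B" "?t y = arrow_elt Q a \<odot>\<^bsub>M'\<^esub> ?t x" for a x y
    by (rule inj_onD[OF inj _ X(1)[OF that(1)] that(2)]) (simp only: X(2)[OF that(1)] that(3))
  interpret L: std_quiver Q B vt X
  proof
    show "finite B" unfolding B_def by simp
    show "i \<in> B \<Longrightarrow> vt i \<in> verts Q" for i by (rule eB(1))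
    fix a assume a: "a \<in> arcs Q"
    note ac = arrow_elt_closed[OF a]
    show "lin_on B B (X a)"
    proof (rule lin_onI)
      fix x :: "nat \<Rightarrow> 'k"
      show "X a x \<in> coords B" by (rule X(1)[OF a])
      show "X a (\<lambda>i. c * x i) = (\<lambda>i. c * X a x i)" for c
        by (rule Xu[OF a coords_scale[OF X(1)[OF a]]])
          (simp only: th.theta_scale X(2)[OF a] E.act_sc[OF ac th.theta_closed])
      fix y :: "nat \<Rightarrow> 'k"
      show "X a (\<lambda>i. x i + y i) = (\<lambda>i. X a x i + X a y i)"
        by (rule Xu[OF a coords_add[OF X(1)[OF a] X(1)[OF a]]])
          (simp only: th.theta_add X(2)[OF a] E.act_add_right[OF ac th.theta_closed th.theta_closed])
    qed
  qed
  have hom: "?t \<in> left_module_hom PA L.M M'"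
  proof (rule L.std_hom[OF M'])
    show "?t \<in> coords B \<rightarrow> carrier M'" using th.theta_closed by blast
    show "?t (L.Xa a x) = arrow_elt Q a \<odot>\<^bsub>M'\<^esub> ?t x" if a: "a \<in> arcs Q" for a x
      unfolding arrow_op_def th.theta_vertex[OF L.arrow_verts(1)[OF a]] X(2)[OF a] th.theta_vertex[OF L.arrow_verts(2)[OF a]]
        E.act_arrow(2)[OF a th.theta_closed] by (rule E.act_arrow(1)[OF a th.theta_closed])
  qed (rule th.theta_add th.theta_scale, rule th.theta_scale th.theta_vertex, erule th.theta_vertex)
  have "card {i \<in> B. vt i = v} = m v" if v: "v \<in> verts Q" for v
  proof -
    have "bij_betw (\<lambda>j. e' (v, j)) {..<m v} {i \<in> B. vt i = v}"
      by (rule bij_betw_byWitness[where f' = "\<lambda>i. snd (e i)"])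
        (use e'[OF v] e'e eB in \<open>auto simp: vt_def\<close>)
    then show ?thesis using bij_betw_same_card by fastforce
  qed
  then show thesis
    by (rule that[OF L.std_quiver_axioms hom bij_betw_imageI[OF inj surj]])
qed

end


section \<open>Endomorphisms of an indecomposable rigid representation\<close>

context std_quiver
begin

lemma endo_comp:
  assumes F: "endo F" and G: "endo G" shows "endo (\<lambda>x. F (G x))"
  unfolding endo_def graded_def
proof (intro conjI ballI lin_onI)
  note Fd = endoD[OF F] and Gd = endoD[OF G]
  note Fl = lin_onD[OF Fd(1)] and Gl = lin_onD[OF Gd(1)]
  fix x :: "nat \<Rightarrow> 'k" assume x: "x \<in> coords B"
  note Gx = Gl(1)[OF x]
  show "F (G x) \<in> coords B" by (rule Fl(1)[OF Gx])
  show "F (G (\<lambda>i. c * x i)) = (\<lambda>i. c * F (G x) i)" for c unfolding Gl(3)[OF x] by (rule Fl(3)[OF Gx])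
  show "F (G (res v x)) = res v (F (G x))" if "v \<in> verts Q" for v
    unfolding Gd(2)[OF that x] by (rule Fd(2)[OF that Gx])
  show "F (G (Xa a x)) = Xa a (F (G x))" if "a \<in> arcs Q" for a
    unfolding Gd(3)[OF that x] by (rule Fd(3)[OF that Gx])
  fix y :: "nat \<Rightarrow> 'k" assume y: "y \<in> coords B"
  show "F (G (\<lambda>i. x i + y i)) = (\<lambda>i. F (G x) i + F (G y) i)"
    unfolding Gl(2)[OF x y] by (rule Fl(2)[OF Gx Gl(1)[OF y]])
qed

lemma endo_id: "endo (\<lambda>x. x)"
  unfolding endo_def graded_def by (simp add: lin_on_def)

lemma endo_compow: "endo F \<Longrightarrow> endo (F ^^ n)"
proof (induction n)
  case 0
  then show ?case using endo_id by (simp add: id_def)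
next
  case (Suc n)
  then show ?case using endo_comp[of F "F ^^ n"] by (simp add: o_def)
qed

text \<open>\<open>M\<close> is the direct sum of the kernel \<open>K\<close> and the image
  \<open>I\<close> of a power \<open>G\<close> of \<open>F\<close>, so one of them is zero. If it is
  \<open>I\<close>, then \<open>F\<close> is nilpotent; if it is \<open>K\<close>, then
  \<open>F\<close> is injective, because the exponent of the power is positive.\<close>

lemma endo_nilpotent_or_injective:
  assumes ind: "indecomposable PA M" and F: "endo F"
  shows "(\<exists>m. \<forall>x\<in>coords B. (F ^^ m) x = (\<lambda>_. 0)) \<or> (\<forall>x\<in>coords B. F x = (\<lambda>_. 0) \<longrightarrow> x = (\<lambda>_. 0))"
proof -
  obtain m g where g: "lin_on B B g" "\<And>x. x \<in> coords B \<Longrightarrow> (F ^^ m) ((F ^^ m) (g x)) = (F ^^ m) x"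
    "\<And>x. x \<in> coords B \<Longrightarrow> g ((F ^^ m) ((F ^^ m) x)) = (F ^^ m) x" and m: "0 < m"
  proof (rule Fitting_operator[OF finB endoD(1)[OF F]])
    fix g m assume "lin_on B B g" "\<And>x. x \<in> coords B \<Longrightarrow> (F ^^ m) ((F ^^ m) (g x)) = (F ^^ m) x"
      "\<And>x. x \<in> coords B \<Longrightarrow> g ((F ^^ m) ((F ^^ m) x)) = (F ^^ m) x" "0 < m"
    then show thesis by (rule that)
  qed
  define G where "G = F ^^ m"
  note gm = g[folded G_def]
  have G: "endo G" unfolding G_def by (rule endo_compow[OF F])
  note Gd = endoD[OF G] and Gl = lin_onD[OF endoD(1)[OF G]] and gl = lin_onD[OF g(1)]
  define K where "K = {x \<in> coords B. G x = (\<lambda>_. 0)}"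
  define I where "I = G ` coords B"
  have K: "left_submodule PA M K"
  proof (rule std_submodule)
    show "K \<subseteq> coords B" "(\<lambda>_. 0) \<in> K" unfolding K_def using lin_on_zero[OF Gd(1)] by auto
    fix x assume "x \<in> K"
    then have x: "x \<in> coords B" "G x = (\<lambda>_. 0)" unfolding K_def by auto
    show "(\<lambda>i. c * x i) \<in> K" for c unfolding K_def using coords_scale[OF x(1)] Gl(3)[OF x(1)] x(2) by simp
    show "res v x \<in> K" if "v \<in> verts Q" for v
      unfolding K_def using res_closed[OF x(1)] Gd(2)[OF that x(1)] x(2) by simp
    show "Xa a x \<in> K" if "a \<in> arcs Q" for a
      unfolding K_def using lin_onD(1)[OF arrow_lin[OF that] x(1)] Gd(3)[OF that x(1)] x(2) lin_on_zero[OF arrow_lin[OF that]] by simp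
    fix y assume "y \<in> K"
    then have y: "y \<in> coords B" "G y = (\<lambda>_. 0)" unfolding K_def by auto
    show "(\<lambda>i. x i + y i) \<in> K" unfolding K_def using coords_add[OF x(1) y(1)] Gl(2)[OF x(1) y(1)] x(2) y(2) by simp
  qed
  have I: "left_submodule PA M I"
  proof (rule std_submodule)
    show "I \<subseteq> coords B" unfolding I_def using Gl(1) by blast
    show "(\<lambda>_. 0) \<in> I" unfolding I_def by (rule image_eqI[OF _ coords_zero]) (rule lin_on_zero[OF Gd(1), symmetric])
    fix x assume "x \<in> I"
    then obtain u where u: "u \<in> coords B" "x = G u" unfolding I_def by blast
    show "(\<lambda>i. c * x i) \<in> I" for c
      unfolding I_def u(2) by (rule image_eqI[OF _ coords_scale[OF u(1)]]) (rule Gl(3)[OF u(1), symmetric])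
    show "res v x \<in> I" if "v \<in> verts Q" for v
      unfolding I_def u(2) by (rule image_eqI[OF _ res_closed[OF u(1)]]) (rule Gd(2)[OF that u(1), symmetric])
    show "Xa a x \<in> I" if "a \<in> arcs Q" for a
      unfolding I_def u(2) by (rule image_eqI[OF _ lin_onD(1)[OF arrow_lin[OF that] u(1)]]) (rule Gd(3)[OF that u(1), symmetric])
    fix y assume "y \<in> I"
    then obtain w where w: "w \<in> coords B" "y = G w" unfolding I_def by blast
    show "(\<lambda>i. x i + y i) \<in> I"
      unfolding I_def u(2) w(2) by (rule image_eqI[OF _ coords_add[OF u(1) w(1)]]) (rule Gl(2)[OF u(1) w(1), symmetric])
  qed
  have int: "K \<inter> I = {\<lambda>_. 0}"
  proof
    show "K \<inter> I \<subseteq> {\<lambda>_. 0}"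
    proof
      fix x assume x: "x \<in> K \<inter> I"
      then obtain u where u: "u \<in> coords B" "x = G u" unfolding I_def by blast
      have "G (G u) = (\<lambda>_. 0)" using x unfolding K_def u(2) by blast
      then have "G u = (\<lambda>_. 0)" using gm(3)[OF u(1)] lin_on_zero[OF g(1)] by simp
      then show "x \<in> {\<lambda>_. 0}" unfolding u(2) by simp
    qed
    show "{\<lambda>_. 0} \<subseteq> K \<inter> I" using submoduleD(2)[OF K] submoduleD(2)[OF I] by blast
  qed
  have sum: "{(\<lambda>i. x i + y i) |x y. x \<in> K \<and> y \<in> I} = coords B"
  proof
    show "{(\<lambda>i. x i + y i) |x y. x \<in> K \<and> y \<in> I} \<subseteq> coords B"
      using submoduleD(1)[OF K] submoduleD(1)[OF I] coords_add by blast
    show "coords B \<subseteq> {(\<lambda>i. x i + y i) |x y. x \<in> K \<and> y \<in> I}"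
    proof
      fix x :: "nat \<Rightarrow> 'k" assume x: "x \<in> coords B"
      note gx = gl(1)[OF x] and Ggx = Gl(1)[OF gl(1)[OF x]]
      let ?u = "\<lambda>i. x i - G (g x) i"
      have "G ?u = (\<lambda>_. 0)" unfolding lin_on_diff[OF Gd(1) x Ggx] gm(2)[OF x] by simp
      then have u1: "?u \<in> K" unfolding K_def using coords_diff[OF x Ggx] by simp
      have u2: "G (g x) \<in> I" unfolding I_def using gx by blast
      show "x \<in> {(\<lambda>i. x i + y i) |x y. x \<in> K \<and> y \<in> I}"
        by (intro CollectI exI[of _ ?u] exI[of _ "G (g x)"] conjI u1 u2) simp
    qed
  qed
  have "K = {\<lambda>_. 0} \<or> I = {\<lambda>_. 0}"
    using ind K I int sum unfolding indecomposable_def std_module_simps by blast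
  then show ?thesis
  proof
    assume K0: "K = {\<lambda>_. 0}"
    obtain m' where m': "m = Suc m'" using m by (cases m) auto
    have "x = (\<lambda>_. 0)" if x: "x \<in> coords B" and "F x = (\<lambda>_. 0)" for x
    proof -
      have "G x = (F ^^ m') (F x)" unfolding G_def m' funpow_Suc_right by simp
      also have "\<dots> = (\<lambda>_. 0)" unfolding that(2) by (rule lin_on_zero[OF endoD(1)[OF endo_compow[OF F]]])
      finally have "x \<in> K" unfolding K_def using x by simp
      then show ?thesis unfolding K0 by simp
    qed
    then show ?thesis by blast
  next
    assume "I = {\<lambda>_. 0}"
    then have "\<forall>x\<in>coords B. G x = (\<lambda>_. 0)" unfolding I_def by blast
    then show ?thesis unfolding G_def by blast
  qed
qed

lemma res_at: "i \<in> B \<Longrightarrow> res (vt i) y i = y i" by (simp add: restr_def)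

text \<open>Of an arbitrary generalised inverse \<open>h\<close> the blocks that stay at one vertex
  are kept. Since \<open>f\<close> preserves vertices, these blocks still satisfy
  \<open>f g f = f\<close>.\<close>

lemma graded_generalized_inverse:
  assumes f: "graded f"
  obtains g where "graded g" "\<And>x. x \<in> coords B \<Longrightarrow> f (g (f x)) = f x"
proof -
  note fl = lin_onD[OF gradedD(1)[OF f]] and fg = gradedD(2)[OF f]
  obtain h where h: "lin_on B B h" "\<And>x. x \<in> coords B \<Longrightarrow> f (h (f x)) = f x"
    using generalized_inverse[OF finB gradedD(1)[OF f]] by blast
  note hl = lin_onD[OF h(1)]
  define g where "g x i = (if i \<in> B then h (res (vt i) x) i else 0)" for x i
  have rg: "res v (g x) = res v (h (res v x))" for v x
    unfolding g_def restr_def[of B vt v "\<lambda>i. if i \<in> B then _ i else 0"] restr_def[of B vt v "h _"] by (rule ext) simp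
  have eqI: "x = y" if "x \<in> coords B" "y \<in> coords B" "\<And>i. i \<in> B \<Longrightarrow> res (vt i) x i = res (vt i) y i" for x y :: "nat \<Rightarrow> 'k"
  proof
    fix i
    show "x i = y i" using that(3)[of i] coords_off[OF that(1)] coords_off[OF that(2)] by (cases "i \<in> B") (simp_all add: res_at)
  qed
  have gc: "g x \<in> coords B" for x unfolding g_def coords_def by simp
  have "graded g"
    unfolding graded_def
  proof (intro conjI ballI lin_onI gc)
    fix x :: "nat \<Rightarrow> 'k" assume x: "x \<in> coords B"
    note R = lin_onD[OF restr_lin[of B vt]]
    show "g (\<lambda>i. c * x i) = (\<lambda>i. c * g x i)" for c
      unfolding g_def R(3)[OF x] hl(3)[OF R(1)[OF x]] by (rule ext) simp
    show "g (res v x) = res v (g x)" for v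
    proof
      fix i
      show "g (res v x) i = res v (g x) i"
        unfolding rg by (auto simp: g_def restr_restr restr_def[of B vt v "h _"] lin_on_zero[OF h(1)])
    qed
    fix y :: "nat \<Rightarrow> 'k" assume y: "y \<in> coords B"
    show "g (\<lambda>i. x i + y i) = (\<lambda>i. g x i + g y i)"
      unfolding g_def R(2)[OF x y] hl(2)[OF R(1)[OF x] R(1)[OF y]] by (rule ext) simp
  qed
  moreover have "f (g (f x)) = f x" if x: "x \<in> coords B" for x
  proof (rule eqI[OF fl(1)[OF gc] fl(1)[OF x]])
    fix i assume i: "i \<in> B"
    note v = vtB[OF i] and rx = res_closed[OF x, of "vt i"]
    have "res (vt i) (f (g (f x))) = f (res (vt i) (h (res (vt i) (f x))))"
      unfolding fg[OF v gc, symmetric] rg ..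
    also have "\<dots> = res (vt i) (f (h (f (res (vt i) x))))"
      unfolding fg[OF v x, symmetric] by (rule fg[OF v hl(1)[OF fl(1)[OF rx]]])
    also have "\<dots> = res (vt i) (f x)"
      unfolding h(2)[OF rx] unfolding fg[OF v x] restr_restr by simp
    finally show "res (vt i) (f (g (f x))) i = res (vt i) (f x) i" by (rule fun_cong)
  qed
  ultimately show thesis by (rule that)
qed

lemma nilpotent_fixed:
  assumes "(F ^^ m) y = z" "F y = y" shows "y = z"
proof -
  have "(F ^^ m) y = y" by (induction m) (simp_all add: assms(2))
  then show ?thesis using assms(1) by simp
qed

text \<open>
  The argument of Happel and Ringel. With a graded \<open>g\<close> such that \<open>f g f = f\<close>, rigidity corrects \<open>f g\<close> to an
  endomorphism \<open>\<psi> = f (g - F)\<close>, and \<open>F f\<close> is an endomorphism as well.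
\<close>

lemma nilpotent_endo_zero:
  assumes ind: "indecomposable PA M" and rigid and f: "endo f" and nil: "\<And>x. x \<in> coords B \<Longrightarrow> (f ^^ k) x = (\<lambda>_. 0)"
    and x: "x \<in> coords B"
  shows "f x = (\<lambda>_. 0)"
proof -
  have gf: "graded f" using f by (simp add: endo_def)
  obtain g where g: "graded g" and fgf: "\<And>x. x \<in> coords B \<Longrightarrow> f (g (f x)) = f x"
  proof (rule graded_generalized_inverse[OF gf])
    fix g assume "graded g" "\<And>x. x \<in> coords B \<Longrightarrow> f (g (f x)) = f x"
    then show thesis by (rule that)
  qed
  note fd = endoD[OF f] and fl = lin_onD[OF endoD(1)[OF f]]
  note gd = gradedD(2)[OF g] and gl = lin_onD[OF gradedD(1)[OF g]]
  define d where "d x = (\<lambda>i. x i - f (g x) i)" for x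
  have dc: "d x \<in> coords B" if "x \<in> coords B" for x
    unfolding d_def by (rule coords_diff[OF that fl(1)[OF gl(1)[OF that]]])
  have dlin: "lin_on B B d"
  proof (rule lin_onI)
    show "d (\<lambda>i. c * x i) = (\<lambda>i. c * d x i)" if "x \<in> coords B" for c x
      unfolding d_def gl(3)[OF that] fl(3)[OF gl(1)[OF that]] by (simp add: right_diff_distrib)
    show "d (\<lambda>i. x i + y i) = (\<lambda>i. d x i + d y i)" if "x \<in> coords B" "y \<in> coords B" for x y
      unfolding d_def gl(2)[OF that] fl(2)[OF gl(1)[OF that(1)] gl(1)[OF that(2)]] by (simp add: algebra_simps)
  qed (rule dc)
  have dres: "d (res v x) = res v (d x)" if v: "v \<in> verts Q" and x: "x \<in> coords B" for v x
    unfolding d_def gd[OF v x] fd(2)[OF v gl(1)[OF x]]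
    by (rule lin_on_diff[OF restr_lin x fl(1)[OF gl(1)[OF x]], symmetric])
  note dl = lin_onD[OF dlin]
  \<comment> \<open>Chosen so that \<open>f H_a = (f g) X_a - X_a (f g)\<close>, the failure of
    \<open>f g\<close> to be an endomorphism, and so that \<open>H_a f = 0\<close>, because
    \<open>d\<close> vanishes on the image of \<open>f\<close>. The first property makes \<psi> an
    endomorphism, the second \<open>F f\<close>.\<close>
  define H where "H a x = g (Xa a (d x))" for a x
  have "arrow_family H"
    unfolding arrow_family_def
  proof (intro ballI conjI lin_onI)
    fix a and x :: "nat \<Rightarrow> 'k" assume a: "a \<in> arcs Q" and x: "x \<in> coords B"
    note A = lin_onD[OF arrow_lin[OF a]] and v = arrow_verts[OF a]
    note dx = dc[OF x] and Adx = A(1)[OF dc[OF x]]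
    show "H a x \<in> coords B" unfolding H_def by (rule gl(1)[OF Adx])
    show "H a (\<lambda>i. c * x i) = (\<lambda>i. c * H a x i)" for c
      unfolding H_def dl(3)[OF x] A(3)[OF dx] by (rule gl(3)[OF Adx])
    show "H a (res (tail Q a) x) = H a x" unfolding H_def dres[OF v(2) x] Xa_tail ..
    show "res (head Q a) (H a x) = H a x" unfolding H_def gd[OF v(1) Adx, symmetric] Xa_head ..
    fix y :: "nat \<Rightarrow> 'k" assume y: "y \<in> coords B"
    show "H a (\<lambda>i. x i + y i) = (\<lambda>i. H a x i + H a y i)"
      unfolding H_def dl(2)[OF x y] A(2)[OF dx dc[OF y]] by (rule gl(2)[OF Adx A(1)[OF dc[OF y]]])
  qed
  then obtain F where F: "graded F" and FX: "\<And>a x. a \<in> arcs Q \<Longrightarrow> x \<in> coords B \<Longrightarrow> F (Xa a x) = (\<lambda>i. Xa a (F x) i + H a x i)"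
    using \<open>rigid\<close> unfolding rigid_def by blast
  note Fd = gradedD(2)[OF F] and Fl = lin_onD[OF gradedD(1)[OF F]]
  define N where "N x = F (f x)" for x
  define \<psi> where "\<psi> x = f (\<lambda>i. g x i - F x i)" for x
  have \<psi>eq: "\<psi> x = (\<lambda>i. f (g x) i - f (F x) i)" if "x \<in> coords B" for x
    unfolding \<psi>_def by (rule lin_on_diff[OF fd(1) gl(1)[OF that] Fl(1)[OF that]])
  have N: "endo N"
    unfolding endo_def graded_def
  proof (intro conjI ballI lin_onI)
    fix x :: "nat \<Rightarrow> 'k" assume x: "x \<in> coords B"
    note fx = fl(1)[OF x]
    show "N x \<in> coords B" unfolding N_def by (rule Fl(1)[OF fx])
    show "N (\<lambda>i. c * x i) = (\<lambda>i. c * N x i)" for c unfolding N_def fl(3)[OF x] by (rule Fl(3)[OF fx])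
    show "N (res v x) = res v (N x)" if "v \<in> verts Q" for v unfolding N_def fd(2)[OF that x] by (rule Fd[OF that fx])
    show "N (Xa a x) = Xa a (N x)" if a: "a \<in> arcs Q" for a
    proof -
      have "d (f x) = (\<lambda>_. 0)" unfolding d_def fgf[OF x] by simp
      then have "H a (f x) = (\<lambda>_. 0)"
        unfolding H_def using lin_on_zero[OF arrow_lin[OF a]] lin_on_zero[OF gradedD(1)[OF g]] by simp
      then show ?thesis unfolding N_def fd(3)[OF a x] FX[OF a fx] by simp
    qed
    fix y :: "nat \<Rightarrow> 'k" assume y: "y \<in> coords B"
    show "N (\<lambda>i. x i + y i) = (\<lambda>i. N x i + N y i)"
      unfolding N_def fl(2)[OF x y] by (rule Fl(2)[OF fx fl(1)[OF y]])
  qed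
  have \<psi>: "endo \<psi>"
    unfolding endo_def graded_def
  proof (intro conjI ballI lin_onI)
    fix x :: "nat \<Rightarrow> 'k" assume x: "x \<in> coords B"
    note gx = gl(1)[OF x] and Fx = Fl(1)[OF x]
    note c = coords_diff[OF gx Fx]
    show "\<psi> x \<in> coords B" unfolding \<psi>_def by (rule fl(1)[OF c])
    show "\<psi> (\<lambda>i. b * x i) = (\<lambda>i. b * \<psi> x i)" for b
      unfolding \<psi>_def gl(3)[OF x] Fl(3)[OF x] right_diff_distrib[symmetric] by (rule fl(3)[OF c])
    show "\<psi> (res v x) = res v (\<psi> x)" if "v \<in> verts Q" for v
      unfolding \<psi>_def gd[OF that x] Fd[OF that x] lin_on_diff[OF restr_lin gx Fx, symmetric] by (rule fd(2)[OF that c])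
    show "\<psi> (Xa a x) = Xa a (\<psi> x)" if a: "a \<in> arcs Q" for a
    proof -
      note A = lin_onD[OF arrow_lin[OF a]]
      note Ax = A(1)[OF x] and fgx = fl(1)[OF gx]
      have Hx: "H a x = (\<lambda>i. g (Xa a x) i - g (Xa a (f (g x))) i)"
        unfolding H_def d_def lin_on_diff[OF arrow_lin[OF a] x fgx]
        by (rule lin_on_diff[OF gradedD(1)[OF g] Ax A(1)[OF fgx]])
      have Hc: "H a x \<in> coords B" unfolding Hx by (rule coords_diff[OF gl(1)[OF Ax] gl(1)[OF A(1)[OF fgx]]])
      have fH: "f (H a x) = (\<lambda>i. f (g (Xa a x)) i - Xa a (f (g x)) i)"
        unfolding Hx lin_on_diff[OF fd(1) gl(1)[OF Ax] gl(1)[OF A(1)[OF fgx]]]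
        unfolding fd(3)[OF a gx, symmetric] fgf[OF A(1)[OF gx]] ..
      have "\<psi> (Xa a x) = (\<lambda>i. f (g (Xa a x)) i - (Xa a (f (F x)) i + f (H a x) i))"
        unfolding \<psi>eq[OF Ax] FX[OF a x] fl(2)[OF A(1)[OF Fx] Hc] fd(3)[OF a Fx] ..
      also have "\<dots> = (\<lambda>i. Xa a (f (g x)) i - Xa a (f (F x)) i)" unfolding fH by simp
      also have "\<dots> = Xa a (\<psi> x)"
        unfolding \<psi>eq[OF x] by (rule lin_on_diff[OF arrow_lin[OF a] fgx fl(1)[OF Fx], symmetric])
      finally show ?thesis .
    qed
    fix y :: "nat \<Rightarrow> 'k" assume y: "y \<in> coords B"
    note gy = gl(1)[OF y] and Fy = Fl(1)[OF y]
    have "(\<lambda>i. g (\<lambda>i. x i + y i) i - F (\<lambda>i. x i + y i) i) = (\<lambda>i. (g x i - F x i) + (g y i - F y i))"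
      unfolding gl(2)[OF x y] Fl(2)[OF x y] by (simp add: algebra_simps)
    then show "\<psi> (\<lambda>i. x i + y i) = (\<lambda>i. \<psi> x i + \<psi> y i)"
      unfolding \<psi>_def using fl(2)[OF c coords_diff[OF gy Fy]] by simp
  qed
  have zero_or: "(\<exists>x\<in>coords B. x \<noteq> (\<lambda>_. 0 :: 'k))"
  proof -
    have "coords B \<noteq> {\<lambda>_. 0 :: 'k}" using ind unfolding indecomposable_def by simp
    then show ?thesis using coords_zero[of B] by blast
  qed
  then obtain w where w: "w \<in> coords B" "w \<noteq> (\<lambda>_. 0 :: 'k)" by blast
  have not_inj_f: "\<exists>y\<in>coords B. y \<noteq> (\<lambda>_. 0) \<and> f y = (\<lambda>_. 0)"
  proof (rule ccontr)
    assume no: "\<not> ?thesis"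
    have "(f ^^ n) w \<in> coords B \<and> (f ^^ n) w \<noteq> (\<lambda>_. 0)" for n
    proof (induction n)
      case (Suc n)
      then show ?case using no fl(1) by auto
    qed (use w in simp)
    then show False using nil[OF w(1)] by blast
  qed
  \<comment> \<open>A nilpotent \<open>f\<close> has a non-zero kernel, which \<open>N = F f\<close>
    inherits, so \<open>N\<close> is not injective.\<close>
  have "\<exists>m. \<forall>x\<in>coords B. (N ^^ m) x = (\<lambda>_. 0)"
  proof -
    obtain y where y: "y \<in> coords B" "y \<noteq> (\<lambda>_. 0)" "f y = (\<lambda>_. 0)" using not_inj_f by blast
    have "N y = (\<lambda>_. 0)" unfolding N_def y(3) by (rule lin_on_zero[OF gradedD(1)[OF F]])
    then show ?thesis using endo_nilpotent_or_injective[OF ind N] y(1,2) by blast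
  qed
  then obtain q where q: "\<And>x. x \<in> coords B \<Longrightarrow> (N ^^ q) x = (\<lambda>_. 0)" by blast
  \<comment> \<open>Otherwise \<psi> is injective, hence onto, and so is \<open>f\<close>, whose
    image contains that of \<psi>. Then no power of \<open>f\<close> is zero.\<close>
  have "\<exists>m. \<forall>x\<in>coords B. (\<psi> ^^ m) x = (\<lambda>_. 0)"
  proof (rule ccontr)
    assume "\<not> ?thesis"
    then have inj: "\<And>x. x \<in> coords B \<Longrightarrow> \<psi> x = (\<lambda>_. 0) \<Longrightarrow> x = (\<lambda>_. 0)"
      using endo_nilpotent_or_injective[OF ind \<psi>] by blast
    have surj: "\<exists>u\<in>coords B. f u = y" if y: "y \<in> coords B" for y
    proof -
      obtain u where u: "u \<in> coords B" "\<psi> u = y"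
        using injective_imp_surjective[OF finB finB order_refl endoD(1)[OF \<psi>] inj y] by blast
      show ?thesis
        using u(2) coords_diff[OF gl(1)[OF u(1)] Fl(1)[OF u(1)]] unfolding \<psi>_def by blast
    qed
    have "\<exists>u\<in>coords B. (f ^^ n) u = w" for n
    proof (induction n)
      case 0
      show ?case using w(1) by simp
    next
      case (Suc n)
      then obtain u where u: "u \<in> coords B" "(f ^^ n) u = w" by blast
      obtain u' where "u' \<in> coords B" "f u' = u" using surj[OF u(1)] by blast
      then show ?case using u(2) by (intro bexI[of _ u']) (simp_all add: funpow_swap1)
    qed
    from this[of k] obtain u where u: "u \<in> coords B" "(f ^^ k) u = w" by blast
    show False using nil[OF u(1)] w(2) unfolding u(2) by blast
  qed
  then obtain p where p: "\<And>x. x \<in> coords B \<Longrightarrow> (\<psi> ^^ p) x = (\<lambda>_. 0)" by blast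
  have Nc: "(N ^^ n) x \<in> coords B" for n by (rule lin_onD(1)[OF endoD(1)[OF endo_compow[OF N]] x])
  \<comment> \<open>Put \<open>y = N^n x\<close>. If \<open>f N y = 0\<close>, then
    \<open>\<psi> (f y) = f g f y - f N y = f y\<close>, and a vector fixed by the nilpotent \<psi>
    is zero. Descending from \<open>N^q x = 0\<close>, this ends with
    \<open>f x = 0\<close>.\<close>
  have step: "f ((N ^^ n) x) = (\<lambda>_. 0)" if z: "f ((N ^^ Suc n) x) = (\<lambda>_. 0)" for n
  proof (rule nilpotent_fixed)
    let ?y = "(N ^^ n) x"
    note fy = fl(1)[OF Nc[of n]]
    show "(\<psi> ^^ p) (f ?y) = (\<lambda>_. 0)" by (rule p[OF fy])
    have "f (F (f ?y)) = (\<lambda>_. 0)" using z by (simp add: N_def)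
    then show "\<psi> (f ?y) = f ?y" unfolding \<psi>eq[OF fy] fgf[OF Nc] by simp
  qed
  have "f ((N ^^ (q - j)) x) = (\<lambda>_. 0)" if "j \<le> q" for j
    using that
  proof (induction j)
    case 0
    show ?case using q[OF x] lin_on_zero[OF fd(1)] by simp
  next
    case (Suc j)
    then show ?case using step[of "q - Suc j"] by (simp add: Suc_diff_Suc)
  qed
  from this[of q] show ?thesis by simp
qed

end

text \<open>An endomorphism minus one of its eigenvalues is not injective, hence nilpotent, hence
  zero by rigidity. The assumption \<open>alg\<close> supplies the eigenvector, since the scalars of
  the locale form an arbitrary field.\<close>

lemma (in std_quiver) rigid_indecomposable_brick:
  assumes alg: "\<And>F :: (nat \<Rightarrow> 'k) \<Rightarrow> nat \<Rightarrow> 'k. B \<noteq> {} \<Longrightarrow> lin_on B B F \<Longrightarrow>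
      \<exists>l y. y \<in> coords B \<and> y \<noteq> (\<lambda>_. 0) \<and> F y = (\<lambda>i. l * y i)"
    and ind: "indecomposable PA M" and rigid
  shows "B \<noteq> {}" brick
proof -
  show ne: "B \<noteq> {}"
  proof
    assume "B = {}"
    then have "coords B = {\<lambda>_. 0 :: 'k}" by (auto simp: coords_def fun_eq_iff)
    then show False using ind unfolding indecomposable_def by simp
  qed
  show brick
    unfolding brick_def
  proof (intro allI impI)
    fix F assume F: "endo F"
    note Fd = endoD[OF F] and Fl = lin_onD[OF endoD(1)[OF F]]
    obtain l y where y: "y \<in> coords B" "y \<noteq> (\<lambda>_. 0)" "F y = (\<lambda>i. l * y i)" using alg[OF ne Fd(1)] by blast
    define G where "G x = (\<lambda>i. F x i - l * x i)" for x
    have G: "endo G"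
      unfolding endo_def graded_def
    proof (intro conjI ballI lin_onI)
      fix x :: "nat \<Rightarrow> 'k" assume x: "x \<in> coords B"
      note Fx = Fl(1)[OF x] and lx = coords_scale[OF x, of l]
      show "G x \<in> coords B" unfolding G_def by (rule coords_diff[OF Fx lx])
      show "G (\<lambda>i. c * x i) = (\<lambda>i. c * G x i)" for c unfolding G_def Fl(3)[OF x] by (simp add: algebra_simps)
      show "G (res v x) = res v (G x)" if "v \<in> verts Q" for v
        unfolding G_def Fd(2)[OF that x] lin_on_diff[OF restr_lin Fx lx] lin_onD(3)[OF restr_lin x] ..
      show "G (Xa a x) = Xa a (G x)" if "a \<in> arcs Q" for a
        unfolding G_def Fd(3)[OF that x] lin_on_diff[OF arrow_lin[OF that] Fx lx] lin_onD(3)[OF arrow_lin[OF that] x] ..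
      fix y :: "nat \<Rightarrow> 'k" assume y: "y \<in> coords B"
      show "G (\<lambda>i. x i + y i) = (\<lambda>i. G x i + G y i)" unfolding G_def Fl(2)[OF x y] by (simp add: algebra_simps)
    qed
    have "G y = (\<lambda>_. 0)" unfolding G_def y(3) by simp
    then obtain k where k: "\<And>x. x \<in> coords B \<Longrightarrow> (G ^^ k) x = (\<lambda>_. 0)"
      using endo_nilpotent_or_injective[OF ind G] y(1,2) by blast
    have "F x = (\<lambda>i. l * x i)" if x: "x \<in> coords B" for x
    proof
      fix i
      have "G x i = 0" using nilpotent_endo_zero[OF ind \<open>rigid\<close> G k x] by simp
      then show "F x i = l * x i" unfolding G_def by simp
    qed
    then show "\<exists>c. \<forall>x\<in>coords B. F x = (\<lambda>i. c * x i)" by blast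
  qed
qed

text \<open>Coordinates for the comparison of dimensions: \<open>(v, i, j)\<close> in
  \<open>S\<close> is the entry in row \<open>i\<close> and column \<open>j\<close> of a graded map
  at the vertex \<open>v\<close>, and \<open>(a, j, i)\<close> in \<open>T\<close> is the entry in
  column \<open>j\<close> and row \<open>i\<close> of a map along the arrow \<open>a\<close>. In
  these coordinates \<open>D\<close> is the map \<open>F \<mapsto> F X - X F\<close>.\<close>

lemma (in std_quiver) brick_rigid_iff_card:
  assumes brick and ne: "B \<noteq> {}" and fa: "finite (arcs Q)"
  shows "rigid \<longleftrightarrow> (\<Sum>v\<in>verts Q. card {i \<in> B. vt i = v} ^ 2)
    = (\<Sum>a\<in>arcs Q. card {i \<in> B. vt i = tail Q a} * card {i \<in> B. vt i = head Q a}) + 1"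
proof -
  let ?N = "\<lambda>v. {i \<in> B. vt i = v}"
  define S where "S = (SIGMA v:verts Q. ?N v \<times> ?N v)"
  define T where "T = (SIGMA a:arcs Q. ?N (tail Q a) \<times> ?N (head Q a))"
  have finN: "finite (?N v)" for v using finB by simp
  have finS: "finite S" unfolding S_def using fin finN by blast
  have finT: "finite T" unfolding T_def using fa finN by blast
  have cS: "card S = (\<Sum>v\<in>verts Q. card (?N v) ^ 2)"
    unfolding S_def using finN fin by (simp add: card_SigmaI card_cartesian_product power2_eq_square)
  have cT: "card T = (\<Sum>a\<in>arcs Q. card (?N (tail Q a)) * card (?N (head Q a)))"
    unfolding T_def using finN fa by (simp add: card_SigmaI card_cartesian_product)
  have SI: "(vt j, i, j) \<in> S \<longleftrightarrow> i \<in> B \<and> j \<in> B \<and> vt i = vt j" for i j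
    unfolding S_def using vtB by auto
  define mat where "mat A x = (\<lambda>i. \<Sum>j\<in>B. A (vt j, i, j) * x j)" for A :: "'v \<times> nat \<times> nat \<Rightarrow> 'k" and x
  have mat_unit: "mat A (unit_at j) = (\<lambda>i. A (vt j, i, j))" if "j \<in> B" for A j
  proof
    fix i
    have "mat A (unit_at j) i = (\<Sum>l\<in>B. if l = j then A (vt l, i, l) else 0)"
      unfolding mat_def by (intro sum.cong refl) (simp add: unit_at_def)
    then show "mat A (unit_at j) i = A (vt j, i, j)" using that finB by simp
  qed
  have A0: "A (vt j, i, j) = 0" if "A \<in> coords S" "\<not> (i \<in> B \<and> j \<in> B \<and> vt i = vt j)" for A :: "'v \<times> nat \<times> nat \<Rightarrow> 'k" and i j
    using coords_off[OF that(1)] that(2) SI by blast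
  have mat_graded: "graded (mat A)" if A: "A \<in> coords S" for A
    unfolding graded_def
  proof (intro conjI ballI lin_onI)
    fix x y :: "nat \<Rightarrow> 'k"
    show "mat A x \<in> coords B" unfolding mat_def coords_def using A0[OF A] by (simp add: sum.neutral)
    show "mat A (\<lambda>i. x i + y i) = (\<lambda>i. mat A x i + mat A y i)"
      unfolding mat_def by (simp add: distrib_left sum.distrib)
    show "mat A (\<lambda>i. c * x i) = (\<lambda>i. c * mat A x i)" for c
      unfolding mat_def by (simp add: sum_distrib_left mult.left_commute)
    show "mat A (res v x) = res v (mat A x)" for v
    proof
      fix i
      show "mat A (res v x) i = res v (mat A x) i"
      proof (cases "i \<in> B \<and> vt i = v")
        case True
        have "A (vt j, i, j) * res v x j = A (vt j, i, j) * x j" if "j \<in> B" for j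
          using A0[OF A, of i j] True that by (cases "vt j = v") (simp_all add: restr_def)
        then have "mat A (res v x) i = mat A x i" unfolding mat_def by (rule sum.cong[OF refl])
        then show ?thesis unfolding restr_def[of B vt v "mat A x"] if_P[OF True] .
      next
        case False
        have "A (vt j, i, j) * res v x j = 0" if "j \<in> B" for j
          using A0[OF A, of i j] False that by (cases "vt j = v") (auto simp add: restr_def)
        then have "mat A (res v x) i = 0" unfolding mat_def by (intro sum.neutral) simp
        then show ?thesis unfolding restr_def[of B vt v "mat A x"] if_not_P[OF False] .
      qed
    qed
  qed
  define D where "D A = (\<lambda>(a, j, i). if (a, j, i) \<in> T
      then mat A (Xa a (unit_at j)) i - Xa a (mat A (unit_at j)) i else 0)" for A
  have Dt: "D A (a, j, i) = mat A (Xa a (unit_at j)) i - Xa a (mat A (unit_at j)) i" if "(a, j, i) \<in> T" for A a j i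
    using that by (simp add: D_def)
  have TD: "a \<in> arcs Q" "j \<in> B" "i \<in> B" "vt j = tail Q a" "vt i = head Q a" if "(a, j, i) \<in> T" for a j i
    using that unfolding T_def by auto
  have matl: "lin_on B B (mat A)" if "A \<in> coords S" for A by (rule gradedD(1)[OF mat_graded[OF that]])
  have mat_add: "mat (\<lambda>s. A s + A' s) x = (\<lambda>i. mat A x i + mat A' x i)" for A A' x
    unfolding mat_def by (simp add: distrib_right sum.distrib)
  have mat_scale: "mat (\<lambda>s. c * A s) x = (\<lambda>i. c * mat A x i)" for c A x
    unfolding mat_def by (simp add: sum_distrib_left mult.assoc)
  have ub: "(unit_at j :: nat \<Rightarrow> 'k) \<in> coords B" if "j \<in> B" for j by (rule coords_unit[OF that])
  have Dlin: "lin_on S T D"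
  proof (rule lin_onI)
    fix A :: "'v \<times> nat \<times> nat \<Rightarrow> 'k" assume A: "A \<in> coords S"
    show "D A \<in> coords T" unfolding D_def coords_def by auto
    show "D (\<lambda>s. c * A s) = (\<lambda>t. c * D A t)" for c
    proof
      fix t :: "'e \<times> nat \<times> nat"
      obtain a j i where t: "t = (a, j, i)" by (cases t)
      show "D (\<lambda>s. c * A s) t = c * D A t"
      proof (cases "t \<in> T")
        case True
        note td = TD[OF True[unfolded t]]
        show ?thesis
          unfolding t Dt[OF True[unfolded t]] mat_scale lin_onD(3)[OF arrow_lin[OF td(1)] lin_onD(1)[OF matl[OF A] ub[OF td(2)]]]
          by (simp add: right_diff_distrib)
      qed (simp add: t D_def)
    qed
    fix A' :: "'v \<times> nat \<times> nat \<Rightarrow> 'k" assume A': "A' \<in> coords S"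
    show "D (\<lambda>s. A s + A' s) = (\<lambda>t. D A t + D A' t)"
    proof
      fix t :: "'e \<times> nat \<times> nat"
      obtain a j i where t: "t = (a, j, i)" by (cases t)
      show "D (\<lambda>s. A s + A' s) t = D A t + D A' t"
      proof (cases "t \<in> T")
        case True
        note td = TD[OF True[unfolded t]]
        show ?thesis
          unfolding t Dt[OF True[unfolded t]] mat_add lin_onD(2)[OF arrow_lin[OF td(1)] lin_onD(1)[OF matl[OF A] ub[OF td(2)]] lin_onD(1)[OF matl[OF A'] ub[OF td(2)]]]
          by simp
      qed (simp add: t D_def)
    qed
  qed
  \<comment> \<open>It suffices to compare images of unit vectors entry by entry. For a unit vector
    off the tail of \<open>a\<close> every term vanishes, and so do all entries off its head; the
    remaining entries are those recorded by \<open>D\<close>.\<close>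
  have solve: "mat A (Xa a x) = (\<lambda>i. Xa a (mat A x) i + H a x i)"
    if A: "A \<in> coords S" and H: "arrow_family H" and a: "a \<in> arcs Q"
      and DA: "\<And>j i. (a, j, i) \<in> T \<Longrightarrow> D A (a, j, i) = H a (unit_at j) i" and x: "x \<in> coords B" for A H a x
  proof -
    note X = lin_onD[OF arrow_lin[OF a]] and Ml = lin_onD[OF matl[OF A]] and Hl = lin_onD[OF arrow_familyD(1)[OF H a]]
    note v = arrow_verts[OF a]
    show ?thesis
    proof (rule lin_on_eq_on_units[OF _ _ finB _ x])
      show "lin_on B B (\<lambda>x. mat A (Xa a x))"
        by (rule lin_onI) (simp_all only: X Ml)
      show "lin_on B B (\<lambda>x i. Xa a (mat A x) i + H a x i)"
      proof (rule lin_onI)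
        fix x y :: "nat \<Rightarrow> 'k" and c assume x: "x \<in> coords B"
        show "(\<lambda>i. Xa a (mat A x) i + H a x i) \<in> coords B" by (intro coords_add X(1) Ml(1) Hl(1) x)
        show "(\<lambda>i. Xa a (mat A (\<lambda>i. c * x i)) i + H a (\<lambda>i. c * x i) i) = (\<lambda>i. c * (Xa a (mat A x) i + H a x i))"
          unfolding Ml(3)[OF x] X(3)[OF Ml(1)[OF x]] Hl(3)[OF x] by (simp add: distrib_left)
        assume y: "y \<in> coords B"
        show "(\<lambda>i. Xa a (mat A (\<lambda>i. x i + y i)) i + H a (\<lambda>i. x i + y i) i)
            = (\<lambda>i. (Xa a (mat A x) i + H a x i) + (Xa a (mat A y) i + H a y i))"
          unfolding Ml(2)[OF x y] X(2)[OF Ml(1)[OF x] Ml(1)[OF y]] Hl(2)[OF x y] by (simp add: add_ac)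
      qed
      fix j assume j: "j \<in> B"
      note u = ub[OF j]
      show "mat A (Xa a (unit_at j)) = (\<lambda>i. Xa a (mat A (unit_at j)) i + H a (unit_at j) i)"
      proof (cases "vt j = tail Q a")
        case True
        show ?thesis
        proof
          fix i
          show "mat A (Xa a (unit_at j)) i = Xa a (mat A (unit_at j)) i + H a (unit_at j) i"
          proof (cases "i \<in> B \<and> vt i = head Q a")
            case in_head: True
            then have t: "(a, j, i) \<in> T" unfolding T_def using a j True by simp
            from DA[OF t] t show ?thesis unfolding D_def by (simp add: algebra_simps)
          next
            case False
            have z: "y i = 0" if "res (head Q a) y = y" for y :: "nat \<Rightarrow> 'k"
              using fun_cong[OF that, of i] False by (simp add: restr_def split: if_splits)
            have "mat A (Xa a (unit_at j)) i = 0"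
              by (rule z) (simp only: gradedD(2)[OF mat_graded[OF A] v(1) X(1)[OF u], symmetric] Xa_head)
            moreover have "Xa a (mat A (unit_at j)) i = 0" by (rule z[OF Xa_head])
            moreover have "H a (unit_at j) i = 0" by (rule z[OF arrow_familyD(3)[OF H a u]])
            ultimately show ?thesis by simp
          qed
        qed
      next
        case False
        have r: "res (tail Q a) (unit_at j) = (\<lambda>_. 0 :: 'k)" using False by (auto simp: restr_def unit_at_def fun_eq_iff)
        have "Xa a (unit_at j) = (\<lambda>_. 0)"
          using Xa_tail[of a "unit_at j"] unfolding r lin_on_zero[OF arrow_lin[OF a]] by simp
        moreover have "H a (unit_at j) = (\<lambda>_. 0)"
          using arrow_familyD(2)[OF H a u] unfolding r lin_on_zero[OF arrow_familyD(1)[OF H a]] by simp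
        moreover have "Xa a (mat A (unit_at j)) = (\<lambda>_. 0)"
          using Xa_tail[of a "mat A (unit_at j)"]
          unfolding gradedD(2)[OF mat_graded[OF A] v(2) u, symmetric] r lin_on_zero[OF matl[OF A]] lin_on_zero[OF arrow_lin[OF a]] by simp
        ultimately show ?thesis using lin_on_zero[OF matl[OF A]] by simp
      qed
    qed
  qed
  \<comment> \<open>The identity matrix, which spans the kernel of \<open>D\<close>.\<close>
  define u where "u = (\<lambda>(v, i, j). if (v, i, j) \<in> S \<and> i = j then 1 else (0::'k))"
  have uS: "u \<in> coords S" unfolding u_def coords_def by auto
  obtain b where b: "b \<in> B" using ne by blast
  have ub1: "u (vt b, b, b) = 1" unfolding u_def using SI b by simp
  have u0: "u \<noteq> (\<lambda>_. 0)"
  proof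
    assume "u = (\<lambda>_. 0)"
    then show False using ub1 by simp
  qed
  have mu: "mat u x = x" if x: "x \<in> coords B" for x
  proof -
    have "lin_on B B (\<lambda>x. x :: nat \<Rightarrow> 'k)" by (simp add: lin_on_def)
    then show ?thesis
    proof (rule lin_on_eq_on_units[OF matl[OF uS] _ finB _ x])
      fix j assume j: "j \<in> B"
      show "mat u (unit_at j) = unit_at j"
        unfolding mat_unit[OF j] u_def by (rule ext) (use SI j in \<open>auto simp: unit_at_def\<close>)
    qed
  qed
  have Du: "D u = (\<lambda>_. 0)"
  proof
    fix t :: "'e \<times> nat \<times> nat"
    obtain a j i where t: "t = (a, j, i)" by (cases t)
    show "D u t = 0"
    proof (cases "t \<in> T")
      case True
      note td = TD[OF True[unfolded t]]
      show ?thesis unfolding t Dt[OF True[unfolded t]] mu[OF ub[OF td(2)]] mu[OF lin_onD(1)[OF arrow_lin[OF td(1)] ub[OF td(2)]]] by simp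
    qed (simp add: t D_def)
  qed
  have zero_family: "arrow_family (\<lambda>_ _ _. 0)"
    unfolding arrow_family_def by (auto intro!: lin_onI)
  have ker: "\<exists>c. A = (\<lambda>s. c * u s)" if A: "A \<in> coords S" and DA: "D A = (\<lambda>_. 0)" for A
  proof -
    have "endo (mat A)"
      unfolding endo_def
    proof (intro conjI ballI mat_graded[OF A])
      fix a and x :: "nat \<Rightarrow> 'k" assume a: "a \<in> arcs Q" and x: "x \<in> coords B"
      show "mat A (Xa a x) = Xa a (mat A x)"
        using solve[OF A zero_family a _ x] unfolding DA by simp
    qed
    then obtain c where c: "\<And>x. x \<in> coords B \<Longrightarrow> mat A x = (\<lambda>i. c * x i)" using \<open>brick\<close> unfolding brick_def by blast
    have "A s = c * u s" for s
    proof (cases "s \<in> S")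
      case True
      then obtain i j where s: "s = (vt j, i, j)" "i \<in> B" "j \<in> B" unfolding S_def by auto
      have "A (vt j, i, j) = c * unit_at j i"
        using fun_cong[OF c[OF ub[OF s(3)]], of i] unfolding mat_unit[OF s(3)] .
      then show ?thesis using True unfolding s(1) u_def by (simp add: unit_at_def)
    next
      case False
      then show ?thesis using coords_off[OF A False] coords_off[OF uS False] by simp
    qed
    then show ?thesis by blast
  qed
  have "rigid \<longleftrightarrow> (\<forall>h\<in>coords T. \<exists>A\<in>coords S. D A = h)"
  proof
    assume rigid
    show "\<forall>h\<in>coords T. \<exists>A\<in>coords S. D A = h"
    proof
      fix h :: "'e \<times> nat \<times> nat \<Rightarrow> 'k" assume h: "h \<in> coords T"
      define H where "H a x = (\<lambda>i. \<Sum>j\<in>B. h (a, j, i) * x j)" for a x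
      have h0: "h (a, j, i) = 0" if "\<not> (i \<in> B \<and> vt i = head Q a \<and> j \<in> B \<and> vt j = tail Q a)" for a i j
        using coords_off[OF h, of "(a, j, i)"] that TD by blast
      have "arrow_family H"
        unfolding arrow_family_def
      proof (intro ballI conjI lin_onI)
        fix a and x y :: "nat \<Rightarrow> 'k"
        show "H a x \<in> coords B" unfolding H_def coords_def using h0 by (simp add: sum.neutral)
        show "H a (\<lambda>i. x i + y i) = (\<lambda>i. H a x i + H a y i)"
          unfolding H_def by (simp add: distrib_left sum.distrib)
        show "H a (\<lambda>i. c * x i) = (\<lambda>i. c * H a x i)" for c
          unfolding H_def by (simp add: sum_distrib_left mult.left_commute)
        show "H a (res (tail Q a) x) = H a x"
          unfolding H_def
        proof (intro ext sum.cong refl)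
          fix i j assume "j \<in> B"
          then show "h (a, j, i) * res (tail Q a) x j = h (a, j, i) * x j"
            using h0[of i a j] by (cases "vt j = tail Q a") (simp_all add: restr_def)
        qed
        show "res (head Q a) (H a x) = H a x"
        proof
          fix i
          show "res (head Q a) (H a x) i = H a x i"
          proof (cases "i \<in> B \<and> vt i = head Q a")
            case True
            then show ?thesis by (simp add: restr_def)
          next
            case False
            then have "h (a, j, i) = 0" for j using h0 by blast
            then show ?thesis using False by (simp add: restr_def H_def)
          qed
        qed
      qed
      then obtain F where F: "graded F" "\<And>a x. a \<in> arcs Q \<Longrightarrow> x \<in> coords B \<Longrightarrow> F (Xa a x) = (\<lambda>i. Xa a (F x) i + H a x i)"
        using \<open>rigid\<close> unfolding rigid_def by blast
      define A where "A = (\<lambda>(v, i, j). if (v, i, j) \<in> S then F (unit_at j) i else 0)"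
      have A: "A \<in> coords S" unfolding A_def coords_def by auto
      have mF: "mat A x = F x" if x: "x \<in> coords B" for x
      proof (rule lin_on_eq_on_units[OF matl[OF A] gradedD(1)[OF F(1)] finB _ x])
        fix j assume j: "j \<in> B"
        have r: "res (vt j) (F (unit_at j)) = F (unit_at j)"
        proof -
          have "res (vt j) (unit_at j) = (unit_at j :: nat \<Rightarrow> 'k)" using j by (auto simp: restr_def unit_at_def fun_eq_iff)
          then show ?thesis using gradedD(2)[OF F(1) vtB[OF j] ub[OF j]] by simp
        qed
        show "mat A (unit_at j) = F (unit_at j)"
        proof
          fix i
          show "mat A (unit_at j) i = F (unit_at j) i"
          proof (cases "i \<in> B \<and> vt i = vt j")
            case True
            then show ?thesis unfolding mat_unit[OF j] A_def using SI j by simp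
          next
            case False
            then have "F (unit_at j) i = 0" using fun_cong[OF r, of i] by (simp add: restr_def split: if_splits)
            then show ?thesis unfolding mat_unit[OF j] using A0[OF A, of i j] False by auto
          qed
        qed
      qed
      have "D A t = h t" for t :: "'e \<times> nat \<times> nat"
      proof -
        obtain a j i where t: "t = (a, j, i)" by (cases t)
        show ?thesis
        proof (cases "t \<in> T")
          case True
          note td = TD[OF True[unfolded t]]
          have "H a (unit_at j) i = (\<Sum>l\<in>B. if l = j then h (a, l, i) else 0)"
            unfolding H_def by (intro sum.cong refl) (simp add: unit_at_def)
          then have "H a (unit_at j) i = h (a, j, i)" using td(2) finB by simp
          then show ?thesis
            unfolding t Dt[OF True[unfolded t]] mF[OF ub[OF td(2)]] mF[OF lin_onD(1)[OF arrow_lin[OF td(1)] ub[OF td(2)]]] F(2)[OF td(1) ub[OF td(2)]]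
            by simp
        next
          case False
          then show ?thesis using coords_off[OF h False] by (simp add: t D_def)
        qed
      qed
      then show "\<exists>A\<in>coords S. D A = h" using A by blast
    qed
  next
    assume surj: "\<forall>h\<in>coords T. \<exists>A\<in>coords S. D A = h"
    show rigid
      unfolding rigid_def
    proof (intro allI impI)
      fix H assume H: "arrow_family H"
      define h where "h = (\<lambda>(a, j, i). if (a, j, i) \<in> T then H a (unit_at j) i else 0)"
      have "h \<in> coords T" unfolding h_def coords_def by auto
      then obtain A where A: "A \<in> coords S" "D A = h" using surj by blast
      show "\<exists>F. graded F \<and> (\<forall>a\<in>arcs Q. \<forall>x\<in>coords B. F (Xa a x) = (\<lambda>i. Xa a (F x) i + H a x i))"
      proof (intro exI[of _ "mat A"] conjI mat_graded[OF A(1)] ballI)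
        fix a and x :: "nat \<Rightarrow> 'k" assume a: "a \<in> arcs Q" and x: "x \<in> coords B"
        show "mat A (Xa a x) = (\<lambda>i. Xa a (mat A x) i + H a x i)"
          by (rule solve[OF A(1) H a _ x]) (simp add: A(2) h_def)
      qed
    qed
  qed
  also have "\<dots> \<longleftrightarrow> card S = card T + 1"
    by (rule surjective_iff_card[OF finS finT Dlin uS u0 Du ker])
  finally show ?thesis unfolding cS cT .
qed


section \<open>Representations of type D\<close>

text \<open>A single zero-one matrix, given by the relation \<open>R\<close>, serves all arrows:
  \<open>arrow_op\<close> cuts out the block from the tail to the head.\<close>

definition zero_one_map :: "nat set \<Rightarrow> (nat \<Rightarrow> nat \<Rightarrow> bool) \<Rightarrow> 'e \<Rightarrow> (nat \<Rightarrow> 'k::field) \<Rightarrow> nat \<Rightarrow> 'k" where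
  "zero_one_map B R a x = (\<lambda>r. if r \<in> B then \<Sum>q\<in>B. if R q r then x q else 0 else 0)"

lemma (in pa_quiver) zero_one_std:
  assumes "finite B" "\<And>k. k \<in> B \<Longrightarrow> vt k \<in> verts Q"
  shows "std_quiver Q B vt (zero_one_map B R :: 'e \<Rightarrow> (nat \<Rightarrow> 'k::field) \<Rightarrow> _)"
proof
  fix a
  show "lin_on B B (zero_one_map B R a :: (nat \<Rightarrow> 'k) \<Rightarrow> _)"
  proof (rule lin_onI)
    fix x y :: "nat \<Rightarrow> 'k" and c
    show "zero_one_map B R a x \<in> coords B" by (simp add: zero_one_map_def coords_def)
    have s: "(\<Sum>q\<in>B. if R q r then x q + y q else 0) = (\<Sum>q\<in>B. if R q r then x q else 0) + (\<Sum>q\<in>B. if R q r then y q else 0)" for r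
      unfolding sum.distrib[symmetric] by (intro sum.cong refl) simp
    show "zero_one_map B R a (\<lambda>i. x i + y i) = (\<lambda>j. zero_one_map B R a x j + zero_one_map B R a y j)"
      unfolding zero_one_map_def s by (rule ext) simp
    have s: "(\<Sum>q\<in>B. if R q r then c * x q else 0) = c * (\<Sum>q\<in>B. if R q r then x q else 0)" for r
      unfolding sum_distrib_left by (intro sum.cong refl) simp
    show "zero_one_map B R a (\<lambda>i. c * x i) = (\<lambda>j. c * zero_one_map B R a x j)"
      unfolding zero_one_map_def s by (rule ext) simp
  qed
qed (use assms in auto)

context std_quiver
begin

text \<open>The entry in column \<open>q\<close> and row \<open>r\<close> of the matrix equation
  \<open>F X_a = X_a F\<close>.\<close>

lemma zero_one_commute:
  assumes X: "X = zero_one_map B R" and F: "endo F" and a: "a \<in> arcs Q"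
    and q: "q \<in> B" "vt q = tail Q a" and r: "r \<in> B" "vt r = head Q a"
  shows "(\<Sum>p\<in>{p \<in> B. vt p = head Q a}. if R q p then F (unit_at p) r else 0)
    = (\<Sum>p\<in>{p \<in> B. vt p = tail Q a}. if R p r then F (unit_at q) p else 0)"
proof -
  note Fd = endoD[OF F]
  have op: "Xa a y i = (if i \<in> B \<and> vt i = head Q a then \<Sum>p\<in>B. if R p i then res (tail Q a) y p else 0 else 0)" for y i
    unfolding arrow_op_def X zero_one_map_def restr_def[of B vt "head Q a"] by simp
  let ?P = "{p \<in> B. vt p = head Q a}" and ?c = "\<lambda>p. if R q p then 1 else (0::'k)"
  have P: "finite ?P" "\<And>p. p \<in> ?P \<Longrightarrow> (unit_at p :: nat \<Rightarrow> 'k) \<in> coords B" using finB by (auto intro: coords_unit)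
  have u: "Xa a (unit_at q) = (\<lambda>i. \<Sum>p\<in>?P. ?c p * unit_at p i)"
  proof
    fix i
    have "(\<Sum>p\<in>?P. ?c p * unit_at p i) = (\<Sum>p\<in>?P. if p = i then ?c p else 0)"
      by (intro sum.cong refl) (simp add: unit_at_def)
    then have R: "(\<Sum>p\<in>?P. ?c p * unit_at p i) = (if i \<in> ?P then ?c i else 0)" using P(1) by simp
    have "(\<Sum>p\<in>B. if R p i then res (tail Q a) (unit_at q) p else 0) = (\<Sum>p\<in>B. if p = q then ?c i else 0)"
      using q by (intro sum.cong refl) (auto simp: restr_def unit_at_def)
    then have "(\<Sum>p\<in>B. if R p i then res (tail Q a) (unit_at q) p else 0) = ?c i" using q(1) finB by simp
    then show "Xa a (unit_at q) i = (\<Sum>p\<in>?P. ?c p * unit_at p i)" unfolding R op by simp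
  qed
  have "(\<Sum>p\<in>?P. if R q p then F (unit_at p) r else 0) = (\<Sum>p\<in>?P. ?c p * F (unit_at p) r)"
    by (intro sum.cong refl) simp
  also have "\<dots> = F (Xa a (unit_at q)) r"
    unfolding u using lin_on_sum(2)[OF Fd(1) P, where c = ?c] by simp
  also have "\<dots> = (\<Sum>p\<in>B. if R p r then res (tail Q a) (F (unit_at q)) p else 0)"
    unfolding Fd(3)[OF a coords_unit[OF q(1)]] op using r by simp
  also have "\<dots> = (\<Sum>p\<in>{p \<in> B. vt p = tail Q a}. if R p r then F (unit_at q) p else 0)"
    using finB by (intro sum.mono_neutral_cong_right) (auto simp: restr_def)
  finally show ?thesis .
qed

text \<open>Entries between different vertices vanish because \<open>F\<close> is graded, so it is
  enough to look at the entries within each vertex.\<close>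

lemma brick_of_units:
  assumes "\<And>F. endo F \<Longrightarrow> \<exists>c. \<forall>q\<in>B. \<forall>r\<in>B. vt r = vt q \<longrightarrow> F (unit_at q) r = (if r = q then c else 0)"
  shows brick
  unfolding brick_def
proof (intro allI impI)
  fix F assume F: "endo F"
  note Fd = endoD[OF F]
  obtain c where c: "\<And>q r. q \<in> B \<Longrightarrow> r \<in> B \<Longrightarrow> vt r = vt q \<Longrightarrow> F (unit_at q) r = (if r = q then c else 0)"
    using assms[OF F] by blast
  have lin: "lin_on B B (\<lambda>x i. c * x i)" by (rule lin_onI) (auto simp: coords_scale algebra_simps)
  have "F x = (\<lambda>i. c * x i)" if "x \<in> coords B" for x
  proof (rule lin_on_eq_on_units[OF Fd(1) lin finB _ that])
    fix q assume q: "q \<in> B"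
    have "res (vt q) (unit_at q) = (unit_at q :: nat \<Rightarrow> 'k)" using q by (auto simp: restr_def unit_at_def fun_eq_iff)
    then have g: "F (unit_at q) = res (vt q) (F (unit_at q))" using Fd(2)[OF vtB[OF q] coords_unit[OF q]] by simp
    show "F (unit_at q) = (\<lambda>i. c * unit_at q i)"
    proof
      fix r
      show "F (unit_at q) r = c * unit_at q r"
      proof (cases "r \<in> B \<and> vt r = vt q")
        case True
        then show ?thesis using c[OF q, of r] by (simp add: unit_at_def)
      next
        case False
        then have "res (vt q) (F (unit_at q)) r = 0" unfolding restr_def by auto
        then have "F (unit_at q) r = 0" using fun_cong[OF g, of r] by (rule trans[rotated])
        then show ?thesis using False q by (auto simp: unit_at_def)
      qed
    qed
  qed
  then show "\<exists>c. \<forall>x\<in>coords B. F x = (\<lambda>i. c * x i)" by blast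
qed

end

text \<open>At each vertex of the support an endomorphism is a number, and an arrow that acts as 1
  equates the numbers at its two ends.\<close>

lemma (in pa_quiver) thin_brick:
  assumes std: "std_quiver Q S vt (zero_one_map S (\<lambda>_ _. True) :: 'e \<Rightarrow> (nat \<Rightarrow> 'k::field) \<Rightarrow> _)"
    and inj: "inj_on vt S" and p: "p \<in> S"
    and conn: "\<And>q. q \<in> S \<Longrightarrow> (p, q) \<in> {(s, t). s \<in> S \<and> t \<in> S \<and> (\<exists>a\<in>arcs Q. tail Q a = vt s \<and> head Q a = vt t)}\<^sup>*"
  shows "std_quiver.brick Q S vt (zero_one_map S (\<lambda>_ _. True) :: 'e \<Rightarrow> (nat \<Rightarrow> 'k) \<Rightarrow> _)"
proof -
  interpret std_quiver Q S vt "zero_one_map S (\<lambda>_ _. True) :: 'e \<Rightarrow> (nat \<Rightarrow> 'k) \<Rightarrow> _" by (rule std)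
  show ?thesis
  proof (rule brick_of_units)
    fix F assume F: "endo F"
    have N: "{k \<in> S. vt k = vt s} = {s}" if "s \<in> S" for s using inj that by (auto simp: inj_on_def)
    have "F (unit_at q) q = F (unit_at p) p" if "q \<in> S" for q
      using conn[OF that]
    proof (induction rule: rtrancl_induct)
      case (step s t)
      then obtain a where a: "s \<in> S" "t \<in> S" "a \<in> arcs Q" "tail Q a = vt s" "head Q a = vt t" by blast
      from zero_one_commute[OF refl F a(3) a(1) a(4)[symmetric] a(2) a(5)[symmetric]]
      have "F (unit_at t) t = F (unit_at s) s" unfolding a(4,5) N[OF a(1)] N[OF a(2)] by simp
      then show ?case using step.IH by simp
    qed simp
    then have "F (unit_at q) r = (if r = q then F (unit_at p) p else 0)" if "q \<in> S" "r \<in> S" "vt r = vt q" for q r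
      using inj_onD[OF inj that(3,2,1)] that by simp
    then show "\<exists>c. \<forall>q\<in>S. \<forall>r\<in>S. vt r = vt q \<longrightarrow> F (unit_at q) r = (if r = q then c else 0)"
      by blast
  qed
qed

section \<open>Bricks over the quiver of type D\<close>

lemma D_pa: "n \<ge> 4 \<Longrightarrow> pa_quiver (D_quiver n)"
  by (rule pa_quiver.intro) (simp_all add: wf_D_quiver)

lemma D_arcs_finite: "finite (arcs (D_quiver n))"
proof (rule finite_subset)
  show "arcs (D_quiver n) \<subseteq> {0..n} \<times> {0..n}" by (auto simp: D_quiver_def)
qed simp

text \<open>Turns norm 2 into the equation between natural numbers that appears in
  \<open>brick_rigid_iff_card\<close>.\<close>

lemma D_form_card:
  fixes m :: "nat \<Rightarrow> nat"
  assumes n: "n \<ge> 4" and x: "\<And>v. v \<in> {1..n} \<Longrightarrow> x v = int (m v)"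
  shows "sym_form (D_quiver n) x x = 2 \<longleftrightarrow> (\<Sum>v\<in>verts (D_quiver n). m v ^ 2)
    = (\<Sum>a\<in>arcs (D_quiver n). m (tail (D_quiver n) a) * m (head (D_quiver n) a)) + 1"
proof -
  have sub: "arcs (D_quiver n) \<subseteq> {1..n} \<times> {1..n}" using n by (auto simp: D_quiver_def)
  have 1: "(\<Sum>i\<in>{1..n}. (x i)\<^sup>2) = int (\<Sum>v\<in>{1..n}. m v ^ 2)" using x by simp
  have 2: "(\<Sum>(i, j)\<in>arcs (D_quiver n). x i * x j) = int (\<Sum>a\<in>arcs (D_quiver n). m (fst a) * m (snd a))"
    unfolding of_nat_sum
  proof (intro sum.cong refl)
    fix a assume "a \<in> arcs (D_quiver n)"
    then have "fst a \<in> {1..n}" "snd a \<in> {1..n}" using sub by auto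
    then show "(case a of (i, j) \<Rightarrow> x i * x j) = int (m (fst a) * m (snd a))"
      using x by (simp add: case_prod_beta)
  qed
  have 3: "2 * (int a - int b) = 2 \<longleftrightarrow> a = b + 1" for a b by presburger
  show ?thesis unfolding D_form_euler[OF n] 1 2 3 D_verts D_tail_head ..
qed

text \<open>Once the norm is known to be 2, every brick with this dimension vector is rigid as well
  as indecomposable.\<close>

lemma real_Schur_root_of_brick:
  fixes X :: "nat \<times> nat \<Rightarrow> (nat \<Rightarrow> 'k::field) \<Rightarrow> nat \<Rightarrow> 'k"
  assumes n: "n \<ge> 4" and std: "std_quiver (D_quiver n) B vt X" and brick: "std_quiver.brick (D_quiver n) B vt X"
    and ne: "B \<noteq> {}" and off: "\<And>v. v \<notin> {1..n} \<Longrightarrow> b v = 0"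
    and b: "\<And>v. v \<in> {1..n} \<Longrightarrow> b v = int (card {i \<in> B. vt i = v})"
    and two: "sym_form (D_quiver n) b b = 2"
  shows "b \<in> real_Schur_roots TYPE('k) (D_quiver n)"
proof -
  interpret std_quiver "D_quiver n" B vt X by (rule std)
  let ?m = "\<lambda>v. card {i \<in> B. vt i = v}"
  have rigid using brick_rigid_iff_card[OF brick ne D_arcs_finite] D_form_card[OF n b] two by simp
  have "b v = int (?m v)" for v
  proof (cases "v \<in> {1..n}")
    case False
    then have "{i \<in> B. vt i = v} = {}" using vtB by auto
    then show ?thesis using off[OF False] by (simp only: card.empty of_nat_0)
  qed (rule b)
  then have "b = (\<lambda>v. int (?m v))" by blast
  then show ?thesis
    unfolding real_Schur_roots_def mem_Collect_eq
    by (intro exI[of _ ?m] exI[of _ M] conjI std_left_module brick_imp_indecomposable[OF brick ne]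
        rigid_imp_Ext1_zero[OF \<open>rigid\<close>] std_dimension_vector)
qed

text \<open>The module is moved into coordinates, where it is a brick; its rigidity then says that
  the dimension vector has norm 2, and non-negativity leaves only the positive roots.\<close>

lemma real_Schur_root_in_D_roots:
  assumes n: "n \<ge> 4" and b: "b \<in> real_Schur_roots TYPE('k::alg_closed_field) (D_quiver n)"
  shows "b \<in> D_roots n"
proof -
  interpret pa_quiver "D_quiver n" by (rule D_pa[OF n])
  obtain m and M :: "(nat, nat \<times> nat, 'k) kQ_module" where m: "b = (\<lambda>v. int (m v))"
    and M: "left_module PA M" "indecomposable PA M" "Ext1_zero (D_quiver n) M M" "has_dimension_vector (D_quiver n) M m"
    using b unfolding real_Schur_roots_def by blast
  obtain B vt and X :: "nat \<times> nat \<Rightarrow> (nat \<Rightarrow> 'k) \<Rightarrow> nat \<Rightarrow> 'k" and h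
    where std: "std_quiver (D_quiver n) B vt X" and h: "h \<in> left_module_hom PA (std_module (D_quiver n) B vt X) M"
    "bij_betw h (coords B) (carrier M)" and card: "\<And>v. v \<in> verts (D_quiver n) \<Longrightarrow> card {i \<in> B. vt i = v} = m v"
  proof (rule finite_dimensional_std[OF M(1,4)])
    fix B vt h and X :: "nat \<times> nat \<Rightarrow> (nat \<Rightarrow> 'k) \<Rightarrow> nat \<Rightarrow> 'k"
    assume "std_quiver (D_quiver n) B vt X" "h \<in> left_module_hom PA (std_module (D_quiver n) B vt X) M"
      "bij_betw h (coords B) (carrier M)" "\<And>v. v \<in> verts (D_quiver n) \<Longrightarrow> card {i \<in> B. vt i = v} = m v"
    then show thesis by (rule that)
  qed
  interpret L: std_quiver "D_quiver n" B vt X by (rule std)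
  have bij: "bij_betw h (carrier L.M) (carrier M)" using h(2) by simp
  have ind: "indecomposable PA L.M" by (rule iso_indecomposable[OF L.std_left_module M(1) h(1) bij M(2)])
  have rigid: L.rigid by (rule L.Ext1_zero_imp_rigid[OF iso_Ext1_zero[OF L.std_left_module M(1) h(1) bij M(3)]])
  have eig: "\<exists>l y. y \<in> coords B \<and> y \<noteq> (\<lambda>_. 0) \<and> F y = (\<lambda>i. l * y i)"
    if "B \<noteq> {}" "lin_on B B F" for F :: "(nat \<Rightarrow> 'k) \<Rightarrow> nat \<Rightarrow> 'k"
    by (rule eigenvector_exists[OF L.finB that]) blast
  have br: "B \<noteq> {}" L.brick using L.rigid_indecomposable_brick[OF eig ind rigid] by blast+
  have bv: "b v = int (card {i \<in> B. vt i = v})" if "v \<in> {1..n}" for v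
    using card[of v] that unfolding m by simp
  have "sym_form (D_quiver n) b b = 2"
    using L.brick_rigid_iff_card[OF br(2,1) D_arcs_finite] rigid D_form_card[OF n bv] by simp
  moreover have "b k = 0" if "k \<notin> {1..n}" for k
    using M(4) that unfolding m has_dimension_vector_def by simp
  ultimately show ?thesis using D_nonneg_form_two[OF n, of b] unfolding m by simp
qed

lemma thin_real_Schur_root:
  assumes n: "n \<ge> 4" and S: "S \<subseteq> {1..n}" and p: "p \<in> S"
    and conn: "\<And>q. q \<in> S \<Longrightarrow> (p, q) \<in> {(s, t). s \<in> S \<and> t \<in> S \<and> (s, t) \<in> arcs (D_quiver n)}\<^sup>*"
    and two: "sym_form (D_quiver n) b b = 2" and b: "b = (\<lambda>k. if k \<in> S then 1 else 0)"
  shows "b \<in> real_Schur_roots TYPE('k::field) (D_quiver n)"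
proof -
  interpret pa_quiver "D_quiver n" by (rule D_pa[OF n])
  let ?X = "zero_one_map S (\<lambda>_ _. True) :: nat \<times> nat \<Rightarrow> (nat \<Rightarrow> 'k) \<Rightarrow> nat \<Rightarrow> 'k"
  have std: "std_quiver (D_quiver n) S (\<lambda>k. k) ?X"
    using S finite_subset[OF S] by (intro zero_one_std) auto
  have "{(s, t). s \<in> S \<and> t \<in> S \<and> (s, t) \<in> arcs (D_quiver n)}
      \<subseteq> {(s, t). s \<in> S \<and> t \<in> S \<and> (\<exists>a\<in>arcs (D_quiver n). tail (D_quiver n) a = s \<and> head (D_quiver n) a = t)}" by force
  then have "std_quiver.brick (D_quiver n) S (\<lambda>k. k) ?X"
    using conn rtrancl_mono by (intro thin_brick[OF std _ p]) (simp, blast)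
  then show ?thesis
  proof (rule real_Schur_root_of_brick[OF n std])
    show "S \<noteq> {}" using p by blast
    show "b v = 0" if "v \<notin> {1..n}" for v using that S unfolding b by auto
    show "b v = int (card {i \<in> S. i = v})" for v
    proof -
      have "{i \<in> S. i = v} = (if v \<in> S then {v} else {})" by auto
      then show ?thesis unfolding b by (simp del: Collect_conj_eq)
    qed
  qed (rule two)
qed

text \<open>Every vertex of the support other than \<open>p\<close> is entered from a smaller one,
  so going back along arrows must end at \<open>p\<close>.\<close>

lemma thin_chain_real_Schur_root:
  assumes n: "n \<ge> 4" and S: "S \<subseteq> {1..n}" and p: "p \<in> S"
    and pred: "\<And>q. q \<in> S \<Longrightarrow> q \<noteq> p \<Longrightarrow> \<exists>s\<in>S. s < q \<and> (s, q) \<in> arcs (D_quiver n)"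
    and two: "sym_form (D_quiver n) b b = 2" and b: "b = (\<lambda>k. if k \<in> S then 1 else 0)"
  shows "b \<in> real_Schur_roots TYPE('k::field) (D_quiver n)"
proof (rule thin_real_Schur_root[OF n S p _ two b])
  let ?r = "{(s, t). s \<in> S \<and> t \<in> S \<and> (s, t) \<in> arcs (D_quiver n)}"
  show "q \<in> S \<Longrightarrow> (p, q) \<in> ?r\<^sup>*" for q
  proof (induction q rule: less_induct)
    case (less q)
    show ?case
    proof (cases "q = p")
      case False
      then obtain s where s: "s \<in> S" "s < q" "(s, q) \<in> arcs (D_quiver n)" using pred[OF less.prems] by blast
      have "(s, q) \<in> ?r" using s less.prems by blast
      with less.IH[OF s(2,1)] show ?thesis by (rule rtrancl_into_rtrancl)
    qed simp
  qed
qed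

text \<open>
  Over the interval from \<open>j\<close> to \<open>n - 2\<close> the vector space is a plane with basis \<open>v\<close>, \<open>n + v\<close>. The three
  remaining arrows at the ends of this interval embed the diagonal and project onto the two axes, and
  only scalars preserve these three lines.
\<close>

lemma rootD_real_Schur_root:
  assumes n: "n \<ge> 4" and ij: "1 \<le> i" "i < j" "j \<le> n - 2"
    and two: "sym_form (D_quiver n) (rootD n i j) (rootD n i j) = 2"
  shows "rootD n i j \<in> real_Schur_roots TYPE('k::field) (D_quiver n)"
proof -
  interpret pa_quiver "D_quiver n" by (rule D_pa[OF n])
  define B where "B = {i..n} \<union> {n + j..n + (n - 2)}"
  define vt where "vt k = (if k \<le> n then k else k - n)" for k
  \<comment> \<open>The plane at \<open>v\<close> has the axes \<open>v\<close> and
    \<open>n + v\<close>. The first clause keeps the first axis away from the second axis and from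
    \<open>n\<close>; the second clause keeps the second axis away from the first and from
    \<open>n - 1\<close>. Neither restricts \<open>j - 1\<close>, whose basis vector goes to the sum
    of those at \<open>j\<close> and \<open>n + j\<close>.\<close>
  define R where "R q r = (\<not> (j \<le> q \<and> q \<le> n - 2 \<and> (r > n \<or> r = n)) \<and> \<not> (q > n \<and> (j \<le> r \<and> r \<le> n - 2 \<or> r = n - 1)))" for q r
  let ?X = "zero_one_map B R :: nat \<times> nat \<Rightarrow> (nat \<Rightarrow> 'k) \<Rightarrow> nat \<Rightarrow> 'k"
  have N1: "{p \<in> B. vt p = v} = {v}" if "i \<le> v \<and> v < j \<or> v = n - 1 \<or> v = n" for v
    using that ij n unfolding B_def vt_def by (auto split: if_splits)
  have N2: "{p \<in> B. vt p = v} = {v, n + v}" if "j \<le> v" "v \<le> n - 2" for v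
    using that ij n unfolding B_def vt_def by (auto split: if_splits)
  have N0: "{p \<in> B. vt p = v} = {}" if "1 \<le> v" "v < i" for v
    using that ij n unfolding B_def vt_def by (auto split: if_splits)
  have mem: "v \<in> B" if "i \<le> v" "v \<le> n" for v using that unfolding B_def by simp
  have mem': "n + v \<in> B" if "j \<le> v" "v \<le> n - 2" for v using that unfolding B_def by simp
  have vt: "vt v = v" if "v \<le> n" for v using that unfolding vt_def by simp
  have vt': "vt (n + v) = v" if "j \<le> v" for v using that ij unfolding vt_def by simp
  have std: "std_quiver (D_quiver n) B vt ?X"
  proof (rule zero_one_std)
    show "finite B" unfolding B_def by simp
    show "k \<in> B \<Longrightarrow> vt k \<in> verts (D_quiver n)" for k
      using ij n unfolding B_def vt_def D_verts by auto
  qed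
  interpret std_quiver "D_quiver n" B vt ?X by (rule std)
  have brick
  proof (rule brick_of_units)
    fix F assume F: "endo F"
    define f where "f q r = F (unit_at q) r" for q r
    have C: "(\<Sum>p\<in>{p \<in> B. vt p = t}. if R q p then f p r else 0)
        = (\<Sum>p\<in>{p \<in> B. vt p = s}. if R p r then f q p else 0)"
      if "(s, t) \<in> arcs (D_quiver n)" "q \<in> B" "vt q = s" "r \<in> B" "vt r = t" for s t q r
      using zero_one_commute[OF refl F that(1), of q r] that(2-5) unfolding f_def by simp
    \<comment> \<open>The maps between the planes are identities, so the 2 by 2 block of
      \<open>F\<close> is the same in all of them.\<close>
    have step: "f (Suc v) (Suc v) = f v v \<and> f (n + Suc v) (n + Suc v) = f (n + v) (n + v)
        \<and> f (Suc v) (n + Suc v) = f v (n + v) \<and> f (n + Suc v) (Suc v) = f (n + v) v"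
      if v: "j \<le> v" "Suc v \<le> n - 2" for v
    proof -
      have arc: "(v, Suc v) \<in> arcs (D_quiver n)" using v ij by (simp add: D_arcs_iff)
      have le: "v \<le> n - 2" "j \<le> Suc v" "i \<le> v" "i \<le> Suc v" "v \<le> n" "Suc v \<le> n" using v ij by linarith+
      note Nv = N2[OF v(1) le(1)] N2[OF le(2) v(2)]
      note m = mem[OF le(3,5)] mem'[OF v(1) le(1)] mem[OF le(4,6)] mem'[OF le(2) v(2)]
      note w = vt[OF le(5)] vt'[OF v(1)] vt[OF le(6)] vt'[OF le(2)]
      have Rs: "R v (Suc v)" "\<not> R v (n + Suc v)" "\<not> R (n + v) (Suc v)" "R (n + v) (n + Suc v)"
        unfolding R_def using v ij n by auto
      have d: "v \<noteq> n + v" "Suc v \<noteq> n + Suc v" using n by simp_all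
      show ?thesis
        using C[OF arc m(1) w(1) m(3) w(3)] C[OF arc m(2) w(2) m(4) w(4)]
          C[OF arc m(1) w(1) m(4) w(4)] C[OF arc m(2) w(2) m(3) w(3)]
        unfolding Nv using d Rs by simp
    qed
    have chain: "f v v = f j j \<and> f (n + v) (n + v) = f (n + j) (n + j)
        \<and> f v (n + v) = f j (n + j) \<and> f (n + v) v = f (n + j) j" if "j \<le> v" "v \<le> n - 2" for v
      using that
    proof (induction v rule: dec_induct)
      case (step v)
      then show ?case using \<open>\<And>v. j \<le> v \<Longrightarrow> Suc v \<le> n - 2 \<Longrightarrow> _ v\<close>[of v] by simp
    qed simp
    have low: "f (Suc k) (Suc k) = f k k" if k: "i \<le> k" "Suc k < j" for k
    proof -
      have arc: "(k, Suc k) \<in> arcs (D_quiver n)" using k ij by (simp add: D_arcs_iff)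
      have le: "i \<le> Suc k" "k \<le> n" "Suc k \<le> n" using k ij by linarith+
      have Nk: "{p \<in> B. vt p = k} = {k}" "{p \<in> B. vt p = Suc k} = {Suc k}" using k by (intro N1; simp)+
      have "R k (Suc k)" unfolding R_def using k ij by auto
      then show ?thesis
        using C[OF arc mem[OF k(1) le(2)] vt[OF le(2)] mem[OF le(1,3)] vt[OF le(3)]] unfolding Nk by simp
    qed
    let ?c = "f (j - 1) (j - 1)"
    have lowc: "f k k = ?c" if "i \<le> k" "k \<le> j - 1" for k
      using that(2,1)
    proof (induction k rule: inc_induct)
      case (step k)
      then show ?case using low[of k] by simp
    qed simp
    \<comment> \<open>The diagonal vector is multiplied by \<open>?c\<close>: both rows of the block
      have the sum \<open>?c\<close>.\<close>
    have diag: "f j j + f (n + j) j = ?c" "f j (n + j) + f (n + j) (n + j) = ?c"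
    proof -
      have arc: "(j - 1, j) \<in> arcs (D_quiver n)"
        unfolding D_arcs_iff using ij by (intro disjI1 conjI) linarith+
      have le: "i \<le> j - 1" "j - 1 \<le> n" "i \<le> j" "j \<le> n" using ij by linarith+
      have Nk: "{p \<in> B. vt p = j - 1} = {j - 1}" using ij by (intro N1 disjI1 conjI) linarith+
      have Rs: "R (j - 1) j" "R (j - 1) (n + j)" unfolding R_def using ij by auto
      have d: "j \<noteq> n + j" using n by simp
      note m = mem[OF le(1,2)] vt[OF le(2)]
      show "f j j + f (n + j) j = ?c"
        using C[OF arc m mem[OF le(3,4)] vt[OF le(4)]] Rs d unfolding Nk N2[OF order_refl ij(3)] by simp
      show "f j (n + j) + f (n + j) (n + j) = ?c"
        using C[OF arc m mem'[OF order_refl ij(3)] vt'[OF order_refl]] Rs d unfolding Nk N2[OF order_refl ij(3)] by simp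
    qed
    let ?v = "n - 2"
    \<comment> \<open>The two projections at the end are respected, so the off-diagonal entries of
      the block vanish. Together with \<open>diag\<close> this makes the block \<open>?c\<close>
      times the identity.\<close>
    have tips: "f (n - 1) (n - 1) = f ?v ?v" "f (n + ?v) ?v = 0" "f ?v (n + ?v) = 0" "f n n = f (n + ?v) (n + ?v)"
    proof -
      have arc: "(?v, n - 1) \<in> arcs (D_quiver n)" "(?v, n) \<in> arcs (D_quiver n)" by (simp_all add: D_arcs_iff)
      have le: "i \<le> ?v" "?v \<le> n" "i \<le> n - 1" "n - 1 \<le> n" "i \<le> n" using ij by linarith+
      have Nk: "{p \<in> B. vt p = n - 1} = {n - 1}" "{p \<in> B. vt p = n} = {n}" by (intro N1; simp)+
      have Rs: "R ?v (n - 1)" "\<not> R (n + ?v) (n - 1)" "\<not> R ?v n" "R (n + ?v) n" unfolding R_def using ij n by auto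
      have d: "?v \<noteq> n + ?v" using n by simp
      note m = mem[OF le(1,2)] vt[OF le(2)] and m' = mem'[OF ij(3) order_refl] vt'[OF ij(3)]
      note t1 = mem[OF le(3,4)] vt[OF le(4)] and t2 = mem[OF le(5) order_refl] vt[OF order_refl]
      show "f (n - 1) (n - 1) = f ?v ?v" using C[OF arc(1) m t1] Rs d unfolding Nk N2[OF ij(3) order_refl] by simp
      show "f (n + ?v) ?v = 0" using C[OF arc(1) m' t1] Rs d unfolding Nk N2[OF ij(3) order_refl] by simp
      show "f ?v (n + ?v) = 0" using C[OF arc(2) m t2] Rs d unfolding Nk N2[OF ij(3) order_refl] by simp
      show "f n n = f (n + ?v) (n + ?v)" using C[OF arc(2) m' t2] Rs d unfolding Nk N2[OF ij(3) order_refl] by simp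
    qed
    note top = chain[OF ij(3) order_refl]
    have jj: "f j (n + j) = 0" "f (n + j) j = 0" "f j j = ?c" "f (n + j) (n + j) = ?c"
      using top tips diag by simp_all
    have "f q r = (if r = q then ?c else 0)" if q: "q \<in> B" and r: "r \<in> B" and e: "vt r = vt q" for q r
    proof -
      consider (low) "i \<le> q" "q \<le> j - 1" | (plane) "j \<le> q" "q \<le> ?v" | (plane') v where "q = n + v" "j \<le> v" "v \<le> ?v"
        | (tip) "q = n - 1" | (tip') "q = n"
      proof -
        have "q \<in> {i..n} \<or> q \<in> {n + j..n + (n - 2)}" using q unfolding B_def by blast
        then show thesis
        proof
          assume "q \<in> {i..n}"
          then have "q \<le> j - 1 \<or> j \<le> q \<and> q \<le> ?v \<or> q = n - 1 \<or> q = n" by (simp, linarith)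
          then show thesis using that(1,2,4,5) \<open>q \<in> {i..n}\<close> by auto
        next
          assume "q \<in> {n + j..n + (n - 2)}"
          then show thesis using that(3)[of "q - n"] by auto
        qed
      qed
      then show ?thesis
      proof cases
        case low
        have "vt q = q" using low ij by (intro vt) linarith
        moreover have "{p \<in> B. vt p = q} = {q}" using low ij by (intro N1) linarith
        ultimately have "r = q" using r e by auto
        then show ?thesis using lowc[OF low] by simp
      next
        case plane
        have "vt q = q" using plane ij by (intro vt) linarith
        then have "r \<in> {q, n + q}" using r e unfolding N2[OF plane, symmetric] by simp
        then show ?thesis using chain[OF plane] jj n by auto
      next
        case plane'
        have "r \<in> {v, n + v}" using r e unfolding plane'(1) vt'[OF plane'(2)] N2[OF plane'(2,3), symmetric] by simp
        then show ?thesis using chain[OF plane'(2,3)] jj n unfolding plane'(1) by auto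
      next
        case tip
        have "vt q = q" unfolding tip by (intro vt) simp
        moreover have "{p \<in> B. vt p = q} = {q}" unfolding tip by (intro N1) simp
        ultimately have "r = q" using r e by auto
        then show ?thesis using tips(1) top jj unfolding tip by simp
      next
        case tip'
        have "vt q = q" unfolding tip' by (intro vt) simp
        moreover have "{p \<in> B. vt p = q} = {q}" unfolding tip' by (intro N1) simp
        ultimately have "r = q" using r e by auto
        then show ?thesis using tips(4) top jj unfolding tip' by simp
      qed
    qed
    then show "\<exists>c. \<forall>q\<in>B. \<forall>r\<in>B. vt r = vt q \<longrightarrow> F (unit_at q) r = (if r = q then c else 0)"
      unfolding f_def by blast
  qed
  then show ?thesis
  proof (rule real_Schur_root_of_brick[OF n std _ _ _ _ two])
    have "n \<in> B" by (rule mem) (use ij in linarith)+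
    then show "B \<noteq> {}" by blast
    show "rootD n i j v = 0" if "v \<notin> {1..n}" for v using that ij unfolding rootD_def by auto
    fix v assume v: "v \<in> {1..n}"
    then consider "v < i" | "i \<le> v" "v < j" | "j \<le> v" "v \<le> n - 2" | "v = n - 1" | "v = n" by fastforce
    then show "rootD n i j v = int (card {p \<in> B. vt p = v})"
    proof cases
      case 1
      then have "{p \<in> B. vt p = v} = {}" using v by (intro N0) auto
      then show ?thesis using 1 by (simp only: card.empty) (simp add: rootD_def)
    next
      case 2
      then have "{p \<in> B. vt p = v} = {v}" by (intro N1) simp
      then have "card {p \<in> B. vt p = v} = 1" by (simp only: card.insert card.empty) simp
      then show ?thesis using 2 v by (simp add: rootD_def)
    next
      case 3
      then have "{p \<in> B. vt p = v} = {v, n + v}" by (intro N2)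
      moreover have "card {v, n + v} = 2" using n by simp
      ultimately have "card {p \<in> B. vt p = v} = 2" by (simp only:)
      then show ?thesis using 3 ij by (simp add: rootD_def)
    next
      case 4
      then have "{p \<in> B. vt p = v} = {v}" by (intro N1) simp
      then have "card {p \<in> B. vt p = v} = 1" by (simp only: card.insert card.empty) simp
      moreover have "\<not> n - 1 \<le> n - 2" "i \<le> n - 1" using ij n by linarith+
      ultimately show ?thesis unfolding rootD_def 4 by simp
    next
      case 5
      then have "{p \<in> B. vt p = v} = {v}" by (intro N1) simp
      then have "card {p \<in> B. vt p = v} = 1" by (simp only: card.insert card.empty) simp
      moreover have "\<not> n \<le> n - 2" "i \<le> n" using ij n by linarith+
      ultimately show ?thesis unfolding rootD_def 5 by simp
    qed
  qed
qed

lemma D_root_real_Schur_root: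
  assumes n: "n \<ge> 4" and b: "b \<in> D_roots n" and two: "sym_form (D_quiver n) b b = 2"
  shows "b \<in> real_Schur_roots TYPE('k::field) (D_quiver n)"
proof -
  consider (A) i j where "1 \<le> i" "i \<le> j" "j \<le> n - 1" "b = rootA i j"
    | (B) i where "1 \<le> i" "i \<le> n - 1" "b = rootB n i"
    | (D) i j where "1 \<le> i" "i < j" "j \<le> n - 1" "b = rootD n i j"
    using b unfolding D_roots_def by blast
  then show ?thesis
  proof cases
    case A
    show ?thesis
    proof (rule thin_chain_real_Schur_root[OF n _ _ _ two])
      show "{i..j} \<subseteq> {1..n}" "i \<in> {i..j}" using A by auto
      show "\<exists>s\<in>{i..j}. s < q \<and> (s, q) \<in> arcs (D_quiver n)" if "q \<in> {i..j}" "q \<noteq> i" for q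
        using that A n by (intro bexI[of _ "q - 1"]) (auto simp: D_arcs_iff)
      show "b = (\<lambda>k. if k \<in> {i..j} then 1 else 0)" unfolding A(4) rootA_def by auto
    qed
  next
    case B
    let ?S = "{i..n - 2} \<union> {n}" and ?p = "if i \<le> n - 2 then i else n"
    show ?thesis
    proof (rule thin_chain_real_Schur_root[OF n _ _ _ two])
      show "?S \<subseteq> {1..n}" "?p \<in> ?S" using B n by auto
      show "b = (\<lambda>k. if k \<in> ?S then 1 else 0)" unfolding B(3) rootB_def by auto
      fix q assume q: "q \<in> ?S" "q \<noteq> ?p"
      show "\<exists>s\<in>?S. s < q \<and> (s, q) \<in> arcs (D_quiver n)"
      proof (cases "q = n")
        case True
        then have "i \<le> n - 2" using q(2) by (auto split: if_splits)
        then show ?thesis using True n by (intro bexI[of _ "n - 2"]) (auto simp: D_arcs_iff)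
      next
        case False
        then have "i < q" "q \<le> n - 2" using q by (auto split: if_splits)
        then show ?thesis using B(1) by (intro bexI[of _ "q - 1"]) (auto simp: D_arcs_iff)
      qed
    qed
  next
    case D
    show ?thesis
    proof (cases "j = n - 1")
      \<comment> \<open>For \<open>j = n - 1\<close> no coefficient is 2, and the root is the
        indicator of \<open>{i..n}\<close>.\<close>
      case True
      show ?thesis
      proof (rule thin_chain_real_Schur_root[OF n _ _ _ two])
        show "{i..n} \<subseteq> {1..n}" "i \<in> {i..n}" using D by auto
        show "\<exists>s\<in>{i..n}. s < q \<and> (s, q) \<in> arcs (D_quiver n)" if "q \<in> {i..n}" "q \<noteq> i" for q
        proof (cases "q = n")
          case True
          then show ?thesis using D n by (intro bexI[of _ "n - 2"]) (auto simp: D_arcs_iff)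
        next
          case False
          then show ?thesis using that D n by (intro bexI[of _ "q - 1"]) (auto simp: D_arcs_iff)
        qed
        show "b = (\<lambda>k. if k \<in> {i..n} then 1 else 0)"
          unfolding D(4) rootD_def True using n by (intro ext) auto
      qed
    next
      case False
      then have "j \<le> n - 2" using D(3) by linarith
      from rootD_real_Schur_root[OF n D(1,2) this two[unfolded D(4)]] show ?thesis unfolding D(4) .
    qed
  qed
qed

section \<open>Roots attached to curves, and the two inclusions\<close>

lemma curve_root_form:
  assumes n: "n \<ge> 4" and \<eta>: "\<eta> \<in> simple_admissible (D_quiver n) \<sigma>"
  shows "(\<forall>k. 0 \<le> curve_root (D_quiver n) \<sigma> \<eta> k) \<and> (\<forall>k. k \<notin> {1..n} \<longrightarrow> curve_root (D_quiver n) \<sigma> \<eta> k = 0)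
    \<and> sym_form (D_quiver n) (curve_root (D_quiver n) \<sigma> \<eta>) (curve_root (D_quiver n) \<sigma> \<eta>) = 2"
proof -
  have "crossing_word (card (verts (D_quiver n))) \<sigma> \<eta> \<in> reflection_words (D_quiver n)"
    using \<eta> by (simp add: simple_admissible_def admissible_def Let_def)
  then have t: "word_elt (D_quiver n) (crossing_word (card (verts (D_quiver n))) \<sigma> \<eta>) \<in> reflections (D_quiver n)"
    unfolding reflection_words_def words_of_def by blast
  have sign: "(\<forall>k. 0 \<le> x k) \<or> (\<forall>k. x k \<le> 0)"
    if "sym_form (D_quiver n) x x = 2" "\<And>k. k \<notin> verts (D_quiver n) \<Longrightarrow> x k = 0" for x
    using D_sign[OF n that(1)] that(2) unfolding D_verts by blast
  from D.root_of_reflection_norm[OF sign t] show ?thesis unfolding curve_root_def D_verts .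
qed

theorem mainTheorem3:
  fixes n :: nat
  assumes "n \<ge> 4"
  shows "{curve_root (D_quiver n) \<sigma> \<eta> | \<sigma> \<eta>.
            \<sigma> \<in> P_perms (D_quiver n) \<and> \<eta> \<in> simple_admissible (D_quiver n) \<sigma>}
       = real_Schur_roots TYPE('k::alg_closed_field) (D_quiver n)"
proof (rule Set.set_eqI, rule iffI)
  fix b
  assume "b \<in> {curve_root (D_quiver n) \<sigma> \<eta> | \<sigma> \<eta>.
      \<sigma> \<in> P_perms (D_quiver n) \<and> \<eta> \<in> simple_admissible (D_quiver n) \<sigma>}"
  then obtain \<sigma> \<eta> where \<eta>: "\<eta> \<in> simple_admissible (D_quiver n) \<sigma>" and b: "b = curve_root (D_quiver n) \<sigma> \<eta>"
    by blast
  from curve_root_form[OF assms \<eta>] have f: "\<And>k. 0 \<le> b k" "\<And>k. k \<notin> {1..n} \<Longrightarrow> b k = 0"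
    "sym_form (D_quiver n) b b = 2" unfolding b by blast+
  have "b \<in> D_roots n" by (rule D_nonneg_form_two[OF assms f(2,3,1)])
  then show "b \<in> real_Schur_roots TYPE('k) (D_quiver n)"
    by (rule D_root_real_Schur_root[OF assms _ f(3)])
next
  fix b assume "b \<in> real_Schur_roots TYPE('k) (D_quiver n)"
  from D_root_curve[OF assms real_Schur_root_in_D_roots[OF assms this]]
  show "b \<in> {curve_root (D_quiver n) \<sigma> \<eta> | \<sigma> \<eta>.
      \<sigma> \<in> P_perms (D_quiver n) \<and> \<eta> \<in> simple_admissible (D_quiver n) \<sigma>}" by blast
qed

end
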